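(* Let $\lambda\in\operatorname{Irr}{}_{\mathcal D(H)}\mathcal C$ be a weight and let $$n=\min\{k\in\mathbb Z\mid \text{there is a highest-weight } \mu \text{ in } (\mathsf M^V_H(\lambda))_k\}.$$ Then $\mathsf M^V_H(\lambda)$ has a unique highest-weight $\mu$ in degree $n$, and $\mathsf S^V_H(\lambda)\simeq\mathsf L^V_H(\mu)[n]$.
   Context: $\Bbbk$ is an algebraically closed field of characteristic zero; graded means $\mathbb Z$-graded. $H$ is a finite-dimensional Hopf algebra over $\Bbbk$ with antipode $\mathcal S$, and $V$ is a finite-dimensional left Yetter-Drinfeld module over $H$ whose Nichols algebra $\mathfrak B(V)=\bigoplus_{j=0}^{n_{top}}\mathfrak B^j(V)$ is finite-dimensional. $\mathcal D(H)$ is the Drinfeld double: the space $H\otimes H^*$ in which $H$ and $H^{*\mathrm{op}}$ are Hopf subalgebras and $fh=\langle f_{(1)},h_{(1)}\rangle\langle f_{(3)},\mathcal S(h_{(3)})\rangle h_{(2)}f_{(2)}$. Yetter-Drinfeld modules over $H$ are $\mathcal D(H)$-modules via $(hf)\cdot m=\langle f,m_{(-1)}\rangle h\cdot m_{(0)}$. $\overline V$ is the dual $\mathcal D(H)$-module $V^*$, made a Yetter-Drinfeld module over $\mathcal D(H)$ by $\alpha\mapsto\sum_i\mathcal S(f_i)\otimes h_i\cdot\alpha$ for dual bases $\{h_i\},\{f_i\}$ of $H,H^*$. $\mathcal D(V,H)$ is the Drinfeld double of the bosonization $\mathfrak B(V)\#H$. It is generated by $V,\overline V$ and $\mathcal D(H)$,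 contains $\mathfrak B(V)\#\mathcal D(H)$ and $\mathcal D^{\ge0}(V,H)=\mathfrak B(\overline V)\#\mathcal D(H)$ as Hopf subalgebras, and $\alpha v=(\alpha_{(-1)}\cdot v)\alpha_{(0)}+\langle\alpha,v\rangle-\alpha_{(-1)}v_{(-1)}\langle\alpha_{(0)},v_{(0)}\rangle$ for $v\in V,\alpha\in\overline V$. It is graded with $\deg V=-1$, $\deg\overline V=1$, $\deg\mathcal D(H)=0$, and multiplication gives a linear isomorphism $\mathfrak B(V)\otimes\mathcal D(H)\otimes\mathfrak B(\overline V)\simeq\mathcal D(V,H)$. For a graded algebra $A$, ${}_A\mathcal C$ denotes either the category ${}_A\mathcal M$ of finite-dimensional left $A$-modules or the category ${}_A\mathcal G$ of finite-dimensional graded ones with grading-preserving morphisms; $\operatorname{Irr}$ denotes a set of representatives of simple objects. $N[j]$ is the shift, $N[j]_a=N_{a-j}$. A weight is an element of $\operatorname{Irr}{}_{\mathcal D(H)}\mathcal C$. The Verma module of $\lambda$ is $\mathsf M^V_H(\lambda)=\mathcal D(V,H)\otimes_{\mathcal D^{\ge0}(V,H)}\lambda$, with $\overline V$ acting by zero on $\lambda$; as a $\mathcal D(H)$-module it is $\mathfrak B(V)\otimes\lambda$, and $(\mathsf M^V_H(\lambda))_k=\mathfrak B^{-k}(V)\otimes\lambda$. $\mathsf L^V_H(\lambda)$ is its head (a simple module) and $\mathsf S^V_H(\lambda)$ is its socle. A highest-weight of a $\mathcal D(V,H)$-module is a simple $\mathcal D(H)$-submodule annihilated by $\overline V$. Convention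 for the shift: in the conclusion, $\mu$ is regarded (as an abstract $\mathcal D(H)$-module) as concentrated in the same degree as $\lambda$ (degree $0$ in the ungraded situation, where modules $\mathsf M^V_H(\lambda)$, $\mathsf L^V_H(\mu)$ carry the grading with $\lambda$, resp. $\mu$, in degree $0$). *)

theory Defs
  imports
    "HOL-Library.Function_Algebras"
    "HOL-Computational_Algebra.Polynomial"
    "HOL-Algebra.Module"
    "HOL-Algebra.AbelCoset"
    "HOL-Algebra.Generated_Rings"
begin

section \<open>Linear algebra in coordinates\<close>

text \<open>
  A finite-dimensional space with a chosen basis indexed by a finite type is a function type
  \<open>'i \<Rightarrow> 'k\<close>. If \<open>X = 'i \<Rightarrow> 'k\<close> and \<open>Y\<close> is any vector space, then \<open>X \<otimes> Y\<close> is represented by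
  \<open>'i \<Rightarrow> Y\<close>, the function \<open>t\<close> standing for the sum of all \<open>e\<^sub>i \<otimes> t i\<close>. In particular
  \<open>X \<otimes> X \<otimes> X\<close> is \<open>'i \<Rightarrow> 'i \<Rightarrow> 'i \<Rightarrow> 'k\<close>. When a tensor product \<open>X \<otimes> Y\<close> itself has to be a space
  with a finite basis, it is represented by \<open>'i \<times> 'j \<Rightarrow> 'k\<close>, see \<open>outer\<close>; the passage between the two
  representations is \<open>curry\<close>. A functional \<open>f\<close> on \<open>'i \<Rightarrow> 'k\<close> is given by its coordinates \<open>f i = f (e\<^sub>i)\<close> in
  the dual basis. The pointwise multiplication of functions is never used.
\<close>

definition fscale :: "('k \<Rightarrow> 'v \<Rightarrow> 'v) \<Rightarrow> 'k \<Rightarrow> ('i \<Rightarrow> 'v) \<Rightarrow> 'i \<Rightarrow> 'v" where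
  "fscale s c t = (\<lambda>i. s c (t i))"

abbreviation vscale :: "'k::times \<Rightarrow> ('i \<Rightarrow> 'k) \<Rightarrow> 'i \<Rightarrow> 'k" where
  "vscale \<equiv> fscale (*)"

definition bvec :: "'i \<Rightarrow> 'i \<Rightarrow> 'k::zero_neq_one" where
  "bvec i = (\<lambda>j. if j = i then 1 else 0)"

definition tens :: "('k \<Rightarrow> 'v \<Rightarrow> 'v) \<Rightarrow> ('i \<Rightarrow> 'k) \<Rightarrow> 'v \<Rightarrow> 'i \<Rightarrow> 'v" where
  "tens s x y = (\<lambda>i. s (x i) y)"

definition outer :: "('i \<Rightarrow> 'k::times) \<Rightarrow> ('j \<Rightarrow> 'k) \<Rightarrow> 'i \<times> 'j \<Rightarrow> 'k" where
  "outer x y = (\<lambda>(i, j). x i * y j)"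

definition pairing :: "('i::finite \<Rightarrow> 'k::comm_ring_1) \<Rightarrow> ('i \<Rightarrow> 'k) \<Rightarrow> 'k" where
  "pairing f x = (\<Sum>i\<in>UNIV. f i * x i)"

text \<open>
  The value at \<open>t\<close> of the linear map on the tensor product induced by a bilinear map \<open>F\<close>. Thus
  \<open>sweedler (comult H h) (\<lambda>h1 h2. F h1 h2)\<close> is what Sweedler's notation writes as
  \<open>F(h\<^sub>(\<^sub>1\<^sub>), h\<^sub>(\<^sub>2\<^sub>))\<close>, for \<open>F\<close> bilinear.
\<close>

definition sweedler ::
  "('i::finite \<Rightarrow> 'v) \<Rightarrow> (('i \<Rightarrow> 'k::zero_neq_one) \<Rightarrow> 'v \<Rightarrow> 'w::comm_monoid_add) \<Rightarrow> 'w" where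
  "sweedler t F = (\<Sum>i\<in>UNIV. F (bvec i) (t i))"

section \<open>Hopf algebras and Yetter-Drinfeld modules\<close>

record ('i, 'k) hopf = "('i \<Rightarrow> 'k) ring" +
  comult :: "('i \<Rightarrow> 'k) \<Rightarrow> 'i \<Rightarrow> 'i \<Rightarrow> 'k"
  counit :: "('i \<Rightarrow> 'k) \<Rightarrow> 'k"
  antipode :: "('i \<Rightarrow> 'k) \<Rightarrow> 'i \<Rightarrow> 'k"

locale fd_algebra = ring A for A :: "('i::finite \<Rightarrow> 'k::field, 'm) ring_scheme" (structure) +
  assumes carrier_eq: "carrier A = UNIV"
    and zero_eq: "\<zero> = 0"
    and add_eq: "x \<oplus> y = x + y"
    and scale_mult: "vscale c x \<otimes> y = vscale c (x \<otimes> y)"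
    and mult_scale: "x \<otimes> vscale c y = vscale c (x \<otimes> y)"

locale fd_coalgebra =
  fixes A :: "('i::finite, 'k::field, 'm) hopf_scheme" (structure)
  assumes comult_linear: "Vector_Spaces.linear vscale (fscale vscale) (comult A)"
    and counit_linear: "Vector_Spaces.linear vscale (*) (counit A)"
    and coassoc:
      "sweedler (comult A x) (\<lambda>a b. sweedler (comult A a) (\<lambda>a1 a2.
          tens (fscale vscale) a1 (tens vscale a2 b)))
       = sweedler (comult A x) (\<lambda>a b. tens (fscale vscale) a (comult A b))"
    and counit_left: "sweedler (comult A x) (\<lambda>a b. vscale (counit A a) b) = x"
    and counit_right: "sweedler (comult A x) (\<lambda>a b. vscale (counit A b) a) = x"

locale convolution_antipode =
  fixes A :: "('i::finite, 'k::field, 'm) hopf_scheme" (structure)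
  assumes antipode_linear: "Vector_Spaces.linear vscale vscale (antipode A)"
    and antipode_left: "sweedler (comult A x) (\<lambda>a b. antipode A a \<otimes> b) = vscale (counit A x) \<one>"
    and antipode_right: "sweedler (comult A x) (\<lambda>a b. a \<otimes> antipode A b) = vscale (counit A x) \<one>"

locale hopf_algebra = fd_algebra H + fd_coalgebra H + convolution_antipode H
  for H :: "('h::finite, 'k::field, 'm) hopf_scheme" (structure) +
  assumes comult_mult:
      "comult H (x \<otimes> y) = sweedler (comult H x) (\<lambda>x1 x2. sweedler (comult H y) (\<lambda>y1 y2.
          tens vscale (x1 \<otimes> y1) (x2 \<otimes> y2)))"
    and comult_one: "comult H \<one> = tens vscale \<one> \<one>"
    and counit_mult: "counit H (x \<otimes> y) = counit H x * counit H y"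
    and counit_one: "counit H \<one> = 1"

locale yd_module = hopf_algebra H + vector_space s
  for H :: "('h::finite, 'k::field) hopf"
    and s :: "'k \<Rightarrow> 'v::ab_group_add \<Rightarrow> 'v" +
  fixes act :: "('h \<Rightarrow> 'k) \<Rightarrow> 'v \<Rightarrow> 'v"
    and coact :: "'v \<Rightarrow> 'h \<Rightarrow> 'v"
  assumes act_linear_left: "Vector_Spaces.linear vscale s (\<lambda>h. act h v)"
    and act_linear_right: "Vector_Spaces.linear s s (act h)"
    and act_one: "act \<one>\<^bsub>H\<^esub> v = v"
    and act_mult: "act (g \<otimes>\<^bsub>H\<^esub> h) v = act g (act h v)"
    and coact_linear: "Vector_Spaces.linear s (fscale s) coact"
    and coact_coassoc:
      "sweedler (coact v) (\<lambda>h w. sweedler (comult H h) (\<lambda>h1 h2.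
          tens (fscale s) h1 (tens s h2 w)))
       = sweedler (coact v) (\<lambda>h w. tens (fscale s) h (coact w))"
    and coact_counit: "sweedler (coact v) (\<lambda>h w. s (counit H h) w) = v"
    and yd_compat:
      "coact (act h v) =
        sweedler (comult H h) (\<lambda>h1 h'. sweedler (comult H h') (\<lambda>h2 h3.
          sweedler (coact v) (\<lambda>g w. tens s (h1 \<otimes>\<^bsub>H\<^esub> g \<otimes>\<^bsub>H\<^esub> antipode H h3) (act h2 w))))"

section \<open>Nichols algebras\<close>

text \<open>
  A finite-dimensional Hopf algebra in the braided category of Yetter-Drinfeld modules over \<open>H\<close>,
  together with a family of homogeneous components.
\<close>

record ('b, 'h, 'k) braided_hopf = "('b, 'k) hopf" +
  yact :: "('h \<Rightarrow> 'k) \<Rightarrow> ('b \<Rightarrow> 'k) \<Rightarrow> 'b \<Rightarrow> 'k"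
  ycoact :: "('b \<Rightarrow> 'k) \<Rightarrow> 'h \<Rightarrow> 'b \<Rightarrow> 'k"
  comp :: "nat \<Rightarrow> ('b \<Rightarrow> 'k) set"

locale braided_hopf_algebra =
  yd_module H vscale "yact B" "ycoact B" + B: fd_algebra B + B: fd_coalgebra B + B: convolution_antipode B
  for H :: "('h::finite, 'k::field) hopf"
    and B :: "('b::finite, 'h, 'k) braided_hopf" +
  assumes act_prod:
      "yact B h (x \<otimes>\<^bsub>B\<^esub> y) = sweedler (comult H h) (\<lambda>h1 h2. yact B h1 x \<otimes>\<^bsub>B\<^esub> yact B h2 y)"
    and act_unit: "yact B h \<one>\<^bsub>B\<^esub> = vscale (counit H h) \<one>\<^bsub>B\<^esub>"
    and coact_prod:
      "ycoact B (x \<otimes>\<^bsub>B\<^esub> y) = sweedler (ycoact B x) (\<lambda>g x0. sweedler (ycoact B y) (\<lambda>h y0.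
          tens vscale (g \<otimes>\<^bsub>H\<^esub> h) (x0 \<otimes>\<^bsub>B\<^esub> y0)))"
    and coact_unit: "ycoact B \<one>\<^bsub>B\<^esub> = tens vscale \<one>\<^bsub>H\<^esub> \<one>\<^bsub>B\<^esub>"
    and comult_act:
      "comult B (yact B h x) = sweedler (comult H h) (\<lambda>h1 h2. sweedler (comult B x) (\<lambda>x1 x2.
          tens vscale (yact B h1 x1) (yact B h2 x2)))"
    and counit_act: "counit B (yact B h x) = counit H h * counit B x"
    and comult_coact:
      "sweedler (ycoact B x) (\<lambda>g x0. tens (fscale vscale) g (comult B x0))
       = sweedler (comult B x) (\<lambda>x1 x2. sweedler (ycoact B x1) (\<lambda>g y1. sweedler (ycoact B x2) (\<lambda>h y2.
          tens (fscale vscale) (g \<otimes>\<^bsub>H\<^esub> h) (tens vscale y1 y2))))"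
    and counit_coact:
      "sweedler (ycoact B x) (\<lambda>g x0. vscale (counit B x0) g) = vscale (counit B x) \<one>\<^bsub>H\<^esub>"
    and comult_prod:
      "comult B (x \<otimes>\<^bsub>B\<^esub> y) = sweedler (comult B x) (\<lambda>x1 x2. sweedler (comult B y) (\<lambda>y1 y2.
          sweedler (ycoact B x2) (\<lambda>g x0. tens vscale (x1 \<otimes>\<^bsub>B\<^esub> yact B g y1) (x0 \<otimes>\<^bsub>B\<^esub> y2))))"
    and comult_unit: "comult B \<one>\<^bsub>B\<^esub> = tens vscale \<one>\<^bsub>B\<^esub> \<one>\<^bsub>B\<^esub>"
    and counit_prod: "counit B (x \<otimes>\<^bsub>B\<^esub> y) = counit B x * counit B y"
    and counit_unit: "counit B \<one>\<^bsub>B\<^esub> = 1"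

text \<open>
  \<open>B\<close> is a finite-dimensional Nichols algebra of \<open>V\<close>: a connected graded Hopf algebra in the category
  of Yetter-Drinfeld modules whose degree one part is identified with \<open>V\<close> by \<open>\<iota>\<close>, is the space of
  all primitive elements, and generates \<open>B\<close>. These properties determine \<open>B\<close> up to isomorphism.
\<close>

locale nichols_algebra =
  V: yd_module H s act coact + braided_hopf_algebra H B
  for H :: "('h::finite, 'k::field) hopf"
    and s :: "'k \<Rightarrow> 'v::ab_group_add \<Rightarrow> 'v"
    and act coact
    and B :: "('b::finite, 'h, 'k) braided_hopf" +
  fixes \<iota> :: "'v \<Rightarrow> 'b \<Rightarrow> 'k"
  assumes comp_subspace: "module.subspace vscale (comp B n)"
    and comp_direct:
      "\<exists>!c :: nat \<Rightarrow> 'b \<Rightarrow> 'k. (\<forall>n. c n \<in> comp B n) \<and> finite {n. c n \<noteq> 0} \<and> x = (\<Sum>n | c n \<noteq> 0. c n)"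
    and comp_act: "x \<in> comp B n \<Longrightarrow> yact B h x \<in> comp B n"
    and comp_coact: "x \<in> comp B n \<Longrightarrow> ycoact B x i \<in> comp B n"
    and comp_mult: "x \<in> comp B m \<Longrightarrow> y \<in> comp B n \<Longrightarrow> x \<otimes>\<^bsub>B\<^esub> y \<in> comp B (m + n)"
    and comp_comult:
      "x \<in> comp B n \<Longrightarrow>
        comult B x \<in> module.span (fscale vscale)
          {tens vscale y z | y z k l. y \<in> comp B k \<and> z \<in> comp B l \<and> k + l = n}"
    and connected: "comp B 0 = range (\<lambda>c. vscale c \<one>\<^bsub>B\<^esub>)"
    and \<iota>_linear: "Vector_Spaces.linear s vscale \<iota>"
    and \<iota>_inj: "inj \<iota>"
    and \<iota>_range: "range \<iota> = comp B 1"
    and \<iota>_act: "\<iota> (act h v) = yact B h (\<iota> v)"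
    and \<iota>_coact: "ycoact B (\<iota> v) i = \<iota> (coact v i)"
    and primitives: "{x. comult B x = tens vscale x \<one>\<^bsub>B\<^esub> + tens vscale \<one>\<^bsub>B\<^esub> x} = comp B 1"
    and generated: "generate_ring B (range (\<lambda>c. vscale c \<one>\<^bsub>B\<^esub>) \<union> comp B 1) = UNIV"

section \<open>Bosonization and Drinfeld double\<close>

text \<open>\<open>x # h\<close> is \<open>outer x h\<close>.\<close>

definition smash_mult ::
  "('h::finite, 'k::field) hopf \<Rightarrow> ('b::finite, 'h, 'k) braided_hopf \<Rightarrow>
    ('b \<times> 'h \<Rightarrow> 'k) \<Rightarrow> ('b \<times> 'h \<Rightarrow> 'k) \<Rightarrow> 'b \<times> 'h \<Rightarrow> 'k" where
  "smash_mult H B t u =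
    sweedler (curry t) (\<lambda>x h. sweedler (curry u) (\<lambda>y g. sweedler (comult H h) (\<lambda>h1 h2.
      outer (x \<otimes>\<^bsub>B\<^esub> yact B h1 y) (h2 \<otimes>\<^bsub>H\<^esub> g))))"

definition bosonization ::
  "('h::finite, 'k::field) hopf \<Rightarrow> ('b::finite, 'h, 'k) braided_hopf \<Rightarrow> ('b \<times> 'h, 'k) hopf" where
  "bosonization H B =
    \<lparr>carrier = UNIV,
     mult = smash_mult H B,
     one = outer \<one>\<^bsub>B\<^esub> \<one>\<^bsub>H\<^esub>,
     zero = 0,
     add = (+),
     comult = (\<lambda>t. sweedler (curry t) (\<lambda>x h.
       sweedler (comult B x) (\<lambda>x1 x2. sweedler (ycoact B x2) (\<lambda>g x0. sweedler (comult H h) (\<lambda>h1 h2.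
         tens vscale (outer x1 (g \<otimes>\<^bsub>H\<^esub> h1)) (outer x0 h2)))))),
     counit = (\<lambda>t. sweedler (curry t) (\<lambda>x h. counit B x * counit H h)),
     antipode = (\<lambda>t. sweedler (curry t) (\<lambda>x h. sweedler (ycoact B x) (\<lambda>g x0.
       smash_mult H B (outer \<one>\<^bsub>B\<^esub> (antipode H (g \<otimes>\<^bsub>H\<^esub> h))) (outer (antipode B x0) \<one>\<^bsub>H\<^esub>))))\<rparr>"

definition counit_coords :: "('i::finite, 'k::field, 'm) hopf_scheme \<Rightarrow> 'i \<Rightarrow> 'k" where
  "counit_coords A = (\<lambda>i. counit A (bvec i))"

definition dual_mult ::
  "('i::finite, 'k::field, 'm) hopf_scheme \<Rightarrow> ('i \<Rightarrow> 'k) \<Rightarrow> ('i \<Rightarrow> 'k) \<Rightarrow> 'i \<Rightarrow> 'k" where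
  "dual_mult A f g = (\<lambda>i. sweedler (comult A (bvec i)) (\<lambda>a b. pairing f a * pairing g b))"

definition dual_comult ::
  "('i::finite, 'k::field, 'm) hopf_scheme \<Rightarrow> ('i \<Rightarrow> 'k) \<Rightarrow> 'i \<Rightarrow> 'i \<Rightarrow> 'k" where
  "dual_comult A f = (\<lambda>i j. pairing f (bvec i \<otimes>\<^bsub>A\<^esub> bvec j))"

text \<open>
  The algebra underlying the Drinfeld double, on \<open>A \<otimes> A\<^sup>*\<close> with \<open>outer a f\<close> the product \<open>a f\<close>.
  The second factor carries the opposite of the convolution product, and
  \<open>f a = \<langle>f\<^sub>(\<^sub>1\<^sub>), a\<^sub>(\<^sub>1\<^sub>)\<rangle> \<langle>f\<^sub>(\<^sub>3\<^sub>), S(a\<^sub>(\<^sub>3\<^sub>))\<rangle> a\<^sub>(\<^sub>2\<^sub>) f\<^sub>(\<^sub>2\<^sub>)\<close>. Only modules over the double are considered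
  below, so its coalgebra structure is not recorded.
\<close>

definition drinfeld_double ::
  "('a::finite, 'k::field, 'm) hopf_scheme \<Rightarrow> ('a \<times> 'a \<Rightarrow> 'k) ring" where
  "drinfeld_double A =
    \<lparr>carrier = UNIV,
     mult = (\<lambda>t u. sweedler (curry t) (\<lambda>a f. sweedler (curry u) (\<lambda>b g.
       sweedler (comult A b) (\<lambda>b1 b'. sweedler (comult A b') (\<lambda>b2 b3.
       sweedler (dual_comult A f) (\<lambda>f1 f'. sweedler (dual_comult A f') (\<lambda>f2 f3.
         vscale (pairing f1 b1 * pairing f3 (antipode A b3))
           (outer (a \<otimes>\<^bsub>A\<^esub> b2) (dual_mult A g f2))))))))),
     one = outer \<one>\<^bsub>A\<^esub> (counit_coords A),
     zero = 0,
     add = (+)\<rparr>"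

definition DVH ::
  "('h::finite, 'k::field) hopf \<Rightarrow> ('b::finite, 'h, 'k) braided_hopf \<Rightarrow>
    (('b \<times> 'h) \<times> ('b \<times> 'h) \<Rightarrow> 'k) ring" where
  "DVH H B = drinfeld_double (bosonization H B)"

text \<open>
  The inclusions of \<open>B(V)\<close> and of the double of \<open>H\<close>; the latter sends \<open>h f\<close> to \<open>(1 # h) (f \<circ> \<pi>)\<close>,
  where \<open>\<pi>(x # h) = \<epsilon>(x) h\<close> is the projection of the bosonization onto \<open>H\<close>.
\<close>

definition incl_B ::
  "('h::finite, 'k::field) hopf \<Rightarrow> ('b::finite, 'h, 'k) braided_hopf \<Rightarrow>
    ('b \<Rightarrow> 'k) \<Rightarrow> ('b \<times> 'h) \<times> ('b \<times> 'h) \<Rightarrow> 'k" where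
  "incl_B H B x = outer (outer x \<one>\<^bsub>H\<^esub>) (counit_coords (bosonization H B))"

definition incl_DH ::
  "('h::finite, 'k::field) hopf \<Rightarrow> ('b::finite, 'h, 'k) braided_hopf \<Rightarrow>
    ('h \<times> 'h \<Rightarrow> 'k) \<Rightarrow> ('b \<times> 'h) \<times> ('b \<times> 'h) \<Rightarrow> 'k" where
  "incl_DH H B t =
    sweedler (curry t) (\<lambda>h f. outer (outer \<one>\<^bsub>B\<^esub> h) (outer (counit_coords B) f))"

text \<open>
  The copy of \<open>V\<^sup>*\<close> in the double: \<open>\<alpha>\<close> is the functional \<open>x # h \<mapsto> \<langle>\<alpha>, x\<^sub>1\<rangle> \<epsilon>(h)\<close>, with \<open>x\<^sub>1\<close> the component
  of \<open>x\<close> in degree one, and \<open>\<phi>\<close> below is \<open>\<alpha>\<close> extended by zero to the other degrees. In the coproduct of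
  \<open>A\<^sup>*\<close> it becomes \<open>\<alpha> \<otimes> 1 + \<Sum>\<^sub>i f\<^sub>i \<otimes> \<alpha>(h\<^sub>i \<cdot> _)\<close>, and \<open>\<Sum>\<^sub>i f\<^sub>i \<otimes> \<alpha>(h\<^sub>i \<cdot> _) = \<Sum>\<^sub>i S(f\<^sub>i) \<otimes> h\<^sub>i \<cdot> \<alpha>\<close>
  because the antipode of \<open>H\<^sup>*\<^sup>o\<^sup>p\<close> is the transpose of the inverse of that of \<open>H\<close>. The multiplication
  rule of the double then yields
  \<open>\<alpha> v = (\<alpha>\<^sub>(\<^sub>-\<^sub>1\<^sub>) \<cdot> v) \<alpha>\<^sub>(\<^sub>0\<^sub>) + \<langle>\<alpha>, v\<rangle> - \<alpha>\<^sub>(\<^sub>-\<^sub>1\<^sub>) v\<^sub>(\<^sub>-\<^sub>1\<^sub>) \<langle>\<alpha>\<^sub>(\<^sub>0\<^sub>), v\<^sub>(\<^sub>0\<^sub>)\<rangle>\<close>.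
\<close>

definition Vbar ::
  "('h::finite, 'k::field) hopf \<Rightarrow> ('b::finite, 'h, 'k) braided_hopf \<Rightarrow>
    (('b \<times> 'h) \<times> ('b \<times> 'h) \<Rightarrow> 'k) set" where
  "Vbar H B = {outer \<one>\<^bsub>bosonization H B\<^esub> (outer \<phi> (counit_coords H)) | \<phi>.
     \<forall>n x. n \<noteq> 1 \<longrightarrow> x \<in> comp B n \<longrightarrow> pairing \<phi> x = 0}"

definition DVH_nonneg ::
  "('h::finite, 'k::field) hopf \<Rightarrow> ('b::finite, 'h, 'k) braided_hopf \<Rightarrow>
    (('b \<times> 'h) \<times> ('b \<times> 'h) \<Rightarrow> 'k) ring" where
  "DVH_nonneg H B =
    (DVH H B)\<lparr>carrier := generate_ring (DVH H B) (Vbar H B \<union> range (incl_DH H B))\<rparr>"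

text \<open>
  The linear map \<open>(x # h) f \<mapsto> \<epsilon>(x) h f|\<^sub>H\<close>. Its restriction to \<open>DVH_nonneg\<close> is the algebra map onto
  the double of \<open>H\<close> that is the identity on the latter and annihilates \<open>Vbar\<close>.
\<close>

definition proj_DH ::
  "('h::finite, 'k::field) hopf \<Rightarrow> ('b::finite, 'h, 'k) braided_hopf \<Rightarrow>
    (('b \<times> 'h) \<times> ('b \<times> 'h) \<Rightarrow> 'k) \<Rightarrow> 'h \<times> 'h \<Rightarrow> 'k" where
  "proj_DH H B t =
    sweedler (curry t) (\<lambda>a f. sweedler (curry a) (\<lambda>x h.
      outer (vscale (counit B x) h) (\<lambda>i. pairing f (outer \<one>\<^bsub>B\<^esub> (bvec i)))))"

section \<open>Modules\<close>

text \<open>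
  Modules are records of type \<open>module\<close> from HOL-Algebra (whose fields \<open>mult\<close> and \<open>one\<close> play no role);
  unlike in the locale \<open>module\<close> there, the ring is not assumed to be commutative.
\<close>

locale left_module = R?: ring R + M?: abelian_group M
  for R :: "('r, 'n) ring_scheme" (structure) and M :: "('r, 'm) module" (structure) +
  assumes smult_closed: "a \<in> carrier R \<Longrightarrow> x \<in> carrier M \<Longrightarrow> a \<odot>\<^bsub>M\<^esub> x \<in> carrier M"
    and smult_l_distr: "a \<in> carrier R \<Longrightarrow> b \<in> carrier R \<Longrightarrow> x \<in> carrier M \<Longrightarrow>
      (a \<oplus>\<^bsub>R\<^esub> b) \<odot>\<^bsub>M\<^esub> x = a \<odot>\<^bsub>M\<^esub> x \<oplus>\<^bsub>M\<^esub> b \<odot>\<^bsub>M\<^esub> x"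
    and smult_r_distr: "a \<in> carrier R \<Longrightarrow> x \<in> carrier M \<Longrightarrow> y \<in> carrier M \<Longrightarrow>
      a \<odot>\<^bsub>M\<^esub> (x \<oplus>\<^bsub>M\<^esub> y) = a \<odot>\<^bsub>M\<^esub> x \<oplus>\<^bsub>M\<^esub> a \<odot>\<^bsub>M\<^esub> y"
    and smult_assoc: "a \<in> carrier R \<Longrightarrow> b \<in> carrier R \<Longrightarrow> x \<in> carrier M \<Longrightarrow>
      (a \<otimes>\<^bsub>R\<^esub> b) \<odot>\<^bsub>M\<^esub> x = a \<odot>\<^bsub>M\<^esub> (b \<odot>\<^bsub>M\<^esub> x)"
    and smult_one: "x \<in> carrier M \<Longrightarrow> \<one>\<^bsub>R\<^esub> \<odot>\<^bsub>M\<^esub> x = x"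

text \<open>The scalar multiplication of a module over an algebra \<open>R\<close> is the action of \<open>c 1\<^sub>R\<close>.\<close>

definition kscale ::
  "('i \<Rightarrow> 'k::field, 'n) ring_scheme \<Rightarrow> ('i \<Rightarrow> 'k, 'm) module \<Rightarrow> 'k \<Rightarrow> 'm \<Rightarrow> 'm" where
  "kscale R M c x = vscale c \<one>\<^bsub>R\<^esub> \<odot>\<^bsub>M\<^esub> x"

definition fin_dim :: "('i \<Rightarrow> 'k::field, 'n) ring_scheme \<Rightarrow> ('i \<Rightarrow> 'k, 'm) module \<Rightarrow> bool" where
  "fin_dim R M \<longleftrightarrow> (\<exists>F. finite F \<and> F \<subseteq> carrier M \<and>
     generate (add_monoid M) {kscale R M c x | c x. x \<in> F} = carrier M)"

definition restrict_scalars :: "('r \<Rightarrow> 'r') \<Rightarrow> ('r', 'm) module \<Rightarrow> ('r, 'm) module" where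
  "restrict_scalars \<phi> M =
    \<lparr>carrier = carrier M, mult = mult M, one = one M, zero = zero M, add = add M,
     smult = (\<lambda>a. smult M (\<phi> a))\<rparr>"

definition quot_module :: "('r, 'm) module \<Rightarrow> 'm set \<Rightarrow> ('r, 'm set) module" where
  "quot_module M K =
    \<lparr>carrier = a_rcosets\<^bsub>M\<^esub> K, mult = undefined, one = undefined, zero = K, add = set_add M,
     smult = (\<lambda>a X. \<Union>x\<in>X. K +>\<^bsub>M\<^esub> (a \<odot>\<^bsub>M\<^esub> x))\<rparr>"

text \<open>The tensor product over the base field of an algebra \<open>D\<close> and a module \<open>N\<close> over \<open>R\<close>.\<close>

definition ktensor ::
  "('i::finite \<Rightarrow> 'k::field) ring \<Rightarrow> ('i \<Rightarrow> 'k) ring \<Rightarrow> ('i \<Rightarrow> 'k, 'm) module \<Rightarrow>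
    ('i \<Rightarrow> 'k, 'i \<Rightarrow> 'm) module" where
  "ktensor D R N =
    \<lparr>carrier = {t. \<forall>i. t i \<in> carrier N}, mult = undefined, one = undefined,
     zero = (\<lambda>i. \<zero>\<^bsub>N\<^esub>), add = (\<lambda>t u i. t i \<oplus>\<^bsub>N\<^esub> u i),
     smult = (\<lambda>a t j. \<Oplus>\<^bsub>N\<^esub>i\<in>UNIV. kscale R N ((a \<otimes>\<^bsub>D\<^esub> bvec i) j) (t i))\<rparr>"

definition induced_relations ::
  "('i::finite \<Rightarrow> 'k::field) ring \<Rightarrow> ('i \<Rightarrow> 'k) ring \<Rightarrow> ('i \<Rightarrow> 'k, 'm) module \<Rightarrow> ('i \<Rightarrow> 'm) set" where
  "induced_relations D R N =
    generate (add_monoid (ktensor D R N))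
      {tens (kscale R N) (d \<otimes>\<^bsub>D\<^esub> r) x \<ominus>\<^bsub>ktensor D R N\<^esub> tens (kscale R N) d (r \<odot>\<^bsub>N\<^esub> x) | d r x.
        d \<in> carrier D \<and> r \<in> carrier R \<and> x \<in> carrier N}"

text \<open>\<open>D \<otimes>\<^sub>R N\<close>, for \<open>R\<close> a subalgebra of \<open>D\<close>.\<close>

definition induced_module ::
  "('i::finite \<Rightarrow> 'k::field) ring \<Rightarrow> ('i \<Rightarrow> 'k) ring \<Rightarrow> ('i \<Rightarrow> 'k, 'm) module \<Rightarrow>
    ('i \<Rightarrow> 'k, ('i \<Rightarrow> 'm) set) module" where
  "induced_module D R N = quot_module (ktensor D R N) (induced_relations D R N)"

definition induced_tensor ::
  "('i::finite \<Rightarrow> 'k::field) ring \<Rightarrow> ('i \<Rightarrow> 'k) ring \<Rightarrow> ('i \<Rightarrow> 'k, 'm) module \<Rightarrow>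
    ('i \<Rightarrow> 'k) \<Rightarrow> 'm \<Rightarrow> ('i \<Rightarrow> 'm) set" where
  "induced_tensor D R N d x =
    induced_relations D R N +>\<^bsub>ktensor D R N\<^esub> tens (kscale R N) d x"

section \<open>The two module categories\<close>

datatype mod_category = Ungraded | Graded

text \<open>
  In the category \<open>Ungraded\<close> the grading \<open>gr\<close> is ignored; in \<open>Graded\<close> a subobject is a submodule
  generated by its homogeneous elements.
\<close>

definition subobject ::
  "mod_category \<Rightarrow> 'r ring \<Rightarrow> ('r, 'm) module \<Rightarrow> (int \<Rightarrow> 'm set) \<Rightarrow> 'm set \<Rightarrow> bool" where
  "subobject C R M gr N \<longleftrightarrow>
    submodule N R M \<and> (C = Graded \<longrightarrow> generate (add_monoid M) (\<Union>a. N \<inter> gr a) = N)"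

definition simple_subobject ::
  "mod_category \<Rightarrow> 'r ring \<Rightarrow> ('r, 'm) module \<Rightarrow> (int \<Rightarrow> 'm set) \<Rightarrow> 'm set \<Rightarrow> bool" where
  "simple_subobject C R M gr N \<longleftrightarrow>
    subobject C R M gr N \<and> N \<noteq> {\<zero>\<^bsub>M\<^esub>} \<and>
    (\<forall>P. subobject C R M gr P \<and> P \<subseteq> N \<longrightarrow> P = {\<zero>\<^bsub>M\<^esub>} \<or> P = N)"

definition maximal_subobject ::
  "mod_category \<Rightarrow> 'r ring \<Rightarrow> ('r, 'm) module \<Rightarrow> (int \<Rightarrow> 'm set) \<Rightarrow> 'm set \<Rightarrow> bool" where
  "maximal_subobject C R M gr N \<longleftrightarrow>
    subobject C R M gr N \<and> N \<noteq> carrier M \<and>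
    (\<forall>P. subobject C R M gr P \<and> N \<subseteq> P \<longrightarrow> P = N \<or> P = carrier M)"

definition socle ::
  "mod_category \<Rightarrow> 'r ring \<Rightarrow> ('r, 'm) module \<Rightarrow> (int \<Rightarrow> 'm set) \<Rightarrow> 'm set" where
  "socle C R M gr = generate (add_monoid M) (\<Union>{N. simple_subobject C R M gr N})"

definition radical ::
  "mod_category \<Rightarrow> 'r ring \<Rightarrow> ('r, 'm) module \<Rightarrow> (int \<Rightarrow> 'm set) \<Rightarrow> 'm set" where
  "radical C R M gr = carrier M \<inter> \<Inter>{N. maximal_subobject C R M gr N}"

definition head ::
  "mod_category \<Rightarrow> 'r ring \<Rightarrow> ('r, 'm) module \<Rightarrow> (int \<Rightarrow> 'm set) \<Rightarrow> ('r, 'm set) module" where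
  "head C R M gr = quot_module M (radical C R M gr)"

definition head_grading ::
  "mod_category \<Rightarrow> 'r ring \<Rightarrow> ('r, 'm) module \<Rightarrow> (int \<Rightarrow> 'm set) \<Rightarrow> int \<Rightarrow> 'm set set" where
  "head_grading C R M gr a = (\<lambda>x. radical C R M gr +>\<^bsub>M\<^esub> x) ` gr a"

definition shift :: "(int \<Rightarrow> 'm set) \<Rightarrow> int \<Rightarrow> int \<Rightarrow> 'm set" where
  "shift gr j a = gr (a - j)"

definition concentrated :: "int \<Rightarrow> ('r, 'm) module \<Rightarrow> int \<Rightarrow> 'm set" where
  "concentrated d M a = (if a = d then carrier M else {\<zero>\<^bsub>M\<^esub>})"

definition graded_isomorphic ::
  "'r ring \<Rightarrow> ('r, 'm) module \<Rightarrow> (int \<Rightarrow> 'm set) \<Rightarrow> ('r, 'n) module \<Rightarrow> (int \<Rightarrow> 'n set) \<Rightarrow> bool" where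
  "graded_isomorphic R M gr N gr' \<longleftrightarrow>
    (\<exists>\<phi> \<in> iso (add_monoid M) (add_monoid N).
      (\<forall>a\<in>carrier R. \<forall>x\<in>carrier M. \<phi> (a \<odot>\<^bsub>M\<^esub> x) = a \<odot>\<^bsub>N\<^esub> \<phi> x) \<and>
      (\<forall>j. \<phi> ` gr j = gr' j))"

text \<open>Gradings of a module over an algebra that is itself concentrated in degree zero.\<close>

definition module_grading :: "'r ring \<Rightarrow> ('r, 'm) module \<Rightarrow> (int \<Rightarrow> 'm set) \<Rightarrow> bool" where
  "module_grading R M gr \<longleftrightarrow>
    (\<forall>j. submodule (gr j) R M) \<and>
    (\<forall>x\<in>carrier M. \<exists>!c. (\<forall>j. c j \<in> gr j) \<and> finite {j. c j \<noteq> \<zero>\<^bsub>M\<^esub>} \<and>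
       x = (\<Oplus>\<^bsub>M\<^esub>j\<in>{j. c j \<noteq> \<zero>\<^bsub>M\<^esub>}. c j))"

section \<open>Weights, Verma modules and highest-weights\<close>

text \<open>
  A simple object of the category of finite-dimensional (graded) modules over the double of \<open>H\<close>. An
  ungraded weight is given the grading concentrated in degree zero.
\<close>

definition weight ::
  "mod_category \<Rightarrow> ('h::finite, 'k::field) hopf \<Rightarrow> ('h \<times> 'h \<Rightarrow> 'k, 'l) module \<Rightarrow>
    (int \<Rightarrow> 'l set) \<Rightarrow> bool" where
  "weight C H lam gr \<longleftrightarrow>
    left_module (drinfeld_double H) lam \<and> fin_dim (drinfeld_double H) lam \<and>
    module_grading (drinfeld_double H) lam gr \<and>
    (C = Ungraded \<longrightarrow> gr = concentrated 0 lam) \<and>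
    simple_subobject C (drinfeld_double H) lam gr (carrier lam)"

text \<open>A simple graded module over an algebra in degree zero has only one nonzero component.\<close>

definition weight_degree :: "('r, 'l) module \<Rightarrow> (int \<Rightarrow> 'l set) \<Rightarrow> int" where
  "weight_degree lam gr = (THE d. gr d = carrier lam)"

text \<open>\<open>lam\<close> as a module over \<open>DVH_nonneg\<close> with \<open>Vbar\<close> acting by zero.\<close>

definition inflate ::
  "('h::finite, 'k::field) hopf \<Rightarrow> ('b::finite, 'h, 'k) braided_hopf \<Rightarrow>
    ('h \<times> 'h \<Rightarrow> 'k, 'l) module \<Rightarrow> (('b \<times> 'h) \<times> ('b \<times> 'h) \<Rightarrow> 'k, 'l) module" where
  "inflate H B lam = restrict_scalars (proj_DH H B) lam"

definition verma ::
  "('h::finite, 'k::field) hopf \<Rightarrow> ('b::finite, 'h, 'k) braided_hopf \<Rightarrow>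
    ('h \<times> 'h \<Rightarrow> 'k, 'l) module \<Rightarrow>
    (('b \<times> 'h) \<times> ('b \<times> 'h) \<Rightarrow> 'k, (('b \<times> 'h) \<times> ('b \<times> 'h) \<Rightarrow> 'l) set) module" where
  "verma H B lam = induced_module (DVH H B) (DVH_nonneg H B) (inflate H B lam)"

text \<open>
  The grading of the Verma module of a graded \<open>lam\<close>: the component of degree \<open>a\<close> is the sum of the
  \<open>B\<^sup>m(V) \<otimes> gr j\<close> with \<open>j - m = a\<close>.
\<close>

definition verma_grading ::
  "('h::finite, 'k::field) hopf \<Rightarrow> ('b::finite, 'h, 'k) braided_hopf \<Rightarrow>
    ('h \<times> 'h \<Rightarrow> 'k, 'l) module \<Rightarrow> (int \<Rightarrow> 'l set) \<Rightarrow> int \<Rightarrow>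
    (('b \<times> 'h) \<times> ('b \<times> 'h) \<Rightarrow> 'l) set set" where
  "verma_grading H B lam gr a =
    generate (add_monoid (verma H B lam))
      {induced_tensor (DVH H B) (DVH_nonneg H B) (inflate H B lam) (incl_B H B b) x | b x m j.
        b \<in> comp B m \<and> x \<in> gr j \<and> j - int m = a}"

text \<open>\<open>B\<^sup>-\<^sup>k(V) \<otimes> lam\<close>: the degree \<open>k\<close> is relative to the one of \<open>lam\<close>.\<close>

definition verma_component ::
  "('h::finite, 'k::field) hopf \<Rightarrow> ('b::finite, 'h, 'k) braided_hopf \<Rightarrow>
    ('h \<times> 'h \<Rightarrow> 'k, 'l) module \<Rightarrow> int \<Rightarrow> (('b \<times> 'h) \<times> ('b \<times> 'h) \<Rightarrow> 'l) set set" where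
  "verma_component H B lam k = verma_grading H B lam (concentrated 0 lam) k"

definition highest_weight ::
  "mod_category \<Rightarrow> ('h::finite, 'k::field) hopf \<Rightarrow> ('b::finite, 'h, 'k) braided_hopf \<Rightarrow>
    (('b \<times> 'h) \<times> ('b \<times> 'h) \<Rightarrow> 'k, 'm) module \<Rightarrow> (int \<Rightarrow> 'm set) \<Rightarrow> 'm set \<Rightarrow> bool" where
  "highest_weight C H B M gr \<mu> \<longleftrightarrow>
    simple_subobject C (drinfeld_double H) (restrict_scalars (incl_DH H B) M) gr \<mu> \<and>
    (\<forall>\<alpha>\<in>Vbar H B. \<forall>x\<in>\<mu>. \<alpha> \<odot>\<^bsub>M\<^esub> x = \<zero>\<^bsub>M\<^esub>)"

definition simple_L ::
  "mod_category \<Rightarrow> ('h::finite, 'k::field) hopf \<Rightarrow> ('b::finite, 'h, 'k) braided_hopf \<Rightarrow>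
    ('h \<times> 'h \<Rightarrow> 'k, 'l) module \<Rightarrow> (int \<Rightarrow> 'l set) \<Rightarrow>
    (('b \<times> 'h) \<times> ('b \<times> 'h) \<Rightarrow> 'k, (('b \<times> 'h) \<times> ('b \<times> 'h) \<Rightarrow> 'l) set set) module" where
  "simple_L C H B lam gr = head C (DVH H B) (verma H B lam) (verma_grading H B lam gr)"

definition simple_L_grading ::
  "mod_category \<Rightarrow> ('h::finite, 'k::field) hopf \<Rightarrow> ('b::finite, 'h, 'k) braided_hopf \<Rightarrow>
    ('h \<times> 'h \<Rightarrow> 'k, 'l) module \<Rightarrow> (int \<Rightarrow> 'l set) \<Rightarrow> int \<Rightarrow>
    (('b \<times> 'h) \<times> ('b \<times> 'h) \<Rightarrow> 'l) set set set" where
  "simple_L_grading C H B lam gr =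
    head_grading C (DVH H B) (verma H B lam) (verma_grading H B lam gr)"

definition verma_socle ::
  "mod_category \<Rightarrow> ('h::finite, 'k::field) hopf \<Rightarrow> ('b::finite, 'h, 'k) braided_hopf \<Rightarrow>
    ('h \<times> 'h \<Rightarrow> 'k, 'l) module \<Rightarrow> (int \<Rightarrow> 'l set) \<Rightarrow> (('b \<times> 'h) \<times> ('b \<times> 'h) \<Rightarrow> 'l) set set" where
  "verma_socle C H B lam gr = socle C (DVH H B) (verma H B lam) (verma_grading H B lam gr)"

definition verma_submodule ::
  "('h::finite, 'k::field) hopf \<Rightarrow> ('b::finite, 'h, 'k) braided_hopf \<Rightarrow>
    ('h \<times> 'h \<Rightarrow> 'k, 'l) module \<Rightarrow> (('b \<times> 'h) \<times> ('b \<times> 'h) \<Rightarrow> 'l) set set \<Rightarrow>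
    ('h \<times> 'h \<Rightarrow> 'k, (('b \<times> 'h) \<times> ('b \<times> 'h) \<Rightarrow> 'l) set) module" where
  "verma_submodule H B lam \<mu> = (restrict_scalars (incl_DH H B) (verma H B lam))\<lparr>carrier := \<mu>\<rparr>"

definition hw_in_component ::
  "mod_category \<Rightarrow> ('h::finite, 'k::field) hopf \<Rightarrow> ('b::finite, 'h, 'k) braided_hopf \<Rightarrow>
    ('h \<times> 'h \<Rightarrow> 'k, 'l) module \<Rightarrow> (int \<Rightarrow> 'l set) \<Rightarrow> int \<Rightarrow>
    (('b \<times> 'h) \<times> ('b \<times> 'h) \<Rightarrow> 'l) set set \<Rightarrow> bool" where
  "hw_in_component C H B lam gr k \<mu> \<longleftrightarrow>
    highest_weight C H B (verma H B lam) (verma_grading H B lam gr) \<mu> \<and>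
    \<mu> \<subseteq> verma_component H B lam k"

end

theory Submission
  imports Defs
begin

text \<open>
  View the double of \<open>A = B # H\<close> as linear operators on \<open>A\<close>; its product then has a closed formula from which the
  triangular decomposition and the integer grading can be read off. Because the degree-one part of the Nichols algebra consists of all
  primitives, \<open>B\<close> is a Frobenius algebra with one-dimensional top component. Hence every nonzero submodule of a Verma
  module meets the top component, and by simplicity of \<open>\<lambda>\<close> contains all of it; so there is a least nonzero submodule,
  the socle. Its component of highest degree is a simple highest weight \<open>\<mu>\<close>, and any highest weight generates a submodule
  containing the socle, which gives minimality and uniqueness. The map from the Verma module of \<open>\<mu>\<close> onto the socle has a
  kernel containing every proper submodule, so the socle is the head.
\<close>

section \<open>Linear maps in coordinates\<close>

text \<open>The double comes only with a product in coordinates, so nothing about its structure can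
  be quoted. As an operator on A, an element of B acts through left multiplication, the nonnegative
  part consists of the operators with values in \<open>1 # H\<close>, and homogeneous of degree k
  means lowering degrees of A by k. To identify this part with the subalgebra generated by
  \<open>Vbar\<close> and the double of H, the dual of B has to be generated in degree one; this is
  where an element of higher degree would turn out primitive. For the Frobenius property, a
  generator v killing x is moved across the coproduct of x by the antipode of A. To conclude
  something about all of A, that antipode has to be onto, hence the trace argument for
  finite-dimensional Hopf algebras. Graded and ungraded modules are treated together: the least
  submodule is taken among all submodules and is then shown to be homogeneous, and the kernel of the
  cover is homogeneous and contains every proper submodule. Inside Verma modules degrees are counted
  downwards from the inducing module, as depths; the least depth \<open>j0\<close> met by the socle
  gives n as \<open>- int j0\<close>.\<close>

definition lin :: "(('i \<Rightarrow> 'k::field) \<Rightarrow> 'k) \<Rightarrow> bool" where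
  "lin f \<longleftrightarrow> (\<forall>x y. f (x + y) = f x + f y) \<and> (\<forall>c x. f (vscale c x) = c * f x)"

text \<open>\<open>lin\<close> and \<open>vlin\<close> carry no locale premises, so the simplifier
  can discharge the linearity conditions of nested Sweedler sums.
  \<open>Vector_Spaces.linear\<close> is recovered where theorems on vector spaces are
  applied.\<close>

definition vlin :: "(('i \<Rightarrow> 'k::field) \<Rightarrow> 'j \<Rightarrow> 'k) \<Rightarrow> bool" where
  "vlin f \<longleftrightarrow> (\<forall>x y. f (x + y) = f x + f y) \<and> (\<forall>c x. f (vscale c x) = vscale c (f x))"

lemma lin_add: "lin f \<Longrightarrow> f (x + y) = f x + f y"
  and lin_scale: "lin f \<Longrightarrow> f (vscale c x) = c * f x"
  by (auto simp: lin_def)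

lemma vlin_add: "vlin f \<Longrightarrow> f (x + y) = f x + f y"
  and vlin_scale: "vlin f \<Longrightarrow> f (vscale c x) = vscale c (f x)"
  by (auto simp: vlin_def)

lemma vscale_simps [simp]:
  "vscale 1 x = (x :: 'i \<Rightarrow> 'k::field)" "vscale 0 x = (0 :: 'i \<Rightarrow> 'k)" "vscale c 0 = (0 :: 'i \<Rightarrow> 'k)"
  "vscale c (vscale d x) = vscale (c * d) (x :: 'i \<Rightarrow> 'k)"
  by (auto simp: fscale_def fun_eq_iff)

lemma vscale_add: "vscale c (x + y) = vscale c x + vscale c (y :: 'i \<Rightarrow> 'k::field)"
  "vscale (c + d) x = vscale c x + vscale d (x :: 'i \<Rightarrow> 'k::field)"
  by (auto simp: fscale_def fun_eq_iff algebra_simps)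

lemma fscale_apply: "fscale s c t i = s c (t i)"
  by (simp add: fscale_def)

lemma vscale_apply: "vscale c x i = c * x i"
  by (simp add: fscale_def)

lemma bvec_apply: "bvec i j = (if j = i then 1 else 0)"
  by (simp add: bvec_def)

lemma uminus_vscale: "- x = vscale (-1) (x :: 'i \<Rightarrow> 'k::field)"
  by (auto simp: fscale_def fun_eq_iff)

lemma lin_zero: "lin f \<Longrightarrow> f 0 = 0"
  using lin_scale[of f 0 0] by simp

lemma vlin_zero: "vlin f \<Longrightarrow> f 0 = 0"
  using vlin_scale[of f 0 0] by simp

lemma lin_sum: "lin f \<Longrightarrow> f (\<Sum>i\<in>I. g i) = (\<Sum>i\<in>I. f (g i))"
  by (induction I rule: infinite_finite_induct) (auto simp: lin_add lin_zero)

lemma vlin_sum: "vlin f \<Longrightarrow> f (\<Sum>i\<in>I. g i) = (\<Sum>i\<in>I. f (g i))"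
  by (induction I rule: infinite_finite_induct) (auto simp: vlin_add vlin_zero)

lemma lin_minus: "lin f \<Longrightarrow> f (- x) = - f x"
  by (simp add: uminus_vscale lin_scale)

lemma vlin_minus: "vlin f \<Longrightarrow> f (- x) = - f x"
  by (simp add: uminus_vscale vlin_scale)

lemma lin_diff: "lin f \<Longrightarrow> f (x - y) = f x - f y"
  using lin_add[of f x "- y"] lin_minus[of f y] by simp

lemma vlin_diff: "vlin f \<Longrightarrow> f (x - y) = f x - f y"
  using vlin_add[of f x "- y"] vlin_minus[of f y] by simp

lemma sum_apply: "(\<Sum>i\<in>I. g i) j = (\<Sum>i\<in>I. g i j)"
  by (induction I rule: infinite_finite_induct) auto

lemma sum_rotate:
  "(\<Sum>a\<in>A. \<Sum>b\<in>B. \<Sum>c\<in>C. f a b c) = (\<Sum>b\<in>B. \<Sum>c\<in>C. \<Sum>a\<in>A. f a b c)"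
proof -
  have "(\<Sum>a\<in>A. \<Sum>b\<in>B. \<Sum>c\<in>C. f a b c) = (\<Sum>b\<in>B. \<Sum>a\<in>A. \<Sum>c\<in>C. f a b c)"
    by (rule sum.swap)
  also have "\<dots> = (\<Sum>b\<in>B. \<Sum>c\<in>C. \<Sum>a\<in>A. f a b c)"
    by (intro sum.cong refl sum.swap)
  finally show ?thesis .
qed

lemma sum_rotate4:
  "(\<Sum>a\<in>A. \<Sum>b\<in>B. \<Sum>c\<in>C. \<Sum>d\<in>D. f a b c d) = (\<Sum>d\<in>D. \<Sum>a\<in>A. \<Sum>b\<in>B. \<Sum>c\<in>C. f a b c d)"
proof -
  have "(\<Sum>a\<in>A. \<Sum>b\<in>B. \<Sum>c\<in>C. \<Sum>d\<in>D. f a b c d) = (\<Sum>a\<in>A. \<Sum>d\<in>D. \<Sum>b\<in>B. \<Sum>c\<in>C. f a b c d)"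
    by (rule sum.cong[OF refl], rule sum_rotate[symmetric])
  also have "\<dots> = (\<Sum>d\<in>D. \<Sum>a\<in>A. \<Sum>b\<in>B. \<Sum>c\<in>C. f a b c d)"
    by (rule sum.swap)
  finally show ?thesis .
qed

lemma vec_expand: "x = (\<Sum>i\<in>UNIV. vscale (x i) (bvec i))" for x :: "'i::finite \<Rightarrow> 'k::field"
  by (auto simp: fun_eq_iff sum_apply fscale_def bvec_def if_distrib[where f="(*) _"] sum.delta
      cong: if_cong)

lemma lin_expand: "lin f \<Longrightarrow> f x = (\<Sum>i\<in>UNIV. x i * f (bvec i))"
  for x :: "'i::finite \<Rightarrow> 'k::field"
  by (subst vec_expand) (simp add: lin_sum lin_scale)

lemma vlin_expand: "vlin f \<Longrightarrow> f x = (\<Sum>i\<in>UNIV. vscale (x i) (f (bvec i)))"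
  for x :: "'i::finite \<Rightarrow> 'k::field"
  by (subst vec_expand) (simp add: vlin_sum vlin_scale)

lemma lin_pairing0: "lin (pairing p)"
  by (simp add: lin_def pairing_def fscale_def algebra_simps sum.distrib sum_distrib_left)

lemma vlin_id [simp]: "vlin (\<lambda>x. x)"
  by (simp add: vlin_def)

lemma lin_comp: "lin g \<Longrightarrow> vlin f \<Longrightarrow> lin (\<lambda>x. g (f x))"
  by (simp add: vlin_def lin_def)

lemma vlin_comp: "vlin g \<Longrightarrow> vlin f \<Longrightarrow> vlin (\<lambda>x. g (f x))"
  by (simp add: vlin_def)

lemma lin_pairing [simp]: "vlin f \<Longrightarrow> lin (\<lambda>x. pairing p (f x))"
  by (rule lin_comp[OF lin_pairing0])

lemma lin_mult_left [simp]: "lin f \<Longrightarrow> lin (\<lambda>x. f x * c)"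
  and lin_mult_right [simp]: "lin f \<Longrightarrow> lin (\<lambda>x. c * f x)"
  by (auto simp: lin_def algebra_simps)

lemma lin_add_fun [simp]: "lin f \<Longrightarrow> lin g \<Longrightarrow> lin (\<lambda>x. f x + g x)"
  by (auto simp: lin_def algebra_simps)

lemma lin_uminus_fun [simp]: "lin f \<Longrightarrow> lin (\<lambda>x. - f x)"
  by (auto simp: lin_def algebra_simps)

lemma lin_diff_fun [simp]: "lin f \<Longrightarrow> lin g \<Longrightarrow> lin (\<lambda>x. f x - g x)"
  by (auto simp: lin_def algebra_simps)

lemma vlin_add_fun [simp]: "vlin f \<Longrightarrow> vlin g \<Longrightarrow> vlin (\<lambda>x. f x + g x)"
  by (auto simp: vlin_def vscale_add)

lemma vlin_diff_fun [simp]: "vlin f \<Longrightarrow> vlin g \<Longrightarrow> vlin (\<lambda>x. f x - g x)"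
  by (auto simp: vlin_def fscale_def algebra_simps fun_eq_iff)

lemma lin_sum_fun [simp]: "(\<And>i. lin (f i)) \<Longrightarrow> lin (\<lambda>x. \<Sum>i\<in>I. f i x)"
  by (auto simp: lin_def sum.distrib sum_distrib_left)

lemma vlin_sum_fun [simp]: "(\<And>i. vlin (f i)) \<Longrightarrow> vlin (\<lambda>x. \<Sum>i\<in>I. f i x)"
  by (auto simp: vlin_def sum.distrib fun_eq_iff sum_apply fscale_def sum_distrib_left)

lemma vlin_coords: "vlin f \<longleftrightarrow> (\<forall>i. lin (\<lambda>x. f x i))"
  by (auto simp: vlin_def lin_def fun_eq_iff fscale_def)

lemma vlin_vscale [simp]: "lin f \<Longrightarrow> vlin (\<lambda>x. vscale (f x) v)"
  and vlin_vscale_right [simp]: "vlin g \<Longrightarrow> vlin (\<lambda>x. vscale c (g x))"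
  by (auto simp: vlin_def lin_def vscale_add mult.commute)

lemma lin_sw_param [simp]: "(\<And>a b. lin (\<lambda>x. F x a b)) \<Longrightarrow> lin (\<lambda>x. sweedler t (\<lambda>a b. F x a b))"
  by (simp add: sweedler_def)

lemma vlin_sw_param [simp]: "(\<And>a b. vlin (\<lambda>x. F x a b)) \<Longrightarrow> vlin (\<lambda>x. sweedler t (\<lambda>a b. F x a b))"
  by (simp add: sweedler_def)

lemma vlin_outer [simp]: "vlin f \<Longrightarrow> vlin (\<lambda>x. outer (f x) h)"
  and vlin_outer_right [simp]: "vlin f \<Longrightarrow> vlin (\<lambda>x. outer c (f x))"
  by (auto simp: vlin_def outer_def fun_eq_iff fscale_def algebra_simps)

lemma pairing_bvec: "pairing (bvec i) x = x i"
  by (simp add: pairing_def bvec_def if_distrib[where f="\<lambda>x. x * _"] cong: if_cong)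

lemma pairing_bvec_right [simp]: "pairing x (bvec i) = x i"
  by (simp add: pairing_def bvec_def if_distrib[where f="(*) _"] cong: if_cong)

lemma vec_eqI: "(\<And>p. pairing p x = pairing p y) \<Longrightarrow> x = y"
  by (metis ext pairing_bvec)

lemma pairing_simps [simp]:
  "pairing p (x + y) = pairing p x + pairing p y" "pairing p (vscale c x) = c * pairing p x"
  "pairing p 0 = 0" "pairing p (- x) = - pairing p x" "pairing p (x - y) = pairing p x - pairing p y"
  for p :: "'i::finite \<Rightarrow> 'k::field"
  using lin_pairing0[of p]
  by (simp_all add: lin_add lin_scale lin_zero lin_minus lin_diff)

lemma pairing_sum: "pairing p (\<Sum>i\<in>I. f i) = (\<Sum>i\<in>I. pairing p (f i))"
  for p :: "'i::finite \<Rightarrow> 'k::field"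
  using lin_pairing0[of p] by (rule lin_sum)

lemma pairing_sw [simp]: "pairing p (sweedler t F) = sweedler t (\<lambda>a b. pairing p (F a b))"
  for p :: "'i::finite \<Rightarrow> 'k::field"
  by (simp add: sweedler_def pairing_sum)

lemma lin_sw: "lin G \<Longrightarrow> G (sweedler t F) = sweedler t (\<lambda>a b. G (F a b))"
  by (simp add: sweedler_def lin_sum)

lemma sw_mult_left: "sweedler t F * c = sweedler t (\<lambda>a b. F a b * (c :: 'k::field))"
  and sw_mult_right: "c * sweedler t F = sweedler t (\<lambda>a b. c * (F a b :: 'k::field))"
  by (simp_all add: sweedler_def sum_distrib_left sum_distrib_right)

lemma sw_cong: "(\<And>a b. F a b = G a b) \<Longrightarrow> sweedler t F = sweedler t G"
  by (simp add: sweedler_def)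

lemma sw_swap:
  "sweedler t (\<lambda>a b. sweedler u (\<lambda>c d. F a b c d)) = sweedler u (\<lambda>c d. sweedler t (\<lambda>a b. F a b c d))"
  unfolding sweedler_def by (rule sum.swap)

lemma sw_add: "(\<And>a x y. F a (x + y) = F a x + F a y) \<Longrightarrow> sweedler (t + u) F = sweedler t F + sweedler u F"
  by (simp add: sweedler_def sum.distrib)

text \<open>The coordinates of a sum of tensors are the sums of their second legs, so an
  \<open>F\<close> additive in the second argument passes inside the outer sum. This evaluates a
  coproduct that is itself written as a Sweedler sum.\<close>

lemma sw_sw:
  fixes F :: "('i::finite \<Rightarrow> 'k::field) \<Rightarrow> 'v::ab_group_add \<Rightarrow> 'w::ab_group_add"
    and t :: "'j::finite \<Rightarrow> 'u"
  assumes add: "\<And>a x y. F a (x + y) = F a x + F a y"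
  shows "sweedler (sweedler t G) F = sweedler t (\<lambda>a b. sweedler (G a b) F)"
proof -
  have zero: "F a 0 = 0" for a
    using add[of a 0 0] by simp
  have sum: "F a (\<Sum>i\<in>I. f i) = (\<Sum>i\<in>I. F a (f i))" if "finite I" for a I and f :: "'j::finite \<Rightarrow> _"
    using that by (induction I) (auto simp: zero add)
  show ?thesis
    unfolding sweedler_def sum_apply by (subst sum.swap) (simp only: sum[OF finite_UNIV])
qed

text \<open>The axioms equate tensors, while the later computations take place in scalars;
  evaluation on pure tensors translates the former into rewrite rules for Sweedler sums.\<close>

lemma sw_tens [simp]:
  assumes "\<And>b. lin (\<lambda>a. F a b)" "\<And>a. lin (F a)"
  shows "sweedler (tens vscale x y) F = F x y"
proof -
  have "sweedler (tens vscale x y) F = (\<Sum>i\<in>UNIV. x i * F (bvec i) y)"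
    by (simp add: sweedler_def tens_def lin_scale[OF assms(2)])
  also have "\<dots> = F x y"
    using lin_expand[OF assms(1)] by metis
  finally show ?thesis .
qed

lemma sw_tens3 [simp]:
  assumes "\<And>b c. lin (\<lambda>a. F a b c)" "\<And>a c. lin (\<lambda>b. F a b c)" "\<And>a b. lin (\<lambda>c. F a b c)"
  shows "sweedler (tens (fscale vscale) x (tens vscale y z)) (\<lambda>a t. sweedler t (\<lambda>b c. F a b c)) = F x y z"
proof -
  have "sweedler (fscale vscale c (tens vscale y z)) (\<lambda>b c. F a b c) = c * F a y z" for a c
  proof -
    have "fscale vscale c (tens vscale y z) = tens vscale (vscale c y) z"
      by (auto simp: tens_def fscale_def fun_eq_iff)
    then show ?thesis
      using assms by (simp add: lin_scale[OF assms(2)])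
  qed
  then have "sweedler (tens (fscale vscale) x (tens vscale y z)) (\<lambda>a t. sweedler t (\<lambda>b c. F a b c))
      = (\<Sum>i\<in>UNIV. x i * F (bvec i) y z)"
    by (simp add: sweedler_def tens_def)
  also have "\<dots> = F x y z"
    using lin_expand[OF assms(1)] by metis
  finally show ?thesis .
qed

lemma sw_tens_right:
  assumes "\<And>b. lin (\<lambda>a. F a b)" "\<And>a c x. F a (fscale vscale c x) = c * F a x"
  shows "sweedler (tens (fscale vscale) x y) F = F x y"
proof -
  have "sweedler (tens (fscale vscale) x y) F = (\<Sum>i\<in>UNIV. x i * F (bvec i) y)"
    using assms(2) by (simp add: sweedler_def tens_def)
  also have "\<dots> = F x y"
    using lin_expand[OF assms(1)] by metis
  finally show ?thesis .
qed

text \<open>The way back from scalars to tensors: with two unit vectors as functionals the sum is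
  the single entry \<open>t i j\<close>.\<close>

lemma tensor_eqI:
  assumes "\<And>p q. sweedler t (\<lambda>a b. pairing p a * pairing q b) = sweedler u (\<lambda>a b. pairing p a * pairing q b)"
  shows "t = u"
proof (intro ext)
  fix i j
  show "t i j = u i j"
    using assms[of "bvec i" "bvec j"]
    by (simp add: sweedler_def pairing_bvec) (simp add: if_distrib[where f="\<lambda>x. x * _"] bvec_def cong: if_cong)
qed

lemma linear_maps:
  assumes "Vector_Spaces.linear s1 s2 f"
  shows "f (x + y) = f x + f y" "f (s1 c x) = s2 c (f x)"
  using assms unfolding Vector_Spaces.linear_def
  by (auto simp: module_hom.add module_hom.scale)

lemma linear_vlin: "Vector_Spaces.linear vscale vscale f \<Longrightarrow> vlin f"
  by (auto simp: vlin_def linear_maps)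

lemma lin_sw_arg0:
  assumes "\<And>x y. f (x + y) = f x + f y" "\<And>c x. f (vscale c x) = fscale vscale c (f x)"
    and "vlin g" "\<And>a. lin (F a)"
  shows "lin (\<lambda>x. sweedler (f (g x)) F)"
  unfolding lin_def
proof safe
  fix x y
  show "sweedler (f (g (x + y))) F = sweedler (f (g x)) F + sweedler (f (g y)) F"
    by (simp add: vlin_add[OF assms(3)] assms(1) sw_add lin_add[OF assms(4)])
next
  fix c x
  show "sweedler (f (g (vscale c x))) F = c * sweedler (f (g x)) F"
    by (simp add: vlin_scale[OF assms(3)] assms(2) lin_scale[OF assms(4)] sweedler_def sum_distrib_left fscale_apply)
qed

section \<open>Hopf algebras\<close>

context fd_algebra
begin

lemma assoc: "x \<otimes> y \<otimes> z = x \<otimes> (y \<otimes> z)"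
  using m_assoc[of x y z] by (simp add: carrier_eq)

lemma one_left [simp]: "\<one> \<otimes> x = x" and one_right [simp]: "x \<otimes> \<one> = x"
  using l_one[of x] r_one[of x] by (simp_all add: carrier_eq)

lemma mult_add: "(x + y) \<otimes> z = x \<otimes> z + y \<otimes> z" "x \<otimes> (y + z) = x \<otimes> y + x \<otimes> z"
  using l_distr[of x y z] r_distr[of y z x] by (simp_all add: carrier_eq add_eq)

lemma vlin_mult [simp]: "vlin f \<Longrightarrow> vlin (\<lambda>x. f x \<otimes> c)"
  and vlin_mult_right [simp]: "vlin f \<Longrightarrow> vlin (\<lambda>x. c \<otimes> f x)"
  by (simp_all add: vlin_def mult_add scale_mult mult_scale)

end

context fd_coalgebra
begin

lemma lin_sw_comult [simp]:
  "vlin g \<Longrightarrow> (\<And>a. lin (F a)) \<Longrightarrow> lin (\<lambda>x. sweedler (comult A (g x)) F)"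
  by (rule lin_sw_arg0[where f="comult A"]) (auto simp: linear_maps[OF comult_linear])

lemma lin_counit [simp]: "vlin g \<Longrightarrow> lin (\<lambda>x. counit A (g x))"
  by (simp add: vlin_def lin_def linear_maps[OF counit_linear])

text \<open>The functional on the triple tensor product induced by \<open>F\<close> is applied to
  both sides of the tensor identity \<open>coassoc\<close>. Scalar values keep the rule usable under
  further sums; vector identities are recovered by pairing with an arbitrary
  \<open>p\<close>.\<close>

lemma sw_coassoc:
  assumes "\<And>b c. lin (\<lambda>a. F a b c)" "\<And>a c. lin (\<lambda>b. F a b c)" "\<And>a b. lin (\<lambda>c. F a b c)"
  shows "sweedler (comult A x) (\<lambda>a b. sweedler (comult A a) (\<lambda>a1 a2. F a1 a2 b))
    = sweedler (comult A x) (\<lambda>a b. sweedler (comult A b) (\<lambda>b1 b2. F a b1 b2))"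
proof -
  let ?P = "\<lambda>T. sweedler T (\<lambda>a t. sweedler t (\<lambda>b c. F a b c))"
  have add: "sweedler (x + y) (\<lambda>b c. F a b c) = sweedler x (\<lambda>b c. F a b c) + sweedler y (\<lambda>b c. F a b c)" for a x y
    by (rule sw_add) (rule lin_add[OF assms(3)])
  have "?P (sweedler (comult A x) (\<lambda>a b. sweedler (comult A a) (\<lambda>a1 a2.
          tens (fscale vscale) a1 (tens vscale a2 b))))
      = ?P (sweedler (comult A x) (\<lambda>a b. tens (fscale vscale) a (comult A b)))"
    by (simp only: coassoc)
  moreover have "?P (tens (fscale vscale) a (comult A b)) = sweedler (comult A b) (\<lambda>b1 b2. F a b1 b2)" for a b
    using assms by (intro sw_tens_right)
     (auto simp: sweedler_def lin_scale[OF assms(3)] sum_distrib_left fscale_apply)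
  ultimately show ?thesis
    using assms by (simp add: sw_sw add)
qed

lemma sw_counit_left [simp]:
  assumes "lin G"
  shows "sweedler (comult A x) (\<lambda>a b. counit A a * G b) = G x"
proof -
  have "G (sweedler (comult A x) (\<lambda>a b. vscale (counit A a) b)) = G x"
    by (simp add: counit_left)
  then show ?thesis
    by (simp add: lin_sw[OF assms] lin_scale[OF assms])
qed

lemma sw_counit_right [simp]:
  assumes "lin G"
  shows "sweedler (comult A x) (\<lambda>a b. counit A b * G a) = G x"
proof -
  have "G (sweedler (comult A x) (\<lambda>a b. vscale (counit A b) a)) = G x"
    by (simp add: counit_right)
  then show ?thesis
    by (simp add: lin_sw[OF assms] lin_scale[OF assms])
qed

lemma sw_counit' [simp]:
  "lin G \<Longrightarrow> sweedler (comult A x) (\<lambda>a b. G b * counit A a) = G x"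
  "lin G \<Longrightarrow> sweedler (comult A x) (\<lambda>a b. G a * counit A b) = G x"
  using sw_counit_left sw_counit_right by (simp_all add: mult.commute)

end

context convolution_antipode
begin

lemma vlin_antipode [simp]: "vlin f \<Longrightarrow> vlin (\<lambda>x. antipode A (f x))"
  by (rule vlin_comp[OF linear_vlin[OF antipode_linear]])

lemma sw_antipode:
  assumes "lin G"
  shows "sweedler (comult A x) (\<lambda>a b. G (antipode A a \<otimes> b)) = counit A x * G \<one>"
    and "sweedler (comult A x) (\<lambda>a b. G (a \<otimes> antipode A b)) = counit A x * G \<one>"
  using lin_sw[OF assms] lin_scale[OF assms] antipode_left antipode_right by metis+

end

context hopf_algebra
begin

lemma comult_mult_sw:
  assumes "\<And>b. lin (\<lambda>a. F a b)" "\<And>a. lin (F a)"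
  shows "sweedler (comult H (x \<otimes> y)) F =
    sweedler (comult H x) (\<lambda>x1 x2. sweedler (comult H y) (\<lambda>y1 y2. F (x1 \<otimes> y1) (x2 \<otimes> y2)))"
  using assms by (simp add: comult_mult sw_sw lin_add[OF assms(2)])

lemma comult_one_sw:
  assumes "\<And>b. lin (\<lambda>a. F a b)" "\<And>a. lin (F a)"
  shows "sweedler (comult H \<one>) F = F \<one> \<one>"
  using assms by (simp add: comult_one)

text \<open>Cancelling neighbours in a threefold coproduct. As the nesting is to the right, the last
  two forms apply the antipode law to the inner coproduct directly; the first two regroup by
  coassociativity before.\<close>

lemma sw_antipode_cancel:
  assumes "\<And>b. lin (\<lambda>a. F a b)" "\<And>a. lin (F a)"
  shows "sweedler (comult H x) (\<lambda>a b. sweedler (comult H b) (\<lambda>b c. F (antipode H a \<otimes> b) c)) = F \<one> x"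
    "sweedler (comult H x) (\<lambda>a b. sweedler (comult H b) (\<lambda>b c. F (a \<otimes> antipode H b) c)) = F \<one> x"
    "sweedler (comult H x) (\<lambda>a b. sweedler (comult H b) (\<lambda>b c. F a (antipode H b \<otimes> c))) = F x \<one>"
    "sweedler (comult H x) (\<lambda>a b. sweedler (comult H b) (\<lambda>b c. F a (b \<otimes> antipode H c))) = F x \<one>"
proof -
  have l: "vlin f \<Longrightarrow> lin (\<lambda>x. F (f x) b)" "vlin f \<Longrightarrow> lin (\<lambda>x. F b (f x))" for f :: "('h \<Rightarrow> 'k) \<Rightarrow> _" and b
    using lin_comp[OF assms(1)] lin_comp[OF assms(2)] by auto
  have "sweedler (comult H x) (\<lambda>a b. sweedler (comult H b) (\<lambda>b c. F (antipode H a \<otimes> b) c))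
      = sweedler (comult H x) (\<lambda>a b. sweedler (comult H a) (\<lambda>a1 a2. F (antipode H a1 \<otimes> a2) b))"
    by (rule sw_coassoc[symmetric]) (auto intro!: l)
  also have "\<dots> = F \<one> x"
    by (simp only: sw_antipode[OF assms(1)] sw_counit_left[OF assms(2)])
  finally show "sweedler (comult H x) (\<lambda>a b. sweedler (comult H b) (\<lambda>b c. F (antipode H a \<otimes> b) c)) = F \<one> x" .
  have "sweedler (comult H x) (\<lambda>a b. sweedler (comult H b) (\<lambda>b c. F (a \<otimes> antipode H b) c))
      = sweedler (comult H x) (\<lambda>a b. sweedler (comult H a) (\<lambda>a1 a2. F (a1 \<otimes> antipode H a2) b))"
    by (rule sw_coassoc[symmetric]) (auto intro!: l)
  also have "\<dots> = F \<one> x"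
    by (simp only: sw_antipode[OF assms(1)] sw_counit_left[OF assms(2)])
  finally show "sweedler (comult H x) (\<lambda>a b. sweedler (comult H b) (\<lambda>b c. F (a \<otimes> antipode H b) c)) = F \<one> x" .
  show "sweedler (comult H x) (\<lambda>a b. sweedler (comult H b) (\<lambda>b c. F a (antipode H b \<otimes> c))) = F x \<one>"
    by (simp only: sw_antipode[OF assms(2)] sw_counit_right[OF assms(1)])
  show "sweedler (comult H x) (\<lambda>a b. sweedler (comult H b) (\<lambda>b c. F a (b \<otimes> antipode H c))) = F x \<one>"
    by (simp only: sw_antipode[OF assms(2)] sw_counit_right[OF assms(1)])
qed

text \<open>The expression \<open>S(x1 y1) x2 y2 S(y3) S(x3)\<close> is evaluated twice: collapsing
  from the right leaves \<open>S(x y)\<close>, collapsing from the left leaves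
  \<open>S(y) S(x)\<close>. This is uniqueness of convolution inverses written out.\<close>

lemma antipode_mult: "antipode H (x \<otimes> y) = antipode H y \<otimes> antipode H x"
proof (rule vec_eqI)
  fix p
  let ?S = "antipode H" and ?D = "\<lambda>x. sweedler (comult H x)"
  let ?F = "\<lambda>x1 x2 x3 y1 y2 y3. pairing p (?S (x1 \<otimes> y1) \<otimes> ((x2 \<otimes> y2) \<otimes> (?S y3 \<otimes> ?S x3)))"
  have 1: "?D x (\<lambda>x1 x'. ?D x' (\<lambda>x2 x3. ?D y (\<lambda>y1 y'. ?D y' (\<lambda>y2 y3. ?F x1 x2 x3 y1 y2 y3))))
    = pairing p (?S (x \<otimes> y))"
  proof -
    have "?D y (\<lambda>y1 y'. ?D y' (\<lambda>y2 y3. ?F x1 x2 x3 y1 y2 y3)) = pairing p (?S (x1 \<otimes> y) \<otimes> (x2 \<otimes> ?S x3))" for x1 x2 x3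
      using sw_antipode_cancel(4)[of "\<lambda>y1 w. pairing p (?S (x1 \<otimes> y1) \<otimes> (x2 \<otimes> (w \<otimes> ?S x3)))" y]
      by (simp add: assoc)
    then show ?thesis
      using sw_antipode_cancel(4)[of "\<lambda>x1 w. pairing p (?S (x1 \<otimes> y) \<otimes> w)" x]
      by simp
  qed
  have anti: "?D u (\<lambda>x1 x2. ?D v (\<lambda>y1 y2. pairing p (?S (x1 \<otimes> y1) \<otimes> ((x2 \<otimes> y2) \<otimes> w)))) = counit H u * (counit H v * pairing p w)" for u v w
    using sw_antipode(1)[of "\<lambda>u. pairing p (u \<otimes> w)" "u \<otimes> v"] by (simp add: assoc counit_mult mult.assoc comult_mult_sw)
  have "?D x (\<lambda>x1 x'. ?D x' (\<lambda>x2 x3. ?D y (\<lambda>y1 y'. ?D y' (\<lambda>y2 y3. ?F x1 x2 x3 y1 y2 y3))))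
    = ?D x (\<lambda>x' x3. ?D x' (\<lambda>x1 x2. ?D y (\<lambda>y' y3. ?D y' (\<lambda>y1 y2. ?F x1 x2 x3 y1 y2 y3))))"
    by (simp add: sw_coassoc)
  also have "\<dots> = ?D x (\<lambda>x' x3. ?D y (\<lambda>y' y3. ?D x' (\<lambda>x1 x2. ?D y' (\<lambda>y1 y2. ?F x1 x2 x3 y1 y2 y3))))"
    by (intro sw_cong sw_swap)
  also have "\<dots> = ?D x (\<lambda>x' x3. ?D y (\<lambda>y' y3. counit H x' * (counit H y' * pairing p (?S y3 \<otimes> ?S x3))))"
    by (intro sw_cong anti)
  also have "\<dots> = pairing p (?S y \<otimes> ?S x)"
    by (simp add: sw_mult_right[symmetric])
  finally show "pairing p (?S (x \<otimes> y)) = pairing p (?S y \<otimes> ?S x)"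
    using 1 by simp
qed

lemma antipode_one [simp]: "antipode H \<one> = \<one>"
proof (rule vec_eqI)
  fix p
  show "pairing p (antipode H \<one>) = pairing p \<one>"
    using sw_antipode(1)[of "pairing p" \<one>]
    by (simp add: comult_one_sw counit_one lin_pairing0)
qed

lemma counit_antipode [simp]: "counit H (antipode H x) = counit H x"
proof -
  have "counit H (antipode H x) = sweedler (comult H x) (\<lambda>a b. counit H b * counit H (antipode H a))"
    by simp
  also have "\<dots> = sweedler (comult H x) (\<lambda>a b. counit H (antipode H a \<otimes> b))"
    by (simp add: counit_mult mult.commute)
  also have "\<dots> = counit H x"
    by (subst sw_antipode(1)) (simp_all add: counit_one lin_counit[of "\<lambda>x. x", simplified])
  finally show ?thesis .
qed

text \<open>Dual to \<open>antipode_mult\<close>: the coproduct of \<open>S x1\<close>, times the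
  coproduct of \<open>x2\<close>, times the tensor of \<open>S x4\<close> and \<open>S x3\<close> is
  evaluated twice, once by cancelling the last two factors (\<open>A\<close>) and once by merging
  the first two into the coproduct of \<open>S(x1) x2\<close> (\<open>B\<close>).\<close>

lemma comult_antipode_sw:
  assumes "\<And>b. lin (\<lambda>a. F a b)" "\<And>a. lin (F a)"
  shows "sweedler (comult H (antipode H x)) F
    = sweedler (comult H x) (\<lambda>a b. F (antipode H b) (antipode H a))"
proof -
  let ?S = "antipode H" and ?D = "\<lambda>x. sweedler (comult H x)"
  have l: "vlin f \<Longrightarrow> lin (\<lambda>x. F (f x) b)" "vlin f \<Longrightarrow> lin (\<lambda>x. F b (f x))" for f :: "('h \<Rightarrow> 'k) \<Rightarrow> _" and b
    using lin_comp[OF assms(1)] lin_comp[OF assms(2)] by auto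
  have A: "?D y (\<lambda>x2 t. ?D x2 (\<lambda>v1 v2. ?D t (\<lambda>x3 x4. F (u1 \<otimes> (v1 \<otimes> ?S x4)) (u2 \<otimes> (v2 \<otimes> ?S x3)))))
    = counit H y * F u1 u2" for y u1 u2
  proof -
    have "?D y (\<lambda>x2 t. ?D x2 (\<lambda>v1 v2. ?D t (\<lambda>x3 x4. F (u1 \<otimes> (v1 \<otimes> ?S x4)) (u2 \<otimes> (v2 \<otimes> ?S x3)))))
      = ?D y (\<lambda>v1 t. ?D t (\<lambda>v2 t. ?D t (\<lambda>x3 x4. F (u1 \<otimes> (v1 \<otimes> ?S x4)) (u2 \<otimes> (v2 \<otimes> ?S x3)))))"
      by (simp add: sw_coassoc l)
    also have "\<dots> = ?D y (\<lambda>v1 t. F (u1 \<otimes> (v1 \<otimes> ?S t)) (u2 \<otimes> \<one>))"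
      by (intro sw_cong sw_antipode_cancel(2)) (simp_all add: l)
    also have "\<dots> = counit H y * F u1 u2"
      using sw_antipode(2)[of "\<lambda>w. F (u1 \<otimes> w) u2"] by (simp add: l)
    finally show ?thesis .
  qed
  have B: "?D (?S x1) (\<lambda>u1 u2. ?D x2 (\<lambda>v1 v2. K (u1 \<otimes> v1) (u2 \<otimes> v2)))
    = ?D (?S x1 \<otimes> x2) K" if "\<And>b. lin (\<lambda>a. K a b)" "\<And>a. lin (K a)" for K x1 x2
    using that by (simp add: comult_mult_sw)
  have "?D (?S x) F = ?D x (\<lambda>x1 y. counit H y * ?D (?S x1) F)"
    by (simp add: l assms)
  also have "\<dots> = ?D x (\<lambda>x1 y. ?D (?S x1) (\<lambda>u1 u2. ?D y (\<lambda>x2 t. ?D x2 (\<lambda>v1 v2. ?D t (\<lambda>x3 x4.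
      F (u1 \<otimes> (v1 \<otimes> ?S x4)) (u2 \<otimes> (v2 \<otimes> ?S x3)))))))"
    by (simp only: A sw_mult_right)
  also have "\<dots> = ?D x (\<lambda>x1 y. ?D y (\<lambda>x2 t. ?D (?S x1) (\<lambda>u1 u2. ?D x2 (\<lambda>v1 v2. ?D t (\<lambda>x3 x4.
      F (u1 \<otimes> (v1 \<otimes> ?S x4)) (u2 \<otimes> (v2 \<otimes> ?S x3)))))))"
    by (intro sw_cong sw_swap)
  also have "\<dots> = ?D x (\<lambda>y t. ?D y (\<lambda>x1 x2. ?D (?S x1) (\<lambda>u1 u2. ?D x2 (\<lambda>v1 v2. ?D t (\<lambda>x3 x4.
      F (u1 \<otimes> (v1 \<otimes> ?S x4)) (u2 \<otimes> (v2 \<otimes> ?S x3)))))))"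
    by (rule sw_coassoc[symmetric]) (simp_all add: l)
  also have "\<dots> = ?D x (\<lambda>y t. ?D y (\<lambda>x1 x2. ?D (?S x1 \<otimes> x2) (\<lambda>u1 u2. ?D t (\<lambda>x3 x4.
      F (u1 \<otimes> ?S x4) (u2 \<otimes> ?S x3)))))"
    by (intro sw_cong, subst B[symmetric]) (simp_all add: l assoc)
  also have "\<dots> = ?D x (\<lambda>y t. counit H y * ?D \<one> (\<lambda>u1 u2. ?D t (\<lambda>x3 x4.
      F (u1 \<otimes> ?S x4) (u2 \<otimes> ?S x3))))"
    by (intro sw_cong sw_antipode(1)) (simp add: l)
  also have "\<dots> = ?D x (\<lambda>a b. F (?S b) (?S a))"
    by (simp add: comult_one_sw l)
  finally show ?thesis .
qed

end

section \<open>Bijectivity of the antipode\<close>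

lemma lin_expand_nested:
  "lin f \<Longrightarrow> (\<Sum>i\<in>UNIV. x i * f (bvec i)) = f x" for x :: "'i::finite \<Rightarrow> 'k::field"
  by (rule lin_expand[symmetric])

context hopf_algebra
begin

text \<open>The trace of \<open>y \<mapsto> x S\<^sup>2(y\<^sub>(\<^sub>1\<^sub>)) \<langle>q, y\<^sub>(\<^sub>2\<^sub>)\<rangle>\<close>. It is the projection of \<open>q\<close> to the coinvariants of the
  Hopf module \<open>H\<^sup>*\<close>, hence an integral.\<close>

definition trace_integral :: "('h \<Rightarrow> 'k) \<Rightarrow> ('h \<Rightarrow> 'k) \<Rightarrow> 'k" where
  "trace_integral q x = (\<Sum>i\<in>UNIV. sweedler (comult H (bvec i)) (\<lambda>a b.
     pairing (bvec i) (x \<otimes> antipode H (antipode H a)) * pairing q b))"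

lemma lin_trace_integral: "lin (trace_integral q)"
  unfolding trace_integral_def by simp

text \<open>Every functional is recovered from trace integrals: in the expansion of
  \<open>pairing f x\<close> over a basis one inserts \<open>S(S(a) b)\<close>, which cancels to the
  unit, splits it by antimultiplicativity, and expands the remaining leg over a second basis
  \<open>bvec k\<close>. Hence not all trace integrals vanish.\<close>

lemma trace_integral_nonzero:
  assumes "\<And>q x. trace_integral q x = 0"
  shows False
proof -
  let ?S = "antipode H" and ?D = "\<lambda>x. sweedler (comult H x)"
  have "pairing f x = 0" for f x :: "'h \<Rightarrow> 'k"
  proof -
    have "pairing f x = (\<Sum>i\<in>UNIV. x i * pairing f (bvec i))"
      using lin_expand[OF lin_pairing0[of f], of x] by simp
    also have "\<dots> = (\<Sum>i\<in>UNIV. pairing (bvec i) x * pairing f (bvec i))"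
      by (simp add: pairing_bvec)
    also have "\<dots> = (\<Sum>i\<in>UNIV. ?D (bvec i) (\<lambda>a t. ?D t (\<lambda>b c. pairing (bvec i) (x \<otimes> ?S (?S a \<otimes> b)) * pairing f c)))"
      by (subst sw_antipode_cancel(1)[where F="\<lambda>u c. pairing (bvec _) (x \<otimes> ?S u) * pairing f c"])
         simp_all
    also have "\<dots> = (\<Sum>i\<in>UNIV. ?D (bvec i) (\<lambda>a t. \<Sum>k\<in>UNIV. t k *
        ?D (bvec k) (\<lambda>b c. pairing (bvec i) (x \<otimes> ?S (?S a \<otimes> b)) * pairing f c)))"
      by (subst lin_expand_nested) simp_all
    also have "\<dots> = (\<Sum>k\<in>UNIV. ?D (bvec k) (\<lambda>b c. trace_integral (bvec k) (x \<otimes> ?S b) * pairing f c))"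
      unfolding trace_integral_def sweedler_def sum_distrib_left sum_distrib_right antipode_mult assoc
      by (rule trans[OF sum_rotate[symmetric]], rule sum.cong[OF refl], rule trans[OF sum_rotate[symmetric]])
         (simp add: mult_ac pairing_bvec)
    also have "\<dots> = 0"
      by (simp add: assms sweedler_def)
    finally show ?thesis .
  qed
  from this[of "bvec undefined" "bvec undefined"] show False
    by simp (simp add: bvec_def)
qed

text \<open>The antipode reverses coproducts, so the first leg of the coproduct of
  \<open>x S(h1)\<close> ends in the antipode of the leg adjacent to \<open>h2\<close>, and
  multiplication by \<open>h2\<close> removes it.\<close>

lemma sw_comult_mult_antipode:
  assumes "lin p" "lin G"
  shows "sweedler (comult H x) (\<lambda>x1 x2. p (x2 \<otimes> antipode H h) * G x1)
    = sweedler (comult H h) (\<lambda>h1 h2. sweedler (comult H (x \<otimes> antipode H h1)) (\<lambda>z1 z2. p z2 * G (z1 \<otimes> h2)))"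
proof -
  let ?S = "antipode H" and ?D = "\<lambda>x. sweedler (comult H x)"
  have l: "vlin f \<Longrightarrow> lin (\<lambda>x. p (f x))" "vlin f \<Longrightarrow> lin (\<lambda>x. G (f x))" for f :: "('h \<Rightarrow> 'k) \<Rightarrow> _"
    using lin_comp[OF assms(1)] lin_comp[OF assms(2)] by auto
  have "?D h (\<lambda>h1 h2. ?D (x \<otimes> ?S h1) (\<lambda>z1 z2. p z2 * G (z1 \<otimes> h2)))
    = ?D h (\<lambda>t h2. ?D x (\<lambda>x1 x2. ?D t (\<lambda>a b. p (x2 \<otimes> ?S a) * G (x1 \<otimes> (?S b \<otimes> h2)))))"
    by (simp add: comult_mult_sw comult_antipode_sw l assoc)
  also have "\<dots> = ?D h (\<lambda>t h2. ?D t (\<lambda>a b. ?D x (\<lambda>x1 x2. p (x2 \<otimes> ?S a) * G (x1 \<otimes> (?S b \<otimes> h2)))))"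
    by (intro sw_cong sw_swap)
  also have "\<dots> = ?D h (\<lambda>a t. ?D t (\<lambda>b h2. ?D x (\<lambda>x1 x2. p (x2 \<otimes> ?S a) * G (x1 \<otimes> (?S b \<otimes> h2)))))"
    by (rule sw_coassoc) (simp_all add: l)
  also have "\<dots> = ?D x (\<lambda>x1 x2. p (x2 \<otimes> ?S h) * G (x1 \<otimes> \<one>))"
    by (rule sw_antipode_cancel(3)) (simp_all add: l)
  finally show ?thesis
    by simp
qed

text \<open>Multiplication by \<open>S(S a)\<close> is pulled through the coproduct of x by
  \<open>sw_comult_mult_antipode\<close>. Cyclicity of the trace then makes \<open>z1\<close> and
  \<open>a1\<close> neighbouring legs of one threefold coproduct, and \<open>z1 S(a1)\<close>
  cancels.\<close>

lemma trace_integral_invariant: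
  assumes "lin G"
  shows "sweedler (comult H x) (\<lambda>a b. trace_integral q b * G a) = trace_integral q x * G \<one>"
proof -
  let ?S = "antipode H" and ?D = "\<lambda>x. sweedler (comult H x)"
  let ?c = "\<lambda>i. pairing (bvec i)"
  have l: "vlin f \<Longrightarrow> lin (\<lambda>x. G (f x))" for f :: "('h \<Rightarrow> 'k) \<Rightarrow> _"
    using lin_comp[OF assms] by auto
  have "?D x (\<lambda>x1 x2. trace_integral q x2 * G x1)
    = (\<Sum>i\<in>UNIV. ?D (bvec i) (\<lambda>a b. ?D x (\<lambda>x1 x2. ?c i (x2 \<otimes> ?S (?S a)) * G x1) * pairing q b))"
    unfolding trace_integral_def sweedler_def sum_distrib_left sum_distrib_right
    by (rule trans[OF sum_rotate]) (simp add: mult_ac)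
  also have "\<dots> = (\<Sum>i\<in>UNIV. ?D (bvec i) (\<lambda>t b. ?D t (\<lambda>a1 a2.
      ?D (x \<otimes> ?S (?S a2)) (\<lambda>z1 z2. ?c i z2 * G (z1 \<otimes> ?S a1) * pairing q b))))"
    by (simp add: sw_comult_mult_antipode lin_pairing0 assms comult_antipode_sw l sw_mult_left)
  also have "\<dots> = (\<Sum>i\<in>UNIV. ?D (bvec i) (\<lambda>a1 t. ?D t (\<lambda>a2 b.
      ?D (x \<otimes> ?S (?S a2)) (\<lambda>z1 z2. ?c i z2 * G (z1 \<otimes> ?S a1) * pairing q b))))"
    by (intro sum.cong refl sw_coassoc) (simp_all add: l)
  also have "\<dots> = (\<Sum>i\<in>UNIV. ?D (bvec i) (\<lambda>a1 t. ?D t (\<lambda>a2 b. \<Sum>k\<in>UNIV. (x \<otimes> ?S (?S a2)) k *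
      ?D (bvec k) (\<lambda>z1 z2. ?c i z2 * G (z1 \<otimes> ?S a1) * pairing q b))))"
    by (subst lin_expand_nested) (simp_all add: l)
  \<comment> \<open>Cyclicity of the trace: the old outer index \<open>i\<close> becomes a
    coordinate of \<open>z2\<close>, and the new outer index \<open>k\<close> reads off a coordinate
    of \<open>x S(S a2)\<close>.\<close>
  also have "\<dots> = (\<Sum>k\<in>UNIV. ?D (bvec k) (\<lambda>z1 z2. \<Sum>i\<in>UNIV. z2 i * ?D (bvec i) (\<lambda>a1 t. ?D t (\<lambda>a2 b.
      ?c k (x \<otimes> ?S (?S a2)) * G (z1 \<otimes> ?S a1) * pairing q b))))"
    unfolding sweedler_def sum_distrib_left sum_distrib_right pairing_bvec
    by (rule trans[OF sum_rotate4], rule sum.cong[OF refl], rule trans[OF sum_rotate4])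
       (simp add: mult_ac)
  also have "\<dots> = (\<Sum>k\<in>UNIV. ?D (bvec k) (\<lambda>z1 z2. ?D z2 (\<lambda>a1 t. ?D t (\<lambda>a2 b.
      ?c k (x \<otimes> ?S (?S a2)) * G (z1 \<otimes> ?S a1) * pairing q b))))"
    by (subst lin_expand_nested) (simp_all add: l)
  also have "\<dots> = (\<Sum>k\<in>UNIV. ?D (bvec k) (\<lambda>a2 b. ?c k (x \<otimes> ?S (?S a2)) * G \<one> * pairing q b))"
    by (intro sum.cong refl sw_antipode_cancel(2)) (simp_all add: l)
  also have "\<dots> = trace_integral q x * G \<one>"
    unfolding trace_integral_def sweedler_def sum_distrib_left sum_distrib_right by (simp add: mult_ac)
  finally show ?thesis .
qed

text \<open>An invariant functional \<open>l\<close> with \<open>l x \<noteq> 0\<close> detects the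
  kernel. If \<open>S h = 0\<close>, then by \<open>*\<close> the vector
  \<open>l(y S(h1)) h2\<close> vanishes for every y. The expansion of \<open>l x\<close> times h
  through \<open>S(h1 S(h2)) = S(S h2) S(h1)\<close> consists of such terms, with
  \<open>y = x S(S h2)\<close>.\<close>

lemma inj_antipode: "inj (antipode H)"
proof -
  let ?S = "antipode H" and ?D = "\<lambda>x. sweedler (comult H x)"
  have zero: "h = 0" if h: "?S h = 0" for h
  proof -
    obtain q x where x: "trace_integral q x \<noteq> 0"
      using trace_integral_nonzero by blast
    define l where "l = trace_integral q"
    have l: "lin l" and lc: "vlin f \<Longrightarrow> lin (\<lambda>x. l (f x))" for f :: "('h \<Rightarrow> 'k) \<Rightarrow> _"
      using lin_comp[OF lin_trace_integral[of q]] by (auto simp: l_def lin_trace_integral)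
    have inv: "?D x (\<lambda>a b. l b * G a) = l x * G \<one>" if "lin G" for x G
      using trace_integral_invariant[OF that] by (simp add: l_def)
    \<comment> \<open>The left side of \<open>sw_comult_mult_antipode\<close> contains
      \<open>S h\<close>, and its right side collapses by the invariance of
      \<open>l\<close>.\<close>
    have *: "?D h (\<lambda>h1 h2. l (y \<otimes> ?S h1) * pairing p h2) = 0" for y p
    proof -
      have "?D y (\<lambda>x1 x2. l (x2 \<otimes> ?S h) * pairing p x1) = 0"
        using lin_zero[OF l] by (simp add: h vlin_zero[OF vlin_mult_right[OF vlin_id]] sweedler_def)
      then show ?thesis
        by (simp add: sw_comult_mult_antipode l lin_pairing0 inv)
    qed
    have "pairing p h = 0" for p
    proof -
      have "l x * pairing p h = ?D h (\<lambda>h1 t. ?D t (\<lambda>h2 h3. l (x \<otimes> ?S (h1 \<otimes> ?S h2)) * pairing p h3))"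
        by (subst sw_antipode_cancel(2)) (simp_all add: lc)
      also have "\<dots> = ?D h (\<lambda>h1 t. \<Sum>k\<in>UNIV. t k * ?D (bvec k) (\<lambda>h2 h3. l (x \<otimes> ?S (h1 \<otimes> ?S h2)) * pairing p h3))"
        by (subst lin_expand_nested) (simp_all add: lc)
      also have "\<dots> = (\<Sum>k\<in>UNIV. ?D (bvec k) (\<lambda>h2 h3. ?D h (\<lambda>h1 t. l ((x \<otimes> ?S (?S h2)) \<otimes> ?S h1) * pairing (bvec k) t) * pairing p h3))"
        unfolding sweedler_def sum_distrib_left sum_distrib_right pairing_bvec antipode_mult assoc
        by (rule trans[OF sum_rotate]) (simp add: mult_ac)
      also have "\<dots> = 0"
        by (simp only: *) (simp add: sweedler_def)
      finally show ?thesis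
        using x by (simp add: l_def)
    qed
    then show ?thesis
      by (intro vec_eqI) simp
  qed
  have vS: "vlin ?S"
    by (rule linear_vlin[OF antipode_linear])
  show ?thesis
  proof (rule injI)
    fix a b assume "?S a = ?S b"
    then have "?S (a - b) = 0"
      by (simp add: vlin_diff[OF vS])
    then show "a = b"
      using zero by fastforce
  qed
qed

end

lemma finite_range_bvec: "finite (range (bvec :: 'i::finite \<Rightarrow> 'i \<Rightarrow> 'k::field))"
  by simp

text \<open>Gives function spaces over a finite index type the library theory of finite dimension:
  surjectivity of injective endomorphisms, bases of subspaces, extension of independent
  sets.\<close>

global_interpretation kvec: finite_dimensional_vector_space "vscale :: 'k::field \<Rightarrow> ('i::finite \<Rightarrow> 'k) \<Rightarrow> 'i \<Rightarrow> 'k" "range bvec"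
proof
  show "vscale a (x + y) = vscale a x + vscale a y" for a and x y :: "'i \<Rightarrow> 'k"
    by (rule vscale_add)
  show "vscale (a + b) x = vscale a x + vscale b x" for a b and x :: "'i \<Rightarrow> 'k"
    by (rule vscale_add)
  show "vscale a (vscale b x) = vscale (a * b) x" for a b and x :: "'i \<Rightarrow> 'k"
    by simp
  show "vscale 1 x = x" for x :: "'i \<Rightarrow> 'k"
    by simp
  show "finite (range (bvec :: 'i \<Rightarrow> 'i \<Rightarrow> 'k))"
    by (rule finite_range_bvec)
  have vs: "vector_space (vscale :: 'k \<Rightarrow> ('i \<Rightarrow> 'k) \<Rightarrow> 'i \<Rightarrow> 'k)"
    by unfold_locales (simp_all add: vscale_add)
  interpret vector_space "vscale :: 'k \<Rightarrow> ('i \<Rightarrow> 'k) \<Rightarrow> 'i \<Rightarrow> 'k"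
    by (rule vs)
  show "independent (range bvec :: ('i \<Rightarrow> 'k) set)"
    unfolding independent_explicit_module
  proof safe
    fix t and u :: "('i \<Rightarrow> 'k) \<Rightarrow> 'k" and w
    assume t: "finite t" "t \<subseteq> range bvec" "(\<Sum>v\<in>t. vscale (u v) v) = 0" "w \<in> t"
    then obtain i where i: "w = bvec i"
      by auto
    have *: "vscale (u v) v i = (if v = bvec i then u v else 0)" if v: "v \<in> t" for v
    proof -
      obtain j where "v = bvec j"
        using v t(2) by auto
      then show ?thesis
        by (cases "i = j") (auto simp: vscale_apply bvec_apply fun_eq_iff)
    qed
    have "(\<Sum>v\<in>t. vscale (u v) v) i = (\<Sum>v\<in>t. if v = bvec i then u v else 0)"
      unfolding sum_apply by (intro sum.cong refl *)
    then show "u w = 0"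
      using t by (simp add: i)
  qed
  show "span (range bvec) = (UNIV :: ('i \<Rightarrow> 'k) set)"
  proof safe
    fix x :: "'i \<Rightarrow> 'k"
    have "(\<Sum>i\<in>UNIV. vscale (x i) (bvec i)) \<in> span (range bvec)"
      by (intro span_sum span_scale span_base) auto
    then show "x \<in> span (range bvec)"
      using vec_expand[of x] by simp
  qed auto
qed

lemma vlin_linear: "vlin f \<Longrightarrow> Vector_Spaces.linear vscale vscale f"
  for f :: "('i::finite \<Rightarrow> 'k::field) \<Rightarrow> 'j::finite \<Rightarrow> 'k"
  by (intro Vector_Spaces.linear.intro module_hom.intro module_hom_axioms.intro
      kvec.vector_space_axioms kvec.module_axioms) (auto simp: vlin_def)

context hopf_algebra
begin

lemma surj_antipode: "surj (antipode H)"
  using kvec.linear_inj_imp_surj[OF antipode_linear inj_antipode] .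

definition antipode_inv :: "('h \<Rightarrow> 'k) \<Rightarrow> 'h \<Rightarrow> 'k" where
  "antipode_inv = inv_into UNIV (antipode H)"

lemma antipode_inv [simp]:
  "antipode_inv (antipode H x) = x" "antipode H (antipode_inv x) = x"
  by (simp_all add: antipode_inv_def inj_antipode surj_antipode surj_f_inv_f)

lemma vlin_antipode_inv0: "vlin antipode_inv"
proof -
  have "vlin (antipode H)"
    by (rule linear_vlin[OF antipode_linear])
  then show ?thesis
    unfolding vlin_def by (metis antipode_inv)
qed

lemmas vlin_antipode_inv [simp] = vlin_comp[OF vlin_antipode_inv0]

lemma antipode_inv_mult: "antipode_inv (x \<otimes> y) = antipode_inv y \<otimes> antipode_inv x"
  by (metis antipode_inv antipode_mult)

lemma antipode_inv_one [simp]: "antipode_inv \<one> = \<one>"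
  by (metis antipode_inv(1) antipode_one)

text \<open>The inverse antipode reverses products, so applying it inside the antipode laws gives
  their opposite versions.\<close>

lemma sw_antipode_inv:
  assumes "lin G"
  shows "sweedler (comult H x) (\<lambda>a b. G (antipode_inv b \<otimes> a)) = counit H x * G \<one>"
    and "sweedler (comult H x) (\<lambda>a b. G (b \<otimes> antipode_inv a)) = counit H x * G \<one>"
  using sw_antipode(1)[OF lin_comp[OF assms vlin_antipode_inv0], of x]
    sw_antipode(2)[OF lin_comp[OF assms vlin_antipode_inv0], of x]
  by (simp_all add: antipode_inv_mult)

end

section \<open>Braided Hopf algebras and bosonization\<close>

lemma sw_cong3:
  "(\<And>a b c d e f. F a b c d e f = G a b c d e f) \<Longrightarrow>
    sweedler t (\<lambda>a b. sweedler (u a b) (\<lambda>c d. sweedler (v a b c d) (\<lambda>e f. F a b c d e f)))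
    = sweedler t (\<lambda>a b. sweedler (u a b) (\<lambda>c d. sweedler (v a b c d) (\<lambda>e f. G a b c d e f)))"
  by simp

lemma sw_swap2:
  "sweedler t (\<lambda>a b. sweedler (u a b) (\<lambda>c d. sweedler v (\<lambda>e f. F a b c d e f)))
    = sweedler v (\<lambda>e f. sweedler t (\<lambda>a b. sweedler (u a b) (\<lambda>c d. F a b c d e f)))"
  by (rule trans[OF sw_cong[OF sw_swap] sw_swap])

lemma sw_swap3:
  "sweedler t (\<lambda>a b. sweedler (u a b) (\<lambda>c d. sweedler (v a b c d) (\<lambda>e f. sweedler w (\<lambda>g h. F a b c d e f g h))))
    = sweedler w (\<lambda>g h. sweedler t (\<lambda>a b. sweedler (u a b) (\<lambda>c d. sweedler (v a b c d) (\<lambda>e f. F a b c d e f g h))))"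
  by (rule trans[OF sw_cong[OF sw_swap2] sw_swap])

lemma sw_swap4:
  "sweedler t (\<lambda>a b. sweedler (u a b) (\<lambda>c d. sweedler (v a b c d) (\<lambda>e f. sweedler (w a b c d e f) (\<lambda>g h.
      sweedler z (\<lambda>i j. F a b c d e f g h i j)))))
    = sweedler z (\<lambda>i j. sweedler t (\<lambda>a b. sweedler (u a b) (\<lambda>c d. sweedler (v a b c d) (\<lambda>e f.
      sweedler (w a b c d e f) (\<lambda>g h. F a b c d e f g h i j)))))"
  by (rule trans[OF sw_cong[OF sw_swap3] sw_swap])

lemma vlin_sw: "vlin f \<Longrightarrow> f (sweedler t F) = sweedler t (\<lambda>a b. f (F a b))"
  by (simp add: sweedler_def vlin_sum)

lemma fd_algebraI:
  fixes A :: "('i::finite \<Rightarrow> 'k::field, 'm) ring_scheme" (structure)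
  assumes "carrier A = UNIV" "\<zero> = 0" "\<And>x y. x \<oplus> y = x + y"
    and "\<And>c. vlin (\<lambda>x. x \<otimes> c)" "\<And>c. vlin (\<lambda>x. c \<otimes> x)"
    and "\<And>x y z. x \<otimes> y \<otimes> z = x \<otimes> (y \<otimes> z)" "\<And>x. \<one> \<otimes> x = x" "\<And>x. x \<otimes> \<one> = x"
  shows "fd_algebra A"
proof -
  have "abelian_group A"
    by (rule abelian_groupI) (auto simp: assms algebra_simps intro: exI[of _ "- _"] add.left_inverse)
  moreover have "Group.monoid A"
    by unfold_locales (auto simp: assms)
  ultimately have "ring A"
    by (intro ring.intro ring_axioms.intro)
       (auto simp: assms vlin_add[OF assms(4)] vlin_add[OF assms(5)])
  then show ?thesis
    by (intro fd_algebra.intro fd_algebra_axioms.intro)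
       (auto simp: assms vlin_scale[OF assms(4)] vlin_scale[OF assms(5)])
qed

lemma vector_space_fscale: "vector_space s \<Longrightarrow> vector_space (fscale s)"
  by (auto simp: vector_space_def fscale_def fun_eq_iff)

lemma vector_space_mult: "vector_space ((*) :: 'k::field \<Rightarrow> _)"
  by unfold_locales (simp_all add: algebra_simps)

lemma sw_fscale: "(\<And>a. lin (F a)) \<Longrightarrow> sweedler (fscale vscale c t) F = c * sweedler t F"
  unfolding sweedler_def by (simp add: fscale_apply sum_distrib_left) (meson lin_scale)

lemma lin_linear: "lin f \<Longrightarrow> Vector_Spaces.linear vscale (*) f"
  for f :: "('i::finite \<Rightarrow> 'k::field) \<Rightarrow> 'k"
  by (intro Vector_Spaces.linear.intro module_hom.intro module_hom_axioms.intro
      kvec.vector_space_axioms kvec.module_axioms vector_space_mult)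
    (auto simp: lin_def module_iff_vector_space vector_space_mult)

lemma tensor_map_linearI:
  fixes f :: "('i::finite \<Rightarrow> 'k::field) \<Rightarrow> 'j::finite \<Rightarrow> 'l::finite \<Rightarrow> 'k"
  assumes "\<And>p q. lin (\<lambda>x. sweedler (f x) (\<lambda>a b. pairing p a * pairing q b))"
  shows "Vector_Spaces.linear vscale (fscale vscale) f"
proof -
  have "f (x + y) = f x + f y" for x y
    by (rule tensor_eqI) (simp add: sw_add algebra_simps lin_add[OF assms])
  moreover have "f (vscale c x) = fscale vscale c (f x)" for c x
    by (rule tensor_eqI) (simp add: sw_fscale lin_scale[OF assms])
  moreover have "vector_space (fscale vscale :: 'k \<Rightarrow> ('j \<Rightarrow> 'l \<Rightarrow> 'k) \<Rightarrow> _)"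
    by (rule vector_space_fscale) (rule kvec.vector_space_axioms)
  ultimately show ?thesis
    by (intro Vector_Spaces.linear.intro module_hom.intro module_hom_axioms.intro
        kvec.vector_space_axioms kvec.module_axioms) (auto simp: module_iff_vector_space)
qed

lemma tensor3_eqI:
  fixes t u :: "'i::finite \<Rightarrow> 'j::finite \<Rightarrow> 'l::finite \<Rightarrow> 'k::field"
  assumes "\<And>p q r. sweedler t (\<lambda>a t. sweedler t (\<lambda>b c. pairing p a * pairing q b * pairing r c))
    = sweedler u (\<lambda>a t. sweedler t (\<lambda>b c. pairing p a * pairing q b * pairing r c))"
  shows "t = u"
proof
  fix i
  show "t i = u i"
  proof (rule tensor_eqI)
    fix q r
    have *: "sweedler t (\<lambda>a t. sweedler t (\<lambda>b c. pairing (bvec i) a * pairing q b * pairing r c))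
        = sweedler (t i) (\<lambda>b c. pairing q b * pairing r c)" for t :: "'i \<Rightarrow> 'j \<Rightarrow> 'l \<Rightarrow> 'k"
    proof -
      have "sweedler t (\<lambda>a t. sweedler t (\<lambda>b c. pairing (bvec i) a * pairing q b * pairing r c))
        = (\<Sum>j\<in>UNIV. if j = i then sweedler (t j) (\<lambda>b c. pairing q b * pairing r c) else 0)"
        unfolding sweedler_def by (intro sum.cong refl) (simp add: bvec_apply)
      then show ?thesis
        by simp
    qed
    show "sweedler (t i) (\<lambda>b c. pairing q b * pairing r c) = sweedler (u i) (\<lambda>b c. pairing q b * pairing r c)"
      using assms[of "bvec i" q r] by (simp only: *)
  qed
qed

lemma bvec_Pair: "bvec (i, j) = (outer (bvec i) (bvec j) :: 'i \<times> 'j \<Rightarrow> 'k::field)"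
  by (auto simp: bvec_def outer_def fun_eq_iff)

text \<open>The standard basis of a space indexed by pairs consists of pure tensors. Most identities
  in the bosonization are checked on \<open>outer x h\<close> and extended by this rule.\<close>

lemma lin_eq_outerI:
  fixes f g :: "('i::finite \<times> 'j::finite \<Rightarrow> 'k::field) \<Rightarrow> 'k"
  assumes "lin f" "lin g" "\<And>x y. f (outer x y) = g (outer x y)"
  shows "f t = g t"
proof -
  have "f (bvec a) = g (bvec a)" for a
    using assms(3) by (cases a) (simp add: bvec_Pair)
  then show ?thesis
    using lin_expand[OF assms(1), of t] lin_expand[OF assms(2), of t] by simp
qed

lemma curry_outer: "curry (outer x y) = tens vscale x y"
  by (auto simp: fun_eq_iff curry_def outer_def tens_def fscale_def)

lemma sw_curry_outer:
  assumes "\<And>b. lin (\<lambda>a. F a b)" "\<And>a. lin (F a)"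
  shows "sweedler (curry (outer x y)) F = F x y"
  using assms by (simp add: curry_outer)

lemma vlin_curry [simp]: "vlin g \<Longrightarrow> (\<And>a. lin (F a)) \<Longrightarrow> lin (\<lambda>x. sweedler (curry (g x)) F)"
  by (rule lin_sw_arg0[where f=curry]) (auto simp: curry_def fun_eq_iff fscale_def)

lemma vlin_pairingI: "(\<And>p. lin (\<lambda>x. pairing p (f x))) \<Longrightarrow> vlin f"
  for f :: "_ \<Rightarrow> 'j::finite \<Rightarrow> 'k::field"
  unfolding vlin_coords using pairing_bvec by (metis (no_types, lifting) ext)

context yd_module
begin

end

section \<open>Sweedler rules for braided Hopf algebras\<close>

context braided_hopf_algebra
begin

abbreviation actB (infixr "\<rightharpoonup>" 72) where "actB \<equiv> yact B"
abbreviation multB (infixl "\<cdot>" 70) where "multB \<equiv> mult B"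
abbreviation DH where "DH h \<equiv> sweedler (comult H h)"
abbreviation DB where "DB h \<equiv> sweedler (comult B h)"
abbreviation CB where "CB x \<equiv> sweedler (ycoact B x)"

lemma vlin_act [simp]: "vlin f \<Longrightarrow> vlin (\<lambda>x. f x \<rightharpoonup> v)"
  by (rule vlin_comp[OF linear_vlin[OF act_linear_left]])

lemma vlin_act_right [simp]: "vlin f \<Longrightarrow> vlin (\<lambda>x. h \<rightharpoonup> f x)"
  by (rule vlin_comp[OF linear_vlin[OF act_linear_right]])

lemma lin_sw_coact [simp]:
  "vlin g \<Longrightarrow> (\<And>a. lin (F a)) \<Longrightarrow> lin (\<lambda>x. CB (g x) F)"
  by (rule lin_sw_arg0[where f="ycoact B"]) (auto simp: linear_maps[OF coact_linear])

lemma sw_coact_coassoc: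
  assumes "\<And>b c. lin (\<lambda>a. F a b c)" "\<And>a c. lin (\<lambda>b. F a b c)" "\<And>a b. lin (\<lambda>c. F a b c)"
  shows "CB x (\<lambda>g y. DH g (\<lambda>g1 g2. F g1 g2 y)) = CB x (\<lambda>g y. CB y (\<lambda>h z. F g h z))"
proof -
  let ?P = "\<lambda>T. sweedler T (\<lambda>a t. sweedler t (\<lambda>b c. F a b c))"
  have add: "sweedler (x + y) (\<lambda>b c. F a b c) = sweedler x (\<lambda>b c. F a b c) + sweedler y (\<lambda>b c. F a b c)" for a x y
    by (rule sw_add) (rule lin_add[OF assms(3)])
  have "?P (CB x (\<lambda>h w. DH h (\<lambda>h1 h2. tens (fscale vscale) h1 (tens vscale h2 w))))
      = ?P (CB x (\<lambda>h w. tens (fscale vscale) h (ycoact B w)))"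
    by (simp only: coact_coassoc)
  moreover have "?P (tens (fscale vscale) a (ycoact B b)) = CB b (\<lambda>b1 b2. F a b1 b2)" for a b
    using assms by (intro sw_tens_right)
     (auto simp: sweedler_def lin_scale[OF assms(3)] sum_distrib_left fscale_apply)
  ultimately show ?thesis
    using assms by (simp add: sw_sw add)
qed

lemma sw_coact_counit [simp]:
  assumes "lin G"
  shows "CB x (\<lambda>g y. counit H g * G y) = G x"
proof -
  have "G (CB x (\<lambda>h w. vscale (counit H h) w)) = G x"
    by (simp add: coact_counit)
  then show ?thesis
    by (simp add: lin_sw[OF assms] lin_scale[OF assms])
qed

lemma sw_counit_coact [simp]:
  assumes "lin G"
  shows "CB x (\<lambda>g y. counit B y * G g) = counit B x * G \<one>\<^bsub>H\<^esub>"
  using lin_sw[OF assms, of "ycoact B x" "\<lambda>g y. vscale (counit B y) g"]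
  by (simp add: counit_coact lin_scale[OF assms])

lemma sw_coact_act:
  assumes "\<And>b. lin (\<lambda>a. F a b)" "\<And>a. lin (F a)"
  shows "CB (h \<rightharpoonup> v) F = DH h (\<lambda>h1 h'. DH h' (\<lambda>h2 h3. CB v (\<lambda>g w.
    F (h1 \<otimes>\<^bsub>H\<^esub> g \<otimes>\<^bsub>H\<^esub> antipode H h3) (h2 \<rightharpoonup> w))))"
  using assms by (simp add: yd_compat sw_sw lin_add[OF assms(2)])

lemma sw_coact_prod:
  assumes "\<And>b. lin (\<lambda>a. F a b)" "\<And>a. lin (F a)"
  shows "CB (x \<cdot> y) F = CB x (\<lambda>g x0. CB y (\<lambda>h y0. F (g \<otimes>\<^bsub>H\<^esub> h) (x0 \<cdot> y0)))"
  using assms by (simp add: coact_prod sw_sw lin_add[OF assms(2)])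

lemma sw_coact_unit:
  assumes "\<And>b. lin (\<lambda>a. F a b)" "\<And>a. lin (F a)"
  shows "CB \<one>\<^bsub>B\<^esub> F = F \<one>\<^bsub>H\<^esub> \<one>\<^bsub>B\<^esub>"
  using assms by (simp add: coact_unit)

lemma sw_comult_act:
  assumes "\<And>b. lin (\<lambda>a. F a b)" "\<And>a. lin (F a)"
  shows "DB (h \<rightharpoonup> x) F = DH h (\<lambda>h1 h2. DB x (\<lambda>x1 x2. F (h1 \<rightharpoonup> x1) (h2 \<rightharpoonup> x2)))"
  using assms by (simp add: comult_act sw_sw lin_add[OF assms(2)])

lemma sw_comult_prod:
  assumes "\<And>b. lin (\<lambda>a. F a b)" "\<And>a. lin (F a)"
  shows "DB (x \<cdot> y) F = DB x (\<lambda>x1 x2. DB y (\<lambda>y1 y2. CB x2 (\<lambda>g x0. F (x1 \<cdot> (g \<rightharpoonup> y1)) (x0 \<cdot> y2))))"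
  using assms by (simp add: comult_prod sw_sw lin_add[OF assms(2)])

lemma sw_comult_unit:
  assumes "\<And>b. lin (\<lambda>a. F a b)" "\<And>a. lin (F a)"
  shows "DB \<one>\<^bsub>B\<^esub> F = F \<one>\<^bsub>B\<^esub> \<one>\<^bsub>B\<^esub>"
  using assms by (simp add: comult_unit)

lemma sw_comult_coact:
  assumes "\<And>b c. lin (\<lambda>a. F a b c)" "\<And>a c. lin (\<lambda>b. F a b c)" "\<And>a b. lin (\<lambda>c. F a b c)"
  shows "CB x (\<lambda>g y. DB y (\<lambda>y1 y2. F g y1 y2))
    = DB x (\<lambda>x1 x2. CB x1 (\<lambda>g y1. CB x2 (\<lambda>h y2. F (g \<otimes>\<^bsub>H\<^esub> h) y1 y2)))"
proof -
  let ?P = "\<lambda>T. sweedler T (\<lambda>a t. sweedler t (\<lambda>b c. F a b c))"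
  have add: "sweedler (x + y) (\<lambda>b c. F a b c) = sweedler x (\<lambda>b c. F a b c) + sweedler y (\<lambda>b c. F a b c)" for a x y
    by (rule sw_add) (rule lin_add[OF assms(3)])
  have "?P (CB x (\<lambda>g x0. tens (fscale vscale) g (comult B x0)))
      = ?P (DB x (\<lambda>x1 x2. CB x1 (\<lambda>g y1. CB x2 (\<lambda>h y2.
          tens (fscale vscale) (g \<otimes>\<^bsub>H\<^esub> h) (tens vscale y1 y2)))))"
    by (simp only: comult_coact)
  moreover have "?P (tens (fscale vscale) a (comult B b)) = DB b (\<lambda>b1 b2. F a b1 b2)" for a b
    using assms by (intro sw_tens_right)
     (auto simp: sweedler_def lin_scale[OF assms(3)] sum_distrib_left fscale_apply)
  ultimately show ?thesis
    using assms by (simp add: sw_sw add)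
qed

lemmas sw_push = vlin_sw[OF vlin_mult[OF vlin_id]] vlin_sw[OF vlin_mult_right[OF vlin_id]]
  vlin_sw[OF B.vlin_mult[OF vlin_id]] vlin_sw[OF B.vlin_mult_right[OF vlin_id]]
  vlin_sw[OF vlin_act[OF vlin_id]] vlin_sw[OF vlin_act_right[OF vlin_id]]
  vlin_sw[OF vlin_outer[OF vlin_id]] vlin_sw[OF vlin_outer_right[OF vlin_id]]

section \<open>The bosonization as an algebra\<close>

abbreviation A where "A \<equiv> bosonization H B"

lemma A_simps [simp]: "carrier A = UNIV" "\<zero>\<^bsub>A\<^esub> = 0" "x \<oplus>\<^bsub>A\<^esub> y = x + y" "\<one>\<^bsub>A\<^esub> = outer \<one>\<^bsub>B\<^esub> \<one>\<^bsub>H\<^esub>"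
  by (simp_all add: bosonization_def)

lemma A_mult_def: "x \<otimes>\<^bsub>A\<^esub> y = smash_mult H B x y"
  by (simp add: bosonization_def)

lemma A_vlin_mult [simp]: "vlin f \<Longrightarrow> vlin (\<lambda>x. f x \<otimes>\<^bsub>A\<^esub> c)"
  and A_vlin_mult_right [simp]: "vlin f \<Longrightarrow> vlin (\<lambda>x. c \<otimes>\<^bsub>A\<^esub> f x)"
  unfolding A_mult_def smash_mult_def by (rule vlin_pairingI; simp)+

lemma outer_mult:
  "outer x h \<otimes>\<^bsub>A\<^esub> outer y g = DH h (\<lambda>h1 h2. outer (x \<cdot> (h1 \<rightharpoonup> y)) (h2 \<otimes>\<^bsub>H\<^esub> g))"
  unfolding A_mult_def smash_mult_def
  by (rule vec_eqI) (simp add: sw_curry_outer)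

lemmas A_sw_push = vlin_sw[OF A_vlin_mult[OF vlin_id]] vlin_sw[OF A_vlin_mult_right[OF vlin_id]]

text \<open>The left bracketing uses that the coproduct of H is multiplicative, the right one that
  the action distributes over products of B; after coassociativity only the order of summation
  differs.\<close>

lemma A_assoc_outer:
  "(outer x h \<otimes>\<^bsub>A\<^esub> outer y g) \<otimes>\<^bsub>A\<^esub> outer z k = outer x h \<otimes>\<^bsub>A\<^esub> (outer y g \<otimes>\<^bsub>A\<^esub> outer z k)"
proof (rule vec_eqI)
  fix p
  have "pairing p ((outer x h \<otimes>\<^bsub>A\<^esub> outer y g) \<otimes>\<^bsub>A\<^esub> outer z k)
    = DH h (\<lambda>h1 h'. DH h' (\<lambda>h2 h3. DH g (\<lambda>g1 g2. pairing p (outer (x \<cdot> (h1 \<rightharpoonup> y) \<cdot> (h2 \<rightharpoonup> g1 \<rightharpoonup> z)) (h3 \<otimes>\<^bsub>H\<^esub> g2 \<otimes>\<^bsub>H\<^esub> k)))))"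
    by (simp add: outer_mult A_sw_push comult_mult_sw act_mult)
  moreover have "pairing p (outer x h \<otimes>\<^bsub>A\<^esub> (outer y g \<otimes>\<^bsub>A\<^esub> outer z k))
    = DH g (\<lambda>g1 g2. DH h (\<lambda>h1 h'. DH h' (\<lambda>h2 h3. pairing p (outer (x \<cdot> (h1 \<rightharpoonup> y) \<cdot> (h2 \<rightharpoonup> g1 \<rightharpoonup> z)) (h3 \<otimes>\<^bsub>H\<^esub> g2 \<otimes>\<^bsub>H\<^esub> k)))))"
    by (simp add: outer_mult A_sw_push act_prod sw_push B.assoc assoc sw_coassoc)
  moreover have "\<dots> = DH h (\<lambda>h1 h'. DH h' (\<lambda>h2 h3. DH g (\<lambda>g1 g2. pairing p (outer (x \<cdot> (h1 \<rightharpoonup> y) \<cdot> (h2 \<rightharpoonup> g1 \<rightharpoonup> z)) (h3 \<otimes>\<^bsub>H\<^esub> g2 \<otimes>\<^bsub>H\<^esub> k)))))"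
    by (subst sw_swap) (intro sw_cong sw_swap)
  ultimately show "pairing p ((outer x h \<otimes>\<^bsub>A\<^esub> outer y g) \<otimes>\<^bsub>A\<^esub> outer z k)
    = pairing p (outer x h \<otimes>\<^bsub>A\<^esub> (outer y g \<otimes>\<^bsub>A\<^esub> outer z k))"
    by simp
qed

lemma A_assoc: "(t \<otimes>\<^bsub>A\<^esub> u) \<otimes>\<^bsub>A\<^esub> v = t \<otimes>\<^bsub>A\<^esub> (u \<otimes>\<^bsub>A\<^esub> v)"
proof (rule vec_eqI)
  fix p
  have 1: "pairing p ((outer x h \<otimes>\<^bsub>A\<^esub> outer y g) \<otimes>\<^bsub>A\<^esub> v) = pairing p (outer x h \<otimes>\<^bsub>A\<^esub> (outer y g \<otimes>\<^bsub>A\<^esub> v))" for x h y g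
    by (rule lin_eq_outerI[where t=v]) (simp_all add: A_assoc_outer)
  have 2: "pairing p ((outer x h \<otimes>\<^bsub>A\<^esub> u) \<otimes>\<^bsub>A\<^esub> v) = pairing p (outer x h \<otimes>\<^bsub>A\<^esub> (u \<otimes>\<^bsub>A\<^esub> v))" for x h
    by (rule lin_eq_outerI[where t=u]) (simp_all add: 1)
  show "pairing p ((t \<otimes>\<^bsub>A\<^esub> u) \<otimes>\<^bsub>A\<^esub> v) = pairing p (t \<otimes>\<^bsub>A\<^esub> (u \<otimes>\<^bsub>A\<^esub> v))"
    by (rule lin_eq_outerI[where t=t]) (simp_all add: 2)
qed

lemma A_one: "outer \<one>\<^bsub>B\<^esub> \<one>\<^bsub>H\<^esub> \<otimes>\<^bsub>A\<^esub> t = t" "t \<otimes>\<^bsub>A\<^esub> outer \<one>\<^bsub>B\<^esub> \<one>\<^bsub>H\<^esub> = t"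
proof -
  show "outer \<one>\<^bsub>B\<^esub> \<one>\<^bsub>H\<^esub> \<otimes>\<^bsub>A\<^esub> t = t"
  proof (rule vec_eqI)
    fix p
    show "pairing p (outer \<one>\<^bsub>B\<^esub> \<one>\<^bsub>H\<^esub> \<otimes>\<^bsub>A\<^esub> t) = pairing p t"
      by (rule lin_eq_outerI[where t=t]) (simp_all add: outer_mult comult_one_sw act_one)
  qed
  show "t \<otimes>\<^bsub>A\<^esub> outer \<one>\<^bsub>B\<^esub> \<one>\<^bsub>H\<^esub> = t"
  proof (rule vec_eqI)
    fix p
    show "pairing p (t \<otimes>\<^bsub>A\<^esub> outer \<one>\<^bsub>B\<^esub> \<one>\<^bsub>H\<^esub>) = pairing p t"
      by (rule lin_eq_outerI[where t=t])
         (simp_all add: outer_mult act_unit B.mult_scale vlin_scale[OF vlin_outer[OF vlin_id]])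
  qed
qed

lemma fd_algebra_A: "fd_algebra A"
  by (rule fd_algebraI) (simp_all add: A_assoc A_one)


section \<open>The coalgebra structure of the bosonization\<close>

lemma A_comult_sw:
  assumes "\<And>b. lin (\<lambda>a. F a b)" "\<And>a. lin (F a)"
  shows "sweedler (comult A t) F = sweedler (curry t) (\<lambda>x h. DB x (\<lambda>x1 x2. CB x2 (\<lambda>g x0. DH h (\<lambda>h1 h2.
    F (outer x1 (g \<otimes>\<^bsub>H\<^esub> h1)) (outer x0 h2)))))"
  using assms by (simp add: bosonization_def sw_sw lin_add[OF assms(2)])

lemma A_comult_outer:
  assumes "\<And>b. lin (\<lambda>a. F a b)" "\<And>a. lin (F a)"
  shows "sweedler (comult A (outer x h)) F = DB x (\<lambda>x1 x2. CB x2 (\<lambda>g x0. DH h (\<lambda>h1 h2.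
    F (outer x1 (g \<otimes>\<^bsub>H\<^esub> h1)) (outer x0 h2))))"
proof -
  have l: "vlin f \<Longrightarrow> lin (\<lambda>x. F (f x) b)" "vlin f \<Longrightarrow> lin (\<lambda>x. F b (f x))" for f :: "('c \<Rightarrow> 'k) \<Rightarrow> _" and b
    using lin_comp[OF assms(1)] lin_comp[OF assms(2)] by auto
  show ?thesis
    by (subst A_comult_sw[OF assms], subst sw_curry_outer) (simp_all add: l)
qed

lemma lin_A_comult:
  assumes "vlin g" "\<And>b. lin (\<lambda>a. F a b)" "\<And>a. lin (F a)"
  shows "lin (\<lambda>t. sweedler (comult A (g t)) F)"
proof -
  have l: "vlin f \<Longrightarrow> lin (\<lambda>x. F (f x) b)" "vlin f \<Longrightarrow> lin (\<lambda>x. F b (f x))" for f :: "('c \<Rightarrow> 'k) \<Rightarrow> _" and b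
    using lin_comp[OF assms(2)] lin_comp[OF assms(3)] by auto
  show ?thesis
    by (subst A_comult_sw[OF assms(2,3)]) (simp add: assms(1) l)
qed

lemma A_counit_outer: "counit A (outer x h) = counit B x * counit H h"
  by (simp add: bosonization_def sw_curry_outer)

lemma lin_A_counit [simp]: "vlin g \<Longrightarrow> lin (\<lambda>t. counit A (g t))"
  by (simp add: bosonization_def)


text \<open>Both sides are brought to one normal form: x split into three legs, the second coacting
  once and the third twice, and h split into three. From the left this uses coassociativity of the
  coaction, from the right \<open>sw_comult_coact\<close>.\<close>

lemma A_coassoc_outer:
  assumes "\<And>b c. lin (\<lambda>a. F a b c)" "\<And>a c. lin (\<lambda>b. F a b c)" "\<And>a b. lin (\<lambda>c. F a b c)"
  shows "sweedler (comult A (outer x h)) (\<lambda>a b. sweedler (comult A a) (\<lambda>a1 a2. F a1 a2 b))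
   = sweedler (comult A (outer x h)) (\<lambda>a b. sweedler (comult A b) (\<lambda>b1 b2. F a b1 b2))"
proof -
  have l: "vlin f \<Longrightarrow> lin (\<lambda>x. F (f x) b c)" "vlin f \<Longrightarrow> lin (\<lambda>x. F b (f x) c)" "vlin f \<Longrightarrow> lin (\<lambda>x. F b c (f x))"
    for f :: "('c \<Rightarrow> 'k) \<Rightarrow> _" and b c
    using lin_comp[OF assms(1)] lin_comp[OF assms(2)] lin_comp[OF assms(3)] by auto
  let ?F = "\<lambda>x1 u g1 k1 y0 g2 k2 w h3. F (outer x1 (u \<otimes>\<^bsub>H\<^esub> (g1 \<otimes>\<^bsub>H\<^esub> k1))) (outer y0 (g2 \<otimes>\<^bsub>H\<^esub> k2)) (outer w h3)"
  have "sweedler (comult A (outer x h)) (\<lambda>a b. sweedler (comult A a) (\<lambda>a1 a2. F a1 a2 b))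
    = DB x (\<lambda>t z. CB z (\<lambda>g w. DH h (\<lambda>k h3. DB t (\<lambda>x1 y. CB y (\<lambda>u y0. DH g (\<lambda>g1 g2. DH k (\<lambda>k1 k2.
        ?F x1 u g1 k1 y0 g2 k2 w h3)))))))"
    by (simp add: A_comult_outer lin_A_comult comult_mult_sw l)
  also have "\<dots> = DB x (\<lambda>t z. DB t (\<lambda>x1 y. CB z (\<lambda>g w. DH h (\<lambda>k h3. CB y (\<lambda>u y0. DH g (\<lambda>g1 g2. DH k (\<lambda>k1 k2.
        ?F x1 u g1 k1 y0 g2 k2 w h3)))))))"
    by (intro sw_cong sw_swap2)
  also have "\<dots> = DB x (\<lambda>x1 t. DB t (\<lambda>y z. CB z (\<lambda>g w. DH h (\<lambda>k h3. CB y (\<lambda>u y0. DH g (\<lambda>g1 g2. DH k (\<lambda>k1 k2.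
        ?F x1 u g1 k1 y0 g2 k2 w h3)))))))"
    by (rule B.sw_coassoc) (simp_all add: l)
  also have "\<dots> = DB x (\<lambda>x1 t. DB t (\<lambda>y z. CB y (\<lambda>u y0. CB z (\<lambda>g w. DH h (\<lambda>k h3. DH g (\<lambda>g1 g2. DH k (\<lambda>k1 k2.
        ?F x1 u g1 k1 y0 g2 k2 w h3)))))))"
    by (intro sw_cong sw_swap2)
  also have "\<dots> = DB x (\<lambda>x1 t. DB t (\<lambda>y z. CB y (\<lambda>u y0. CB z (\<lambda>g w. DH g (\<lambda>g1 g2. DH h (\<lambda>k h3. DH k (\<lambda>k1 k2.
        ?F x1 u g1 k1 y0 g2 k2 w h3)))))))"
    by (intro sw_cong sw_swap)
  also have "\<dots> = DB x (\<lambda>x1 t. DB t (\<lambda>y z. CB y (\<lambda>u y0. CB z (\<lambda>g1 s. CB s (\<lambda>g2 w. DH h (\<lambda>k1 m. DH m (\<lambda>k2 h3.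
        ?F x1 u g1 k1 y0 g2 k2 w h3)))))))"
    by (simp add: sw_coact_coassoc sw_coassoc l)
  finally have 1: "sweedler (comult A (outer x h)) (\<lambda>a b. sweedler (comult A a) (\<lambda>a1 a2. F a1 a2 b)) = \<dots>" .
  have "sweedler (comult A (outer x h)) (\<lambda>a b. sweedler (comult A b) (\<lambda>b1 b2. F a b1 b2))
    = DB x (\<lambda>x1 t. CB t (\<lambda>g w. DH h (\<lambda>k1 m. DB w (\<lambda>y z. CB z (\<lambda>g2 z0. DH m (\<lambda>k2 h3.
        F (outer x1 (g \<otimes>\<^bsub>H\<^esub> k1)) (outer y (g2 \<otimes>\<^bsub>H\<^esub> k2)) (outer z0 h3)))))))"
    by (simp add: A_comult_outer lin_A_comult comult_mult_sw l)
  also have "\<dots> = DB x (\<lambda>x1 t. CB t (\<lambda>g w. DB w (\<lambda>y z. DH h (\<lambda>k1 m. CB z (\<lambda>g2 z0. DH m (\<lambda>k2 h3.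
        F (outer x1 (g \<otimes>\<^bsub>H\<^esub> k1)) (outer y (g2 \<otimes>\<^bsub>H\<^esub> k2)) (outer z0 h3)))))))"
    by (intro sw_cong sw_swap)
  also have "\<dots> = DB x (\<lambda>x1 t. DB t (\<lambda>y z. CB y (\<lambda>u y0. CB z (\<lambda>g1 s. DH h (\<lambda>k1 m. CB s (\<lambda>g2 w. DH m (\<lambda>k2 h3.
        ?F x1 u g1 k1 y0 g2 k2 w h3)))))))"
    by (intro sw_cong trans[OF sw_comult_coact]) (simp_all add: l assoc)
  also have "\<dots> = DB x (\<lambda>x1 t. DB t (\<lambda>y z. CB y (\<lambda>u y0. CB z (\<lambda>g1 s. CB s (\<lambda>g2 w. DH h (\<lambda>k1 m. DH m (\<lambda>k2 h3.
        ?F x1 u g1 k1 y0 g2 k2 w h3)))))))"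
    by (intro sw_cong sw_swap)
  finally show ?thesis
    using 1 by simp
qed

text \<open>The Yetter-Drinfeld condition freed of its antipode: multiplying the coaction by the
  next leg of the coproduct cancels \<open>S(h3)\<close>.\<close>

lemma sw_yd_twist:
  assumes "\<And>b. lin (\<lambda>a. K a b)" "\<And>a. lin (K a)"
  shows "DH s (\<lambda>q c. CB (q \<rightharpoonup> y) (\<lambda>u w. K (u \<otimes>\<^bsub>H\<^esub> c) w)) = DH s (\<lambda>q c. CB y (\<lambda>u w. K (q \<otimes>\<^bsub>H\<^esub> u) (c \<rightharpoonup> w)))"
proof -
  have l: "vlin f \<Longrightarrow> lin (\<lambda>x. K (f x) b)" "vlin g \<Longrightarrow> lin (\<lambda>x. K a (g x))"
    for f :: "('c \<Rightarrow> 'k) \<Rightarrow> _" and g :: "('d \<Rightarrow> 'k) \<Rightarrow> _" and a b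
    using lin_comp[OF assms(1)] lin_comp[OF assms(2)] by auto
  have "DH s (\<lambda>q c. CB (q \<rightharpoonup> y) (\<lambda>u w. K (u \<otimes>\<^bsub>H\<^esub> c) w))
    = DH s (\<lambda>q c. DH q (\<lambda>h1 h'. DH h' (\<lambda>h2 h3. CB y (\<lambda>u w. K (h1 \<otimes>\<^bsub>H\<^esub> u \<otimes>\<^bsub>H\<^esub> (antipode H h3 \<otimes>\<^bsub>H\<^esub> c)) (h2 \<rightharpoonup> w)))))"
    by (simp add: sw_coact_act l assoc)
  also have "\<dots> = DH s (\<lambda>h1 t. DH t (\<lambda>h2 t. DH t (\<lambda>h3 c. CB y (\<lambda>u w. K (h1 \<otimes>\<^bsub>H\<^esub> u \<otimes>\<^bsub>H\<^esub> (antipode H h3 \<otimes>\<^bsub>H\<^esub> c)) (h2 \<rightharpoonup> w)))))"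
    by (simp add: sw_coassoc l)
  also have "\<dots> = DH s (\<lambda>h1 t. CB y (\<lambda>u w. K (h1 \<otimes>\<^bsub>H\<^esub> u \<otimes>\<^bsub>H\<^esub> \<one>\<^bsub>H\<^esub>) (t \<rightharpoonup> w)))"
    by (intro sw_cong sw_antipode_cancel(3)[where F="\<lambda>h2 m. CB y (\<lambda>u w. K (_ \<otimes>\<^bsub>H\<^esub> u \<otimes>\<^bsub>H\<^esub> m) (h2 \<rightharpoonup> w))"])
       (simp_all add: l)
  finally show ?thesis
    by simp
qed

text \<open>Splitting the coaction of the product leaves two successive coactions of
  \<open>x2\<close>. In \<open>A_comult_mult_outer\<close> the other side produces the same pair
  from one coaction of \<open>x2\<close> followed by a coproduct in H.\<close>

lemma sw_comult_prod_coact: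
  assumes "\<And>b c. lin (\<lambda>a. G a b c)" "\<And>a c. lin (\<lambda>b. G a b c)" "\<And>a b. lin (\<lambda>c. G a b c)"
  shows "DB (x \<cdot> z) (\<lambda>a b. CB b (\<lambda>u b0. G a u b0))
    = DB x (\<lambda>x1 x2. CB x2 (\<lambda>v x3. CB x3 (\<lambda>v' x0. DB z (\<lambda>z1 z2. CB z2 (\<lambda>u z0.
        G (x1 \<cdot> (v \<rightharpoonup> z1)) (v' \<otimes>\<^bsub>H\<^esub> u) (x0 \<cdot> z0))))))"
proof -
  have l: "vlin f \<Longrightarrow> lin (\<lambda>x. G (f x) b c)" "vlin g \<Longrightarrow> lin (\<lambda>x. G a (g x) c)" "vlin k \<Longrightarrow> lin (\<lambda>x. G a b (k x))"
    for f :: "('c \<Rightarrow> 'k) \<Rightarrow> _" and g :: "('d \<Rightarrow> 'k) \<Rightarrow> _" and k :: "('e \<Rightarrow> 'k) \<Rightarrow> _" and a b c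
    using lin_comp[OF assms(1)] lin_comp[OF assms(2)] lin_comp[OF assms(3)] by auto
  have "DB (x \<cdot> z) (\<lambda>a b. CB b (\<lambda>u b0. G a u b0))
    = DB x (\<lambda>x1 x2. DB z (\<lambda>z1 z2. CB x2 (\<lambda>v x3. CB x3 (\<lambda>v' x0. CB z2 (\<lambda>u z0.
        G (x1 \<cdot> (v \<rightharpoonup> z1)) (v' \<otimes>\<^bsub>H\<^esub> u) (x0 \<cdot> z0))))))"
    by (simp add: sw_comult_prod sw_coact_prod l)
  also have "\<dots> = DB x (\<lambda>x1 x2. CB x2 (\<lambda>v x3. DB z (\<lambda>z1 z2. CB x3 (\<lambda>v' x0. CB z2 (\<lambda>u z0.
        G (x1 \<cdot> (v \<rightharpoonup> z1)) (v' \<otimes>\<^bsub>H\<^esub> u) (x0 \<cdot> z0))))))"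
    by (intro sw_cong sw_swap)
  also have "\<dots> = DB x (\<lambda>x1 x2. CB x2 (\<lambda>v x3. CB x3 (\<lambda>v' x0. DB z (\<lambda>z1 z2. CB z2 (\<lambda>u z0.
        G (x1 \<cdot> (v \<rightharpoonup> z1)) (v' \<otimes>\<^bsub>H\<^esub> u) (x0 \<cdot> z0))))))"
    by (intro sw_cong sw_swap)
  finally show ?thesis .
qed

text \<open>Both sides are normalised to one sum over \<open>?J\<close>, with x split as in
  \<open>sw_comult_prod_coact\<close>, y split in two with its second leg coacting, and h split into
  the four legs p, q, c, d.\<close>

lemma A_comult_mult_outer:
  assumes "\<And>b. lin (\<lambda>a. F a b)" "\<And>a. lin (F a)"
  shows "sweedler (comult A (outer x h \<otimes>\<^bsub>A\<^esub> outer y g)) F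
    = sweedler (comult A (outer x h)) (\<lambda>a b. sweedler (comult A (outer y g)) (\<lambda>c d. F (a \<otimes>\<^bsub>A\<^esub> c) (b \<otimes>\<^bsub>A\<^esub> d)))"
proof -
  have l: "vlin f \<Longrightarrow> lin (\<lambda>x. F (f x) b)" "vlin f \<Longrightarrow> lin (\<lambda>x. F b (f x))" for f :: "('c \<Rightarrow> 'k) \<Rightarrow> _" and b
    using lin_comp[OF assms(1)] lin_comp[OF assms(2)] by auto
  let ?J = "\<lambda>x1 v v' x0 p y1 q u c y0 d g1 g2.
    F (outer (x1 \<cdot> (v \<rightharpoonup> p \<rightharpoonup> y1)) (v' \<otimes>\<^bsub>H\<^esub> (q \<otimes>\<^bsub>H\<^esub> (u \<otimes>\<^bsub>H\<^esub> g1)))) (outer (x0 \<cdot> (c \<rightharpoonup> y0)) (d \<otimes>\<^bsub>H\<^esub> g2))"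
  let ?J' = "\<lambda>x1 v v' x0 p y1 u c y0 d g1 g2.
    F (outer (x1 \<cdot> (v \<rightharpoonup> p \<rightharpoonup> y1)) (v' \<otimes>\<^bsub>H\<^esub> ((u \<otimes>\<^bsub>H\<^esub> c) \<otimes>\<^bsub>H\<^esub> g1))) (outer (x0 \<cdot> y0) (d \<otimes>\<^bsub>H\<^esub> g2))"
  have "sweedler (comult A (outer x h \<otimes>\<^bsub>A\<^esub> outer y g)) F
    = DH h (\<lambda>h1 h2. DB (x \<cdot> (h1 \<rightharpoonup> y)) (\<lambda>a b. CB b (\<lambda>u b0. DH (h2 \<otimes>\<^bsub>H\<^esub> g) (\<lambda>c d.
        F (outer a (u \<otimes>\<^bsub>H\<^esub> c)) (outer b0 d)))))"
    by (simp add: outer_mult A_comult_outer l assms lin_sw[OF lin_A_comult[OF vlin_id assms]])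
  also have "\<dots> = DH h (\<lambda>h1 h2. DB x (\<lambda>x1 x2. CB x2 (\<lambda>v x3. CB x3 (\<lambda>v' x0. DH h1 (\<lambda>p q. DB y (\<lambda>y1 y2.
        CB (q \<rightharpoonup> y2) (\<lambda>u y0. DH h2 (\<lambda>c d. DH g (\<lambda>g1 g2. ?J' x1 v v' x0 p y1 u c y0 d g1 g2)))))))))"
    by (simp add: sw_comult_prod_coact l sw_comult_act comult_mult_sw assoc)
  also have "\<dots> = DB x (\<lambda>x1 x2. CB x2 (\<lambda>v x3. CB x3 (\<lambda>v' x0. DH h (\<lambda>h1 h2. DH h1 (\<lambda>p q. DB y (\<lambda>y1 y2.
        CB (q \<rightharpoonup> y2) (\<lambda>u y0. DH h2 (\<lambda>c d. DH g (\<lambda>g1 g2. ?J' x1 v v' x0 p y1 u c y0 d g1 g2)))))))))"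
    by (rule sw_swap3[symmetric])
  also have "\<dots> = DB x (\<lambda>x1 x2. CB x2 (\<lambda>v x3. CB x3 (\<lambda>v' x0. DH h (\<lambda>p t. DH t (\<lambda>q r. DB y (\<lambda>y1 y2.
        CB (q \<rightharpoonup> y2) (\<lambda>u y0. DH r (\<lambda>c d. DH g (\<lambda>g1 g2. ?J' x1 v v' x0 p y1 u c y0 d g1 g2)))))))))"
    by (rule sw_cong3, rule sw_coassoc) (simp_all add: l)
  also have "\<dots> = DB x (\<lambda>x1 x2. CB x2 (\<lambda>v x3. CB x3 (\<lambda>v' x0. DH h (\<lambda>p t. DB y (\<lambda>y1 y2. DH t (\<lambda>q r.
        CB (q \<rightharpoonup> y2) (\<lambda>u y0. DH r (\<lambda>c d. DH g (\<lambda>g1 g2. ?J' x1 v v' x0 p y1 u c y0 d g1 g2)))))))))"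
    by (intro sw_cong sw_swap)
  also have "\<dots> = DB x (\<lambda>x1 x2. CB x2 (\<lambda>v x3. CB x3 (\<lambda>v' x0. DH h (\<lambda>p t. DB y (\<lambda>y1 y2. DH t (\<lambda>q r.
        DH r (\<lambda>c d. CB (q \<rightharpoonup> y2) (\<lambda>u y0. DH g (\<lambda>g1 g2. ?J' x1 v v' x0 p y1 u c y0 d g1 g2)))))))))"
    by (intro sw_cong sw_swap)
  also have "\<dots> = DB x (\<lambda>x1 x2. CB x2 (\<lambda>v x3. CB x3 (\<lambda>v' x0. DH h (\<lambda>p t. DB y (\<lambda>y1 y2. DH t (\<lambda>s d.
        DH s (\<lambda>q c. CB (q \<rightharpoonup> y2) (\<lambda>u y0. DH g (\<lambda>g1 g2. ?J' x1 v v' x0 p y1 u c y0 d g1 g2)))))))))"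
    by (rule sw_cong3, rule sw_cong, rule sw_cong, rule sw_coassoc[symmetric]) (simp_all add: l)
  \<comment> \<open>The compatibility of action and coaction enters here; the other steps expand,
    regroup or reorder.\<close>
  also have "\<dots> = DB x (\<lambda>x1 x2. CB x2 (\<lambda>v x3. CB x3 (\<lambda>v' x0. DH h (\<lambda>p t. DB y (\<lambda>y1 y2. DH t (\<lambda>s d.
        DH s (\<lambda>q c. CB y2 (\<lambda>u y0. DH g (\<lambda>g1 g2. ?J x1 v v' x0 p y1 q u c y0 d g1 g2)))))))))"
  proof -
    have "DH s (\<lambda>q c. CB (q \<rightharpoonup> y2) (\<lambda>u y0. DH g (\<lambda>g1 g2. ?J' x1 v v' x0 p y1 u c y0 d g1 g2)))
      = DH s (\<lambda>q c. CB y2 (\<lambda>u y0. DH g (\<lambda>g1 g2. ?J x1 v v' x0 p y1 q u c y0 d g1 g2)))" for x1 v v' x0 p y1 y2 d s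
      using sw_yd_twist[where K="\<lambda>m y0. DH g (\<lambda>g1 g2.
          F (outer (x1 \<cdot> (v \<rightharpoonup> p \<rightharpoonup> y1)) (v' \<otimes>\<^bsub>H\<^esub> (m \<otimes>\<^bsub>H\<^esub> g1))) (outer (x0 \<cdot> y0) (d \<otimes>\<^bsub>H\<^esub> g2)))"]
      by (simp add: l assoc)
    then show ?thesis
      by simp
  qed
  finally have 1: "sweedler (comult A (outer x h \<otimes>\<^bsub>A\<^esub> outer y g)) F = \<dots>" .
  have "sweedler (comult A (outer x h)) (\<lambda>a b. sweedler (comult A (outer y g)) (\<lambda>c d. F (a \<otimes>\<^bsub>A\<^esub> c) (b \<otimes>\<^bsub>A\<^esub> d)))
    = DB x (\<lambda>x1 x2. CB x2 (\<lambda>w x0. DH h (\<lambda>r s. DB y (\<lambda>y1 y2. CB y2 (\<lambda>u y0. DH g (\<lambda>g1 g2.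
        F (outer x1 (w \<otimes>\<^bsub>H\<^esub> r) \<otimes>\<^bsub>A\<^esub> outer y1 (u \<otimes>\<^bsub>H\<^esub> g1)) (outer x0 s \<otimes>\<^bsub>A\<^esub> outer y0 g2)))))))"
    by (simp add: A_comult_outer lin_A_comult l)
  also have "\<dots> = DB x (\<lambda>x1 x2. CB x2 (\<lambda>w x0. DH h (\<lambda>r s. DB y (\<lambda>y1 y2. CB y2 (\<lambda>u y0. DH g (\<lambda>g1 g2.
        DH w (\<lambda>v v'. DH r (\<lambda>p q. DH s (\<lambda>c d. ?J x1 v v' x0 p y1 q u c y0 d g1 g2)))))))))"
    by (rule sw_cong3, rule sw_cong3, rule trans[OF _ sw_swap2[symmetric]])
       (simp add: outer_mult lin_sw[OF assms(1)] lin_sw[OF assms(2)] comult_mult_sw l act_mult assoc)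
  also have "\<dots> = DB x (\<lambda>x1 x2. CB x2 (\<lambda>w x0. DH w (\<lambda>v v'. DH h (\<lambda>r s. DB y (\<lambda>y1 y2. CB y2 (\<lambda>u y0. DH g (\<lambda>g1 g2.
        DH r (\<lambda>p q. DH s (\<lambda>c d. ?J x1 v v' x0 p y1 q u c y0 d g1 g2)))))))))"
    by (intro sw_cong sw_swap4)
  also have "\<dots> = DB x (\<lambda>x1 x2. CB x2 (\<lambda>v x3. CB x3 (\<lambda>v' x0. DH h (\<lambda>r s. DB y (\<lambda>y1 y2. CB y2 (\<lambda>u y0. DH g (\<lambda>g1 g2.
        DH r (\<lambda>p q. DH s (\<lambda>c d. ?J x1 v v' x0 p y1 q u c y0 d g1 g2)))))))))"
    by (rule sw_cong, rule sw_coact_coassoc) (simp_all add: l)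
  also have "\<dots> = DB x (\<lambda>x1 x2. CB x2 (\<lambda>v x3. CB x3 (\<lambda>v' x0. DH h (\<lambda>r s. DH r (\<lambda>p q. DB y (\<lambda>y1 y2. CB y2 (\<lambda>u y0. DH g (\<lambda>g1 g2.
        DH s (\<lambda>c d. ?J x1 v v' x0 p y1 q u c y0 d g1 g2)))))))))"
    by (intro sw_cong sw_swap3)
  also have "\<dots> = DB x (\<lambda>x1 x2. CB x2 (\<lambda>v x3. CB x3 (\<lambda>v' x0. DH h (\<lambda>p t. DH t (\<lambda>q s. DB y (\<lambda>y1 y2. CB y2 (\<lambda>u y0. DH g (\<lambda>g1 g2.
        DH s (\<lambda>c d. ?J x1 v v' x0 p y1 q u c y0 d g1 g2)))))))))"
    by (rule sw_cong3, rule sw_coassoc) (simp_all add: l)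
  also have "\<dots> = DB x (\<lambda>x1 x2. CB x2 (\<lambda>v x3. CB x3 (\<lambda>v' x0. DH h (\<lambda>p t. DB y (\<lambda>y1 y2. DH t (\<lambda>q s. CB y2 (\<lambda>u y0. DH g (\<lambda>g1 g2.
        DH s (\<lambda>c d. ?J x1 v v' x0 p y1 q u c y0 d g1 g2)))))))))"
    by (intro sw_cong sw_swap)
  also have "\<dots> = DB x (\<lambda>x1 x2. CB x2 (\<lambda>v x3. CB x3 (\<lambda>v' x0. DH h (\<lambda>p t. DB y (\<lambda>y1 y2. DH t (\<lambda>q s. DH s (\<lambda>c d. CB y2 (\<lambda>u y0. DH g (\<lambda>g1 g2.
        ?J x1 v v' x0 p y1 q u c y0 d g1 g2)))))))))"
    by (intro sw_cong sw_swap2)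
  also have "\<dots> = DB x (\<lambda>x1 x2. CB x2 (\<lambda>v x3. CB x3 (\<lambda>v' x0. DH h (\<lambda>p t. DB y (\<lambda>y1 y2. DH t (\<lambda>s d. DH s (\<lambda>q c. CB y2 (\<lambda>u y0. DH g (\<lambda>g1 g2.
        ?J x1 v v' x0 p y1 q u c y0 d g1 g2)))))))))"
    by (rule sw_cong3, rule sw_cong, rule sw_cong, rule sw_coassoc[symmetric]) (simp_all add: l)
  finally show ?thesis
    using 1 by simp
qed

section \<open>The antipode of the bosonization\<close>

lemma A_antipode_def:
  "antipode A t = sweedler (curry t) (\<lambda>x h. CB x (\<lambda>g x0.
    outer \<one>\<^bsub>B\<^esub> (antipode H (g \<otimes>\<^bsub>H\<^esub> h)) \<otimes>\<^bsub>A\<^esub> outer (antipode B x0) \<one>\<^bsub>H\<^esub>))"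
  unfolding A_mult_def unfolding bosonization_def by simp

lemma vlin_A_antipode [simp]: "vlin f \<Longrightarrow> vlin (\<lambda>x. antipode A (f x))"
  unfolding A_antipode_def by (rule vlin_pairingI) simp

lemma A_antipode_outer:
  "antipode A (outer x h) = CB x (\<lambda>g x0. outer \<one>\<^bsub>B\<^esub> (antipode H (g \<otimes>\<^bsub>H\<^esub> h)) \<otimes>\<^bsub>A\<^esub> outer (antipode B x0) \<one>\<^bsub>H\<^esub>)"
  unfolding A_antipode_def by (rule vec_eqI) (simp add: sw_curry_outer)

lemma outer_one_mult: "outer \<one>\<^bsub>B\<^esub> a \<otimes>\<^bsub>A\<^esub> outer \<one>\<^bsub>B\<^esub> b = outer \<one>\<^bsub>B\<^esub> (a \<otimes>\<^bsub>H\<^esub> b)"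
  by (rule vec_eqI) (simp add: outer_mult act_unit vlin_scale[OF vlin_outer[OF vlin_id]])

lemma outer_mult_one_right: "outer x a \<otimes>\<^bsub>A\<^esub> outer \<one>\<^bsub>B\<^esub> b = outer x (a \<otimes>\<^bsub>H\<^esub> b)"
  by (rule vec_eqI) (simp add: outer_mult act_unit vlin_scale[OF vlin_outer[OF vlin_id]] B.mult_scale)

lemma outer_mult_one_left: "outer x \<one>\<^bsub>H\<^esub> \<otimes>\<^bsub>A\<^esub> outer y b = outer (x \<cdot> y) b"
  by (rule vec_eqI) (simp add: outer_mult comult_one_sw act_one)

text \<open>The coactions of the two legs of x multiply to the coaction of x, which exposes the
  braided antipode law inside. The counit that it leaves absorbs the coaction, and the antipode law
  of H finishes.\<close>

lemma A_antipode_left_outer: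
  assumes "lin G"
  shows "sweedler (comult A (outer x h)) (\<lambda>a b. G (antipode A a \<otimes>\<^bsub>A\<^esub> b)) = counit A (outer x h) * G \<one>\<^bsub>A\<^esub>"
proof -
  have l: "vlin f \<Longrightarrow> lin (\<lambda>x. G (f x))" for f :: "('c \<Rightarrow> 'k) \<Rightarrow> _"
    using lin_comp[OF assms(1)] by auto
  let ?S = "antipode H"
  have "sweedler (comult A (outer x h)) (\<lambda>a b. G (antipode A a \<otimes>\<^bsub>A\<^esub> b))
    = DB x (\<lambda>x1 x2. CB x2 (\<lambda>g w. DH h (\<lambda>k h2. CB x1 (\<lambda>u y.
        G (outer \<one>\<^bsub>B\<^esub> (?S ((u \<otimes>\<^bsub>H\<^esub> g) \<otimes>\<^bsub>H\<^esub> k)) \<otimes>\<^bsub>A\<^esub> outer (antipode B y \<cdot> w) h2)))))"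
    by (simp add: A_comult_outer l A_antipode_outer A_sw_push lin_sw[OF assms] A_assoc outer_mult_one_left assoc)
  also have "\<dots> = DB x (\<lambda>x1 x2. CB x1 (\<lambda>u y. CB x2 (\<lambda>g w. DH h (\<lambda>k h2.
        G (outer \<one>\<^bsub>B\<^esub> (?S ((u \<otimes>\<^bsub>H\<^esub> g) \<otimes>\<^bsub>H\<^esub> k)) \<otimes>\<^bsub>A\<^esub> outer (antipode B y \<cdot> w) h2)))))"
    by (rule sw_cong, rule sw_swap2)
  also have "\<dots> = CB x (\<lambda>g w. DB w (\<lambda>y1 y2. DH h (\<lambda>k h2.
        G (outer \<one>\<^bsub>B\<^esub> (?S (g \<otimes>\<^bsub>H\<^esub> k)) \<otimes>\<^bsub>A\<^esub> outer (antipode B y1 \<cdot> y2) h2))))"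
    by (rule sw_comult_coact[symmetric]) (simp_all add: l)
  also have "\<dots> = CB x (\<lambda>g w. DH h (\<lambda>k h2. DB w (\<lambda>y1 y2.
        G (outer \<one>\<^bsub>B\<^esub> (?S (g \<otimes>\<^bsub>H\<^esub> k)) \<otimes>\<^bsub>A\<^esub> outer (antipode B y1 \<cdot> y2) h2))))"
    by (rule sw_cong, rule sw_swap)
  also have "\<dots> = CB x (\<lambda>g w. DH h (\<lambda>k h2. counit B w * G (outer \<one>\<^bsub>B\<^esub> (?S (g \<otimes>\<^bsub>H\<^esub> k) \<otimes>\<^bsub>H\<^esub> h2))))"
  proof -
    have "DB w (\<lambda>y1 y2. G (outer \<one>\<^bsub>B\<^esub> r \<otimes>\<^bsub>A\<^esub> outer (antipode B y1 \<cdot> y2) h2))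
        = counit B w * G (outer \<one>\<^bsub>B\<^esub> (r \<otimes>\<^bsub>H\<^esub> h2))" for w r h2
      using B.sw_antipode(1)[of "\<lambda>y. G (outer \<one>\<^bsub>B\<^esub> r \<otimes>\<^bsub>A\<^esub> outer y h2)" w] by (simp add: l outer_one_mult)
    then show ?thesis
      by simp
  qed
  also have "\<dots> = counit B x * DH h (\<lambda>k h2. G (outer \<one>\<^bsub>B\<^esub> (?S k \<otimes>\<^bsub>H\<^esub> h2)))"
    using sw_counit_coact[of "\<lambda>g. DH h (\<lambda>k h2. G (outer \<one>\<^bsub>B\<^esub> (?S (g \<otimes>\<^bsub>H\<^esub> k) \<otimes>\<^bsub>H\<^esub> h2)))" x]
    by (simp add: l sw_mult_right)
  also have "\<dots> = counit A (outer x h) * G \<one>\<^bsub>A\<^esub>"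
    using sw_antipode(1)[of "\<lambda>a. G (outer \<one>\<^bsub>B\<^esub> a)" h] by (simp add: l A_counit_outer)
  finally show ?thesis .
qed

text \<open>The cancellations go outwards: first \<open>k S(h2)\<close> in H, then the two coaction
  legs after they are merged by coassociativity, and last the braided antipode law.\<close>

lemma A_antipode_right_outer:
  assumes "lin G"
  shows "sweedler (comult A (outer x h)) (\<lambda>a b. G (a \<otimes>\<^bsub>A\<^esub> antipode A b)) = counit A (outer x h) * G \<one>\<^bsub>A\<^esub>"
proof -
  have l: "vlin f \<Longrightarrow> lin (\<lambda>x. G (f x))" for f :: "('c \<Rightarrow> 'k) \<Rightarrow> _"
    using lin_comp[OF assms(1)] by auto
  let ?S = "antipode H"
  have "sweedler (comult A (outer x h)) (\<lambda>a b. G (a \<otimes>\<^bsub>A\<^esub> antipode A b))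
    = DB x (\<lambda>x1 x2. CB x2 (\<lambda>g w. DH h (\<lambda>k h2. CB w (\<lambda>u y.
        G (outer x1 (g \<otimes>\<^bsub>H\<^esub> (k \<otimes>\<^bsub>H\<^esub> ?S h2 \<otimes>\<^bsub>H\<^esub> ?S u)) \<otimes>\<^bsub>A\<^esub> outer (antipode B y) \<one>\<^bsub>H\<^esub>)))))"
    by (simp add: A_comult_outer l A_antipode_outer A_sw_push lin_sw[OF assms] A_assoc[symmetric]
        outer_mult_one_right antipode_mult assoc)
  also have "\<dots> = DB x (\<lambda>x1 x2. CB x2 (\<lambda>g w. CB w (\<lambda>u y. DH h (\<lambda>k h2.
        G (outer x1 (g \<otimes>\<^bsub>H\<^esub> (k \<otimes>\<^bsub>H\<^esub> ?S h2 \<otimes>\<^bsub>H\<^esub> ?S u)) \<otimes>\<^bsub>A\<^esub> outer (antipode B y) \<one>\<^bsub>H\<^esub>)))))"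
    by (rule sw_cong, rule sw_cong, rule sw_swap)
  also have "\<dots> = DB x (\<lambda>x1 x2. CB x2 (\<lambda>g w. CB w (\<lambda>u y.
        counit H h * G (outer x1 (g \<otimes>\<^bsub>H\<^esub> ?S u) \<otimes>\<^bsub>A\<^esub> outer (antipode B y) \<one>\<^bsub>H\<^esub>))))"
  proof -
    have "DH h (\<lambda>k h2. G (outer x1 (g \<otimes>\<^bsub>H\<^esub> (k \<otimes>\<^bsub>H\<^esub> ?S h2 \<otimes>\<^bsub>H\<^esub> v)) \<otimes>\<^bsub>A\<^esub> z))
        = counit H h * G (outer x1 (g \<otimes>\<^bsub>H\<^esub> v) \<otimes>\<^bsub>A\<^esub> z)" for x1 g v z
      using sw_antipode(2)[of "\<lambda>m. G (outer x1 (g \<otimes>\<^bsub>H\<^esub> (m \<otimes>\<^bsub>H\<^esub> v)) \<otimes>\<^bsub>A\<^esub> z)" h] by (simp add: l)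
    then show ?thesis
      by simp
  qed
  also have "\<dots> = counit H h * DB x (\<lambda>x1 x2. CB x2 (\<lambda>g w. CB w (\<lambda>u y.
        G (outer x1 (g \<otimes>\<^bsub>H\<^esub> ?S u) \<otimes>\<^bsub>A\<^esub> outer (antipode B y) \<one>\<^bsub>H\<^esub>))))"
    by (simp only: sw_mult_right)
  also have "\<dots> = counit H h * DB x (\<lambda>x1 x2. CB x2 (\<lambda>g y. DH g (\<lambda>g u.
        G (outer x1 (g \<otimes>\<^bsub>H\<^esub> ?S u) \<otimes>\<^bsub>A\<^esub> outer (antipode B y) \<one>\<^bsub>H\<^esub>))))"
    by (subst sw_coact_coassoc) (simp_all add: l)
  also have "\<dots> = counit H h * DB x (\<lambda>x1 x2. CB x2 (\<lambda>g y. counit H g * G (outer (x1 \<cdot> antipode B y) \<one>\<^bsub>H\<^esub>)))"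
  proof -
    have "DH g (\<lambda>g u. G (outer x1 (g \<otimes>\<^bsub>H\<^esub> ?S u) \<otimes>\<^bsub>A\<^esub> outer y \<one>\<^bsub>H\<^esub>)) = counit H g * G (outer (x1 \<cdot> y) \<one>\<^bsub>H\<^esub>)" for x1 g y
      using sw_antipode(2)[of "\<lambda>m. G (outer x1 m \<otimes>\<^bsub>A\<^esub> outer y \<one>\<^bsub>H\<^esub>)" g] by (simp add: l outer_mult_one_left)
    then show ?thesis
      by simp
  qed
  also have "\<dots> = counit A (outer x h) * G \<one>\<^bsub>A\<^esub>"
    using B.sw_antipode(2)[of "\<lambda>a. G (outer a \<one>\<^bsub>H\<^esub>)" x] by (simp add: l A_counit_outer)
  finally show ?thesis .
qed

section \<open>The Hopf algebra axioms of the bosonization\<close>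

lemma A_comult_linear: "Vector_Spaces.linear vscale (fscale vscale) (comult A)"
  by (rule tensor_map_linearI) (simp add: lin_A_comult)

lemma fd_coalgebra_A: "fd_coalgebra A"
proof (rule fd_coalgebra.intro)
  show "Vector_Spaces.linear vscale (fscale vscale) (comult A)"
    by (rule A_comult_linear)
  show "Vector_Spaces.linear vscale (*) (counit A)"
    by (rule lin_linear) simp
  fix t :: "'b \<times> 'h \<Rightarrow> 'k"
  show "sweedler (comult A t) (\<lambda>a b. sweedler (comult A a) (\<lambda>a1 a2. tens (fscale vscale) a1 (tens vscale a2 b)))
    = sweedler (comult A t) (\<lambda>a b. tens (fscale vscale) a (comult A b))"
  proof (rule tensor3_eqI)
    fix p q r :: "'b \<times> 'h \<Rightarrow> 'k"
    let ?P = "\<lambda>T. sweedler T (\<lambda>a t. sweedler t (\<lambda>b c. pairing p a * pairing q b * pairing r c))"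
    have 1: "?P (tens (fscale vscale) a (comult A b)) = sweedler (comult A b) (\<lambda>b c. pairing p a * pairing q b * pairing r c)" for a b
      by (rule sw_tens_right) (simp_all add: sw_fscale)
    have 2: "?P (sweedler t' G) = sweedler t' (\<lambda>a b. ?P (G a b))"
      for t' :: "'b \<times> 'h \<Rightarrow> 'b \<times> 'h \<Rightarrow> 'k" and G
      by (rule sw_sw) (rule sw_add, simp add: distrib_left)
    have 3: "?P (tens (fscale vscale) a (tens vscale b c)) = pairing p a * pairing q b * pairing r c" for a b c
      by (rule sw_tens3) simp_all
    show "?P (sweedler (comult A t) (\<lambda>a b. sweedler (comult A a) (\<lambda>a1 a2. tens (fscale vscale) a1 (tens vscale a2 b))))
      = ?P (sweedler (comult A t) (\<lambda>a b. tens (fscale vscale) a (comult A b)))"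
      unfolding 1 2 3
      by (rule lin_eq_outerI[where t=t], simp_all add: lin_A_comult, rule A_coassoc_outer) simp_all
  qed
  show "sweedler (comult A t) (\<lambda>a b. vscale (counit A a) b) = t"
  proof (rule vec_eqI, simp)
    fix p
    show "sweedler (comult A t) (\<lambda>a b. counit A a * pairing p b) = pairing p t"
      by (rule lin_eq_outerI[where t=t])
         (simp_all add: lin_A_comult A_comult_outer A_counit_outer counit_mult mult.assoc sw_mult_right[symmetric])
  qed
  show "sweedler (comult A t) (\<lambda>a b. vscale (counit A b) a) = t"
  proof (rule vec_eqI, simp)
    fix p
    show "sweedler (comult A t) (\<lambda>a b. counit A b * pairing p a) = pairing p t"
      by (rule lin_eq_outerI[where t=t])
         (simp_all add: lin_A_comult A_comult_outer A_counit_outer counit_mult mult.assoc sw_mult_right[symmetric])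
  qed
qed

lemma convolution_antipode_A: "convolution_antipode A"
proof (rule convolution_antipode.intro)
  show "Vector_Spaces.linear vscale vscale (antipode A)"
    by (rule vlin_linear) simp
  fix t :: "'b \<times> 'h \<Rightarrow> 'k"
  show "sweedler (comult A t) (\<lambda>a b. antipode A a \<otimes>\<^bsub>A\<^esub> b) = vscale (counit A t) \<one>\<^bsub>A\<^esub>"
  proof (rule vec_eqI, simp del: A_simps)
    fix p
    show "sweedler (comult A t) (\<lambda>a b. pairing p (antipode A a \<otimes>\<^bsub>A\<^esub> b)) = counit A t * pairing p \<one>\<^bsub>A\<^esub>"
      by (rule lin_eq_outerI[where t=t])
         (simp_all add: lin_A_comult A_antipode_left_outer[OF lin_pairing0] del: A_simps)
  qed
  show "sweedler (comult A t) (\<lambda>a b. a \<otimes>\<^bsub>A\<^esub> antipode A b) = vscale (counit A t) \<one>\<^bsub>A\<^esub>"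
  proof (rule vec_eqI, simp del: A_simps)
    fix p
    show "sweedler (comult A t) (\<lambda>a b. pairing p (a \<otimes>\<^bsub>A\<^esub> antipode A b)) = counit A t * pairing p \<one>\<^bsub>A\<^esub>"
      by (rule lin_eq_outerI[where t=t])
         (simp_all add: lin_A_comult A_antipode_right_outer[OF lin_pairing0] del: A_simps)
  qed
qed

lemma hopf_algebra_A: "hopf_algebra A"
proof (intro hopf_algebra.intro hopf_algebra_axioms.intro fd_algebra_A fd_coalgebra_A convolution_antipode_A)
  fix x y :: "'b \<times> 'h \<Rightarrow> 'k"
  show "comult A (x \<otimes>\<^bsub>A\<^esub> y) = sweedler (comult A x) (\<lambda>x1 x2. sweedler (comult A y) (\<lambda>y1 y2.
          tens vscale (x1 \<otimes>\<^bsub>A\<^esub> y1) (x2 \<otimes>\<^bsub>A\<^esub> y2)))"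
  proof (rule tensor_eqI)
    fix p q :: "'b \<times> 'h \<Rightarrow> 'k"
    let ?F = "\<lambda>a b. pairing p a * pairing q b"
    have 1: "sweedler (comult A (outer x h \<otimes>\<^bsub>A\<^esub> y)) ?F = sweedler (comult A (outer x h)) (\<lambda>x1 x2. sweedler (comult A y) (\<lambda>y1 y2.
          ?F (x1 \<otimes>\<^bsub>A\<^esub> y1) (x2 \<otimes>\<^bsub>A\<^esub> y2)))" for x h
      by (rule lin_eq_outerI[where t=y]) (simp_all add: lin_A_comult A_comult_mult_outer)
    have "sweedler (comult A (x \<otimes>\<^bsub>A\<^esub> y)) ?F = sweedler (comult A x) (\<lambda>x1 x2. sweedler (comult A y) (\<lambda>y1 y2.
          ?F (x1 \<otimes>\<^bsub>A\<^esub> y1) (x2 \<otimes>\<^bsub>A\<^esub> y2)))"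
      by (rule lin_eq_outerI[where t=x]) (simp_all add: lin_A_comult 1)
    then show "sweedler (comult A (x \<otimes>\<^bsub>A\<^esub> y)) ?F = sweedler (sweedler (comult A x) (\<lambda>x1 x2. sweedler (comult A y) (\<lambda>y1 y2.
          tens vscale (x1 \<otimes>\<^bsub>A\<^esub> y1) (x2 \<otimes>\<^bsub>A\<^esub> y2)))) ?F"
      by (simp add: sw_sw distrib_left)
  qed
  show "comult A \<one>\<^bsub>A\<^esub> = tens vscale \<one>\<^bsub>A\<^esub> \<one>\<^bsub>A\<^esub>"
    by (rule tensor_eqI) (simp add: A_comult_outer sw_comult_unit sw_coact_unit comult_one_sw)
  have 1: "counit A (outer x h \<otimes>\<^bsub>A\<^esub> outer y g) = counit A (outer x h) * counit A (outer y g)" for x h y g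
  proof -
    have "counit A (outer x h \<otimes>\<^bsub>A\<^esub> outer y g)
      = DH h (\<lambda>h1 h2. counit H h1 * (counit H h2 * (counit B x * counit B y * counit H g)))"
      unfolding outer_mult lin_sw[OF lin_A_counit[OF vlin_id]]
      by (rule sw_cong) (simp add: A_counit_outer counit_prod counit_act counit_mult)
    then show ?thesis
      by (simp add: A_counit_outer)
  qed
  have 2: "counit A (outer x h \<otimes>\<^bsub>A\<^esub> y) = counit A (outer x h) * counit A y" for x h
    by (rule lin_eq_outerI[where t=y]) (simp_all add: 1)
  show "counit A (x \<otimes>\<^bsub>A\<^esub> y) = counit A x * counit A y"
    by (rule lin_eq_outerI[where t=x]) (simp_all add: 2)
  show "counit A \<one>\<^bsub>A\<^esub> = 1"
    by (simp add: A_counit_outer counit_unit counit_one)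
qed

end

section \<open>The Drinfeld double\<close>

text \<open>An element of \<open>X \<otimes> Y\<^sup>*\<close> as a linear map from \<open>Y\<close> to \<open>X\<close>.\<close>

definition ev :: "('i \<times> 'j::finite \<Rightarrow> 'k::field) \<Rightarrow> ('j \<Rightarrow> 'k) \<Rightarrow> 'i \<Rightarrow> 'k" where
  "ev t y = (\<lambda>i. pairing (curry t i) y)"

lemma vlin_ev [simp]: "vlin f \<Longrightarrow> vlin (\<lambda>x. ev t (f x))"
  by (subst vlin_coords) (simp add: ev_def)

lemma pairing_expand: "pairing f y = (\<Sum>i\<in>UNIV. y i * f i)"
  by (simp add: pairing_def mult.commute)

lemma pairing_add_left: "pairing (p + q) x = pairing p x + pairing q x"
  and pairing_scale_left: "pairing (vscale c p) x = c * pairing p x"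
  by (simp_all add: pairing_def algebra_simps sum.distrib fscale_def sum_distrib_left)

lemma lin_pairing_left [simp]: "vlin f \<Longrightarrow> lin (\<lambda>x. pairing (f x) y)"
  by (rule lin_comp[where g="\<lambda>p. pairing p y"]) (simp_all add: lin_def pairing_add_left pairing_scale_left)

lemma vlin_ev_left [simp]: "vlin f \<Longrightarrow> vlin (\<lambda>x. ev (f x) y)"
proof -
  have "vlin (\<lambda>t. ev t y)"
    unfolding vlin_coords ev_def
    by (auto simp: lin_def curry_def pairing_def algebra_simps sum.distrib fscale_def sum_distrib_left)
  then show "vlin f \<Longrightarrow> vlin (\<lambda>x. ev (f x) y)"
    by (rule vlin_comp)
qed

lemma ev_bvec: "ev t (bvec j) i = t (i, j)"
  by (simp add: ev_def curry_def)

lemma ev_eqI: "(\<And>y. ev t y = ev u y) \<Longrightarrow> t = u"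
  by (metis ev_bvec ext surj_pair)

lemma vlin_evI:
  fixes f :: "('l \<Rightarrow> 'k::field) \<Rightarrow> 'i::finite \<times> 'j::finite \<Rightarrow> 'k"
  assumes "\<And>p y. lin (\<lambda>x. pairing p (ev (f x) y))"
  shows "vlin f"
  unfolding vlin_coords
proof
  fix a :: "'i \<times> 'j"
  obtain i j where a: "a = (i, j)"
    by force
  show "lin (\<lambda>x. f x a)"
    using assms[of "bvec i" "bvec j"] by (simp add: pairing_bvec ev_bvec a)
qed

lemma ev_outer: "ev (outer a f) y = vscale (pairing f y) a"
  by (auto simp: ev_def outer_def curry_def pairing_def fscale_def fun_eq_iff sum_distrib_right sum_distrib_left mult_ac)

lemma sw_curry_ev: "lin K \<Longrightarrow> sweedler (curry t) (\<lambda>a f. pairing f y * K a) = K (ev t y)"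
  by (subst lin_expand[of K]) (simp_all add: sweedler_def ev_def)

context fd_coalgebra
begin

lemma pairing_dual_mult: "pairing (dual_mult A f g) y = sweedler (comult A y) (\<lambda>a b. pairing f a * pairing g b)"
  by (subst pairing_expand, subst lin_expand[of "\<lambda>y. sweedler (comult A y) (\<lambda>a b. pairing f a * pairing g b)"])
     (simp_all add: dual_mult_def)

lemma pairing_counit_coords [simp]: "pairing (counit_coords A) y = counit A y"
  by (subst pairing_expand, subst lin_expand[OF lin_counit[OF vlin_id]]) (simp add: counit_coords_def)

end

context hopf_algebra
begin

abbreviation dmult (infixl "\<star>" 70) where "dmult \<equiv> mult (drinfeld_double H)"

text \<open>The coproduct of the dual is the transpose of multiplication, so pairing its first leg
  with b leaves the translate of f by b.\<close>

lemma sw_dual_comult_left: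
  assumes "lin K"
  shows "sweedler (dual_comult H f) (\<lambda>f1 f'. pairing f1 b * K f') = K (\<lambda>j. pairing f (b \<otimes> bvec j))"
proof -
  have "K (\<lambda>j. pairing f (b \<otimes> bvec j)) = K (\<Sum>i\<in>UNIV. vscale (b i) (dual_comult H f i))"
  proof (rule arg_cong[of _ _ K], rule ext)
    fix j
    show "pairing f (b \<otimes> bvec j) = (\<Sum>i\<in>UNIV. vscale (b i) (dual_comult H f i)) j"
      by (subst lin_expand[of "\<lambda>b. pairing f (b \<otimes> bvec j)"])
         (simp_all add: sum_apply vscale_apply dual_comult_def)
  qed
  then show ?thesis
    by (simp add: sweedler_def lin_sum[OF assms] lin_scale[OF assms] pairing_bvec)
qed

lemma sw_dual_comult_right:
  "sweedler (dual_comult H f) (\<lambda>f2 f3. pairing f3 c * pairing f2 y) = pairing f (y \<otimes> c)"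
proof -
  have "pairing (dual_comult H f i) c = pairing f (bvec i \<otimes> c)" for i
    by (subst pairing_expand, subst lin_expand[of "\<lambda>c. pairing f (bvec i \<otimes> c)"])
       (simp_all add: dual_comult_def)
  then show ?thesis
    by (subst lin_expand[of "\<lambda>y. pairing f (y \<otimes> c)"])
       (simp_all add: sweedler_def pairing_bvec mult.commute)
qed

lemma pairing_left_translate: "pairing (\<lambda>j. pairing f (b \<otimes> bvec j)) y = pairing f (b \<otimes> y)"
  by (subst pairing_expand, subst lin_expand[of "\<lambda>y. pairing f (b \<otimes> y)"]) simp_all

lemma pairing_ev_sw:
  "pairing p (ev (sweedler t F) y) = sweedler t (\<lambda>a b. pairing p (ev (F a b) y))"
  by (subst vlin_sw[OF vlin_ev_left[OF vlin_id]]) simp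

text \<open>The closed form of the product: with w for \<open>u(y1)\<close>, the operator of the
  product sends y to \<open>t(w1 y2 S(w3)) w2\<close>. The pairings of f with \<open>b1\<close> and
  \<open>S b3\<close> and the convolution with g merge into a shifted argument of t.\<close>

lemma pairing_double_mult:
  "pairing p (ev (t \<star> u) y) = sweedler (comult H y) (\<lambda>y1 y2.
    sweedler (comult H (ev u y1)) (\<lambda>w1 w'. sweedler (comult H w') (\<lambda>w2 w3.
      pairing p (ev t (w1 \<otimes> (y2 \<otimes> antipode H w3)) \<otimes> w2))))"
proof -
  let ?D = "\<lambda>x. sweedler (comult H x)" and ?S = "antipode H"
  have 1: "sweedler (dual_comult H f) (\<lambda>f1 f'. sweedler (dual_comult H f') (\<lambda>f2 f3.
      pairing f1 b1 * pairing f3 (?S b3) * pairing (dual_mult H g f2) y * c))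
    = ?D y (\<lambda>y1 y2. pairing g y1 * pairing f (b1 \<otimes> (y2 \<otimes> ?S b3)) * c)" for f g b1 b3 c
  proof -
    have "sweedler (dual_comult H f) (\<lambda>f1 f'. sweedler (dual_comult H f') (\<lambda>f2 f3.
        pairing f1 b1 * pairing f3 (?S b3) * pairing (dual_mult H g f2) y * c))
      = ?D y (\<lambda>y1 y2. pairing g y1 * c * sweedler (dual_comult H f) (\<lambda>f1 f'. pairing f1 b1 *
          sweedler (dual_comult H f') (\<lambda>f2 f3. pairing f3 (?S b3) * pairing f2 y2)))"
      unfolding pairing_dual_mult sw_mult_left sw_mult_right
      by (subst sw_swap2) (intro sw_cong, simp add: mult_ac)
    also have "\<dots> = ?D y (\<lambda>y1 y2. pairing g y1 * pairing f (b1 \<otimes> (y2 \<otimes> ?S b3)) * c)"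
      unfolding sw_dual_comult_right
      by (rule sw_cong, subst sw_dual_comult_left) (simp_all add: pairing_left_translate)
    finally show ?thesis .
  qed
  have "pairing p (ev (t \<star> u) y) = sweedler (curry t) (\<lambda>a f. sweedler (curry u) (\<lambda>b g.
      ?D b (\<lambda>b1 b'. ?D b' (\<lambda>b2 b3. ?D y (\<lambda>y1 y2.
        pairing g y1 * pairing f (b1 \<otimes> (y2 \<otimes> ?S b3)) * pairing p (a \<otimes> b2))))))"
    by (simp add: drinfeld_double_def pairing_ev_sw vlin_scale[OF vlin_ev_left[OF vlin_id]] ev_outer 1)
  also have "\<dots> = sweedler (curry u) (\<lambda>b g.
      ?D b (\<lambda>b1 b'. ?D b' (\<lambda>b2 b3. ?D y (\<lambda>y1 y2.
        pairing g y1 * sweedler (curry t) (\<lambda>a f. pairing f (b1 \<otimes> (y2 \<otimes> ?S b3)) * pairing p (a \<otimes> b2))))))"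
    unfolding sw_mult_right by (rule trans[OF _ sw_swap4[symmetric]]) (simp add: mult.assoc)
  also have "\<dots> = sweedler (curry u) (\<lambda>b g.
      ?D b (\<lambda>b1 b'. ?D b' (\<lambda>b2 b3. ?D y (\<lambda>y1 y2.
        pairing g y1 * pairing p (ev t (b1 \<otimes> (y2 \<otimes> ?S b3)) \<otimes> b2)))))"
    by (simp add: sw_curry_ev)
  also have "\<dots> = ?D y (\<lambda>y1 y2. sweedler (curry u) (\<lambda>b g. pairing g y1 *
      ?D b (\<lambda>b1 b'. ?D b' (\<lambda>b2 b3. pairing p (ev t (b1 \<otimes> (y2 \<otimes> ?S b3)) \<otimes> b2)))))"
    unfolding sw_mult_right by (rule sw_swap3)
  also have "\<dots> = ?D y (\<lambda>y1 y2. ?D (ev u y1) (\<lambda>b1 b'. ?D b' (\<lambda>b2 b3.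
      pairing p (ev t (b1 \<otimes> (y2 \<otimes> ?S b3)) \<otimes> b2))))"
    by (rule sw_cong, subst sw_curry_ev) simp_all
  finally show ?thesis .
qed

lemma lin_double_mult:
  assumes "lin G"
  shows "G (ev (t \<star> u) y) = sweedler (comult H y) (\<lambda>y1 y2.
    sweedler (comult H (ev u y1)) (\<lambda>w1 w'. sweedler (comult H w') (\<lambda>w2 w3.
      G (ev t (w1 \<otimes> (y2 \<otimes> antipode H w3)) \<otimes> w2))))"
proof -
  have *: "G z = pairing (\<lambda>i. G (bvec i)) z" for z
    unfolding pairing_expand by (rule lin_expand[OF assms])
  obtain q where q: "\<And>z. G z = pairing q z"
    using that[of "\<lambda>i. G (bvec i)"] * by blast
  show ?thesis
    unfolding q by (rule pairing_double_mult)
qed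

lemma vlin_double_mult [simp]: "vlin f \<Longrightarrow> vlin (\<lambda>x. f x \<star> u)"
  and vlin_double_mult_right [simp]: "vlin f \<Longrightarrow> vlin (\<lambda>x. u \<star> f x)"
  by (rule vlin_evI, simp add: pairing_double_mult)+

text \<open>By the closed formula both sides become the sum of \<open>?P\<close> over y split into
  three legs and \<open>v(y1)\<close> split into five, named a, b, m, c, d. The left side uses that
  the coproduct is multiplicative and reversed by the antipode; the right side uses that it is
  multiplicative on \<open>u(...) m2\<close> and that the antipode reverses products.\<close>

lemma double_assoc: "(t \<star> u) \<star> v = t \<star> (u \<star> v)"
proof (rule ev_eqI, rule vec_eqI)
  fix y p
  let ?D = "\<lambda>x. sweedler (comult H x)" and ?S = "antipode H"
  let ?P = "\<lambda>y2 y3 a b m c d. ?D (ev u (a \<otimes> (y2 \<otimes> ?S d))) (\<lambda>p1 p'. ?D p' (\<lambda>p2 p3.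
      pairing p (ev t (p1 \<otimes> (b \<otimes> (y3 \<otimes> (?S c \<otimes> ?S p3)))) \<otimes> (p2 \<otimes> m))))"
  have e: "pairing p (ev (t \<star> u) z \<otimes> m) = ?D z (\<lambda>z1 z2. ?D (ev u z1) (\<lambda>w1 w'. ?D w' (\<lambda>w2 w3.
      pairing p (ev t (w1 \<otimes> (z2 \<otimes> ?S w3)) \<otimes> w2 \<otimes> m))))" for z m
    by (rule lin_double_mult[where G="\<lambda>z. pairing p (z \<otimes> m)"]) simp
  have e2: "?D (ev (u \<star> v) z) (\<lambda>q1 q'. ?D q' (\<lambda>q2 q3. pairing p (ev t (q1 \<otimes> (y3 \<otimes> ?S q3)) \<otimes> q2)))
    = ?D z (\<lambda>y1 y2. ?D (ev v y1) (\<lambda>m1 m'. ?D m' (\<lambda>m2 m3. ?D (ev u (m1 \<otimes> (y2 \<otimes> ?S m3)) \<otimes> m2)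
      (\<lambda>q1 q'. ?D q' (\<lambda>q2 q3. pairing p (ev t (q1 \<otimes> (y3 \<otimes> ?S q3)) \<otimes> q2))))))" for z y3
    by (rule lin_double_mult[where G="\<lambda>z. ?D z (\<lambda>q1 q'. ?D q' (\<lambda>q2 q3. pairing p (ev t (q1 \<otimes> (y3 \<otimes> ?S q3)) \<otimes> q2)))"]) simp
  have "pairing p (ev ((t \<star> u) \<star> v) y) = ?D y (\<lambda>y1 y'. ?D (ev v y1) (\<lambda>w1 w'. ?D w' (\<lambda>w2 w3.
      pairing p (ev (t \<star> u) (w1 \<otimes> (y' \<otimes> ?S w3)) \<otimes> w2))))"
    by (simp add: pairing_double_mult)
  also have "\<dots> = ?D y (\<lambda>y1 y'. ?D (ev v y1) (\<lambda>w1 w'. ?D w' (\<lambda>w2 w3.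
      ?D w1 (\<lambda>a b. ?D y' (\<lambda>y2 y3. ?D w3 (\<lambda>c d. ?P y2 y3 a b w2 c d))))))"
    by (simp add: e comult_mult_sw comult_antipode_sw assoc)
  also have "\<dots> = ?D y (\<lambda>y1 y'. ?D y' (\<lambda>y2 y3. ?D (ev v y1) (\<lambda>w1 w'. ?D w' (\<lambda>w2 w3.
      ?D w1 (\<lambda>a b. ?D w3 (\<lambda>c d. ?P y2 y3 a b w2 c d))))))"
    by (rule sw_cong, rule sw_swap3)
  also have "\<dots> = ?D y (\<lambda>y1 y'. ?D y' (\<lambda>y2 y3. ?D (ev v y1) (\<lambda>w1 w'. ?D w1 (\<lambda>a b. ?D w' (\<lambda>w2 w3.
      ?D w3 (\<lambda>c d. ?P y2 y3 a b w2 c d))))))"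
    by (rule sw_cong3, rule sw_swap)
  also have "\<dots> = ?D y (\<lambda>y1 y'. ?D y' (\<lambda>y2 y3. ?D (ev v y1) (\<lambda>a s. ?D s (\<lambda>b s. ?D s (\<lambda>m s.
      ?D s (\<lambda>c d. ?P y2 y3 a b m c d))))))"
    by (rule sw_cong, rule sw_cong, rule sw_coassoc) simp_all
  finally have 1: "pairing p (ev ((t \<star> u) \<star> v) y) = \<dots>" .
  have "pairing p (ev (t \<star> (u \<star> v)) y) = ?D y (\<lambda>y' y3. ?D y' (\<lambda>y1 y2. ?D (ev v y1) (\<lambda>m1 m'. ?D m' (\<lambda>m2 m3.
      ?D (ev u (m1 \<otimes> (y2 \<otimes> ?S m3)) \<otimes> m2) (\<lambda>q1 q'. ?D q' (\<lambda>q2 q3. pairing p (ev t (q1 \<otimes> (y3 \<otimes> ?S q3)) \<otimes> q2)))))))"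
    by (simp add: pairing_double_mult e2)
  also have "\<dots> = ?D y (\<lambda>y1 y'. ?D y' (\<lambda>y2 y3. ?D (ev v y1) (\<lambda>m1 m'. ?D m' (\<lambda>m2 m3.
      ?D (ev u (m1 \<otimes> (y2 \<otimes> ?S m3)) \<otimes> m2) (\<lambda>q1 q'. ?D q' (\<lambda>q2 q3. pairing p (ev t (q1 \<otimes> (y3 \<otimes> ?S q3)) \<otimes> q2)))))))"
    by (rule sw_coassoc) simp_all
  also have "\<dots> = ?D y (\<lambda>y1 y'. ?D y' (\<lambda>y2 y3. ?D (ev v y1) (\<lambda>m1 m'. ?D m' (\<lambda>m2 m3.
      ?D m2 (\<lambda>n1 n'. ?D n' (\<lambda>n2 n3. ?P y2 y3 m1 n1 n2 n3 m3))))))"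
  proof -
    have "?D (e \<otimes> m2) (\<lambda>q1 q'. ?D q' (\<lambda>q2 q3. pairing p (ev t (q1 \<otimes> (y3 \<otimes> ?S q3)) \<otimes> q2)))
      = ?D m2 (\<lambda>n1 n'. ?D n' (\<lambda>n2 n3. ?D e (\<lambda>p1 p'. ?D p' (\<lambda>p2 p3.
        pairing p (ev t (p1 \<otimes> (n1 \<otimes> (y3 \<otimes> (?S n3 \<otimes> ?S p3)))) \<otimes> (p2 \<otimes> n2))))))" (is "?L = _") for e m2 y3
    proof -
      have "?L = ?D e (\<lambda>p1 p'. ?D m2 (\<lambda>n1 n'. ?D p' (\<lambda>p2 p3. ?D n' (\<lambda>n2 n3.
        pairing p (ev t (p1 \<otimes> (n1 \<otimes> (y3 \<otimes> (?S n3 \<otimes> ?S p3)))) \<otimes> (p2 \<otimes> n2))))))"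
        by (simp add: comult_mult_sw antipode_mult assoc)
      also have "\<dots> = ?D m2 (\<lambda>n1 n'. ?D e (\<lambda>p1 p'. ?D p' (\<lambda>p2 p3. ?D n' (\<lambda>n2 n3.
        pairing p (ev t (p1 \<otimes> (n1 \<otimes> (y3 \<otimes> (?S n3 \<otimes> ?S p3)))) \<otimes> (p2 \<otimes> n2))))))"
        by (rule sw_swap)
      also have "\<dots> = ?D m2 (\<lambda>n1 n'. ?D n' (\<lambda>n2 n3. ?D e (\<lambda>p1 p'. ?D p' (\<lambda>p2 p3.
        pairing p (ev t (p1 \<otimes> (n1 \<otimes> (y3 \<otimes> (?S n3 \<otimes> ?S p3)))) \<otimes> (p2 \<otimes> n2))))))"
        by (rule sw_cong, rule sw_swap2)
      finally show ?thesis .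
    qed
    then show ?thesis
      by simp
  qed
  also have "\<dots> = ?D y (\<lambda>y1 y'. ?D y' (\<lambda>y2 y3. ?D (ev v y1) (\<lambda>a s. ?D s (\<lambda>b s. ?D s (\<lambda>m s.
      ?D s (\<lambda>c d. ?P y2 y3 a b m c d))))))"
  proof -
    have "?D m' (\<lambda>m2 m3. ?D m2 (\<lambda>n1 n'. ?D n' (\<lambda>n2 n3. Q n1 n2 n3 m3)))
      = ?D m' (\<lambda>b s. ?D s (\<lambda>m s. ?D s (\<lambda>c d. Q b m c d)))"
      if l: "\<And>b c d. lin (\<lambda>a. Q a b c d)" "\<And>a c d. lin (\<lambda>b. Q a b c d)"
        "\<And>a b d. lin (\<lambda>c. Q a b c d)" "\<And>a b c. lin (Q a b c)"
      for m' and Q :: "('h \<Rightarrow> 'k) \<Rightarrow> ('h \<Rightarrow> 'k) \<Rightarrow> ('h \<Rightarrow> 'k) \<Rightarrow> ('h \<Rightarrow> 'k) \<Rightarrow> 'k"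
    proof -
      show ?thesis
        apply (subst sw_coassoc)
        apply (simp_all add: l)
        apply (rule sw_cong)
        apply (subst sw_coassoc)
        apply (simp_all add: l)
        done
    qed
    then show ?thesis
      by (intro sw_cong3) simp_all
  qed
  finally show "pairing p (ev ((t \<star> u) \<star> v) y) = pairing p (ev (t \<star> (u \<star> v)) y)"
    using 1 by simp
qed

lemma double_simps [simp]: "carrier (drinfeld_double H) = UNIV" "\<zero>\<^bsub>drinfeld_double H\<^esub> = 0"
  "x \<oplus>\<^bsub>drinfeld_double H\<^esub> y = x + y" "\<one>\<^bsub>drinfeld_double H\<^esub> = outer \<one> (counit_coords H)"
  by (simp_all add: drinfeld_double_def)

text \<open>The left operand sees its argument only through the counit, which is multiplicative and
  unchanged by the antipode, so the legs \<open>w1\<close>, \<open>w3\<close> and \<open>y2\<close>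
  disappear.\<close>

lemma ev_base_mult: "ev (outer a (counit_coords H) \<star> u) y = a \<otimes> ev u y"
proof (rule vec_eqI)
  fix p
  show "pairing p (ev (outer a (counit_coords H) \<star> u) y) = pairing p (a \<otimes> ev u y)"
    by (simp add: pairing_double_mult ev_outer scale_mult counit_mult mult.assoc)
       (simp add: sw_mult_right[symmetric])
qed

lemma double_one_left: "outer \<one> (counit_coords H) \<star> u = u"
  by (rule ev_eqI) (simp add: ev_base_mult)

lemma sw_comult_scale:
  "(\<And>a. lin (F a)) \<Longrightarrow> sweedler (comult H (vscale c x)) F = c * sweedler (comult H x) F"
  by (rule lin_scale[OF lin_sw_comult[OF vlin_id]])

lemma double_one_right: "t \<star> outer \<one> (counit_coords H) = t"
proof (rule ev_eqI, rule vec_eqI)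
  fix p y
  show "pairing p (ev (t \<star> outer \<one> (counit_coords H)) y) = pairing p (ev t y)"
    by (simp add: pairing_double_mult ev_outer sw_comult_scale comult_one_sw)
qed

lemma fd_algebra_double: "fd_algebra (drinfeld_double H)"
  by (rule fd_algebraI) (simp_all add: double_assoc double_one_left double_one_right)

end

section \<open>The grading of a Nichols algebra\<close>

lemma lin_span_zero:
  fixes F :: "('i::finite \<Rightarrow> 'k::field) \<Rightarrow> 'k"
  assumes "lin F" "x \<in> kvec.span S" "\<And>y. y \<in> S \<Longrightarrow> F y = 0"
  shows "F x = 0"
proof -
  have "kvec.span S \<subseteq> {x. F x = 0}"
    by (rule kvec.span_minimal)
       (auto simp: kvec.subspace_def lin_zero[OF assms(1)] lin_add[OF assms(1)] lin_scale[OF assms(1)] assms(3))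
  then show ?thesis
    using assms(2) by blast
qed

text \<open>Vectors are read as functionals on functionals: a basis of W is extended by
  \<open>\<phi>\<close>, and x collects the coordinates of the functional that is 1 at
  \<open>\<phi>\<close> and 0 on that basis.\<close>

lemma separating_vector:
  fixes W :: "('i::finite \<Rightarrow> 'k::field) set"
  assumes "kvec.subspace W" "\<phi> \<notin> W"
  obtains x where "\<And>w. w \<in> W \<Longrightarrow> pairing w x = 0" "pairing \<phi> x \<noteq> 0"
proof -
  obtain Bs where Bs: "Bs \<subseteq> W" "kvec.independent Bs" "W \<subseteq> kvec.span Bs"
    using kvec.basis_exists[of W] by metis
  have span: "kvec.span Bs = W"
    using Bs assms(1) by (metis kvec.span_minimal subset_antisym)
  then have ind: "kvec.independent (insert \<phi> Bs)"
    using Bs(2) assms(2) by (simp add: kvec.independent_insert)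
  interpret vector_space_pair "vscale :: 'k \<Rightarrow> ('i \<Rightarrow> 'k) \<Rightarrow> 'i \<Rightarrow> 'k" "(*) :: 'k \<Rightarrow> 'k \<Rightarrow> 'k"
    by (intro vector_space_pair.intro kvec.vector_space_axioms vector_space_mult)
  obtain g where g: "Vector_Spaces.linear vscale (*) g" "\<forall>x\<in>insert \<phi> Bs. g x = (if x = \<phi> then 1 else 0)"
    using linear_independent_extend[OF ind, of "\<lambda>x. if x = \<phi> then 1 else 0"] by auto
  have lin: "lin g"
    using linear_maps[OF g(1)] by (auto simp: lin_def)
  have "\<phi> \<notin> Bs"
    using assms(2) Bs(1) by auto
  then have zero: "g w = 0" if "w \<in> Bs" for w
    using g(2) that by auto
  have gW: "g w = 0" if "w \<in> W" for w
    using lin_span_zero[OF lin, of w Bs] zero that span by blast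
  have "pairing w (\<lambda>i. g (bvec i)) = g w" for w
    using lin_expand[OF lin, of w] by (simp add: pairing_def)
  then show ?thesis
    using that[of "\<lambda>i. g (bvec i)"] gW g(2) by simp
qed

context nichols_algebra
begin

lemma comp_zero [simp]: "0 \<in> comp B n"
  and comp_add: "x \<in> comp B n \<Longrightarrow> y \<in> comp B n \<Longrightarrow> x + y \<in> comp B n"
  and comp_scale: "x \<in> comp B n \<Longrightarrow> vscale c x \<in> comp B n"
  using comp_subspace[of n] by (auto simp: kvec.subspace_def)

text \<open>\<open>THE\<close> picks the whole family of components at once, so one uniqueness
  argument, \<open>hcomp_unique\<close>, serves all degrees.\<close>

definition hcomp :: "nat \<Rightarrow> ('b \<Rightarrow> 'k) \<Rightarrow> 'b \<Rightarrow> 'k" where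
  "hcomp n x = (THE c. (\<forall>n. c n \<in> comp B n) \<and> finite {n. c n \<noteq> 0} \<and> x = (\<Sum>n | c n \<noteq> 0. c n)) n"

lemma hcomp_unique:
  assumes "\<And>n. c n \<in> comp B n" "finite F" "\<And>n. n \<notin> F \<Longrightarrow> c n = 0" "x = (\<Sum>n\<in>F. c n)"
  shows "hcomp n x = c n"
proof -
  have sub: "{n. c n \<noteq> 0} \<subseteq> F"
    using assms(3) by blast
  have "x = (\<Sum>n | c n \<noteq> 0. c n)"
    unfolding assms(4) by (rule sum.mono_neutral_right) (use assms(2) sub in auto)
  then have "(THE c. (\<forall>n. c n \<in> comp B n) \<and> finite {n. c n \<noteq> 0} \<and> x = (\<Sum>n | c n \<noteq> 0. c n)) = c"
    using assms(1,2) sub by (intro the1_equality comp_direct) (auto intro: finite_subset)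
  then show ?thesis
    by (simp add: hcomp_def)
qed

lemma hcomp_props: "hcomp n x \<in> comp B n" "finite {n. hcomp n x \<noteq> 0}" "x = (\<Sum>n | hcomp n x \<noteq> 0. hcomp n x)"
proof -
  have "(\<forall>n. hcomp n x \<in> comp B n) \<and> finite {n. hcomp n x \<noteq> 0} \<and> x = (\<Sum>n | hcomp n x \<noteq> 0. hcomp n x)"
    unfolding hcomp_def by (rule theI'[OF comp_direct])
  then show "hcomp n x \<in> comp B n" "finite {n. hcomp n x \<noteq> 0}" "x = (\<Sum>n | hcomp n x \<noteq> 0. hcomp n x)"
    by auto
qed

lemma hcomp_comp: "x \<in> comp B m \<Longrightarrow> hcomp n x = (if n = m then x else 0)"
  by (rule hcomp_unique[where F="{m}" and c="\<lambda>n. if n = m then x else 0"]) auto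

lemma hcomp_sum:
  assumes "finite F" "{n. hcomp n x \<noteq> 0} \<subseteq> F"
  shows "(\<Sum>n\<in>F. hcomp n x) = x"
proof -
  have "(\<Sum>n\<in>F. hcomp n x) = (\<Sum>n | hcomp n x \<noteq> 0. hcomp n x)"
    by (rule sum.mono_neutral_right) (use assms in auto)
  then show ?thesis
    by (simp only: hcomp_props(3)[symmetric])
qed

text \<open>Sums and multiples of decompositions are decompositions again, so uniqueness gives
  linearity.\<close>

lemma vlin_hcomp0: "vlin (hcomp n)"
  unfolding vlin_def
proof safe
  fix x y
  let ?F = "{n. hcomp n x \<noteq> 0} \<union> {n. hcomp n y \<noteq> 0}"
  have fin: "finite ?F"
    by (simp add: hcomp_props(2))
  have "(\<Sum>n\<in>?F. hcomp n x) = x" "(\<Sum>n\<in>?F. hcomp n y) = y"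
    by (rule hcomp_sum[OF fin], blast)+
  then have eq: "x + y = (\<Sum>n\<in>?F. hcomp n x + hcomp n y)"
    by (simp only: sum.distrib)
  show "hcomp n (x + y) = hcomp n x + hcomp n y"
  proof (rule hcomp_unique[where F="?F" and c="\<lambda>n. hcomp n x + hcomp n y", OF _ fin _ eq])
    show "hcomp n x + hcomp n y \<in> comp B n" for n
      by (rule comp_add[OF hcomp_props(1) hcomp_props(1)])
    show "hcomp n x + hcomp n y = 0" if "n \<notin> ?F" for n
      using that by simp
  qed
next
  fix c x
  have eq: "vscale c x = (\<Sum>n | hcomp n x \<noteq> 0. vscale c (hcomp n x))"
    using vlin_sum[OF vlin_vscale_right[OF vlin_id], of c "\<lambda>n. hcomp n x" "{n. hcomp n x \<noteq> 0}"]
    by (simp only: hcomp_props(3)[of x, symmetric])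
  show "hcomp n (vscale c x) = vscale c (hcomp n x)"
  proof (rule hcomp_unique[where F="{n. hcomp n x \<noteq> 0}" and c="\<lambda>n. vscale c (hcomp n x)", OF _ hcomp_props(2) _ eq])
    show "vscale c (hcomp n x) \<in> comp B n" for n
      by (rule comp_scale[OF hcomp_props(1)])
    show "vscale c (hcomp n x) = 0" if "n \<notin> {n. hcomp n x \<noteq> 0}" for n
      using that by simp
  qed
qed

lemmas vlin_hcomp [simp] = vlin_comp[OF vlin_hcomp0]

lemma hcomp_hcomp: "hcomp m (hcomp n x) = (if m = n then hcomp n x else 0)"
  using hcomp_comp[OF hcomp_props(1)] by simp

lemma one_neq_zero: "\<one>\<^bsub>B\<^esub> \<noteq> 0"
  using counit_unit lin_zero[OF B.lin_counit[OF vlin_id]] by force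

lemma one_comp: "\<one>\<^bsub>B\<^esub> \<in> comp B 0"
  using connected by (metis rangeI vscale_simps(1))

text \<open>A uniform range for sums over homogeneous components. It bounds the degrees of all
  vectors because it bounds those of the standard basis.\<close>

definition degree_bound :: nat where
  "degree_bound = Max {n. \<exists>i. hcomp n (bvec i) \<noteq> 0}"

lemma hcomp_bound: "n > degree_bound \<Longrightarrow> hcomp n x = 0"
proof -
  assume n: "n > degree_bound"
  have "{n. \<exists>i. hcomp n (bvec i) \<noteq> 0} = (\<Union>i. {n. hcomp n (bvec i) \<noteq> 0})"
    by auto
  then have fin: "finite {n. \<exists>i. hcomp n (bvec i) \<noteq> 0}"
    using hcomp_props(2) by simp
  have "hcomp n (bvec i) = 0" for i
  proof (rule ccontr)
    assume "hcomp n (bvec i) \<noteq> 0"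
    then have "n \<le> degree_bound"
      unfolding degree_bound_def using fin by (intro Max_ge) auto
    then show False
      using n by simp
  qed
  then show "hcomp n x = 0"
    by (subst vlin_expand[OF vlin_hcomp0]) simp
qed

lemma sum_hcomp: "(\<Sum>n\<le>degree_bound. hcomp n x) = x"
proof -
  have "{n. hcomp n x \<noteq> 0} \<subseteq> {..degree_bound}"
    using hcomp_bound[of _ x] by (force simp: not_le[symmetric])
  then show ?thesis
    by (intro hcomp_sum) auto
qed

lemma comp_bound: "n > degree_bound \<Longrightarrow> x \<in> comp B n \<Longrightarrow> x = 0"
  using hcomp_bound[of n x] hcomp_comp[of x n n] by simp

lemma lin_hcomp_eqI:
  assumes "lin f" "lin g" "\<And>n x. x \<in> comp B n \<Longrightarrow> f x = g x"
  shows "f x = g x"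
proof -
  have "f (\<Sum>n\<le>degree_bound. hcomp n x) = g (\<Sum>n\<le>degree_bound. hcomp n x)"
    unfolding lin_sum[OF assms(1)] lin_sum[OF assms(2)]
    by (rule sum.cong[OF refl], rule assms(3), rule hcomp_props(1))
  then show ?thesis
    by (simp add: sum_hcomp)
qed

text \<open>The formula cuts out a subspace of tensors. It contains the pure tensors of total degree
  n, for which only the summand matching the degrees of the two factors survives.\<close>

lemma sw_comult_comp:
  assumes x: "x \<in> comp B n" and F: "\<And>b. lin (\<lambda>a. F a b)" "\<And>a. lin (F a)"
  shows "DB x F = (\<Sum>k\<le>n. DB x (\<lambda>a b. F (hcomp k a) (hcomp (n - k) b)))"
proof -
  have l: "vlin f \<Longrightarrow> lin (\<lambda>x. F (f x) b)" "vlin f \<Longrightarrow> lin (\<lambda>x. F b (f x))" for f :: "('c \<Rightarrow> 'k) \<Rightarrow> _" and b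
    using lin_comp[OF F(1)] lin_comp[OF F(2)] by auto
  let ?P = "\<lambda>t. sweedler t F = (\<Sum>k\<le>n. sweedler t (\<lambda>a b. F (hcomp k a) (hcomp (n - k) b)))"
  have P: "?P t" if "t = tens vscale y z" "y \<in> comp B k" "z \<in> comp B l" "k + l = n" for t y z k l
  proof -
    have "(\<Sum>i\<le>n. F (hcomp i y) (hcomp (n - i) z)) = (\<Sum>i\<le>n. if i = k then F y z else 0)"
      using that by (intro sum.cong refl) (auto simp: hcomp_comp[OF that(2)] hcomp_comp[OF that(3)] lin_zero[OF F(1)])
    then show ?thesis
      using that(4) by (simp add: that(1) l F)
  qed
  have vs: "Modules.module (fscale vscale :: 'k \<Rightarrow> ('b \<Rightarrow> 'b \<Rightarrow> 'k) \<Rightarrow> _)"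
    using vector_space_fscale[OF kvec.vector_space_axioms] by (simp add: module_iff_vector_space)
  have add: "sweedler (t + u) G = sweedler t G + sweedler u G" if "\<And>a. lin (G a)" for t u and G :: "_ \<Rightarrow> _ \<Rightarrow> 'k"
    by (rule sw_add) (rule lin_add[OF that])
  have "Modules.module.subspace (fscale vscale) {t. ?P t}"
    unfolding Modules.module.subspace_def[OF vs]
    by (auto simp: add sw_fscale l F sum.distrib sum_distrib_left)
       (simp_all add: sweedler_def lin_zero[OF F(2)] lin_zero[OF l(2)[OF vlin_hcomp0]])
  moreover have "{tens vscale y z | y z k l. y \<in> comp B k \<and> z \<in> comp B l \<and> k + l = n} \<subseteq> {t. ?P t}"
    using P by blast
  ultimately have "?P (comult B x)"
    using Modules.module.span_minimal[OF vs] comp_comult[OF x] by blast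
  then show ?thesis .
qed

text \<open>Fixing the degree of one leg kills all summands of \<open>sw_comult_comp\<close> except
  one.\<close>

lemma sw_comult_hcomp:
  assumes x: "x \<in> comp B n" and F: "\<And>b. lin (\<lambda>a. F a b)" "\<And>a. lin (F a)"
  shows "DB x (\<lambda>a b. F (hcomp k a) b) = (if k \<le> n then DB x (\<lambda>a b. F (hcomp k a) (hcomp (n - k) b)) else 0)"
    and "DB x (\<lambda>a b. F a (hcomp k b)) = (if k \<le> n then DB x (\<lambda>a b. F (hcomp (n - k) a) (hcomp k b)) else 0)"
proof -
  have l: "vlin f \<Longrightarrow> lin (\<lambda>x. F (f x) b)" "vlin f \<Longrightarrow> lin (\<lambda>x. F b (f x))" for f :: "('c \<Rightarrow> 'k) \<Rightarrow> _" and b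
    using lin_comp[OF F(1)] lin_comp[OF F(2)] by auto
  have z: "F 0 b = 0" "F b 0 = 0" for b
    using lin_zero[OF F(1)] lin_zero[OF F(2)] by auto
  have "DB x (\<lambda>a b. F (hcomp k a) b) = (\<Sum>i\<le>n. DB x (\<lambda>a b. F (hcomp k (hcomp i a)) (hcomp (n - i) b)))"
    by (rule sw_comult_comp[OF x]) (simp_all add: l F)
  also have "\<dots> = (\<Sum>i\<le>n. if i = k then DB x (\<lambda>a b. F (hcomp k a) (hcomp (n - k) b)) else 0)"
  proof (rule sum.cong[OF refl])
    fix i
    show "DB x (\<lambda>a b. F (hcomp k (hcomp i a)) (hcomp (n - i) b)) = (if i = k then DB x (\<lambda>a b. F (hcomp k a) (hcomp (n - k) b)) else 0)"
      by (cases "i = k") (simp_all add: hcomp_hcomp z sweedler_def)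
  qed
  finally show "DB x (\<lambda>a b. F (hcomp k a) b) = (if k \<le> n then DB x (\<lambda>a b. F (hcomp k a) (hcomp (n - k) b)) else 0)"
    by simp
  have "DB x (\<lambda>a b. F a (hcomp k b)) = (\<Sum>i\<le>n. DB x (\<lambda>a b. F (hcomp i a) (hcomp k (hcomp (n - i) b))))"
    by (rule sw_comult_comp[OF x]) (simp_all add: l F)
  also have "\<dots> = (\<Sum>i\<le>n. if i = n - k then (if k \<le> n then DB x (\<lambda>a b. F (hcomp (n - k) a) (hcomp k b)) else 0) else 0)"
  proof (rule sum.cong[OF refl])
    fix i assume "i \<in> {..n}"
    then show "DB x (\<lambda>a b. F (hcomp i a) (hcomp k (hcomp (n - i) b)))
      = (if i = n - k then (if k \<le> n then DB x (\<lambda>a b. F (hcomp (n - k) a) (hcomp k b)) else 0) else 0)"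
      by (cases "k = n - i") (auto simp: hcomp_hcomp z sweedler_def)
  qed
  finally show "DB x (\<lambda>a b. F a (hcomp k b)) = (if k \<le> n then DB x (\<lambda>a b. F (hcomp (n - k) a) (hcomp k b)) else 0)"
    by simp
qed

text \<open>The counit is not graded by axiom. The counit of \<open>hcomp 0 x\<close>, which is
  zero, is computed from the coproduct: degree 0 on the right forces degree n on the left and
  conversely, so it equals the counit of x.\<close>

lemma counit_comp:
  assumes x: "x \<in> comp B n" and n: "n > 0"
  shows "counit B x = 0"
proof -
  have "0 = counit B (hcomp 0 x)"
    using n lin_zero[OF B.lin_counit[OF vlin_id]] by (simp add: hcomp_comp[OF x])
  also have "\<dots> = DB x (\<lambda>a b. counit B a * counit B (hcomp 0 b))"
    by simp
  also have "\<dots> = DB x (\<lambda>a b. counit B (hcomp n a) * counit B (hcomp 0 b))"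
    using sw_comult_hcomp(2)[OF x, of "\<lambda>a b. counit B a * counit B b" 0] by simp
  also have "\<dots> = DB x (\<lambda>a b. counit B (hcomp n a) * counit B b)"
    using sw_comult_hcomp(1)[OF x, of "\<lambda>a b. counit B a * counit B b" n] hcomp_comp[OF x] by simp
  also have "\<dots> = counit B x"
    by (simp add: hcomp_comp[OF x])
  finally show ?thesis ..
qed

lemma hcomp_0: "hcomp 0 x = vscale (counit B x) \<one>\<^bsub>B\<^esub>"
proof -
  obtain c where c: "hcomp 0 x = vscale c \<one>\<^bsub>B\<^esub>"
    using hcomp_props(1)[of 0 x] connected by auto
  have "counit B x = counit B (hcomp 0 x)"
  proof (rule lin_hcomp_eqI[where x=x])
    fix n x assume x: "x \<in> comp B n"
    show "counit B x = counit B (hcomp 0 x)"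
      using counit_comp[OF x] lin_zero[OF B.lin_counit[OF vlin_id]] by (simp add: hcomp_comp[OF x])
  qed (simp_all add: B.lin_counit[OF vlin_id])
  then show ?thesis
    by (simp add: c lin_scale[OF B.lin_counit[OF vlin_id]] counit_unit)
qed

lemma hcomp_mult_right:
  assumes y: "y \<in> comp B k"
  shows "hcomp (n + k) (z \<cdot> y) = hcomp n z \<cdot> y"
proof (rule vec_eqI)
  fix p
  show "pairing p (hcomp (n + k) (z \<cdot> y)) = pairing p (hcomp n z \<cdot> y)"
  proof (rule lin_hcomp_eqI[where x=z])
    fix m z assume z: "z \<in> comp B m"
    show "pairing p (hcomp (n + k) (z \<cdot> y)) = pairing p (hcomp n z \<cdot> y)"
      by (simp add: hcomp_comp[OF z] hcomp_comp[OF comp_mult[OF z y]] vlin_zero[OF B.vlin_mult[OF vlin_id]])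
  qed simp_all
qed

text \<open>Gradedness of the antipode comes from uniqueness of inverses: its degree-preserving part
  \<open>S'\<close> is again a left convolution inverse of the identity, because multiplication and
  coproduct are graded.\<close>

lemma antipode_hcomp: "antipode B (hcomp n x) = hcomp n (antipode B x)"
proof -
  define S' where "S' x = (\<Sum>n\<le>degree_bound. hcomp n (antipode B (hcomp n x)))" for x
  have vS' [simp]: "vlin f \<Longrightarrow> vlin (\<lambda>x. S' (f x))" for f :: "('c \<Rightarrow> 'k) \<Rightarrow> _"
    unfolding S'_def by simp
  have S'_comp: "S' x = hcomp n (antipode B x)" if x: "x \<in> comp B n" for x n
  proof (cases "n \<le> degree_bound")
    case True
    have "S' x = (\<Sum>m\<le>degree_bound. if m = n then hcomp n (antipode B x) else 0)"
      unfolding S'_def by (intro sum.cong refl)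
        (auto simp: hcomp_comp[OF x] vlin_zero[OF vlin_hcomp0] vlin_zero[OF B.vlin_antipode[OF vlin_id]])
    then show ?thesis
      using True by simp
  next
    case False
    then show ?thesis
      using comp_bound[of n x] x by (simp add: hcomp_bound vlin_zero[OF vS'[OF vlin_id]])
  qed
  have left: "DB x (\<lambda>a b. G (S' a \<cdot> b)) = counit B x * G \<one>\<^bsub>B\<^esub>" if G: "lin G" for G x
  proof (rule lin_hcomp_eqI[where x=x])
    have lG: "vlin f \<Longrightarrow> lin (\<lambda>x. G (f x))" for f :: "('c \<Rightarrow> 'k) \<Rightarrow> _"
      by (rule lin_comp[OF G])
    show "lin (\<lambda>x. DB x (\<lambda>a b. G (S' a \<cdot> b)))" "lin (\<lambda>x. counit B x * G \<one>\<^bsub>B\<^esub>)"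
      by (simp_all add: lG)
    fix n x assume x: "x \<in> comp B n"
    have "DB x (\<lambda>a b. G (S' a \<cdot> b)) = (\<Sum>k\<le>n. DB x (\<lambda>a b. G (S' (hcomp k a) \<cdot> hcomp (n - k) b)))"
      by (rule sw_comult_comp[OF x]) (simp_all add: lG)
    also have "\<dots> = (\<Sum>k\<le>n. DB x (\<lambda>a b. G (hcomp n (antipode B (hcomp k a) \<cdot> hcomp (n - k) b))))"
    proof (rule sum.cong[OF refl], rule sw_cong)
      fix k a b assume "k \<in> {..n}"
      then show "G (S' (hcomp k a) \<cdot> hcomp (n - k) b) = G (hcomp n (antipode B (hcomp k a) \<cdot> hcomp (n - k) b))"
        using hcomp_mult_right[OF hcomp_props(1), of k "n - k"] by (simp add: S'_comp[OF hcomp_props(1)])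
    qed
    also have "\<dots> = DB x (\<lambda>a b. G (hcomp n (antipode B a \<cdot> b)))"
      by (rule sw_comult_comp[OF x, symmetric]) (simp_all add: lG)
    also have "\<dots> = counit B x * G (hcomp n \<one>\<^bsub>B\<^esub>)"
      using B.sw_antipode(1)[OF lG[OF vlin_hcomp0]] by simp
    also have "\<dots> = counit B x * G \<one>\<^bsub>B\<^esub>"
      using counit_comp[OF x] by (cases "n = 0") (simp_all add: hcomp_comp[OF one_comp])
    finally show "DB x (\<lambda>a b. G (S' a \<cdot> b)) = counit B x * G \<one>\<^bsub>B\<^esub>" .
  qed
  have "S' x = antipode B x" for x
  proof (rule vec_eqI)
    fix p
    have "pairing p (S' x) = DB x (\<lambda>a b. counit B b * pairing p (S' a))"
      by simp
    also have "\<dots> = DB x (\<lambda>a t. DB t (\<lambda>b c. pairing p (S' a \<cdot> b \<cdot> antipode B c)))"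
      using B.sw_antipode(2)[OF lin_pairing[OF B.vlin_mult_right[OF vlin_id]]] by (simp add: B.assoc)
    also have "\<dots> = DB x (\<lambda>t c. DB t (\<lambda>a b. pairing p (S' a \<cdot> b \<cdot> antipode B c)))"
      by (rule B.sw_coassoc[symmetric]) simp_all
    also have "\<dots> = pairing p (antipode B x)"
      using left[OF lin_pairing[OF B.vlin_mult[OF vlin_id]]] by simp
    finally show "pairing p (S' x) = pairing p (antipode B x)" .
  qed
  then have S: "antipode B x = hcomp n (antipode B x)" if "x \<in> comp B n" for x n
    using S'_comp[OF that] by simp
  show ?thesis
  proof (rule vec_eqI)
    fix p
    show "pairing p (antipode B (hcomp n x)) = pairing p (hcomp n (antipode B x))"
    proof (rule lin_hcomp_eqI[where x=x])
      fix m x assume x: "x \<in> comp B m"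
      have "antipode B x \<in> comp B m"
        using S[OF x] hcomp_props(1) by metis
      then show "pairing p (antipode B (hcomp n x)) = pairing p (hcomp n (antipode B x))"
        by (simp add: hcomp_comp[OF x] hcomp_comp vlin_zero[OF B.vlin_antipode[OF vlin_id]])
    qed simp_all
  qed
qed

lemma hcomp_act: "hcomp n (h \<rightharpoonup> x) = h \<rightharpoonup> hcomp n x"
proof (rule vec_eqI)
  fix p
  show "pairing p (hcomp n (h \<rightharpoonup> x)) = pairing p (h \<rightharpoonup> hcomp n x)"
  proof (rule lin_hcomp_eqI[where x=x])
    fix m x assume x: "x \<in> comp B m"
    show "pairing p (hcomp n (h \<rightharpoonup> x)) = pairing p (h \<rightharpoonup> hcomp n x)"
      by (simp add: hcomp_comp[OF x] hcomp_comp[OF comp_act[OF x]] vlin_zero[OF vlin_act_right[OF vlin_id]])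
  qed simp_all
qed

lemma sw_coact_hcomp:
  assumes F: "\<And>b. lin (\<lambda>a. F a b)" "\<And>a. lin (F a)"
  shows "CB (hcomp n x) F = CB x (\<lambda>g w. F g (hcomp n w))"
proof (rule lin_hcomp_eqI[where x=x])
  have l: "vlin f \<Longrightarrow> lin (\<lambda>x. F b (f x))" for f :: "('c \<Rightarrow> 'k) \<Rightarrow> _" and b
    using lin_comp[OF F(2)] by auto
  show "lin (\<lambda>x. CB (hcomp n x) F)" "lin (\<lambda>x. CB x (\<lambda>g w. F g (hcomp n w)))"
    by (simp_all add: l F)
  fix m x assume x: "x \<in> comp B m"
  have z: "CB 0 F = 0"
    by (rule lin_zero[OF lin_sw_coact[OF vlin_id]]) (rule F)
  show "CB (hcomp n x) F = CB x (\<lambda>g w. F g (hcomp n w))"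
    using hcomp_comp[OF comp_coact[OF x]] by (cases "n = m")
      (simp_all add: hcomp_comp[OF x] z z[unfolded sweedler_def] sweedler_def lin_zero[OF F(2)])
qed

section \<open>The dual of a Nichols algebra\<close>

definition dual_comp :: "nat \<Rightarrow> ('b \<Rightarrow> 'k) set" where
  "dual_comp n = {\<phi>. \<forall>m x. m \<noteq> n \<longrightarrow> x \<in> comp B m \<longrightarrow> pairing \<phi> x = 0}"

lemma pairing_dual_comp: "\<phi> \<in> dual_comp n \<Longrightarrow> pairing \<phi> (hcomp m x) = (if m = n then pairing \<phi> x else 0)"
proof -
  assume \<phi>: "\<phi> \<in> dual_comp n"
  show ?thesis
  proof (rule lin_hcomp_eqI[where x=x])
    fix l x assume "x \<in> comp B l"
    then show "pairing \<phi> (hcomp m x) = (if m = n then pairing \<phi> x else 0)"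
      using \<phi> by (auto simp: dual_comp_def hcomp_comp)
  next
    show "lin (\<lambda>x. if m = n then pairing \<phi> x else 0)"
      by (cases "m = n") (simp_all add: lin_def)
  qed simp
qed

definition dual_hcomp :: "nat \<Rightarrow> ('b \<Rightarrow> 'k) \<Rightarrow> 'b \<Rightarrow> 'k" where
  "dual_hcomp n \<phi> = (\<lambda>i. pairing \<phi> (hcomp n (bvec i)))"

lemma pairing_dual_hcomp: "pairing (dual_hcomp n \<phi>) x = pairing \<phi> (hcomp n x)"
  by (subst pairing_expand, subst lin_expand[of "\<lambda>x. pairing \<phi> (hcomp n x)"]) (simp_all add: dual_hcomp_def)

lemma dual_hcomp: "dual_hcomp n \<phi> \<in> dual_comp n"
  by (auto simp: dual_comp_def pairing_dual_hcomp hcomp_comp)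

text \<open>A functional of degree one leaves a complementary leg of degree m - 1, so cutting
  \<open>\<psi>\<close> down to degree n - 1 selects the components of degree n. This makes products
  in the dual homogeneous.\<close>

lemma sw_dual_comp_one:
  assumes \<alpha>: "\<alpha> \<in> dual_comp 1" and y: "y \<in> comp B m" and n: "n \<ge> 1"
  shows "DB y (\<lambda>a b. pairing \<alpha> a * pairing (dual_hcomp (n - 1) \<psi>) b)
    = (if m = n then DB y (\<lambda>a b. pairing \<alpha> a * pairing \<psi> b) else 0)"
proof -
  have \<alpha>1: "pairing \<alpha> a = pairing \<alpha> (hcomp 1 a)" for a
    using pairing_dual_comp[OF \<alpha>, of 1] by simp
  have "DB y (\<lambda>a b. pairing \<alpha> (hcomp 1 a) * pairing q b)
    = (if 1 \<le> m then DB y (\<lambda>a b. pairing \<alpha> (hcomp 1 a) * pairing q (hcomp (m - 1) b)) else 0)" for q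
    by (rule sw_comult_hcomp(1)[OF y]) simp_all
  then have 0: "DB y (\<lambda>a b. pairing \<alpha> a * pairing q b)
    = (if 1 \<le> m then DB y (\<lambda>a b. pairing \<alpha> a * pairing q (hcomp (m - 1) b)) else 0)" for q
    by (simp only: \<alpha>1[symmetric])
  have e: "(n - Suc 0 = m - Suc 0) = (n = m)" if "Suc 0 \<le> m"
    using n that by auto
  show ?thesis
    unfolding 0[of \<psi>] 0[of "dual_hcomp (n - 1) \<psi>"] unfolding pairing_dual_hcomp
    using n by (auto simp: hcomp_hcomp sweedler_def e)
qed

text \<open>Dual to primitives being concentrated in degree one. A functional of degree n outside
  the span is detected by some z of degree n that is killed by all products with a left factor of
  degree one. By induction z is then killed by products with left factors of any degree from 1 to n
  - 1, so z is primitive, which contradicts \<open>n \<ge> 2\<close>.\<close>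

lemma dual_comp_span: "n \<ge> 1 \<Longrightarrow> dual_comp n \<subseteq> kvec.span {dual_mult B \<alpha> \<psi> | \<alpha> \<psi>. \<alpha> \<in> dual_comp 1}"
proof (induction n rule: less_induct)
  case (less n)
  let ?W = "kvec.span {dual_mult B \<alpha> \<psi> | \<alpha> \<psi>. \<alpha> \<in> dual_comp 1}"
  show ?case
  proof (cases "n = 1")
    case True
    have "dual_mult B \<phi> (counit_coords B) = \<phi>" for \<phi>
    proof -
      have "pairing (dual_mult B \<phi> (counit_coords B)) y = pairing \<phi> y" for y
        by (simp add: B.pairing_dual_mult)
      then show ?thesis
        by (metis ext pairing_bvec_right)
    qed
    moreover have "dual_mult B \<phi> (counit_coords B) \<in> ?W" if "\<phi> \<in> dual_comp 1" for \<phi>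
      by (rule kvec.span_base) (use that in blast)
    ultimately show ?thesis
      using True by auto
  next
    case False
    with less.prems have n: "n \<ge> 2" by simp
    show ?thesis
    proof
      fix \<phi> assume \<phi>: "\<phi> \<in> dual_comp n"
      show "\<phi> \<in> ?W"
      proof (rule ccontr)
        assume "\<phi> \<notin> ?W"
        then obtain x where x: "\<And>w. w \<in> ?W \<Longrightarrow> pairing w x = 0" "pairing \<phi> x \<noteq> 0"
          using separating_vector[OF kvec.subspace_span] by blast
        define z where "z = hcomp n x"
        have z: "z \<in> comp B n"
          by (simp add: z_def hcomp_props(1))
        have 1: "DB z (\<lambda>a b. pairing \<alpha> a * pairing \<psi> b) = 0" if \<alpha>: "\<alpha> \<in> dual_comp 1" for \<alpha> \<psi>
        proof -
          define \<psi>' where "\<psi>' = dual_hcomp (n - 1) \<psi>"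
          have *: "DB y (\<lambda>a b. pairing \<alpha> a * pairing \<psi>' b) = (if m = n then DB y (\<lambda>a b. pairing \<alpha> a * pairing \<psi> b) else 0)"
            if y: "y \<in> comp B m" for y m
            unfolding \<psi>'_def by (rule sw_dual_comp_one[OF \<alpha> y]) (use n in simp)
          have "0 = DB x (\<lambda>a b. pairing \<alpha> a * pairing \<psi>' b)"
            using x(1)[OF kvec.span_base] \<alpha> B.pairing_dual_mult by (metis (mono_tags, lifting) mem_Collect_eq)
          also have "\<dots> = (\<Sum>m\<le>degree_bound. DB (hcomp m x) (\<lambda>a b. pairing \<alpha> a * pairing \<psi>' b))"
            by (subst sum_hcomp[of x, symmetric], subst lin_sum[of "\<lambda>y. DB y (\<lambda>a b. pairing \<alpha> a * pairing \<psi>' b)"]) simp_all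
          also have "\<dots> = (\<Sum>m\<le>degree_bound. if m = n then DB z (\<lambda>a b. pairing \<alpha> a * pairing \<psi> b) else 0)"
            by (intro sum.cong refl) (simp add: *[OF hcomp_props(1)] z_def)
          also have "\<dots> = DB z (\<lambda>a b. pairing \<alpha> a * pairing \<psi> b)"
          proof (cases "n \<le> degree_bound")
            case False
            then have "z = 0"
              by (simp add: z_def hcomp_bound)
            then show ?thesis
              using False lin_zero[OF B.lin_sw_comult[OF vlin_id, of "\<lambda>a b. pairing \<alpha> a * pairing \<psi> b"]] by simp
          qed simp
          finally show ?thesis ..
        qed
        \<comment> \<open>The induction hypothesis writes \<open>\<beta>\<close> through products,
          whose second factors move to the right leg by coassociativity, so that \<open>1\<close>
          applies.\<close>
        have 2: "DB z (\<lambda>a b. pairing \<beta> a * pairing \<psi> b) = 0" if i: "1 \<le> i" "i < n" and \<beta>: "\<beta> \<in> dual_comp i" for i \<beta> \<psi>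
        proof (rule lin_span_zero[where x=\<beta>])
          show "lin (\<lambda>\<beta>. DB z (\<lambda>a b. pairing \<beta> a * pairing \<psi> b))"
            by simp
          show "\<beta> \<in> ?W"
            using less.IH[OF i(2,1)] \<beta> by auto
          fix y assume "y \<in> {dual_mult B \<alpha> \<psi> | \<alpha> \<psi>. \<alpha> \<in> dual_comp 1}"
          then obtain \<alpha> \<psi>' where y: "y = dual_mult B \<alpha> \<psi>'" "\<alpha> \<in> dual_comp 1"
            by auto
          have "DB z (\<lambda>a b. pairing y a * pairing \<psi> b) = DB z (\<lambda>a b. DB a (\<lambda>a1 a2. pairing \<alpha> a1 * pairing \<psi>' a2 * pairing \<psi> b))"
            by (simp add: y B.pairing_dual_mult sw_mult_left)
          also have "\<dots> = DB z (\<lambda>a b. DB b (\<lambda>b1 b2. pairing \<alpha> a * pairing \<psi>' b1 * pairing \<psi> b2))"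
            by (rule B.sw_coassoc) simp_all
          also have "\<dots> = DB z (\<lambda>a b. pairing \<alpha> a * pairing (dual_mult B \<psi>' \<psi>) b)"
            by (simp add: B.pairing_dual_mult sw_mult_right mult.assoc)
          also have "\<dots> = 0"
            by (rule 1) (rule y)
          finally show "DB z (\<lambda>a b. pairing y a * pairing \<psi> b) = 0" .
        qed
        \<comment> \<open>Only the summands with k = 0 and k = n survive in the coproduct of z;
          connectedness evaluates them through \<open>hcomp_0\<close>.\<close>
        have "comult B z = tens vscale z \<one>\<^bsub>B\<^esub> + tens vscale \<one>\<^bsub>B\<^esub> z"
        proof (rule tensor_eqI)
          fix p q
          define t where "t k = DB z (\<lambda>a b. pairing p (hcomp k a) * pairing q (hcomp (n - k) b))" for k
          have t: "t k = (if k = 0 then t 0 else 0) + (if k = n then t n else 0)" if "k \<le> n" for k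
          proof (cases "k = 0 \<or> k = n")
            case False
            then have "t k = 0"
              using 2[of k "dual_hcomp k p" "dual_hcomp (n - k) q"] dual_hcomp that by (simp add: pairing_dual_hcomp t_def)
            then show ?thesis
              using False by simp
          qed (use n in auto)
          have "DB z (\<lambda>a b. pairing p a * pairing q b) = (\<Sum>k\<le>n. t k)"
            unfolding t_def by (rule sw_comult_comp[OF z]) simp_all
          also have "\<dots> = (\<Sum>k\<le>n. (if k = 0 then t 0 else 0) + (if k = n then t n else 0))"
            by (rule sum.cong[OF refl], rule t) simp
          also have "\<dots> = t 0 + t n"
            by (simp add: sum.distrib)
          also have "t 0 = DB z (\<lambda>a b. pairing p (hcomp 0 a) * pairing q b)"
            using sw_comult_hcomp(1)[OF z, of "\<lambda>a b. pairing p a * pairing q b" 0] by (simp add: t_def)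
          also have "\<dots> = pairing p \<one>\<^bsub>B\<^esub> * pairing q z"
            by (simp add: hcomp_0 mult.assoc)
          also have "t n = DB z (\<lambda>a b. pairing p a * pairing q (hcomp 0 b))"
            using sw_comult_hcomp(2)[OF z, of "\<lambda>a b. pairing p a * pairing q b" 0] by (simp add: t_def)
          also have "\<dots> = pairing p z * pairing q \<one>\<^bsub>B\<^esub>"
            using B.sw_counit_right[of "\<lambda>a. pairing p a * pairing q \<one>\<^bsub>B\<^esub>" z]
            by (simp add: hcomp_0 mult_ac)
          finally show "DB z (\<lambda>a b. pairing p a * pairing q b)
              = sweedler (tens vscale z \<one>\<^bsub>B\<^esub> + tens vscale \<one>\<^bsub>B\<^esub> z) (\<lambda>a b. pairing p a * pairing q b)"
            by (simp add: sw_add distrib_left)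
        qed
        then have "z \<in> comp B 1"
          using primitives by auto
        then have "z = 0"
          using hcomp_comp[OF z, of n] hcomp_comp[of z 1 n] n by simp
        then show False
          using x(2) pairing_dual_comp[OF \<phi>, of n x] by (simp add: z_def)
      qed
    qed
  qed
qed

end

section \<open>Gradings of the bosonization and of its double\<close>

lemma lin_zero_fun [simp]: "lin (\<lambda>x. 0)"
  by (simp add: lin_def)

lemma vlin_zero_fun [simp]: "vlin (\<lambda>x. 0)"
  by (simp add: vlin_def)

lemma ev_zero [simp]: "ev t 0 = 0"
  by (rule vlin_zero[OF vlin_ev[OF vlin_id]])

lemma (in fd_algebra) a_inv_eq: "\<ominus> x = - x"
  by (rule minus_equality) (simp_all add: carrier_eq add_eq zero_eq)

lemma pairing_outer: "pairing (outer p q) (outer x y) = pairing p x * pairing q y"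
  for p :: "'i::finite \<Rightarrow> 'k::field" and q :: "'j::finite \<Rightarrow> 'k"
  unfolding pairing_def outer_def UNIV_Times_UNIV[symmetric] sum_product sum.cartesian_product
  by (rule sum.cong) (auto simp: mult_ac)

sublocale braided_hopf_algebra \<subseteq> AH: hopf_algebra "bosonization H B"
  by (rule hopf_algebra_A)

lemma (in braided_hopf_algebra) A_antipode_one_outer: "antipode A (outer \<one>\<^bsub>B\<^esub> h) = outer \<one>\<^bsub>B\<^esub> (antipode H h)"
proof -
  have S1: "antipode B \<one>\<^bsub>B\<^esub> = \<one>\<^bsub>B\<^esub>"
  proof (rule vec_eqI)
    fix p
    show "pairing p (antipode B \<one>\<^bsub>B\<^esub>) = pairing p \<one>\<^bsub>B\<^esub>"
      using B.sw_antipode(1)[OF lin_pairing0, of "\<one>\<^bsub>B\<^esub>" p] by (simp add: sw_comult_unit counit_unit)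
  qed
  show ?thesis
  proof (rule vec_eqI)
    fix p
    show "pairing p (antipode A (outer \<one>\<^bsub>B\<^esub> h)) = pairing p (outer \<one>\<^bsub>B\<^esub> (antipode H h))"
      by (simp add: A_antipode_outer sw_coact_unit S1 A_one)
  qed
qed

context nichols_algebra
begin

abbreviation DA where "DA t \<equiv> sweedler (comult (bosonization H B) t)"

text \<open>H lies in degree zero, so the projection acts on the B-leg alone.\<close>

definition PA :: "nat \<Rightarrow> ('b \<times> 'h \<Rightarrow> 'k) \<Rightarrow> 'b \<times> 'h \<Rightarrow> 'k" where
  "PA m t = (\<lambda>(i, j). hcomp m (\<lambda>i'. t (i', j)) i)"

lemma vlin_PA0: "vlin (PA m)"
proof -
  have "PA m (x + y) = PA m x + PA m y" for x y
  proof (rule ext, clarify)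
    fix i j
    have "(\<lambda>i'. (x + y) (i', j)) = (\<lambda>i'. x (i', j)) + (\<lambda>i'. y (i', j))"
      by auto
    then show "PA m (x + y) (i, j) = (PA m x + PA m y) (i, j)"
      by (simp only: PA_def split_conv vlin_add[OF vlin_hcomp0] plus_fun_apply)
  qed
  moreover have "PA m (vscale c x) = vscale c (PA m x)" for c x
  proof (rule ext, clarify)
    fix i j
    have "(\<lambda>i'. vscale c x (i', j)) = vscale c (\<lambda>i'. x (i', j))"
      by (auto simp: fscale_def)
    then show "PA m (vscale c x) (i, j) = vscale c (PA m x) (i, j)"
      by (simp only: PA_def split_conv vlin_scale[OF vlin_hcomp0] vscale_apply)
  qed
  ultimately show ?thesis
    by (simp add: vlin_def)
qed

lemmas vlin_PA [simp] = vlin_comp[OF vlin_PA0]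

lemma PA_outer: "PA m (outer x h) = outer (hcomp m x) h"
proof (rule ext, clarify)
  fix i j
  have "(\<lambda>i'. outer x h (i', j)) = vscale (h j) x"
    by (auto simp: outer_def fscale_def)
  then show "PA m (outer x h) (i, j) = outer (hcomp m x) h (i, j)"
    by (simp add: PA_def vlin_scale[OF vlin_hcomp0] vscale_apply) (simp add: outer_def)
qed

lemma vec_eq_outerI:
  fixes f g :: "('b \<times> 'h \<Rightarrow> 'k) \<Rightarrow> 'l::finite \<Rightarrow> 'k"
  assumes "vlin f" "vlin g" "\<And>x h. f (outer x h) = g (outer x h)"
  shows "f t = g t"
proof (rule vec_eqI)
  fix p
  show "pairing p (f t) = pairing p (g t)"
    by (rule lin_eq_outerI[where t=t and f="\<lambda>t. pairing p (f t)" and g="\<lambda>t. pairing p (g t)"]) (simp_all add: assms)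
qed

lemma PA_PA: "PA m (PA n t) = (if m = n then PA n t else 0)"
proof (cases "m = n")
  case True
  have "PA n (PA n t) = PA n t"
    by (rule vec_eq_outerI[where t=t and f="\<lambda>t. PA n (PA n t)" and g="PA n"])
       (simp_all add: vlin_PA0 PA_outer hcomp_hcomp)
  then show ?thesis
    by (simp add: True)
next
  case False
  have "PA m (PA n t) = 0"
    by (rule vec_eq_outerI[where t=t and f="\<lambda>t. PA m (PA n t)" and g="\<lambda>t. 0"])
       (simp_all add: PA_outer hcomp_hcomp False vlin_zero[OF vlin_outer[OF vlin_id]])
  then show ?thesis
    by (simp add: False)
qed

lemma sum_PA: "(\<Sum>n\<le>degree_bound. PA n t) = t"
  by (rule vec_eq_outerI[where t=t and f="\<lambda>t. \<Sum>n\<le>degree_bound. PA n t" and g="\<lambda>t. t"])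
     (simp_all add: PA_outer vlin_sum[OF vlin_outer[OF vlin_id], symmetric] sum_hcomp)

definition acomp :: "nat \<Rightarrow> ('b \<times> 'h \<Rightarrow> 'k) set" where
  "acomp m = {t. PA m t = t}"

lemma PA_acomp: "PA m t \<in> acomp m"
  by (simp add: acomp_def PA_PA)

lemma outer_acomp: "x \<in> comp B m \<Longrightarrow> outer x h \<in> acomp m"
  by (simp add: acomp_def PA_outer hcomp_comp)

lemma acomp_mult:
  assumes "a \<in> acomp i" "b \<in> acomp j"
  shows "a \<otimes>\<^bsub>A\<^esub> b \<in> acomp (i + j)"
proof -
  have "PA (i + j) (outer (hcomp i x) h \<otimes>\<^bsub>A\<^esub> outer (hcomp j y) g) = outer (hcomp i x) h \<otimes>\<^bsub>A\<^esub> outer (hcomp j y) g" for x h y g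
    by (simp add: outer_mult vlin_sw[OF vlin_PA0] PA_outer hcomp_comp[OF comp_mult[OF hcomp_props(1) comp_act[OF hcomp_props(1)]]])
  then have "PA (i + j) (outer (hcomp i x) h \<otimes>\<^bsub>A\<^esub> PA j b) = outer (hcomp i x) h \<otimes>\<^bsub>A\<^esub> PA j b" for x h
    by (intro vec_eq_outerI[where t=b and f="\<lambda>b. PA (i + j) (outer (hcomp i x) h \<otimes>\<^bsub>A\<^esub> PA j b)" and g="\<lambda>b. outer (hcomp i x) h \<otimes>\<^bsub>A\<^esub> PA j b"])
       (simp_all add: PA_outer)
  then have "PA (i + j) (PA i a \<otimes>\<^bsub>A\<^esub> PA j b) = PA i a \<otimes>\<^bsub>A\<^esub> PA j b"
    by (intro vec_eq_outerI[where t=a and f="\<lambda>a. PA (i + j) (PA i a \<otimes>\<^bsub>A\<^esub> PA j b)" and g="\<lambda>a. PA i a \<otimes>\<^bsub>A\<^esub> PA j b"])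
       (simp_all add: PA_outer)
  then show ?thesis
    using assms by (simp add: acomp_def)
qed

lemma PA_antipode: "PA m (antipode A t) = antipode A (PA m t)"
proof (rule vec_eq_outerI[where t=t and f="\<lambda>t. PA m (antipode A t)" and g="\<lambda>t. antipode A (PA m t)"])
  fix x h
  have *: "PA m (outer \<one>\<^bsub>B\<^esub> k \<otimes>\<^bsub>A\<^esub> outer y \<one>\<^bsub>H\<^esub>) = outer \<one>\<^bsub>B\<^esub> k \<otimes>\<^bsub>A\<^esub> outer (hcomp m y) \<one>\<^bsub>H\<^esub>" for k y
    by (simp add: outer_mult vlin_sw[OF vlin_PA0] PA_outer hcomp_act)
  show "PA m (antipode A (outer x h)) = antipode A (PA m (outer x h))"
  proof (rule vec_eqI)
    fix p
    have "pairing p (antipode A (PA m (outer x h)))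
      = CB (hcomp m x) (\<lambda>g w. pairing p (outer \<one>\<^bsub>B\<^esub> (antipode H (g \<otimes>\<^bsub>H\<^esub> h)) \<otimes>\<^bsub>A\<^esub> outer (antipode B w) \<one>\<^bsub>H\<^esub>))"
      by (simp add: PA_outer A_antipode_outer)
    also have "\<dots> = CB x (\<lambda>g w. pairing p (outer \<one>\<^bsub>B\<^esub> (antipode H (g \<otimes>\<^bsub>H\<^esub> h)) \<otimes>\<^bsub>A\<^esub> outer (antipode B (hcomp m w)) \<one>\<^bsub>H\<^esub>))"
      by (rule sw_coact_hcomp) simp_all
    also have "\<dots> = pairing p (PA m (antipode A (outer x h)))"
      by (simp add: A_antipode_outer vlin_sw[OF vlin_PA0] * antipode_hcomp)
    finally show "pairing p (PA m (antipode A (outer x h))) = pairing p (antipode A (PA m (outer x h)))" ..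
  qed
qed simp_all

lemma acomp_antipode: "a \<in> acomp m \<Longrightarrow> antipode A a \<in> acomp m"
  by (simp add: acomp_def PA_antipode)

text \<open>The coaction preserves degrees of B and H sits in degree zero, so the grading of the
  braided coproduct carries over.\<close>

lemma sw_comult_acomp:
  assumes t: "t \<in> acomp n" and F: "\<And>b. lin (\<lambda>a. F a b)" "\<And>a. lin (F a)"
  shows "DA t F = (\<Sum>k\<le>n. DA t (\<lambda>a b. F (PA k a) (PA (n - k) b)))"
proof -
  have l: "vlin f \<Longrightarrow> lin (\<lambda>x. F (f x) b)" "vlin g \<Longrightarrow> lin (\<lambda>x. F a (g x))"
    for f :: "('c \<Rightarrow> 'k) \<Rightarrow> _" and g :: "('d \<Rightarrow> 'k) \<Rightarrow> _" and a b
    using lin_comp[OF F(1)] lin_comp[OF F(2)] by auto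
  have "DA (PA n t) F = (\<Sum>k\<le>n. DA (PA n t) (\<lambda>a b. F (PA k a) (PA (n - k) b)))"
  proof (rule lin_eq_outerI[where t=t and f="\<lambda>t. DA (PA n t) F"
        and g="\<lambda>t. \<Sum>k\<le>n. DA (PA n t) (\<lambda>a b. F (PA k a) (PA (n - k) b))"])
    show "lin (\<lambda>t. DA (PA n t) F)" "lin (\<lambda>t. \<Sum>k\<le>n. DA (PA n t) (\<lambda>a b. F (PA k a) (PA (n - k) b)))"
      by (simp_all add: lin_A_comult F l)
    fix x h
    let ?K = "\<lambda>x1 x2. CB x2 (\<lambda>g x0. DH h (\<lambda>h1 h2. F (outer x1 (g \<otimes>\<^bsub>H\<^esub> h1)) (outer x0 h2)))"
    have "DA (PA n (outer x h)) F = DB (hcomp n x) ?K"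
      by (simp add: PA_outer A_comult_outer F)
    also have "\<dots> = (\<Sum>k\<le>n. DB (hcomp n x) (\<lambda>x1 x2. ?K (hcomp k x1) (hcomp (n - k) x2)))"
      by (rule sw_comult_comp[OF hcomp_props(1)]) (simp_all add: l)
    also have "\<dots> = (\<Sum>k\<le>n. DA (PA n (outer x h)) (\<lambda>a b. F (PA k a) (PA (n - k) b)))"
    proof (rule sum.cong[OF refl])
      fix k
      have "?K (hcomp k x1) (hcomp (n - k) x2) = CB x2 (\<lambda>g x0. DH h (\<lambda>h1 h2. F (outer (hcomp k x1) (g \<otimes>\<^bsub>H\<^esub> h1)) (outer (hcomp (n - k) x0) h2)))" for x1 x2
        by (rule sw_coact_hcomp) (simp_all add: l)
      then show "DB (hcomp n x) (\<lambda>x1 x2. ?K (hcomp k x1) (hcomp (n - k) x2)) = DA (PA n (outer x h)) (\<lambda>a b. F (PA k a) (PA (n - k) b))"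
        by (simp add: PA_outer A_comult_outer l)
    qed
    finally show "DA (PA n (outer x h)) F = (\<Sum>k\<le>n. DA (PA n (outer x h)) (\<lambda>a b. F (PA k a) (PA (n - k) b)))" .
  qed
  then show ?thesis
    using t by (simp add: acomp_def)
qed

lemma sw_comult_acomp_zero:
  assumes t: "t \<in> acomp n" and F: "\<And>b. lin (\<lambda>a. F a b)" "\<And>a. lin (F a)"
    and "\<And>k a b. k \<le> n \<Longrightarrow> a \<in> acomp k \<Longrightarrow> b \<in> acomp (n - k) \<Longrightarrow> F a b = 0"
  shows "DA t F = 0"
proof -
  have "DA t F = (\<Sum>k\<le>n. DA t (\<lambda>a b. F (PA k a) (PA (n - k) b)))"
    by (rule sw_comult_acomp[OF t F])
  also have "\<dots> = 0"
    by (rule sum.neutral) (simp add: assms(4) PA_acomp sweedler_def)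
  finally show ?thesis .
qed

text \<open>Degrees are integers here because operators may lower them below zero; components of
  negative degree are zero by \<open>acomp_int_neg\<close>.\<close>

definition acomp_int :: "int \<Rightarrow> ('b \<times> 'h \<Rightarrow> 'k) set" where
  "acomp_int j = {t. \<forall>m. int m \<noteq> j \<longrightarrow> PA m t = 0}"

lemma acomp_int_acomp: "acomp_int (int m) = acomp m"
proof (intro equalityI subsetI)
  fix t assume t: "t \<in> acomp_int (int m)"
  have "t = (\<Sum>n\<le>degree_bound. PA n t)"
    by (rule sum_PA[symmetric])
  also have "\<dots> = (\<Sum>n\<le>degree_bound. PA m (PA n t))"
    using t by (intro sum.cong refl) (auto simp: acomp_int_def PA_PA)
  also have "\<dots> = PA m t"
    by (simp add: vlin_sum[OF vlin_PA0, symmetric] sum_PA)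
  finally show "t \<in> acomp m"
    by (simp add: acomp_def)
next
  fix t assume t: "t \<in> acomp m"
  have "PA k t = 0" if "k \<noteq> m" for k
    using t that PA_PA[of k m t] by (simp add: acomp_def)
  then show "t \<in> acomp_int (int m)"
    by (simp add: acomp_int_def)
qed

lemma acomp_int_neg: "j < 0 \<Longrightarrow> t \<in> acomp_int j \<Longrightarrow> t = 0"
  using sum_PA[of t] by (simp add: acomp_int_def)

lemma acomp_int_mult:
  assumes "a \<in> acomp_int i" "b \<in> acomp j"
  shows "a \<otimes>\<^bsub>A\<^esub> b \<in> acomp_int (i + int j)"
proof (cases "i < 0")
  case True
  then have "a = 0"
    using assms(1) by (rule acomp_int_neg)
  then show ?thesis
    by (simp add: acomp_int_def vlin_zero[OF A_vlin_mult[OF vlin_id]] vlin_zero[OF vlin_PA0])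
next
  case False
  then obtain k where i: "i = int k"
    by (metis not_le_imp_less nonneg_int_cases)
  have "a \<otimes>\<^bsub>A\<^esub> b \<in> acomp (k + j)"
    using assms by (intro acomp_mult) (simp_all add: i acomp_int_acomp)
  then show ?thesis
    by (simp add: i acomp_int_acomp[symmetric])
qed

text \<open>The integer grading of the double, read off from operators: degree k lowers degrees of A
  by k. Thus V gets degree -1 and its dual degree 1, see \<open>incl_B_dcomp\<close> and
  \<open>Vbar_dcomp\<close>.\<close>

definition dcomp :: "int \<Rightarrow> (('b \<times> 'h) \<times> ('b \<times> 'h) \<Rightarrow> 'k) set" where
  "dcomp k = {t. \<forall>i y. y \<in> acomp i \<longrightarrow> ev t y \<in> acomp_int (int i - k)}"

abbreviation D where "D \<equiv> DVH H B"

lemma D_def: "D = drinfeld_double (bosonization H B)"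
  by (simp add: DVH_def)

text \<open>If \<open>w1\<close>, \<open>w2\<close>, \<open>w3\<close>, \<open>y2\<close> have
  degrees a, b, c, d, the closed formula yields degree \<open>(a + d + c - k) + b\<close>, and
  \<open>a + b + c + d\<close> is the degree of y minus l. When \<open>u(y1)\<close> would have
  negative degree, it is zero.\<close>

lemma dcomp_mult:
  assumes t: "t \<in> dcomp k" and u: "u \<in> dcomp l"
  shows "t \<otimes>\<^bsub>D\<^esub> u \<in> dcomp (k + l)"
  unfolding dcomp_def acomp_int_def
proof safe
  fix n y m assume y: "y \<in> acomp n" and m: "int m \<noteq> int n - (k + l)"
  show "PA m (ev (t \<otimes>\<^bsub>D\<^esub> u) y) = 0"
  proof (rule vec_eqI)
    fix p
    let ?G = "\<lambda>z. pairing p (PA m z)"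
    have 3: "?G (ev t (w1 \<otimes>\<^bsub>A\<^esub> (y2 \<otimes>\<^bsub>A\<^esub> antipode A w3)) \<otimes>\<^bsub>A\<^esub> w2) = 0"
      if "w1 \<in> acomp a" "w2 \<in> acomp b" "w3 \<in> acomp c" "y2 \<in> acomp d" "int a + int b + int c + int d = int n - l"
      for w1 w2 w3 y2 a b c d
    proof -
      have "w1 \<otimes>\<^bsub>A\<^esub> (y2 \<otimes>\<^bsub>A\<^esub> antipode A w3) \<in> acomp (a + (d + c))"
        using that by (intro acomp_mult acomp_antipode)
      then have "ev t (w1 \<otimes>\<^bsub>A\<^esub> (y2 \<otimes>\<^bsub>A\<^esub> antipode A w3)) \<in> acomp_int (int (a + (d + c)) - k)"
        using t unfolding dcomp_def by blast
      then have "ev t (w1 \<otimes>\<^bsub>A\<^esub> (y2 \<otimes>\<^bsub>A\<^esub> antipode A w3)) \<otimes>\<^bsub>A\<^esub> w2 \<in> acomp_int (int (a + (d + c)) - k + int b)"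
        using that(2) by (rule acomp_int_mult)
      moreover have "int m \<noteq> int (a + (d + c)) - k + int b"
        using m that(5) by simp
      ultimately show ?thesis
        by (simp add: acomp_int_def)
    qed
    have 2: "DA w (\<lambda>w1 w'. DA w' (\<lambda>w2 w3. ?G (ev t (w1 \<otimes>\<^bsub>A\<^esub> (y2 \<otimes>\<^bsub>A\<^esub> antipode A w3)) \<otimes>\<^bsub>A\<^esub> w2))) = 0"
      if w: "w \<in> acomp_int e" and y2: "y2 \<in> acomp d" and e: "e + int d = int n - l" for w y2 e d
    proof (cases "e < 0")
      case True
      then have "w = 0"
        using w by (rule acomp_int_neg)
      then show ?thesis
        using lin_zero[OF AH.lin_sw_comult[OF vlin_id, of "\<lambda>w1 w'. DA w' (\<lambda>w2 w3. ?G (ev t (w1 \<otimes>\<^bsub>A\<^esub> (y2 \<otimes>\<^bsub>A\<^esub> antipode A w3)) \<otimes>\<^bsub>A\<^esub> w2))"]]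
        by simp
    next
      case False
      then obtain c where c: "e = int c"
        by (metis not_le_imp_less nonneg_int_cases)
      have w: "w \<in> acomp c"
        using w by (simp add: c acomp_int_acomp)
      show ?thesis
      proof (rule sw_comult_acomp_zero[OF w])
        fix a w1 w' assume a: "a \<le> c" "w1 \<in> acomp a" and w': "w' \<in> acomp (c - a)"
        show "DA w' (\<lambda>w2 w3. ?G (ev t (w1 \<otimes>\<^bsub>A\<^esub> (y2 \<otimes>\<^bsub>A\<^esub> antipode A w3)) \<otimes>\<^bsub>A\<^esub> w2)) = 0"
        proof (rule sw_comult_acomp_zero[OF w'])
          fix b w2 w3 assume "b \<le> c - a" "w2 \<in> acomp b" "w3 \<in> acomp (c - a - b)"
          then show "?G (ev t (w1 \<otimes>\<^bsub>A\<^esub> (y2 \<otimes>\<^bsub>A\<^esub> antipode A w3)) \<otimes>\<^bsub>A\<^esub> w2) = 0"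
            using a y2 e c by (intro 3[of w1 a w2 b w3 "c - a - b" y2 d]) auto
        qed simp_all
      qed simp_all
    qed
    have "?G (ev (t \<otimes>\<^bsub>D\<^esub> u) y) = DA y (\<lambda>y1 y2. DA (ev u y1) (\<lambda>w1 w'. DA w' (\<lambda>w2 w3.
        ?G (ev t (w1 \<otimes>\<^bsub>A\<^esub> (y2 \<otimes>\<^bsub>A\<^esub> antipode A w3)) \<otimes>\<^bsub>A\<^esub> w2))))"
      unfolding D_def by (rule AH.lin_double_mult) simp
    also have "\<dots> = 0"
    proof (rule sw_comult_acomp_zero[OF y])
      fix i y1 y2 assume i: "i \<le> n" "y1 \<in> acomp i" and y2: "y2 \<in> acomp (n - i)"
      show "DA (ev u y1) (\<lambda>w1 w'. DA w' (\<lambda>w2 w3. ?G (ev t (w1 \<otimes>\<^bsub>A\<^esub> (y2 \<otimes>\<^bsub>A\<^esub> antipode A w3)) \<otimes>\<^bsub>A\<^esub> w2))) = 0"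
        using u i by (intro 2[OF _ y2, of _ "int i - l"]) (auto simp: dcomp_def)
    qed simp_all
    finally show "pairing p (PA m (ev (t \<otimes>\<^bsub>D\<^esub> u) y)) = pairing p 0"
      by simp
  qed
qed

text \<open>The inverse of \<open>ev\<close>: the element of the double with a prescribed
  operator.\<close>

definition mat :: "(('j \<Rightarrow> 'k) \<Rightarrow> 'i \<Rightarrow> 'k) \<Rightarrow> 'i \<times> 'j \<Rightarrow> 'k" where
  "mat f = (\<lambda>(i, j). f (bvec j) i)"

lemma ev_mat: "vlin f \<Longrightarrow> ev (mat f) y = f y" for f :: "('j::finite \<Rightarrow> 'k) \<Rightarrow> 'i::finite \<Rightarrow> 'k"
  by (subst vlin_expand[of f]) (auto simp: ev_def mat_def pairing_expand sum_apply vscale_apply)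

text \<open>The operator is cut by the projections of A on both sides; the piece from degree j to
  degree i has degree j - i.\<close>

lemma dcomp_decompose:
  obtains f where "t = (\<Sum>i\<le>degree_bound. \<Sum>j\<le>degree_bound. f i j)" "\<And>i j. f i j \<in> dcomp (int j - int i)"
proof
  let ?f = "\<lambda>i j. mat (\<lambda>y. PA i (ev t (PA j y)))"
  show "t = (\<Sum>i\<le>degree_bound. \<Sum>j\<le>degree_bound. ?f i j)"
  proof (rule ev_eqI)
    fix y
    have "ev (\<Sum>i\<le>degree_bound. \<Sum>j\<le>degree_bound. ?f i j) y = (\<Sum>i\<le>degree_bound. \<Sum>j\<le>degree_bound. PA i (ev t (PA j y)))"
      by (simp add: vlin_sum[OF vlin_ev_left[OF vlin_id]] ev_mat)
    also have "\<dots> = (\<Sum>i\<le>degree_bound. PA i (ev t y))"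
      by (simp add: vlin_sum[OF vlin_PA0, symmetric] vlin_sum[OF vlin_ev[OF vlin_id], symmetric] sum_PA)
    also have "\<dots> = ev t y"
      by (rule sum_PA)
    finally show "ev t y = ev (\<Sum>i\<le>degree_bound. \<Sum>j\<le>degree_bound. ?f i j) y" ..
  qed
  fix i j
  show "?f i j \<in> dcomp (int j - int i)"
  proof (unfold dcomp_def acomp_int_def, safe)
    fix n y m assume y: "y \<in> acomp n" and m: "int m \<noteq> int n - (int j - int i)"
    show "PA m (ev (?f i j) y) = 0"
    proof (cases "j = n")
      case True
      then show ?thesis
        using m by (simp add: ev_mat PA_PA)
    next
      case False
      then have "PA j y = 0"
        using y PA_PA[of j n y] by (simp add: acomp_def)
      moreover have "ev (?f i j) y = PA i (ev t (PA j y))"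
        by (simp add: ev_mat)
      ultimately show ?thesis
        by (simp only: ev_zero vlin_zero[OF vlin_PA0])
    qed
  qed
qed

section \<open>Nichols algebras are Frobenius algebras\<close>

text \<open>The products of arbitrary elements with right factors of degree one span a left ideal L.
  As the scalars and degree one generate B, every element is a scalar modulo L, so functionals
  vanishing on L are multiples of the counit.\<close>

lemma generated_right:
  assumes f: "lin f" and zero: "\<And>y v. v \<in> comp B 1 \<Longrightarrow> f (y \<cdot> v) = 0"
  shows "f x = counit B x * f \<one>\<^bsub>B\<^esub>"
proof -
  define L where "L = kvec.span {y \<cdot> v | y v. v \<in> comp B 1}"
  have L_mult: "x \<cdot> l \<in> L" if "l \<in> L" for x l
  proof -
    have "kvec.span {y \<cdot> v | y v. v \<in> comp B 1} \<subseteq> {l. x \<cdot> l \<in> L}"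
    proof (rule kvec.span_minimal)
      show "{y \<cdot> v | y v. v \<in> comp B 1} \<subseteq> {l. x \<cdot> l \<in> L}"
      proof
        fix l assume "l \<in> {y \<cdot> v | y v. v \<in> comp B 1}"
        then obtain y v where l: "l = y \<cdot> v" "v \<in> comp B 1"
          by blast
        have "(x \<cdot> y) \<cdot> v \<in> L"
          unfolding L_def by (rule kvec.span_base) (use l(2) in blast)
        then show "l \<in> {l. x \<cdot> l \<in> L}"
          by (simp add: l(1) B.assoc)
      qed
      show "kvec.subspace {l. x \<cdot> l \<in> L}"
        unfolding kvec.subspace_def L_def
        by (auto simp: vlin_zero[OF B.vlin_mult_right[OF vlin_id]] B.mult_add B.mult_scale
            intro: kvec.span_zero kvec.span_add kvec.span_scale)
    qed
    then show ?thesis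
      using that by (auto simp: L_def)
  qed
  have "\<exists>c. x - vscale c \<one>\<^bsub>B\<^esub> \<in> L" if "x \<in> generate_ring B (range (\<lambda>c. vscale c \<one>\<^bsub>B\<^esub>) \<union> comp B 1)" for x
    using that
  proof (rule generate_ring.induct[where P="\<lambda>x. \<exists>c. x - vscale c \<one>\<^bsub>B\<^esub> \<in> L"])
    show "\<exists>c. \<one>\<^bsub>B\<^esub> - vscale c \<one>\<^bsub>B\<^esub> \<in> L"
      by (rule exI[of _ 1]) (simp add: L_def kvec.span_zero)
    fix h assume "h \<in> range (\<lambda>c. vscale c \<one>\<^bsub>B\<^esub>) \<union> comp B 1"
    then show "\<exists>c. h - vscale c \<one>\<^bsub>B\<^esub> \<in> L"
    proof
      assume "h \<in> range (\<lambda>c. vscale c \<one>\<^bsub>B\<^esub>)"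
      then obtain c where "h = vscale c \<one>\<^bsub>B\<^esub>"
        by auto
      then show ?thesis
        by (intro exI[of _ c]) (simp add: L_def kvec.span_zero)
    next
      assume "h \<in> comp B 1"
      then have "\<one>\<^bsub>B\<^esub> \<cdot> h \<in> L"
        unfolding L_def by (intro kvec.span_base) blast
      then show ?thesis
        by (intro exI[of _ 0]) simp
    qed
  next
    fix h assume "\<exists>c. h - vscale c \<one>\<^bsub>B\<^esub> \<in> L"
    then obtain c where "h - vscale c \<one>\<^bsub>B\<^esub> \<in> L" ..
    then have "- (h - vscale c \<one>\<^bsub>B\<^esub>) \<in> L"
      unfolding L_def by (rule kvec.span_neg)
    moreover have "- (h - vscale c \<one>\<^bsub>B\<^esub>) = \<ominus>\<^bsub>B\<^esub> h - vscale (- c) \<one>\<^bsub>B\<^esub>"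
      by (simp add: B.a_inv_eq fun_eq_iff fscale_def)
    ultimately show "\<exists>c. \<ominus>\<^bsub>B\<^esub> h - vscale c \<one>\<^bsub>B\<^esub> \<in> L"
      by metis
  next
    fix h1 h2 assume "\<exists>c. h1 - vscale c \<one>\<^bsub>B\<^esub> \<in> L" "\<exists>c. h2 - vscale c \<one>\<^bsub>B\<^esub> \<in> L"
    then obtain c1 c2 where c: "h1 - vscale c1 \<one>\<^bsub>B\<^esub> \<in> L" "h2 - vscale c2 \<one>\<^bsub>B\<^esub> \<in> L"
      by auto
    have "(h1 - vscale c1 \<one>\<^bsub>B\<^esub>) + (h2 - vscale c2 \<one>\<^bsub>B\<^esub>) \<in> L"
      using c unfolding L_def by (rule kvec.span_add)
    moreover have "(h1 - vscale c1 \<one>\<^bsub>B\<^esub>) + (h2 - vscale c2 \<one>\<^bsub>B\<^esub>) = (h1 \<oplus>\<^bsub>B\<^esub> h2) - vscale (c1 + c2) \<one>\<^bsub>B\<^esub>"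
      by (simp add: B.add_eq vscale_add algebra_simps)
    ultimately show "\<exists>c. (h1 \<oplus>\<^bsub>B\<^esub> h2) - vscale c \<one>\<^bsub>B\<^esub> \<in> L"
      by metis
    have "h1 \<cdot> (h2 - vscale c2 \<one>\<^bsub>B\<^esub>) + vscale c2 (h1 - vscale c1 \<one>\<^bsub>B\<^esub>) \<in> L"
      using c L_mult[OF c(2), of h1] unfolding L_def by (intro kvec.span_add kvec.span_scale)
    moreover have "h1 \<cdot> (h2 - vscale c2 \<one>\<^bsub>B\<^esub>) + vscale c2 (h1 - vscale c1 \<one>\<^bsub>B\<^esub>) = (h1 \<cdot> h2) - vscale (c2 * c1) \<one>\<^bsub>B\<^esub>"
      by (simp add: vlin_diff[OF B.vlin_mult_right[OF vlin_id]] vlin_diff[OF vlin_vscale_right[OF vlin_id]] B.mult_scale)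
    ultimately show "\<exists>c. (h1 \<cdot> h2) - vscale c \<one>\<^bsub>B\<^esub> \<in> L"
      by metis
  qed
  then obtain c where c: "x - vscale c \<one>\<^bsub>B\<^esub> \<in> L"
    using generated by blast
  have fL: "g l = 0" if "lin g" "\<And>y v. v \<in> comp B 1 \<Longrightarrow> g (y \<cdot> v) = 0" "l \<in> L" for g l
    using lin_span_zero[OF that(1), of l] that(2,3) unfolding L_def by blast
  have "f (x - vscale c \<one>\<^bsub>B\<^esub>) = 0"
    by (rule fL[OF f zero c])
  moreover have "counit B (x - vscale c \<one>\<^bsub>B\<^esub>) = 0"
    using counit_comp[of _ 1] by (intro fL[OF B.lin_counit[OF vlin_id] _ c]) (simp add: counit_prod)
  ultimately show ?thesis
    by (simp add: lin_diff[OF f] lin_scale[OF f] lin_diff[OF B.lin_counit[OF vlin_id]]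
        lin_scale[OF B.lin_counit[OF vlin_id]] counit_unit)
qed

lemma sw_comult_primitive:
  assumes "v \<in> comp B 1" "\<And>b. lin (\<lambda>a. F a b)" "\<And>a. lin (F a)"
  shows "DB v F = F v \<one>\<^bsub>B\<^esub> + F \<one>\<^bsub>B\<^esub> v"
proof -
  have "comult B v = tens vscale v \<one>\<^bsub>B\<^esub> + tens vscale \<one>\<^bsub>B\<^esub> v"
    using assms(1) primitives by auto
  then show ?thesis
    using assms(2,3) by (simp add: sw_add lin_add[OF assms(3)])
qed

text \<open>The identity \<open>x\<^sub>(\<^sub>1\<^sub>) \<otimes> v x\<^sub>(\<^sub>2\<^sub>) = S(v\<^sub>(\<^sub>1\<^sub>)) (v\<^sub>(\<^sub>2\<^sub>) x)\<^sub>(\<^sub>1\<^sub>) \<otimes> (v\<^sub>(\<^sub>2\<^sub>) x)\<^sub>(\<^sub>2\<^sub>)\<close>, in which only the summand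
  \<open>v \<otimes> 1\<close> of the coproduct of \<open>v\<close> survives when \<open>x\<close> is annihilated by \<open>V\<close>.\<close>

lemma sw_comult_annihilated:
  assumes x: "\<And>v. v \<in> comp B 1 \<Longrightarrow> v \<cdot> x = 0" and v: "v \<in> comp B 1"
    and F: "\<And>b. lin (\<lambda>a. F a b)" "\<And>a. lin (F a)"
  shows "DA (outer x \<one>\<^bsub>H\<^esub>) (\<lambda>a b. F a (outer v \<one>\<^bsub>H\<^esub> \<otimes>\<^bsub>A\<^esub> b))
    = DA (outer x \<one>\<^bsub>H\<^esub>) (\<lambda>a b. F (antipode A (outer v \<one>\<^bsub>H\<^esub>) \<otimes>\<^bsub>A\<^esub> a) b)"
proof -
  have l: "vlin f \<Longrightarrow> lin (\<lambda>x. F (f x) b)" "vlin g \<Longrightarrow> lin (\<lambda>x. F a (g x))"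
    for f :: "('c \<Rightarrow> 'k) \<Rightarrow> _" and g :: "('d \<Rightarrow> 'k) \<Rightarrow> _" and a b
    using lin_comp[OF F(1)] lin_comp[OF F(2)] by auto
  let ?X = "outer x \<one>\<^bsub>H\<^esub>" and ?V = "outer v \<one>\<^bsub>H\<^esub>"
  let ?K = "\<lambda>v1 t. DA (t \<otimes>\<^bsub>A\<^esub> ?X) (\<lambda>a b. F (antipode A v1 \<otimes>\<^bsub>A\<^esub> a) b)"
  have Kl: "vlin f \<Longrightarrow> lin (\<lambda>x. ?K (f x) b)" "vlin g \<Longrightarrow> lin (\<lambda>x. ?K a (g x))"
    for f :: "('c \<Rightarrow> 'k) \<Rightarrow> _" and g :: "('d \<Rightarrow> 'k) \<Rightarrow> _" and a b
    by (simp_all add: l)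
  have "DA ?X (\<lambda>a b. F a (?V \<otimes>\<^bsub>A\<^esub> b)) = DA ?X (\<lambda>a b. F (\<one>\<^bsub>A\<^esub> \<otimes>\<^bsub>A\<^esub> a) (?V \<otimes>\<^bsub>A\<^esub> b))"
    by (simp add: A_one)
  also have "\<dots> = DA ?V (\<lambda>v1 t. DA t (\<lambda>v2 v3. DA ?X (\<lambda>a b. F ((antipode A v1 \<otimes>\<^bsub>A\<^esub> v2) \<otimes>\<^bsub>A\<^esub> a) (v3 \<otimes>\<^bsub>A\<^esub> b))))"
    by (rule AH.sw_antipode_cancel(1)[symmetric, where F="\<lambda>c d. DA ?X (\<lambda>a b. F (c \<otimes>\<^bsub>A\<^esub> a) (d \<otimes>\<^bsub>A\<^esub> b))"]) (simp_all add: l)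
  also have "\<dots> = DA ?V ?K"
    by (rule sw_cong) (simp add: AH.comult_mult_sw l A_assoc)
  also have "\<dots> = DB v (\<lambda>x1 x2. CB x2 (\<lambda>g w. ?K (outer x1 g) (outer w \<one>\<^bsub>H\<^esub>)))"
    by (subst A_comult_outer) (simp_all add: l V.comult_one_sw)
  also have "\<dots> = CB \<one>\<^bsub>B\<^esub> (\<lambda>g w. ?K (outer v g) (outer w \<one>\<^bsub>H\<^esub>)) + CB v (\<lambda>g w. ?K (outer \<one>\<^bsub>B\<^esub> g) (outer w \<one>\<^bsub>H\<^esub>))"
    by (rule sw_comult_primitive[OF v]) (simp_all add: l)
  also have "CB \<one>\<^bsub>B\<^esub> (\<lambda>g w. ?K (outer v g) (outer w \<one>\<^bsub>H\<^esub>)) = ?K ?V (outer \<one>\<^bsub>B\<^esub> \<one>\<^bsub>H\<^esub>)"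
    by (rule sw_coact_unit) (simp_all add: l)
  also have "CB v (\<lambda>g w. ?K (outer \<one>\<^bsub>B\<^esub> g) (outer w \<one>\<^bsub>H\<^esub>)) = 0"
  proof -
    have "outer (ycoact B v i) \<one>\<^bsub>H\<^esub> \<otimes>\<^bsub>A\<^esub> ?X = 0" for i
      by (simp add: outer_mult_one_left x[OF comp_coact[OF v]] vlin_zero[OF vlin_outer[OF vlin_id]])
    then show ?thesis
      unfolding sweedler_def[of "ycoact B v"]
      using lin_zero[OF AH.lin_sw_comult[OF vlin_id F(2)]]
      by (intro sum.neutral) (simp add: lin_zero[OF AH.lin_sw_comult[OF vlin_id]] F l)
  qed
  finally show ?thesis
    by (simp add: A_one)
qed

text \<open>Write z as \<open>S a\<close>. The antipode reverses products, so f after S kills every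
  product with a right factor \<open>v # 1\<close>. Once the B-factor of a stands on the right,
  \<open>generated_right\<close> shows that it matters only through the counit.\<close>

lemma functional_zero_degree:
  assumes f: "lin f" and zero: "\<And>v z. v \<in> comp B 1 \<Longrightarrow> f (antipode A (outer v \<one>\<^bsub>H\<^esub>) \<otimes>\<^bsub>A\<^esub> z) = 0"
  shows "f z = f (PA 0 z)"
proof -
  have l: "vlin g \<Longrightarrow> lin (\<lambda>x. f (g x))" for g :: "('c \<Rightarrow> 'k) \<Rightarrow> _"
    by (rule lin_comp[OF f])
  obtain a where z: "z = antipode A a"
    using AH.surj_antipode by (metis surjD)
  have j: "f (antipode A (outer \<one>\<^bsub>B\<^esub> k \<otimes>\<^bsub>A\<^esub> outer b \<one>\<^bsub>H\<^esub>)) = counit B b * f (antipode A (outer \<one>\<^bsub>B\<^esub> k))" for k b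
  proof -
    have "f (antipode A (outer \<one>\<^bsub>B\<^esub> k \<otimes>\<^bsub>A\<^esub> outer (y \<cdot> v) \<one>\<^bsub>H\<^esub>)) = 0" if "v \<in> comp B 1" for y v
      by (simp add: outer_mult_one_left[symmetric] A_assoc AH.antipode_mult zero[OF that])
    then have "f (antipode A (outer \<one>\<^bsub>B\<^esub> k \<otimes>\<^bsub>A\<^esub> outer b \<one>\<^bsub>H\<^esub>))
      = counit B b * f (antipode A (outer \<one>\<^bsub>B\<^esub> k \<otimes>\<^bsub>A\<^esub> outer \<one>\<^bsub>B\<^esub> \<one>\<^bsub>H\<^esub>))"
      by (intro generated_right[where f="\<lambda>b. f (antipode A (outer \<one>\<^bsub>B\<^esub> k \<otimes>\<^bsub>A\<^esub> outer b \<one>\<^bsub>H\<^esub>))"]) (simp_all add: l)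
    then show ?thesis
      by (simp add: A_one)
  qed
  have "f (antipode A a) = f (antipode A (PA 0 a))"
  proof (rule lin_eq_outerI[where t=a and f="\<lambda>a. f (antipode A a)" and g="\<lambda>a. f (antipode A (PA 0 a))"])
    fix b :: "'b \<Rightarrow> 'k" and h :: "'h \<Rightarrow> 'k"
    have sc: "outer (vscale c \<one>\<^bsub>B\<^esub>) h = vscale c (outer \<one>\<^bsub>B\<^esub> h)" for c
      by (rule vlin_scale[OF vlin_outer[OF vlin_id]])
    have fs: "f (antipode A (vscale c u)) = c * f (antipode A u)" for c u
      using lin_scale[OF l[OF vlin_A_antipode[OF vlin_id]]] .
    \<comment> \<open>Factor \<open>b # h\<close> as \<open>1 # h2\<close> times
      \<open>b' # 1\<close>, where \<open>b'\<close> is b moved by the inverse antipode of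
      \<open>h1\<close>; this puts the B-factor on the right.\<close>
    have "f (antipode A (outer b h)) = DH h (\<lambda>h1 h2. f (antipode A (outer \<one>\<^bsub>B\<^esub> h2 \<otimes>\<^bsub>A\<^esub> outer (V.antipode_inv h1 \<rightharpoonup> b) \<one>\<^bsub>H\<^esub>)))"
    proof -
      have "DH h (\<lambda>h1 h2. f (antipode A (outer \<one>\<^bsub>B\<^esub> h2 \<otimes>\<^bsub>A\<^esub> outer (V.antipode_inv h1 \<rightharpoonup> b) \<one>\<^bsub>H\<^esub>)))
        = DH h (\<lambda>h1 t. DH t (\<lambda>h2 h3. f (antipode A (outer ((h2 \<otimes>\<^bsub>H\<^esub> V.antipode_inv h1) \<rightharpoonup> b) h3))))"
        by (simp add: outer_mult lin_sw[OF l[OF vlin_A_antipode[OF vlin_id]]] act_mult)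
      also have "\<dots> = DH h (\<lambda>t h3. DH t (\<lambda>h1 h2. f (antipode A (outer ((h2 \<otimes>\<^bsub>H\<^esub> V.antipode_inv h1) \<rightharpoonup> b) h3))))"
        by (simp add: V.sw_coassoc l)
      also have "\<dots> = DH h (\<lambda>t h3. counit H t * f (antipode A (outer (\<one>\<^bsub>H\<^esub> \<rightharpoonup> b) h3)))"
        by (rule sw_cong, rule V.sw_antipode_inv(2)[where G="\<lambda>m. f (antipode A (outer (m \<rightharpoonup> b) _))"]) (simp add: l)
      also have "\<dots> = f (antipode A (outer b h))"
        by (simp add: l act_one)
      finally show ?thesis ..
    qed
    also have "\<dots> = DH h (\<lambda>h1 h2. counit B b * (counit H (V.antipode_inv h1) * f (antipode A (outer \<one>\<^bsub>B\<^esub> h2))))"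
      by (simp add: j counit_act mult_ac)
    also have "\<dots> = DH h (\<lambda>h1 h2. counit H h1 * (counit B b * f (antipode A (outer \<one>\<^bsub>B\<^esub> h2))))"
      using V.counit_antipode[of "V.antipode_inv _"] by (simp add: mult_ac)
    also have "\<dots> = f (antipode A (PA 0 (outer b h)))"
      by (simp add: l PA_outer hcomp_0 sc fs)
    finally show "f (antipode A (outer b h)) = f (antipode A (PA 0 (outer b h)))" .
  qed (simp_all add: l)
  then show ?thesis
    by (simp add: z PA_antipode)
qed

text \<open>In essence, injectivity of contraction with x. Induct on a bound d for the degrees in
  which f is nonzero: the functional sending z to \<open>f(S(v) z)\<close> inherits invariance and
  vanishing contraction, the latter by \<open>sw_comult_annihilated\<close>, and its bound is
  smaller by one. So it vanishes, and f lives in degree zero. The premises are chained by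
  \<open>\<Longrightarrow>\<close> so that the induction can vary f.\<close>

lemma annihilated_functional:
  assumes x: "\<And>v. v \<in> comp B 1 \<Longrightarrow> v \<cdot> x = 0" "x \<noteq> 0"
  shows "lin f \<Longrightarrow> (\<And>z h. f (z \<otimes>\<^bsub>A\<^esub> outer \<one>\<^bsub>B\<^esub> h) = counit H h * f z) \<Longrightarrow>
    (\<And>G. lin G \<Longrightarrow> DA (outer x \<one>\<^bsub>H\<^esub>) (\<lambda>a b. f a * G b) = 0) \<Longrightarrow>
    (\<And>m z. m > d \<Longrightarrow> f (PA m z) = 0) \<Longrightarrow> f z = 0"
proof (induction d arbitrary: f z)
  \<comment> \<open>Common end of both cases: invariance under H and concentration in degree zero
    make f a multiple of the counit, and contracting x with it gives that multiple of x.\<close>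
  have base: "f z = 0" if f: "lin f" and inv: "\<And>z h. f (z \<otimes>\<^bsub>A\<^esub> outer \<one>\<^bsub>B\<^esub> h) = counit H h * f z"
    and ker: "\<And>G. lin G \<Longrightarrow> DA (outer x \<one>\<^bsub>H\<^esub>) (\<lambda>a b. f a * G b) = 0"
    and P0: "\<And>z. f z = f (PA 0 z)" for f z
  proof -
    let ?e = "f (outer \<one>\<^bsub>B\<^esub> \<one>\<^bsub>H\<^esub>)"
    have fe: "f z = counit A z * ?e" for z
    proof (rule lin_eq_outerI[where t=z and f=f and g="\<lambda>z. counit A z * ?e"])
      fix y h
      have "f (outer y h) = f (PA 0 (outer y h))"
        by (rule P0)
      also have "\<dots> = counit B y * f (outer \<one>\<^bsub>B\<^esub> h)"
        by (simp add: PA_outer hcomp_0 vlin_scale[OF vlin_outer[OF vlin_id]] lin_scale[OF f])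
      also have "f (outer \<one>\<^bsub>B\<^esub> h) = counit H h * ?e"
        using inv[of "outer \<one>\<^bsub>B\<^esub> \<one>\<^bsub>H\<^esub>" h] by (simp add: A_one)
      finally show "f (outer y h) = counit A (outer y h) * ?e"
        by (simp add: A_counit_outer)
    qed (simp_all add: f)
    have "?e * pairing p (outer x \<one>\<^bsub>H\<^esub>) = 0" for p
    proof -
      have "0 = DA (outer x \<one>\<^bsub>H\<^esub>) (\<lambda>a b. f a * pairing p b)"
        using ker[OF lin_pairing0] by simp
      also have "\<dots> = DA (outer x \<one>\<^bsub>H\<^esub>) (\<lambda>a b. counit A a * (?e * pairing p b))"
        by (rule sw_cong) (subst fe, simp)
      also have "\<dots> = ?e * pairing p (outer x \<one>\<^bsub>H\<^esub>)"
        by simp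
      finally show ?thesis ..
    qed
    moreover have "outer x \<one>\<^bsub>H\<^esub> \<noteq> 0"
    proof
      assume "outer x \<one>\<^bsub>H\<^esub> = 0"
      then have "vscale (counit H \<one>\<^bsub>H\<^esub>) x = 0"
      proof -
        assume o: "outer x \<one>\<^bsub>H\<^esub> = 0"
        have "counit H \<one>\<^bsub>H\<^esub> * x i = (\<Sum>j\<in>UNIV. outer x \<one>\<^bsub>H\<^esub> (i, j) * counit H (bvec j))" for i
          by (subst lin_expand[OF V.lin_counit[OF vlin_id]]) (simp add: outer_def sum_distrib_right sum_distrib_left mult_ac)
        then show ?thesis
          by (simp add: o fscale_def fun_eq_iff)
      qed
      then show False
        using x(2) by (simp add: V.counit_one)
    qed
    then obtain p where "pairing p (outer x \<one>\<^bsub>H\<^esub>) \<noteq> 0"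
      using vec_eqI[of "outer x \<one>\<^bsub>H\<^esub>" 0] by (metis pairing_simps(3))
    ultimately have "?e = 0"
      by (metis mult_eq_0_iff)
    then show ?thesis
      using fe[of z] by simp
  qed
  {
    case 0
    have "f z = f (PA 0 z)" for z
    proof -
      have "f z = f (\<Sum>n\<le>degree_bound. PA n z)"
        by (simp only: sum_PA)
      also have "\<dots> = (\<Sum>n\<le>degree_bound. if n = 0 then f (PA 0 z) else 0)"
        unfolding lin_sum[OF 0(1)] using 0(4) by (intro sum.cong) auto
      finally show ?thesis
        by simp
    qed
    then show ?case
      using base[OF 0(1) 0(2) 0(3)] by blast
  next
    case (Suc d)
    have "f (antipode A (outer v \<one>\<^bsub>H\<^esub>) \<otimes>\<^bsub>A\<^esub> z) = 0" if v: "v \<in> comp B 1" for v z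
    proof (rule Suc.IH[of "\<lambda>z. f (antipode A (outer v \<one>\<^bsub>H\<^esub>) \<otimes>\<^bsub>A\<^esub> z)"])
      show "lin (\<lambda>z. f (antipode A (outer v \<one>\<^bsub>H\<^esub>) \<otimes>\<^bsub>A\<^esub> z))"
        by (rule lin_comp[OF Suc.prems(1)]) simp
      show "f (antipode A (outer v \<one>\<^bsub>H\<^esub>) \<otimes>\<^bsub>A\<^esub> (z \<otimes>\<^bsub>A\<^esub> outer \<one>\<^bsub>B\<^esub> h)) = counit H h * f (antipode A (outer v \<one>\<^bsub>H\<^esub>) \<otimes>\<^bsub>A\<^esub> z)" for z h
        by (simp add: A_assoc[symmetric] Suc.prems(2))
      fix G :: "('b \<times> 'h \<Rightarrow> 'k) \<Rightarrow> 'k" assume G: "lin G"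
      have "DA (outer x \<one>\<^bsub>H\<^esub>) (\<lambda>a b. f (antipode A (outer v \<one>\<^bsub>H\<^esub>) \<otimes>\<^bsub>A\<^esub> a) * G b)
        = DA (outer x \<one>\<^bsub>H\<^esub>) (\<lambda>a b. f a * G (outer v \<one>\<^bsub>H\<^esub> \<otimes>\<^bsub>A\<^esub> b))"
        by (rule sw_comult_annihilated[OF x(1) v, symmetric]) (simp_all add: Suc.prems(1) G)
      also have "\<dots> = 0"
        by (rule Suc.prems(3), rule lin_comp[OF G]) simp
      finally show "DA (outer x \<one>\<^bsub>H\<^esub>) (\<lambda>a b. f (antipode A (outer v \<one>\<^bsub>H\<^esub>) \<otimes>\<^bsub>A\<^esub> a) * G b) = 0" .
    next
      fix m z assume m: "m > d"
      have "antipode A (outer v \<one>\<^bsub>H\<^esub>) \<otimes>\<^bsub>A\<^esub> PA m z \<in> acomp (1 + m)"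
        by (intro acomp_mult acomp_antipode outer_acomp v PA_acomp)
      then have "antipode A (outer v \<one>\<^bsub>H\<^esub>) \<otimes>\<^bsub>A\<^esub> PA m z = PA (Suc m) (antipode A (outer v \<one>\<^bsub>H\<^esub>) \<otimes>\<^bsub>A\<^esub> PA m z)"
        by (simp add: acomp_def)
      then show "f (antipode A (outer v \<one>\<^bsub>H\<^esub>) \<otimes>\<^bsub>A\<^esub> PA m z) = 0"
        using Suc.prems(4)[of "Suc m"] m by (metis Suc_less_eq)
    qed
    then have "f z = f (PA 0 z)" for z
      by (rule functional_zero_degree[OF Suc.prems(1)])
    then show ?case
      using base[OF Suc.prems(1) Suc.prems(2) Suc.prems(3)] by blast
  }
qed

text \<open>The Frobenius map: for nonzero x killed by degree one it is a bijection from functionals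
  to B, as shown inside \<open>annihilated_unique\<close>.\<close>

definition contract :: "('b \<Rightarrow> 'k) \<Rightarrow> ('b \<Rightarrow> 'k) \<Rightarrow> 'b \<Rightarrow> 'k" where
  "contract x \<phi> = DB x (\<lambda>a b. vscale (pairing \<phi> a) b)"

lemma vlin_contract: "vlin (contract x)"
  unfolding contract_def by simp

text \<open>Extending \<open>\<phi>\<close> by the counit of H kills the coaction leg, so the
  coproduct of the bosonization reduces to the braided one.\<close>

lemma sw_contract:
  assumes "lin G"
  shows "DA (outer x \<one>\<^bsub>H\<^esub>) (\<lambda>a b. pairing (outer \<phi> (counit_coords H)) a * G b) = G (outer (contract x \<phi>) \<one>\<^bsub>H\<^esub>)"
proof -
  have l: "vlin g \<Longrightarrow> lin (\<lambda>x. G (g x))" for g :: "('c \<Rightarrow> 'k) \<Rightarrow> _"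
    by (rule lin_comp[OF assms])
  have "DA (outer x \<one>\<^bsub>H\<^esub>) (\<lambda>a b. pairing (outer \<phi> (counit_coords H)) a * G b)
    = DB x (\<lambda>x1 x2. CB x2 (\<lambda>g x0. counit H g * (pairing \<phi> x1 * G (outer x0 \<one>\<^bsub>H\<^esub>))))"
    by (subst A_comult_outer) (simp_all add: l assms V.comult_one_sw pairing_outer mult_ac)
  also have "\<dots> = DB x (\<lambda>x1 x2. pairing \<phi> x1 * G (outer x2 \<one>\<^bsub>H\<^esub>))"
    by (simp add: l)
  also have "\<dots> = G (outer (contract x \<phi>) \<one>\<^bsub>H\<^esub>)"
    by (simp add: contract_def lin_sw[OF l[OF vlin_outer[OF vlin_id]]] vlin_scale[OF vlin_outer[OF vlin_id]] lin_scale[OF assms])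
  finally show ?thesis .
qed

lemma functional_invariant:
  "pairing (outer \<phi> (counit_coords H)) (z \<otimes>\<^bsub>A\<^esub> outer \<one>\<^bsub>B\<^esub> h) = counit H h * pairing (outer \<phi> (counit_coords H)) z"
  by (rule lin_eq_outerI[where t=z and f="\<lambda>z. pairing (outer \<phi> (counit_coords H)) (z \<otimes>\<^bsub>A\<^esub> outer \<one>\<^bsub>B\<^esub> h)"
        and g="\<lambda>z. counit H h * pairing (outer \<phi> (counit_coords H)) z"])
     (simp_all add: outer_mult_one_right pairing_outer V.counit_mult mult_ac)

lemma PA_bound: "m > degree_bound \<Longrightarrow> PA m z = 0"
  by (rule ext, simp add: PA_def hcomp_bound split: prod.split)

text \<open>Contraction with x is injective, hence surjective, so x' is the contraction of some
  \<open>\<phi>\<close>. As V kills x', the functionals sending z to \<open>\<phi>(S(v) z)\<close>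
  contract x to zero and therefore vanish. This makes \<open>\<phi>\<close> a multiple of the counit
  and x' the same multiple of x.\<close>

lemma annihilated_unique:
  assumes x: "\<And>v. v \<in> comp B 1 \<Longrightarrow> v \<cdot> x = 0" "x \<noteq> 0"
    and x': "\<And>v. v \<in> comp B 1 \<Longrightarrow> v \<cdot> x' = 0"
  shows "\<exists>c. x' = vscale c x"
proof -
  let ?f = "\<lambda>\<phi> z. pairing (outer \<phi> (counit_coords H)) z"
  have bound: "f (PA m z) = 0" if "lin f" "m > degree_bound" for f :: "('b \<times> 'h \<Rightarrow> 'k) \<Rightarrow> 'k" and m z
    using that by (simp add: PA_bound lin_zero)
  have out0: "outer 0 \<one>\<^bsub>H\<^esub> = (0 :: 'b \<times> 'h \<Rightarrow> 'k)"
    by (rule vlin_zero[OF vlin_outer[OF vlin_id]])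
  have "inj (contract x)"
  proof (rule injI)
    fix \<phi> \<psi> assume eq: "contract x \<phi> = contract x \<psi>"
    have "?f (\<phi> - \<psi>) z = 0" for z
    proof (rule annihilated_functional[OF x, where d=degree_bound and f="?f (\<phi> - \<psi>)"])
      show "lin (?f (\<phi> - \<psi>))"
        by (rule lin_pairing0)
      show "?f (\<phi> - \<psi>) (z \<otimes>\<^bsub>A\<^esub> outer \<one>\<^bsub>B\<^esub> h) = counit H h * ?f (\<phi> - \<psi>) z" for z h
        by (rule functional_invariant)
      show "DA (outer x \<one>\<^bsub>H\<^esub>) (\<lambda>a b. ?f (\<phi> - \<psi>) a * G b) = 0" if "lin G" for G
        using eq by (simp add: sw_contract[OF that] vlin_diff[OF vlin_contract] out0 lin_zero[OF that])
    next
      show "?f (\<phi> - \<psi>) (PA m z) = 0" if "degree_bound < m" for m z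
        by (rule bound[OF lin_pairing0 that])
    qed
    then have "pairing (\<phi> - \<psi>) y * counit H \<one>\<^bsub>H\<^esub> = 0" for y
      using pairing_outer[of "\<phi> - \<psi>" "counit_coords H" y "\<one>\<^bsub>H\<^esub>"] by (metis V.pairing_counit_coords)
    then have "pairing (\<phi> - \<psi>) y = 0" for y
      by (simp add: V.counit_one del: pairing_simps)
    then have "(\<phi> - \<psi>) i = 0" for i
      by (metis pairing_bvec_right)
    then show "\<phi> = \<psi>"
      by (simp add: fun_eq_iff)
  qed
  then have "surj (contract x)"
    by (rule kvec.linear_inj_imp_surj[OF vlin_linear[OF vlin_contract]])
  then obtain \<phi> where \<phi>: "x' = contract x \<phi>"
    by (metis surjD)
  have "?f \<phi> (antipode A (outer v \<one>\<^bsub>H\<^esub>) \<otimes>\<^bsub>A\<^esub> z) = 0" if v: "v \<in> comp B 1" for v z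
  proof (rule annihilated_functional[OF x, where d=degree_bound and f="\<lambda>z. ?f \<phi> (antipode A (outer v \<one>\<^bsub>H\<^esub>) \<otimes>\<^bsub>A\<^esub> z)"])
    show "lin (\<lambda>z. ?f \<phi> (antipode A (outer v \<one>\<^bsub>H\<^esub>) \<otimes>\<^bsub>A\<^esub> z))"
      by simp
    then show "?f \<phi> (antipode A (outer v \<one>\<^bsub>H\<^esub>) \<otimes>\<^bsub>A\<^esub> PA m z) = 0" if "m > degree_bound" for m z
      using that by (rule bound)
    show "?f \<phi> (antipode A (outer v \<one>\<^bsub>H\<^esub>) \<otimes>\<^bsub>A\<^esub> (z \<otimes>\<^bsub>A\<^esub> outer \<one>\<^bsub>B\<^esub> h)) = counit H h * ?f \<phi> (antipode A (outer v \<one>\<^bsub>H\<^esub>) \<otimes>\<^bsub>A\<^esub> z)" for z h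
      by (simp add: A_assoc[symmetric] functional_invariant)
    fix G :: "('b \<times> 'h \<Rightarrow> 'k) \<Rightarrow> 'k" assume G: "lin G"
    have "DA (outer x \<one>\<^bsub>H\<^esub>) (\<lambda>a b. ?f \<phi> (antipode A (outer v \<one>\<^bsub>H\<^esub>) \<otimes>\<^bsub>A\<^esub> a) * G b)
      = DA (outer x \<one>\<^bsub>H\<^esub>) (\<lambda>a b. ?f \<phi> a * G (outer v \<one>\<^bsub>H\<^esub> \<otimes>\<^bsub>A\<^esub> b))"
      by (rule sw_comult_annihilated[OF x(1) v, symmetric]) (simp_all add: G)
    also have "\<dots> = G (outer v \<one>\<^bsub>H\<^esub> \<otimes>\<^bsub>A\<^esub> outer x' \<one>\<^bsub>H\<^esub>)"
      unfolding \<phi> by (rule sw_contract, rule lin_comp[OF G]) simp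
    also have "\<dots> = 0"
      by (simp add: outer_mult_one_left x'[OF v] out0 lin_zero[OF G])
    finally show "DA (outer x \<one>\<^bsub>H\<^esub>) (\<lambda>a b. ?f \<phi> (antipode A (outer v \<one>\<^bsub>H\<^esub>) \<otimes>\<^bsub>A\<^esub> a) * G b) = 0" .
  qed
  then have f0: "?f \<phi> z = ?f \<phi> (PA 0 z)" for z
    by (rule functional_zero_degree[OF lin_pairing0])
  have \<phi>y: "pairing \<phi> y = counit B y * pairing \<phi> \<one>\<^bsub>B\<^esub>" for y
    using f0[of "outer y \<one>\<^bsub>H\<^esub>"] by (simp add: PA_outer hcomp_0 pairing_outer V.counit_one)
  have "x' = vscale (pairing \<phi> \<one>\<^bsub>B\<^esub>) x"
  proof (rule vec_eqI)
    fix p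
    have "pairing p x' = DB x (\<lambda>a b. pairing \<phi> a * pairing p b)"
      unfolding \<phi> contract_def by simp
    also have "\<dots> = DB x (\<lambda>a b. counit B a * (pairing \<phi> \<one>\<^bsub>B\<^esub> * pairing p b))"
      by (rule sw_cong, subst \<phi>y, simp only: mult.assoc)
    also have "\<dots> = pairing p (vscale (pairing \<phi> \<one>\<^bsub>B\<^esub>) x)"
      by simp
    finally show "pairing p x' = pairing p (vscale (pairing \<phi> \<one>\<^bsub>B\<^esub>) x)" .
  qed
  then show ?thesis ..
qed

text \<open>Elements of top degree N are killed by degree one, so by
  \<open>annihilated_unique\<close> the top component is a line, and \<open>\<theta>\<close> reads
  off the coefficient. The form \<open>\<theta>(b y)\<close> is nondegenerate: for homogeneous y in
  its radical each product v y is in the radical again and of higher degree, hence zero by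
  induction; so y is a multiple of x, and b = 1 shows that it vanishes.\<close>

lemma frobenius:
  obtains N x \<theta> where "x \<in> comp B N" "x \<noteq> 0" "\<And>n y. n > N \<Longrightarrow> y \<in> comp B n \<Longrightarrow> y = 0"
    "\<theta> \<in> dual_comp N" "\<And>y. hcomp N y = vscale (pairing \<theta> y) x"
    "\<And>q. \<exists>b. \<forall>y. pairing q y = pairing \<theta> (b \<cdot> y)"
proof -
  define N where "N = Max {n. \<exists>y \<in> comp B n. y \<noteq> 0}"
  have sub: "{n. \<exists>y \<in> comp B n. y \<noteq> 0} \<subseteq> {..degree_bound}"
    using comp_bound not_le by auto
  then have fin: "finite {n. \<exists>y \<in> comp B n. y \<noteq> 0}"
    by (rule finite_subset) simp
  have "N \<in> {n. \<exists>y \<in> comp B n. y \<noteq> 0}"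
    unfolding N_def using one_comp one_neq_zero by (intro Max_in fin) auto
  then obtain x where x: "x \<in> comp B N" "x \<noteq> 0"
    by auto
  have top: "y = 0" if "n > N" "y \<in> comp B n" for n y
  proof (rule ccontr)
    assume "y \<noteq> 0"
    then have "n \<le> N"
      unfolding N_def using that(2) by (intro Max_ge fin) auto
    then show False
      using that(1) by simp
  qed
  have ann: "v \<cdot> y = 0" if "v \<in> comp B 1" "y \<in> comp B N" for v y
    using comp_mult[OF that] by (intro top[of "1 + N"]) auto
  obtain i where i: "x i \<noteq> 0"
    using x(2) by (auto simp: fun_eq_iff)
  \<comment> \<open>Normalised at a nonzero coordinate of x, so that \<open>\<theta>\<close> takes
    the value 1 at x.\<close>
  define \<theta> where "\<theta> = dual_hcomp N (vscale (1 / x i) (bvec i))"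
  have \<theta>: "\<theta> \<in> dual_comp N"
    by (simp add: \<theta>_def dual_hcomp)
  have \<theta>x: "pairing \<theta> x = 1"
    using i by (simp add: \<theta>_def pairing_dual_hcomp hcomp_comp[OF x(1)] pairing_scale_left pairing_bvec)
  have \<theta>N: "pairing \<theta> (hcomp N y) = pairing \<theta> y" for y
    using pairing_dual_comp[OF \<theta>, of N y] by simp
  have mult: "\<exists>c. y = vscale c x" if "\<And>v. v \<in> comp B 1 \<Longrightarrow> v \<cdot> y = 0" for y
    by (rule annihilated_unique[OF ann[OF _ x(1)] x(2) that])
  have hN: "hcomp N y = vscale (pairing \<theta> y) x" for y
  proof -
    obtain c where c: "hcomp N y = vscale c x"
      using mult[of "hcomp N y"] ann hcomp_props(1) by blast
    then have "pairing \<theta> y = c"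
      using \<theta>N[of y] \<theta>x by simp
    then show ?thesis
      by (simp add: c)
  qed
  have hom: "y = 0" if "y \<in> comp B j" "\<And>b. pairing \<theta> (b \<cdot> y) = 0" for y j
    using that
  proof (induction "N - j" arbitrary: j y rule: less_induct)
    case (less j)
    show ?case
    proof (cases "j > N")
      case False
      have "v \<cdot> y = 0" if v: "v \<in> comp B 1" for v
      proof (cases "j = N")
        case True
        then show ?thesis
          using ann[OF v] less.prems(1) by simp
      next
        case False
        with \<open>\<not> j > N\<close> show ?thesis
          using less.prems comp_mult[OF v less.prems(1)] by (intro less.hyps[of "1 + j"]) (auto simp: B.assoc[symmetric])
      qed
      then obtain c where c: "y = vscale c x"
        using mult by blast
      then have "c = 0"
        using less.prems(2)[of "\<one>\<^bsub>B\<^esub>"] \<theta>x by simp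
      then show ?thesis
        by (simp add: c)
    qed (use top less.prems in blast)
  qed
  have nondeg: "y = 0" if y: "\<And>b. pairing \<theta> (b \<cdot> y) = 0" for y
  proof -
    have "hcomp j y = 0" for j
    proof (rule hom[OF hcomp_props(1)])
      fix b
      \<comment> \<open>As \<open>\<theta>\<close> sees only total degree N, pairing b with one
        component of y is pairing y with the complementary component of b. This reduces the claim to
        homogeneous y.\<close>
      have "pairing \<theta> (b \<cdot> hcomp j y) = (if j \<le> N then pairing \<theta> (hcomp (N - j) b \<cdot> y) else 0)"
      proof (rule lin_hcomp_eqI[where x=b and f="\<lambda>b. pairing \<theta> (b \<cdot> hcomp j y)"
            and g="\<lambda>b. if j \<le> N then pairing \<theta> (hcomp (N - j) b \<cdot> y) else 0"])
        show "lin (\<lambda>b. if j \<le> N then pairing \<theta> (hcomp (N - j) b \<cdot> y) else 0)"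
          by (cases "j \<le> N") simp_all
        fix m b assume b: "b \<in> comp B m"
        show "pairing \<theta> (b \<cdot> hcomp j y) = (if j \<le> N then pairing \<theta> (hcomp (N - j) b \<cdot> y) else 0)"
        proof (rule lin_hcomp_eqI[where x=y and f="\<lambda>y. pairing \<theta> (b \<cdot> hcomp j y)"
            and g="\<lambda>y. if j \<le> N then pairing \<theta> (hcomp (N - j) b \<cdot> y) else 0"])
          show "lin (\<lambda>y. if j \<le> N then pairing \<theta> (hcomp (N - j) b \<cdot> y) else 0)"
            by (cases "j \<le> N") simp_all
          fix l y assume y: "y \<in> comp B l"
          have z: "pairing \<theta> (b \<cdot> y) = 0" if "m + l \<noteq> N"
            using that \<theta>N[of "b \<cdot> y"] hcomp_comp[OF comp_mult[OF b y], of N] by simp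
          show "pairing \<theta> (b \<cdot> hcomp j y) = (if j \<le> N then pairing \<theta> (hcomp (N - j) b \<cdot> y) else 0)"
            by (auto simp: hcomp_comp[OF y] hcomp_comp[OF b] vlin_zero[OF B.vlin_mult[OF vlin_id]]
                vlin_zero[OF B.vlin_mult_right[OF vlin_id]] intro!: z)
        qed simp
      qed simp
      then show "pairing \<theta> (b \<cdot> hcomp j y) = 0"
        using y by simp
    qed
    then show ?thesis
      using sum_hcomp[of y] by simp
  qed
  have "\<exists>b. \<forall>y. pairing q y = pairing \<theta> (b \<cdot> y)" for q
  proof -
    define u where "u b = (\<lambda>i. pairing \<theta> (b \<cdot> bvec i))" for b
    have u: "pairing (u b) y = pairing \<theta> (b \<cdot> y)" for b y
      by (subst pairing_expand, subst lin_expand[of "\<lambda>y. pairing \<theta> (b \<cdot> y)"]) (simp_all add: u_def)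
    have vu: "vlin u"
      unfolding vlin_coords u_def by simp
    \<comment> \<open>Otherwise a vector separating q from the range would lie in the radical of the
      form.\<close>
    have "q \<in> range u"
    proof (rule ccontr)
      assume q: "q \<notin> range u"
      have "kvec.subspace (range u)"
        unfolding kvec.subspace_def
        by (metis (no_types, lifting) rangeE rangeI vlin_add[OF vu] vlin_scale[OF vu] vlin_zero[OF vu])
      then obtain y where y: "\<And>w. w \<in> range u \<Longrightarrow> pairing w y = 0" "pairing q y \<noteq> 0"
        using separating_vector[OF _ q] by blast
      have "y = 0"
        using y(1)[OF rangeI] by (intro nondeg) (simp add: u)
      then show False
        using y(2) by simp
    qed
    then show ?thesis
      using u by (metis rangeE)
  qed
  then show thesis
    by (intro that[of x N \<theta>]) (use x top \<theta> hN in blast)+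
qed

end

section \<open>The triangular decomposition of the double\<close>

context nichols_algebra
begin

sublocale DD: fd_algebra "DVH H B"
  unfolding DVH_def by (rule AH.fd_algebra_double)

sublocale HD: fd_algebra "drinfeld_double H"
  by (rule V.fd_algebra_double)

lemma D_simps [simp]: "carrier D = UNIV" "\<zero>\<^bsub>D\<^esub> = 0" "x \<oplus>\<^bsub>D\<^esub> y = x + y"
  "\<one>\<^bsub>D\<^esub> = outer (outer \<one>\<^bsub>B\<^esub> \<one>\<^bsub>H\<^esub>) (counit_coords (bosonization H B))"
  unfolding D_def by simp_all

text \<open>The slice \<open>\<theta>\<close> tensor identity from A to H. For the counit of B it is
  the Hopf algebra projection \<open>\<pi>\<close>.\<close>

definition coef :: "('b \<Rightarrow> 'k) \<Rightarrow> ('b \<times> 'h \<Rightarrow> 'k) \<Rightarrow> 'h \<Rightarrow> 'k" where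
  "coef \<theta> z = (\<lambda>j. pairing \<theta> (\<lambda>i. z (i, j)))"

lemma vlin_coef0: "vlin (coef \<theta>)"
  unfolding vlin_coords lin_def coef_def
proof safe
  fix j and x y :: "'b \<times> 'h \<Rightarrow> 'k"
  have "(\<lambda>i. (x + y) (i, j)) = (\<lambda>i. x (i, j)) + (\<lambda>i. y (i, j))"
    by auto
  then show "pairing \<theta> (\<lambda>i. (x + y) (i, j)) = pairing \<theta> (\<lambda>i. x (i, j)) + pairing \<theta> (\<lambda>i. y (i, j))"
    by (simp only: pairing_simps)
next
  fix j c and x :: "'b \<times> 'h \<Rightarrow> 'k"
  have "(\<lambda>i. vscale c x (i, j)) = vscale c (\<lambda>i. x (i, j))"
    by (auto simp: fscale_def)
  then show "pairing \<theta> (\<lambda>i. vscale c x (i, j)) = c * pairing \<theta> (\<lambda>i. x (i, j))"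
    by (simp only: pairing_simps)
qed

lemmas vlin_coef [simp] = vlin_comp[OF vlin_coef0]

lemma coef_outer: "coef \<theta> (outer x h) = vscale (pairing \<theta> x) h"
proof
  fix j
  have "(\<lambda>i. outer x h (i, j)) = vscale (h j) x"
    by (auto simp: outer_def fscale_def)
  then show "coef \<theta> (outer x h) j = vscale (pairing \<theta> x) h j"
    by (simp add: coef_def vscale_apply)
qed

abbreviation \<epsilon>B where "\<epsilon>B \<equiv> counit_coords B"
abbreviation \<pi> where "\<pi> \<equiv> coef \<epsilon>B"

lemma coef_mult_right: "coef \<theta> (z \<otimes>\<^bsub>A\<^esub> outer \<one>\<^bsub>B\<^esub> h) = coef \<theta> z \<otimes>\<^bsub>H\<^esub> h"
  by (rule vec_eq_outerI[where t=z and f="\<lambda>z. coef \<theta> (z \<otimes>\<^bsub>A\<^esub> outer \<one>\<^bsub>B\<^esub> h)" and g="\<lambda>z. coef \<theta> z \<otimes>\<^bsub>H\<^esub> h"])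
     (simp_all add: outer_mult_one_right coef_outer V.scale_mult)

lemma \<pi>_mult: "\<pi> (a \<otimes>\<^bsub>A\<^esub> b) = \<pi> a \<otimes>\<^bsub>H\<^esub> \<pi> b"
proof -
  have 1: "\<pi> (outer x h \<otimes>\<^bsub>A\<^esub> outer y g) = \<pi> (outer x h) \<otimes>\<^bsub>H\<^esub> \<pi> (outer y g)" for x h y g
  proof (rule vec_eqI)
    fix p
    have "pairing p (\<pi> (outer x h \<otimes>\<^bsub>A\<^esub> outer y g))
      = DH h (\<lambda>h1 h2. counit H h1 * (counit B x * counit B y * pairing p (h2 \<otimes>\<^bsub>H\<^esub> g)))"
      by (simp add: outer_mult vlin_sw[OF vlin_coef0] coef_outer counit_prod counit_act mult.assoc mult.left_commute[of "counit B x" "counit H a" for a])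
    also have "\<dots> = counit B x * counit B y * pairing p (h \<otimes>\<^bsub>H\<^esub> g)"
      by (rule V.sw_counit_left) simp
    finally show "pairing p (\<pi> (outer x h \<otimes>\<^bsub>A\<^esub> outer y g)) = pairing p (\<pi> (outer x h) \<otimes>\<^bsub>H\<^esub> \<pi> (outer y g))"
      by (simp add: coef_outer V.scale_mult V.mult_scale mult_ac)
  qed
  have 2: "\<pi> (outer x h \<otimes>\<^bsub>A\<^esub> b) = \<pi> (outer x h) \<otimes>\<^bsub>H\<^esub> \<pi> b" for x h
    by (rule vec_eq_outerI[where t=b and f="\<lambda>b. \<pi> (outer x h \<otimes>\<^bsub>A\<^esub> b)" and g="\<lambda>b. \<pi> (outer x h) \<otimes>\<^bsub>H\<^esub> \<pi> b"])
       (simp_all add: 1)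
  show ?thesis
    by (rule vec_eq_outerI[where t=a and f="\<lambda>a. \<pi> (a \<otimes>\<^bsub>A\<^esub> b)" and g="\<lambda>a. \<pi> a \<otimes>\<^bsub>H\<^esub> \<pi> b"])
       (simp_all add: 2)
qed

lemma \<pi>_one_outer [simp]: "\<pi> (outer \<one>\<^bsub>B\<^esub> h) = h"
  by (simp add: coef_outer counit_unit)

lemma sw_comult_one_outer:
  assumes F: "\<And>b. lin (\<lambda>a. F a b)" "\<And>a. lin (F a)"
  shows "DA (outer \<one>\<^bsub>B\<^esub> h) F = DH h (\<lambda>h1 h2. F (outer \<one>\<^bsub>B\<^esub> h1) (outer \<one>\<^bsub>B\<^esub> h2))"
proof -
  have l: "vlin f \<Longrightarrow> lin (\<lambda>x. F (f x) b)" "vlin g \<Longrightarrow> lin (\<lambda>x. F a (g x))"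
    for f :: "('c \<Rightarrow> 'k) \<Rightarrow> _" and g :: "('d \<Rightarrow> 'k) \<Rightarrow> _" and a b
    using lin_comp[OF F(1)] lin_comp[OF F(2)] by auto
  show ?thesis
    by (simp add: A_comult_outer F l sw_comult_unit sw_coact_unit)
qed

lemma sw_comult_\<pi>:
  assumes F: "\<And>b. lin (\<lambda>a. F a b)" "\<And>a. lin (F a)"
  shows "DH (\<pi> y) F = DA y (\<lambda>y1 y2. F (\<pi> y1) (\<pi> y2))"
proof (rule lin_eq_outerI[where t=y and f="\<lambda>y. DH (\<pi> y) F" and g="\<lambda>y. DA y (\<lambda>y1 y2. F (\<pi> y1) (\<pi> y2))"])
  have l: "vlin f \<Longrightarrow> lin (\<lambda>x. F (f x) b)" "vlin g \<Longrightarrow> lin (\<lambda>x. F a (g x))"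
    for f :: "('c \<Rightarrow> 'k) \<Rightarrow> _" and g :: "('d \<Rightarrow> 'k) \<Rightarrow> _" and a b
    using lin_comp[OF F(1)] lin_comp[OF F(2)] by auto
  show "lin (\<lambda>y. DH (\<pi> y) F)" "lin (\<lambda>y. DA y (\<lambda>y1 y2. F (\<pi> y1) (\<pi> y2)))"
    by (simp_all add: F l)
  fix x h
  have "DA (outer x h) (\<lambda>y1 y2. F (\<pi> y1) (\<pi> y2))
    = DB x (\<lambda>x1 x2. CB x2 (\<lambda>g x0. counit B x0 * (counit B x1 * DH h (\<lambda>h1 h2. F (g \<otimes>\<^bsub>H\<^esub> h1) h2))))"
    by (simp add: A_comult_outer l coef_outer lin_scale[OF F(1)] lin_scale[OF F(2)] sw_mult_right mult_ac)
  also have "\<dots> = DB x (\<lambda>x1 x2. counit B x2 * (counit B x1 * DH h F))"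
    by (rule sw_cong, subst sw_counit_coact) (simp_all add: l F)
  also have "\<dots> = DH (\<pi> (outer x h)) F"
    by (simp add: coef_outer V.sw_comult_scale F)
  finally show "DH (\<pi> (outer x h)) F = DA (outer x h) (\<lambda>y1 y2. F (\<pi> y1) (\<pi> y2))" ..
qed

lemma \<pi>_antipode: "\<pi> (antipode A a) = antipode H (\<pi> a)"
proof (rule vec_eq_outerI[where t=a and f="\<lambda>a. \<pi> (antipode A a)" and g="\<lambda>a. antipode H (\<pi> a)"])
  fix x h
  \<comment> \<open>Compare the two sides of \<open>antipode_hcomp\<close> in degree zero, where B
    consists of scalars.\<close>
  have eS: "counit B (antipode B y) = counit B y" for y
  proof -
    have "vscale (counit B (antipode B y)) \<one>\<^bsub>B\<^esub> = vscale (counit B y) (antipode B \<one>\<^bsub>B\<^esub>)"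
      using antipode_hcomp[of 0 y] by (simp add: hcomp_0 vlin_scale[OF B.vlin_antipode[OF vlin_id]])
    then have "counit B (antipode B y) * counit B \<one>\<^bsub>B\<^esub> = counit B y * counit B (antipode B \<one>\<^bsub>B\<^esub>)"
      by (metis lin_scale[OF B.lin_counit[OF vlin_id]])
    moreover have "counit B (antipode B \<one>\<^bsub>B\<^esub>) = 1"
      using B.sw_antipode(1)[OF B.lin_counit[OF vlin_id], of "\<one>\<^bsub>B\<^esub>"] by (simp add: sw_comult_unit counit_unit counit_prod)
    ultimately show ?thesis
      by (simp add: counit_unit)
  qed
  show "\<pi> (antipode A (outer x h)) = antipode H (\<pi> (outer x h))"
  proof (rule vec_eqI)
    fix p
    have "pairing p (\<pi> (antipode A (outer x h))) = CB x (\<lambda>g x0. counit B x0 * pairing p (antipode H (g \<otimes>\<^bsub>H\<^esub> h)))"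
      by (simp add: A_antipode_outer vlin_sw[OF vlin_coef0] \<pi>_mult coef_outer eS counit_unit V.mult_scale)
    also have "\<dots> = pairing p (antipode H (\<pi> (outer x h)))"
      by (simp add: coef_outer vlin_scale[OF V.vlin_antipode[OF vlin_id]])
    finally show "pairing p (\<pi> (antipode A (outer x h))) = pairing p (antipode H (\<pi> (outer x h)))" .
  qed
qed simp_all

lemma lin_D_mult:
  assumes "lin G"
  shows "G (ev (t \<otimes>\<^bsub>D\<^esub> u) y) = DA y (\<lambda>y1 y2. DA (ev u y1) (\<lambda>w1 w'. DA w' (\<lambda>w2 w3.
      G (ev t (w1 \<otimes>\<^bsub>A\<^esub> (y2 \<otimes>\<^bsub>A\<^esub> antipode A w3)) \<otimes>\<^bsub>A\<^esub> w2))))"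
  unfolding D_def by (rule AH.lin_double_mult[OF assms])

section \<open>The subalgebras as operators\<close>

lemma ev_incl_B: "ev (incl_B H B x) y = vscale (counit A y) (outer x \<one>\<^bsub>H\<^esub>)"
  by (simp add: incl_B_def ev_outer)

lemma ev_incl_B_mult: "ev (incl_B H B x \<otimes>\<^bsub>D\<^esub> u) y = outer x \<one>\<^bsub>H\<^esub> \<otimes>\<^bsub>A\<^esub> ev u y"
  unfolding D_def incl_B_def by (rule AH.ev_base_mult)

lemma incl_B_one: "incl_B H B \<one>\<^bsub>B\<^esub> = \<one>\<^bsub>D\<^esub>"
  by (simp add: incl_B_def)

lemma vlin_incl_B: "vlin (incl_B H B)"
  unfolding incl_B_def by simp

lemma ev_incl_DH: "ev (incl_DH H B r) y = outer \<one>\<^bsub>B\<^esub> (ev r (\<pi> y))"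
proof (rule vec_eqI)
  fix p
  have f: "pairing (outer \<epsilon>B f) y = pairing f (\<pi> y)" for f
    by (rule lin_eq_outerI[where t=y and f="\<lambda>y. pairing (outer \<epsilon>B f) y" and g="\<lambda>y. pairing f (\<pi> y)"])
       (simp_all add: pairing_outer coef_outer)
  show "pairing p (ev (incl_DH H B r) y) = pairing p (outer \<one>\<^bsub>B\<^esub> (ev r (\<pi> y)))"
    by (simp add: incl_DH_def V.pairing_ev_sw ev_outer f sw_curry_ev)
qed

lemma vlin_incl_DH: "vlin (incl_DH H B)"
  by (rule vlin_evI) (simp add: ev_incl_DH)

lemma incl_DH_one: "incl_DH H B \<one>\<^bsub>drinfeld_double H\<^esub> = \<one>\<^bsub>D\<^esub>"
proof (rule ev_eqI)
  fix y
  have "counit H (\<pi> y) = counit A y"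
    by (rule lin_eq_outerI[where t=y and f="\<lambda>y. counit H (\<pi> y)" and g="counit A"])
       (simp_all add: coef_outer A_counit_outer lin_scale[OF V.lin_counit[OF vlin_id]] AH.lin_counit[OF vlin_id])
  then show "ev (incl_DH H B \<one>\<^bsub>drinfeld_double H\<^esub>) y = ev \<one>\<^bsub>D\<^esub> y"
    by (simp add: ev_incl_DH ev_outer vlin_scale[OF vlin_outer_right[OF vlin_id]])
qed

text \<open>Operators coming from the double of H factor through \<open>\<pi>\<close>, which
  respects products, coproducts and antipodes, so the closed formula for the bosonization reduces to
  that for H.\<close>

lemma incl_DH_mult: "incl_DH H B (r \<otimes>\<^bsub>drinfeld_double H\<^esub> r') = incl_DH H B r \<otimes>\<^bsub>D\<^esub> incl_DH H B r'"
proof (rule ev_eqI, rule vec_eqI)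
  fix y p
  have "pairing p (ev (incl_DH H B r \<otimes>\<^bsub>D\<^esub> incl_DH H B r') y) = DA y (\<lambda>y1 y2. DH (ev r' (\<pi> y1)) (\<lambda>h1 h'. DH h' (\<lambda>h2 h3.
      pairing p (outer \<one>\<^bsub>B\<^esub> (ev r (h1 \<otimes>\<^bsub>H\<^esub> (\<pi> y2 \<otimes>\<^bsub>H\<^esub> antipode H h3)) \<otimes>\<^bsub>H\<^esub> h2)))))"
    by (subst lin_D_mult) (simp_all add: lin_pairing0 ev_incl_DH sw_comult_one_outer \<pi>_mult \<pi>_antipode A_antipode_one_outer outer_one_mult)
  also have "\<dots> = DH (\<pi> y) (\<lambda>y1 y2. DH (ev r' y1) (\<lambda>h1 h'. DH h' (\<lambda>h2 h3.
      pairing p (outer \<one>\<^bsub>B\<^esub> (ev r (h1 \<otimes>\<^bsub>H\<^esub> (y2 \<otimes>\<^bsub>H\<^esub> antipode H h3)) \<otimes>\<^bsub>H\<^esub> h2)))))"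
    by (rule sw_comult_\<pi>[symmetric]) simp_all
  also have "\<dots> = pairing p (ev (incl_DH H B (r \<otimes>\<^bsub>drinfeld_double H\<^esub> r')) y)"
    unfolding ev_incl_DH by (rule V.lin_double_mult[symmetric, where G="\<lambda>z. pairing p (outer \<one>\<^bsub>B\<^esub> z)"]) simp
  finally show "pairing p (ev (incl_DH H B (r \<otimes>\<^bsub>drinfeld_double H\<^esub> r')) y) = pairing p (ev (incl_DH H B r \<otimes>\<^bsub>D\<^esub> incl_DH H B r') y)" ..
qed

text \<open>The nonnegative part in a form that is tested pointwise; \<open>nonneg_eq\<close>
  identifies it with the generated subring.\<close>

definition Rset :: "(('b \<times> 'h) \<times> ('b \<times> 'h) \<Rightarrow> 'k) set" where
  "Rset = {t. \<forall>y. ev t y = outer \<one>\<^bsub>B\<^esub> (\<pi> (ev t y))}"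

lemma RsetI: "(\<And>y. \<exists>h. ev t y = outer \<one>\<^bsub>B\<^esub> h) \<Longrightarrow> t \<in> Rset"
proof -
  assume *: "\<And>y. \<exists>h. ev t y = outer \<one>\<^bsub>B\<^esub> h"
  have "ev t y = outer \<one>\<^bsub>B\<^esub> (\<pi> (ev t y))" for y
  proof -
    obtain h where h: "ev t y = outer \<one>\<^bsub>B\<^esub> h"
      using *[of y] by blast
    show ?thesis
      unfolding h by simp
  qed
  then show "t \<in> Rset"
    by (simp add: Rset_def)
qed

lemma RsetD: "t \<in> Rset \<Longrightarrow> ev t y = outer \<one>\<^bsub>B\<^esub> (\<pi> (ev t y))"
  by (simp add: Rset_def)

text \<open>The coefficient of d along \<open>\<theta>\<close> in the decomposition into B and
  \<open>Rset\<close>, projected to the double of H. For the counit it is \<open>proj_DH\<close>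
  itself.\<close>

definition qcoef :: "('b \<Rightarrow> 'k) \<Rightarrow> (('b \<times> 'h) \<times> ('b \<times> 'h) \<Rightarrow> 'k) \<Rightarrow> 'h \<times> 'h \<Rightarrow> 'k" where
  "qcoef \<theta> d = mat (\<lambda>k. coef \<theta> (ev d (outer \<one>\<^bsub>B\<^esub> k)))"

lemma ev_qcoef: "ev (qcoef \<theta> d) k = coef \<theta> (ev d (outer \<one>\<^bsub>B\<^esub> k))"
  unfolding qcoef_def by (rule ev_mat) simp

lemma vlin_qcoef0: "vlin (qcoef \<theta>)"
  by (rule vlin_evI) (simp add: ev_qcoef)

lemma proj_DH_eq: "proj_DH H B t = qcoef \<epsilon>B t"
proof (rule ev_eqI, rule vec_eqI)
  fix k p :: "'h \<Rightarrow> 'k"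
  have f: "pairing (\<lambda>i. pairing f (outer \<one>\<^bsub>B\<^esub> (bvec i))) k = pairing f (outer \<one>\<^bsub>B\<^esub> k)" for f
    by (subst pairing_expand, subst lin_expand[of "\<lambda>k. pairing f (outer \<one>\<^bsub>B\<^esub> k)"]) simp_all
  have sc: "sweedler (curry a) (\<lambda>x h. c * (counit B x * pairing p h)) = c * pairing p (\<pi> a)" for a c
    by (rule lin_eq_outerI[where t=a and f="\<lambda>a. sweedler (curry a) (\<lambda>x h. c * (counit B x * pairing p h))"
          and g="\<lambda>a. c * pairing p (\<pi> a)"]) (simp_all add: sw_curry_outer coef_outer)
  have "pairing p (ev (proj_DH H B t) k)
    = sweedler (curry t) (\<lambda>a f. pairing f (outer \<one>\<^bsub>B\<^esub> k) * pairing p (\<pi> a))"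
    by (simp add: proj_DH_def V.pairing_ev_sw ev_outer f sc mult.assoc)
  also have "\<dots> = pairing p (ev (qcoef \<epsilon>B t) k)"
    by (simp add: sw_curry_ev ev_qcoef)
  finally show "pairing p (ev (proj_DH H B t) k) = pairing p (ev (qcoef \<epsilon>B t) k)" .
qed

text \<open>On arguments \<open>1 # k\<close>, and with r taking values in \<open>1 # H\<close>,
  every leg in the closed formula stays in H. This right linearity lets the coefficients descend to
  the Verma module.\<close>

lemma qcoef_mult:
  assumes r: "r \<in> Rset"
  shows "qcoef \<theta> (d \<otimes>\<^bsub>D\<^esub> r) = qcoef \<theta> d \<otimes>\<^bsub>drinfeld_double H\<^esub> proj_DH H B r"
proof (rule ev_eqI, rule vec_eqI)
  fix k p
  let ?r = "\<lambda>k. \<pi> (ev r (outer \<one>\<^bsub>B\<^esub> k))"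
  have "pairing p (ev (qcoef \<theta> (d \<otimes>\<^bsub>D\<^esub> r)) k) = DH k (\<lambda>k1 k2. DA (outer \<one>\<^bsub>B\<^esub> (?r k1)) (\<lambda>w1 w'. DA w' (\<lambda>w2 w3.
      pairing p (coef \<theta> (ev d (w1 \<otimes>\<^bsub>A\<^esub> (outer \<one>\<^bsub>B\<^esub> k2 \<otimes>\<^bsub>A\<^esub> antipode A w3)) \<otimes>\<^bsub>A\<^esub> w2)))))"
    unfolding ev_qcoef by (subst lin_D_mult) (simp_all add: sw_comult_one_outer RsetD[OF r, symmetric])
  also have "\<dots> = DH k (\<lambda>k1 k2. DH (?r k1) (\<lambda>h1 h'. DH h' (\<lambda>h2 h3.
      pairing p (coef \<theta> (ev d (outer \<one>\<^bsub>B\<^esub> (h1 \<otimes>\<^bsub>H\<^esub> (k2 \<otimes>\<^bsub>H\<^esub> antipode H h3)))) \<otimes>\<^bsub>H\<^esub> h2))))"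
    by (simp add: sw_comult_one_outer A_antipode_one_outer outer_one_mult coef_mult_right)
  also have "\<dots> = pairing p (ev (qcoef \<theta> d \<otimes>\<^bsub>drinfeld_double H\<^esub> proj_DH H B r) k)"
    by (simp add: V.pairing_double_mult proj_DH_eq ev_qcoef)
  finally show "pairing p (ev (qcoef \<theta> (d \<otimes>\<^bsub>D\<^esub> r)) k) = pairing p (ev (qcoef \<theta> d \<otimes>\<^bsub>drinfeld_double H\<^esub> proj_DH H B r) k)" .
qed

lemma qcoef_incl_B: "qcoef \<theta> (incl_B H B x) = vscale (pairing \<theta> x) \<one>\<^bsub>drinfeld_double H\<^esub>"
  by (rule ev_eqI) (simp add: ev_qcoef ev_incl_B vlin_scale[OF vlin_coef0] coef_outer A_counit_outer counit_unit
      ev_outer vlin_scale[OF vlin_ev_left[OF vlin_id]] mult.commute)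

lemma proj_incl_DH: "proj_DH H B (incl_DH H B r) = r"
  by (rule ev_eqI) (simp add: proj_DH_eq ev_qcoef ev_incl_DH)

definition Rcoef :: "'b \<Rightarrow> (('b \<times> 'h) \<times> ('b \<times> 'h) \<Rightarrow> 'k) \<Rightarrow> ('b \<times> 'h) \<times> ('b \<times> 'h) \<Rightarrow> 'k" where
  "Rcoef i d = mat (\<lambda>y. outer \<one>\<^bsub>B\<^esub> (coef (bvec i) (ev d y)))"

lemma ev_Rcoef: "ev (Rcoef i d) y = outer \<one>\<^bsub>B\<^esub> (coef (bvec i) (ev d y))"
  unfolding Rcoef_def by (rule ev_mat) simp

lemma Rcoef_Rset: "Rcoef i d \<in> Rset"
  by (rule RsetI) (auto simp: ev_Rcoef)

lemma proj_Rcoef: "proj_DH H B (Rcoef i d) = qcoef (bvec i) d"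
  by (rule ev_eqI) (simp add: proj_DH_eq ev_qcoef ev_Rcoef)

text \<open>The triangular decomposition: expand the values of the operator in the basis of B and
  pull the basis vectors out as left factors.\<close>

lemma decompose: "d = (\<Sum>i\<in>UNIV. incl_B H B (bvec i) \<otimes>\<^bsub>D\<^esub> Rcoef i d)"
proof (rule ev_eqI)
  fix y
  have "(\<Sum>i\<in>UNIV. outer (bvec i) (coef (bvec i) z)) = z" for z :: "'b \<times> 'h \<Rightarrow> 'k"
  proof (rule vec_eq_outerI[where t=z and f="\<lambda>z. \<Sum>i\<in>UNIV. outer (bvec i) (coef (bvec i) z)" and g="\<lambda>z. z"])
    fix x :: "'b \<Rightarrow> 'k" and h :: "'h \<Rightarrow> 'k"
    have "(\<Sum>i\<in>UNIV. outer (bvec i) (coef (bvec i) (outer x h))) = (\<Sum>i\<in>UNIV. vscale (x i) (outer (bvec i) h))"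
      by (simp add: coef_outer pairing_bvec vlin_scale[OF vlin_outer_right[OF vlin_id]])
    also have "\<dots> = outer x h"
      by (rule vlin_expand[OF vlin_outer[OF vlin_id], symmetric])
    finally show "(\<Sum>i\<in>UNIV. outer (bvec i) (coef (bvec i) (outer x h))) = outer x h" .
  qed simp_all
  then show "ev d y = ev (\<Sum>i\<in>UNIV. incl_B H B (bvec i) \<otimes>\<^bsub>D\<^esub> Rcoef i d) y"
    by (simp add: vlin_sum[OF vlin_ev_left[OF vlin_id]] ev_incl_B_mult ev_Rcoef outer_mult_one_right)
qed

text \<open>Since \<open>r'\<close> takes values in \<open>1 # H\<close>, the legs
  \<open>w1\<close>, \<open>w2\<close>, \<open>w3\<close> of the closed formula lie there, and so do
  the values of r.\<close>

lemma Rset_mult: "r \<in> Rset \<Longrightarrow> r' \<in> Rset \<Longrightarrow> r \<otimes>\<^bsub>D\<^esub> r' \<in> Rset"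
proof -
  assume r: "r \<in> Rset" and r': "r' \<in> Rset"
  have "ev (r \<otimes>\<^bsub>D\<^esub> r') y = outer \<one>\<^bsub>B\<^esub> (\<pi> (ev (r \<otimes>\<^bsub>D\<^esub> r') y))" for y
  proof (rule vec_eqI)
    fix p
    have *: "G (ev (r \<otimes>\<^bsub>D\<^esub> r') y) = DA y (\<lambda>y1 y2. DH (\<pi> (ev r' y1)) (\<lambda>h1 h'. DH h' (\<lambda>h2 h3.
        G (outer \<one>\<^bsub>B\<^esub> (\<pi> (ev r (outer \<one>\<^bsub>B\<^esub> h1 \<otimes>\<^bsub>A\<^esub> (y2 \<otimes>\<^bsub>A\<^esub> outer \<one>\<^bsub>B\<^esub> (antipode H h3)))) \<otimes>\<^bsub>H\<^esub> h2)))))"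
      if G: "lin G" for G
    proof -
      have l: "vlin g \<Longrightarrow> lin (\<lambda>x. G (g x))" for g :: "('c \<Rightarrow> 'k) \<Rightarrow> _"
        by (rule lin_comp[OF G])
      have "DA (ev r' y1) (\<lambda>w1 w'. DA w' (\<lambda>w2 w3. G (ev r (w1 \<otimes>\<^bsub>A\<^esub> (y2 \<otimes>\<^bsub>A\<^esub> antipode A w3)) \<otimes>\<^bsub>A\<^esub> w2)))
        = DH (\<pi> (ev r' y1)) (\<lambda>h1 h'. DH h' (\<lambda>h2 h3.
        G (outer \<one>\<^bsub>B\<^esub> (\<pi> (ev r (outer \<one>\<^bsub>B\<^esub> h1 \<otimes>\<^bsub>A\<^esub> (y2 \<otimes>\<^bsub>A\<^esub> outer \<one>\<^bsub>B\<^esub> (antipode H h3)))) \<otimes>\<^bsub>H\<^esub> h2))))" for y1 y2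
        apply (subst RsetD[OF r'])
        apply (subst sw_comult_one_outer)
          apply (simp_all add: l sw_comult_one_outer A_antipode_one_outer)
        apply (intro sw_cong)
        apply (subst RsetD[OF r])
        apply (simp add: outer_one_mult)
        done
      then show ?thesis
        by (subst lin_D_mult[OF G]) simp
    qed
    show "pairing p (ev (r \<otimes>\<^bsub>D\<^esub> r') y) = pairing p (outer \<one>\<^bsub>B\<^esub> (\<pi> (ev (r \<otimes>\<^bsub>D\<^esub> r') y)))"
      using *[of "pairing p"] *[of "\<lambda>z. pairing p (outer \<one>\<^bsub>B\<^esub> (\<pi> z))"] by (simp add: lin_pairing0)
  qed
  then show ?thesis
    by (simp add: Rset_def)
qed

section \<open>The generators of the nonnegative part\<close>

lemma Vbar_eq: "Vbar H B = {outer \<one>\<^bsub>A\<^esub> (outer \<phi> (counit_coords H)) | \<phi>. \<phi> \<in> dual_comp 1}"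
  by (auto simp: Vbar_def dual_comp_def)

lemma Vbar_Rset: "\<alpha> \<in> Vbar H B \<Longrightarrow> \<alpha> \<in> Rset"
  by (rule RsetI) (auto simp: Vbar_eq ev_outer vlin_scale[OF vlin_outer_right[OF vlin_id], symmetric])

lemma proj_Vbar: "\<alpha> \<in> Vbar H B \<Longrightarrow> proj_DH H B \<alpha> = 0"
proof -
  assume "\<alpha> \<in> Vbar H B"
  then obtain \<phi> where \<phi>: "\<alpha> = outer \<one>\<^bsub>A\<^esub> (outer \<phi> (counit_coords H))" "\<phi> \<in> dual_comp 1"
    by (auto simp: Vbar_eq)
  have "pairing \<phi> \<one>\<^bsub>B\<^esub> = 0"
    using \<phi>(2) one_comp by (auto simp: dual_comp_def)
  then show ?thesis
    by (intro ev_eqI) (simp add: proj_DH_eq ev_qcoef \<phi>(1) ev_outer pairing_outer vlin_zero[OF vlin_coef0]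
        vlin_zero[OF vlin_ev_left[OF vlin_id]])
qed

lemma incl_DH_Rset: "incl_DH H B r \<in> Rset"
  by (rule RsetI) (auto simp: ev_incl_DH)

lemma Rset_add: "r \<in> Rset \<Longrightarrow> r' \<in> Rset \<Longrightarrow> r + r' \<in> Rset"
  and Rset_minus: "r \<in> Rset \<Longrightarrow> - r \<in> Rset"
proof -
  assume r: "r \<in> Rset"
  have "ev (- r) y = outer \<one>\<^bsub>B\<^esub> (\<pi> (ev (- r) y))" for y
    using arg_cong[OF RsetD[OF r, of y], of uminus]
    by (simp add: vlin_minus[OF vlin_ev_left[OF vlin_id]] vlin_minus[OF vlin_coef0] vlin_minus[OF vlin_outer_right[OF vlin_id]])
  then show "- r \<in> Rset"
    by (simp add: Rset_def)
  assume r': "r' \<in> Rset"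
  have "ev (r + r') y = outer \<one>\<^bsub>B\<^esub> (\<pi> (ev (r + r') y))" for y
    using arg_cong2[OF RsetD[OF r, of y] RsetD[OF r', of y], of "(+)"]
    by (simp add: vlin_add[OF vlin_ev_left[OF vlin_id]] vlin_add[OF vlin_coef0] vlin_add[OF vlin_outer_right[OF vlin_id]])
  then show "r + r' \<in> Rset"
    by (simp add: Rset_def)
qed

abbreviation nonneg where "nonneg \<equiv> generate_ring D (Vbar H B \<union> range (incl_DH H B))"

lemma nonneg_subset: "nonneg \<subseteq> Rset"
proof
  fix t assume "t \<in> nonneg"
  then show "t \<in> Rset"
  proof (rule generate_ring.induct)
    show "\<one>\<^bsub>D\<^esub> \<in> Rset"
      using incl_DH_Rset[of "\<one>\<^bsub>drinfeld_double H\<^esub>"] by (simp only: incl_DH_one)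
    show "h \<in> Vbar H B \<union> range (incl_DH H B) \<Longrightarrow> h \<in> Rset" for h
      using Vbar_Rset incl_DH_Rset by blast
    show "h \<in> Rset \<Longrightarrow> \<ominus>\<^bsub>D\<^esub> h \<in> Rset" for h
      by (simp only: DD.a_inv_eq Rset_minus)
    show "g \<in> Rset \<Longrightarrow> h \<in> Rset \<Longrightarrow> g \<oplus>\<^bsub>D\<^esub> h \<in> Rset" for g h
      by (simp only: D_simps Rset_add)
    show "g \<in> Rset \<Longrightarrow> h \<in> Rset \<Longrightarrow> g \<otimes>\<^bsub>D\<^esub> h \<in> Rset" for g h
      by (rule Rset_mult)
  qed
qed

text \<open>The dual factor of the double carries the opposite of the convolution product, whence
  the exchange of f and g.\<close>

lemma ev_outer_one_mult: "outer \<one>\<^bsub>A\<^esub> f \<otimes>\<^bsub>D\<^esub> outer \<one>\<^bsub>A\<^esub> g = outer \<one>\<^bsub>A\<^esub> (dual_mult A g f)"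
proof (rule ev_eqI, rule vec_eqI)
  fix y p
  have "pairing p (ev (outer \<one>\<^bsub>A\<^esub> f \<otimes>\<^bsub>D\<^esub> outer \<one>\<^bsub>A\<^esub> g) y)
    = DA y (\<lambda>y1 y2. pairing g y1 * (pairing f y2 * pairing p (outer \<one>\<^bsub>B\<^esub> \<one>\<^bsub>H\<^esub>)))"
    by (subst lin_D_mult[OF lin_pairing0])
       (simp add: ev_outer AH.sw_comult_scale sw_comult_one_outer V.comult_one_sw A_antipode_one_outer A_one AH.scale_mult)
  also have "\<dots> = pairing p (ev (outer \<one>\<^bsub>A\<^esub> (dual_mult A g f)) y)"
    by (simp add: ev_outer AH.pairing_dual_mult sw_mult_left mult.assoc)
  finally show "pairing p (ev (outer \<one>\<^bsub>A\<^esub> f \<otimes>\<^bsub>D\<^esub> outer \<one>\<^bsub>A\<^esub> g) y) = pairing p (ev (outer \<one>\<^bsub>A\<^esub> (dual_mult A g f)) y)" .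
qed

end

section \<open>Generation of the nonnegative part\<close>

context nichols_algebra
begin

lemma nonneg_scale: "t \<in> nonneg \<Longrightarrow> vscale c t \<in> nonneg"
proof -
  assume t: "t \<in> nonneg"
  have "incl_DH H B (vscale c \<one>\<^bsub>drinfeld_double H\<^esub>) \<otimes>\<^bsub>D\<^esub> t \<in> nonneg"
    by (rule generate_ring.eng_mult[OF generate_ring.incl t]) simp
  also have "incl_DH H B (vscale c \<one>\<^bsub>drinfeld_double H\<^esub>) \<otimes>\<^bsub>D\<^esub> t = vscale c t"
    unfolding vlin_scale[OF vlin_incl_DH] incl_DH_one DD.scale_mult DD.one_left ..
  finally show ?thesis .
qed

lemma nonneg_add: "t \<in> nonneg \<Longrightarrow> u \<in> nonneg \<Longrightarrow> t + u \<in> nonneg"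
  using generate_ring.eng_add[of t D _ u] by simp

lemma nonneg_zero: "0 \<in> nonneg"
  using nonneg_scale[OF generate_ring.one, of 0] by (simp add: fscale_def zero_fun_def)

lemma nonneg_sum: "(\<And>i. i \<in> I \<Longrightarrow> f i \<in> nonneg) \<Longrightarrow> sum f I \<in> nonneg"
  by (induction I rule: infinite_finite_induct) (auto intro: nonneg_zero nonneg_add simp del: plus_fun_apply)

lemma subspace_dual_nonneg: "kvec.subspace {f. outer \<one>\<^bsub>A\<^esub> f \<in> nonneg}"
proof (rule kvec.subspaceI; unfold mem_Collect_eq)
  show "outer \<one>\<^bsub>A\<^esub> 0 \<in> nonneg"
    unfolding vlin_zero[OF vlin_outer_right[OF vlin_id]] by (rule nonneg_zero)
  show "outer \<one>\<^bsub>A\<^esub> (f + g) \<in> nonneg" if "outer \<one>\<^bsub>A\<^esub> f \<in> nonneg" "outer \<one>\<^bsub>A\<^esub> g \<in> nonneg" for f g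
    unfolding vlin_add[OF vlin_outer_right[OF vlin_id]] by (rule nonneg_add[OF that])
  show "outer \<one>\<^bsub>A\<^esub> (vscale c f) \<in> nonneg" if "outer \<one>\<^bsub>A\<^esub> f \<in> nonneg" for c f
    unfolding vlin_scale[OF vlin_outer_right[OF vlin_id]] by (rule nonneg_scale[OF that])
qed

lemma dual_mult_nonneg:
  "outer \<one>\<^bsub>A\<^esub> f \<in> nonneg \<Longrightarrow> outer \<one>\<^bsub>A\<^esub> g \<in> nonneg \<Longrightarrow> outer \<one>\<^bsub>A\<^esub> (dual_mult A f g) \<in> nonneg"
  using generate_ring.eng_mult[of "outer \<one>\<^bsub>A\<^esub> g" D _ "outer \<one>\<^bsub>A\<^esub> f"] by (simp only: ev_outer_one_mult)

text \<open>The counit in the first H-slot removes the coaction leg and one leg of h; what remains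
  is the convolution in the dual of B next to g.\<close>

lemma dual_mult_outer: "dual_mult A (outer \<phi> (counit_coords H)) (outer \<psi> g) = outer (dual_mult B \<phi> \<psi>) g"
proof
  fix i
  have "pairing (dual_mult A (outer \<phi> (counit_coords H)) (outer \<psi> g)) y = pairing (outer (dual_mult B \<phi> \<psi>) g) y" for y
  proof (rule lin_eq_outerI[where t=y and f="pairing (dual_mult A (outer \<phi> (counit_coords H)) (outer \<psi> g))"
        and g="pairing (outer (dual_mult B \<phi> \<psi>) g)"])
    fix x h
    have 1: "DH h (\<lambda>h1 h2. a * (counit H u * counit H h1) * (b * pairing g h2)) = counit H u * (a * (b * pairing g h))" for a b u
    proof -
      have "DH h (\<lambda>h1 h2. a * (counit H u * counit H h1) * (b * pairing g h2))
        = DH h (\<lambda>h1 h2. counit H h1 * (counit H u * (a * (b * pairing g h2))))"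
        by (simp only: mult_ac)
      also have "\<dots> = counit H u * (a * (b * pairing g h))"
        by (rule V.sw_counit_left) (simp add: lin_pairing0)
      finally show ?thesis .
    qed
    have "pairing (dual_mult A (outer \<phi> (counit_coords H)) (outer \<psi> g)) (outer x h)
      = DB x (\<lambda>x1 x2. CB x2 (\<lambda>u x0. counit H u * (pairing \<phi> x1 * (pairing \<psi> x0 * pairing g h))))"
      by (simp add: AH.pairing_dual_mult A_comult_outer pairing_outer V.counit_mult 1)
    also have "\<dots> = pairing (outer (dual_mult B \<phi> \<psi>) g) (outer x h)"
      by (simp add: pairing_outer B.pairing_dual_mult sw_mult_left mult.assoc)
    finally show "pairing (dual_mult A (outer \<phi> (counit_coords H)) (outer \<psi> g)) (outer x h)
      = pairing (outer (dual_mult B \<phi> \<psi>) g) (outer x h)" .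
  qed (simp_all add: lin_pairing0)
  from this[of "bvec i"] show "dual_mult A (outer \<phi> (counit_coords H)) (outer \<psi> g) i = outer (dual_mult B \<phi> \<psi>) g i"
    by simp
qed

text \<open>In degree zero, connectedness makes the functional a multiple of the counit. In degree n
  + 1 it lies in the span of \<open>dual_comp_span\<close>; the homogeneous part of a product with
  left factor of degree one is such a product with right factor of degree n, covered by
  induction.\<close>

lemma outer_dual_comp_nonneg: "\<phi> \<in> dual_comp n \<Longrightarrow> outer \<one>\<^bsub>A\<^esub> (outer \<phi> (counit_coords H)) \<in> nonneg"
proof (induction n arbitrary: \<phi>)
  case 0
  have *: "pairing \<phi> y = pairing (vscale (pairing \<phi> \<one>\<^bsub>B\<^esub>) \<epsilon>B) y" for y
    using pairing_dual_comp[OF 0, of 0 y] by (simp add: hcomp_0 pairing_scale_left mult.commute)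
  have \<phi>: "\<phi> = vscale (pairing \<phi> \<one>\<^bsub>B\<^esub>) \<epsilon>B"
  proof
    fix i
    show "\<phi> i = vscale (pairing \<phi> \<one>\<^bsub>B\<^esub>) \<epsilon>B i"
      using *[of "bvec i"] unfolding pairing_bvec_right .
  qed
  have e: "outer \<epsilon>B (counit_coords H) = counit_coords A"
  proof
    fix i
    have "pairing (outer \<epsilon>B (counit_coords H)) y = pairing (counit_coords A) y" for y
      by (rule lin_eq_outerI[where t=y and f="pairing (outer \<epsilon>B (counit_coords H))" and g="pairing (counit_coords A)"])
         (simp_all add: lin_pairing0 pairing_outer A_counit_outer)
    from this[of "bvec i"] show "outer \<epsilon>B (counit_coords H) i = counit_coords A i"
      by simp
  qed
  have "vscale (pairing \<phi> \<one>\<^bsub>B\<^esub>) \<one>\<^bsub>D\<^esub> \<in> nonneg"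
    by (rule nonneg_scale[OF generate_ring.one])
  also have "vscale (pairing \<phi> \<one>\<^bsub>B\<^esub>) \<one>\<^bsub>D\<^esub> = outer \<one>\<^bsub>A\<^esub> (outer (vscale (pairing \<phi> \<one>\<^bsub>B\<^esub>) \<epsilon>B) (counit_coords H))"
    unfolding vlin_scale[OF vlin_outer[OF vlin_id]] e vlin_scale[OF vlin_outer_right[OF vlin_id]] by simp
  finally show ?case
    unfolding \<phi>[symmetric] .
next
  case (Suc n)
  let ?W = "{\<phi>. outer \<one>\<^bsub>A\<^esub> (outer (dual_hcomp (Suc n) \<phi>) (counit_coords H)) \<in> nonneg}"
  have vl: "vlin (\<lambda>\<phi>. outer \<one>\<^bsub>A\<^esub> (outer (dual_hcomp (Suc n) \<phi>) (counit_coords H)))"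
  proof -
    have "vlin (dual_hcomp (Suc n))"
      unfolding vlin_coords lin_def dual_hcomp_def by (simp add: pairing_add_left pairing_scale_left)
    then show ?thesis
      by simp
  qed
  have sub: "kvec.subspace ?W"
  proof (rule kvec.subspaceI; unfold mem_Collect_eq)
    show "outer \<one>\<^bsub>A\<^esub> (outer (dual_hcomp (Suc n) 0) (counit_coords H)) \<in> nonneg"
      unfolding vlin_zero[OF vl] by (rule nonneg_zero)
    show "outer \<one>\<^bsub>A\<^esub> (outer (dual_hcomp (Suc n) (f + g)) (counit_coords H)) \<in> nonneg"
      if "outer \<one>\<^bsub>A\<^esub> (outer (dual_hcomp (Suc n) f) (counit_coords H)) \<in> nonneg"
        "outer \<one>\<^bsub>A\<^esub> (outer (dual_hcomp (Suc n) g) (counit_coords H)) \<in> nonneg" for f g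
      unfolding vlin_add[OF vl] by (rule nonneg_add[OF that])
    show "outer \<one>\<^bsub>A\<^esub> (outer (dual_hcomp (Suc n) (vscale c f)) (counit_coords H)) \<in> nonneg"
      if "outer \<one>\<^bsub>A\<^esub> (outer (dual_hcomp (Suc n) f) (counit_coords H)) \<in> nonneg" for c f
      unfolding vlin_scale[OF vl] by (rule nonneg_scale[OF that])
  qed
  have "{dual_mult B \<alpha> \<psi> | \<alpha> \<psi>. \<alpha> \<in> dual_comp 1} \<subseteq> ?W"
  proof safe
    fix \<alpha> \<psi> assume \<alpha>: "\<alpha> \<in> dual_comp 1"
    have "dual_hcomp (Suc n) (dual_mult B \<alpha> \<psi>) = dual_mult B \<alpha> (dual_hcomp n \<psi>)"
    proof
      fix i
      have "pairing (dual_hcomp (Suc n) (dual_mult B \<alpha> \<psi>)) y = pairing (dual_mult B \<alpha> (dual_hcomp n \<psi>)) y" for y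
      proof (rule lin_hcomp_eqI[where f="pairing (dual_hcomp (Suc n) (dual_mult B \<alpha> \<psi>))" and g="pairing (dual_mult B \<alpha> (dual_hcomp n \<psi>))"])
        fix m y assume y: "y \<in> comp B m"
        show "pairing (dual_hcomp (Suc n) (dual_mult B \<alpha> \<psi>)) y = pairing (dual_mult B \<alpha> (dual_hcomp n \<psi>)) y"
        proof -
          have "pairing (dual_hcomp (Suc n) (dual_mult B \<alpha> \<psi>)) y = (if m = Suc n then pairing (dual_mult B \<alpha> \<psi>) y else 0)"
            by (cases "m = Suc n") (simp_all only: pairing_dual_hcomp hcomp_comp[OF y] if_True if_False refl pairing_simps eq_commute[of "Suc n" m])
          then show ?thesis
            unfolding B.pairing_dual_mult
            by (simp only:) (rule sw_dual_comp_one[OF \<alpha> y, of "Suc n" \<psi>, unfolded diff_Suc_1, symmetric], simp)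
        qed
      qed (simp_all add: lin_pairing0)
      from this[of "bvec i"] show "dual_hcomp (Suc n) (dual_mult B \<alpha> \<psi>) i = dual_mult B \<alpha> (dual_hcomp n \<psi>) i"
        by simp
    qed
    moreover have "outer \<one>\<^bsub>A\<^esub> (outer \<alpha> (counit_coords H)) \<in> nonneg"
      using \<alpha> by (intro generate_ring.incl) (auto simp: Vbar_eq)
    ultimately show "outer \<one>\<^bsub>A\<^esub> (outer (dual_hcomp (Suc n) (dual_mult B \<alpha> \<psi>)) (counit_coords H)) \<in> nonneg"
      using dual_mult_nonneg[OF _ Suc.IH[OF dual_hcomp], of "outer \<alpha> (counit_coords H)" \<psi>] by (simp only: dual_mult_outer)
  qed
  then have "kvec.span {dual_mult B \<alpha> \<psi> | \<alpha> \<psi>. \<alpha> \<in> dual_comp 1} \<subseteq> ?W"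
    by (rule kvec.span_minimal[OF _ sub])
  moreover have "\<phi> \<in> kvec.span {dual_mult B \<alpha> \<psi> | \<alpha> \<psi>. \<alpha> \<in> dual_comp 1}"
    by (rule subsetD[OF dual_comp_span Suc.prems]) simp
  ultimately have W: "outer \<one>\<^bsub>A\<^esub> (outer (dual_hcomp (Suc n) \<phi>) (counit_coords H)) \<in> nonneg"
    by (rule subsetD[THEN CollectD])
  have "dual_hcomp (Suc n) \<phi> = \<phi>"
  proof
    fix i
    show "dual_hcomp (Suc n) \<phi> i = \<phi> i"
      using pairing_dual_comp[OF Suc.prems, of "Suc n" "bvec i"] pairing_dual_hcomp[of "Suc n" \<phi> "bvec i"] by simp
  qed
  then show ?case
    using W by (simp only:)
qed

lemma outer_counit_nonneg: "outer \<one>\<^bsub>A\<^esub> (outer \<epsilon>B g) \<in> nonneg"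
proof -
  have *: "incl_DH H B (outer \<one>\<^bsub>H\<^esub> g) = outer \<one>\<^bsub>A\<^esub> (outer \<epsilon>B g)"
  proof (rule ev_eqI)
    fix y
    have "pairing g (\<pi> y) = pairing (outer \<epsilon>B g) y"
      by (rule lin_eq_outerI[where t=y and f="\<lambda>y. pairing g (\<pi> y)" and g="pairing (outer \<epsilon>B g)"])
         (simp_all add: lin_pairing0 pairing_outer coef_outer)
    then show "ev (incl_DH H B (outer \<one>\<^bsub>H\<^esub> g)) y = ev (outer \<one>\<^bsub>A\<^esub> (outer \<epsilon>B g)) y"
      by (simp add: ev_incl_DH ev_outer vlin_scale[OF vlin_outer_right[OF vlin_id]])
  qed
  then show ?thesis
    unfolding *[symmetric] by (intro generate_ring.incl UnI2 rangeI)
qed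

text \<open>Convolving functionals on B with functionals on H yields all pure tensors, and pure
  tensors span.\<close>

lemma dual_nonneg: "outer \<one>\<^bsub>A\<^esub> f \<in> nonneg"
proof -
  have 1: "outer \<one>\<^bsub>A\<^esub> (outer \<phi> (counit_coords H)) \<in> nonneg" for \<phi>
  proof -
    have "\<phi> = (\<Sum>n\<le>degree_bound. dual_hcomp n \<phi>)"
    proof
      fix i
      have "pairing \<phi> (\<Sum>n\<le>degree_bound. hcomp n (bvec i)) = (\<Sum>n\<le>degree_bound. pairing \<phi> (hcomp n (bvec i)))"
        by (rule lin_sum[OF lin_pairing0])
      then show "\<phi> i = (\<Sum>n\<le>degree_bound. dual_hcomp n \<phi>) i"
        by (simp add: sum_hcomp dual_hcomp_def sum_apply)
    qed
    then have "outer \<one>\<^bsub>A\<^esub> (outer \<phi> (counit_coords H))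
      = (\<Sum>n\<le>degree_bound. outer \<one>\<^bsub>A\<^esub> (outer (dual_hcomp n \<phi>) (counit_coords H)))"
      using vlin_sum[of "\<lambda>\<phi>. outer \<one>\<^bsub>A\<^esub> (outer \<phi> (counit_coords H))" "\<lambda>n. dual_hcomp n \<phi>" "{..degree_bound}"] by simp
    then show ?thesis
      using nonneg_sum[of "{..degree_bound}" "\<lambda>n. outer \<one>\<^bsub>A\<^esub> (outer (dual_hcomp n \<phi>) (counit_coords H))"]
        outer_dual_comp_nonneg[OF dual_hcomp] by simp
  qed
  have 2: "outer \<one>\<^bsub>A\<^esub> (outer \<phi> g) \<in> nonneg" for \<phi> g
  proof -
    have "dual_mult B \<phi> \<epsilon>B = \<phi>"
    proof
      fix i
      have "pairing (dual_mult B \<phi> \<epsilon>B) (bvec i) = DB (bvec i) (\<lambda>a b. counit B b * pairing \<phi> a)"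
        unfolding B.pairing_dual_mult by (simp add: mult.commute)
      then show "dual_mult B \<phi> \<epsilon>B i = \<phi> i"
        by simp
    qed
    then show ?thesis
      using dual_mult_nonneg[OF 1 outer_counit_nonneg, of \<phi> g] by (simp only: dual_mult_outer)
  qed
  have "f = (\<Sum>p\<in>UNIV. vscale (f p) (bvec p))"
    by (rule vlin_expand[OF vlin_id])
  moreover have "vscale (f p) (bvec p) \<in> {f. outer \<one>\<^bsub>A\<^esub> f \<in> nonneg}" for p
    by (rule kvec.subspace_scale[OF subspace_dual_nonneg]) (cases p; simp add: bvec_Pair 2 del: A_simps(4))
  ultimately show ?thesis
    using kvec.subspace_sum[OF subspace_dual_nonneg, of UNIV "\<lambda>p. vscale (f p) (bvec p)"] by simp
qed

text \<open>An operator with values in \<open>1 # H\<close> is a sum of rank-one operators, each a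
  value times a coordinate functional. Such an operator is the product of an element of the double
  of H and an element of the dual.\<close>

lemma nonneg_eq: "nonneg = Rset"
proof
  show "Rset \<subseteq> nonneg"
  proof
    fix t assume t: "t \<in> Rset"
    have "t = (\<Sum>k\<in>UNIV. incl_DH H B (outer (\<pi> (ev t (bvec k))) (counit_coords H)) \<otimes>\<^bsub>D\<^esub> outer \<one>\<^bsub>A\<^esub> (bvec k))"
    proof (rule ev_eqI)
      fix y
      have 1: "ev (incl_DH H B (outer h (counit_coords H)) \<otimes>\<^bsub>D\<^esub> outer \<one>\<^bsub>A\<^esub> f) y = vscale (pairing f y) (outer \<one>\<^bsub>B\<^esub> h)" for h f
      proof -
        have "incl_DH H B (outer h (counit_coords H)) = outer (outer \<one>\<^bsub>B\<^esub> h) (counit_coords A)"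
        proof (rule ev_eqI)
          fix y
          have "counit H (\<pi> y) = counit A y"
            by (rule lin_eq_outerI[where t=y and f="\<lambda>y. counit H (\<pi> y)" and g="counit A"])
               (simp_all add: coef_outer A_counit_outer lin_scale[OF V.lin_counit[OF vlin_id]] AH.lin_counit[OF vlin_id])
          then show "ev (incl_DH H B (outer h (counit_coords H))) y = ev (outer (outer \<one>\<^bsub>B\<^esub> h) (counit_coords A)) y"
            by (simp add: ev_incl_DH ev_outer vlin_scale[OF vlin_outer_right[OF vlin_id]])
        qed
        then show ?thesis
          unfolding D_def by (simp add: AH.ev_base_mult ev_outer AH.mult_scale outer_one_mult)
      qed
      have "ev t y = (\<Sum>k\<in>UNIV. vscale (y k) (ev t (bvec k)))"
        by (rule vlin_expand[OF vlin_ev[OF vlin_id]])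
      also have "\<dots> = ev (\<Sum>k\<in>UNIV. incl_DH H B (outer (\<pi> (ev t (bvec k))) (counit_coords H)) \<otimes>\<^bsub>D\<^esub> outer \<one>\<^bsub>A\<^esub> (bvec k)) y"
        unfolding vlin_sum[OF vlin_ev_left[OF vlin_id]] 1 pairing_bvec RsetD[OF t, symmetric] ..
      finally show "ev t y = ev (\<Sum>k\<in>UNIV. incl_DH H B (outer (\<pi> (ev t (bvec k))) (counit_coords H)) \<otimes>\<^bsub>D\<^esub> outer \<one>\<^bsub>A\<^esub> (bvec k)) y" .
    qed
    moreover have "incl_DH H B r \<otimes>\<^bsub>D\<^esub> outer \<one>\<^bsub>A\<^esub> f \<in> nonneg" for r f
      by (rule generate_ring.eng_mult[OF generate_ring.incl dual_nonneg]) simp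
    ultimately show "t \<in> nonneg"
      using nonneg_sum[of UNIV "\<lambda>k. incl_DH H B (outer (\<pi> (ev t (bvec k))) (counit_coords H)) \<otimes>\<^bsub>D\<^esub> outer \<one>\<^bsub>A\<^esub> (bvec k)"]
      by simp
  qed
qed (rule nonneg_subset)

section \<open>Degrees of the generators and of coefficients\<close>

lemma acomp_int_scale: "t \<in> acomp_int j \<Longrightarrow> vscale c t \<in> acomp_int j"
  unfolding acomp_int_def mem_Collect_eq vlin_scale[OF vlin_PA0] by (simp add: fscale_def zero_fun_def)

lemma acomp_int_zero: "0 \<in> acomp_int j"
  by (simp add: acomp_int_def vlin_zero[OF vlin_PA0])

text \<open>The operator of b is the counit times b, and the counit lives in degree zero.\<close>

lemma incl_B_dcomp: "b \<in> comp B m \<Longrightarrow> incl_B H B b \<in> dcomp (- int m)"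
  unfolding dcomp_def mem_Collect_eq ev_incl_B
proof (intro allI impI)
  fix i y assume b: "b \<in> comp B m" and y: "y \<in> acomp i"
  have o: "outer b \<one>\<^bsub>H\<^esub> \<in> acomp_int (int m)"
    by (simp only: acomp_int_acomp outer_acomp[OF b])
  show "vscale (counit A y) (outer b \<one>\<^bsub>H\<^esub>) \<in> acomp_int (int i - - int m)"
  proof (cases "i = 0")
    case True
    then show ?thesis
      using acomp_int_scale[OF o] by simp
  next
    case False
    have "counit A (PA i z) = 0" for z
      by (rule lin_eq_outerI[where t=z and f="\<lambda>z. counit A (PA i z)" and g="\<lambda>z. 0"])
         (use False in \<open>simp_all add: AH.lin_counit lin_zero_fun PA_outer A_counit_outer counit_comp[OF hcomp_props(1)]\<close>)
    from this[of y] have "counit A y = 0"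
      using y by (simp add: acomp_def)
    then show ?thesis
      using acomp_int_zero by simp
  qed
qed

lemma incl_DH_dcomp: "incl_DH H B r \<in> dcomp 0"
  unfolding dcomp_def mem_Collect_eq ev_incl_DH
proof (intro allI impI)
  fix i y assume y: "y \<in> acomp i"
  have o: "outer \<one>\<^bsub>B\<^esub> (ev r (\<pi> y)) \<in> acomp_int (int 0)"
    unfolding acomp_int_acomp by (rule outer_acomp[OF one_comp])
  show "outer \<one>\<^bsub>B\<^esub> (ev r (\<pi> y)) \<in> acomp_int (int i - 0)"
  proof (cases "i = 0")
    case True
    then show ?thesis
      using o by simp
  next
    case False
    have "\<pi> (PA i z) = 0" for z
      by (rule vec_eq_outerI[where t=z and f="\<lambda>z. \<pi> (PA i z)" and g="\<lambda>z. 0"])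
         (use False in \<open>simp_all add: vlin_zero_fun PA_outer coef_outer counit_comp[OF hcomp_props(1)]\<close>)
    from this[of y] have "\<pi> y = 0"
      using y by (simp add: acomp_def)
    then show ?thesis
      using acomp_int_zero by (simp add: vlin_zero[OF vlin_ev[OF vlin_id]] vlin_zero[OF vlin_outer_right[OF vlin_id]])
  qed
qed

lemma coef_acomp_int:
  assumes z: "z \<in> acomp_int j" and \<theta>: "\<And>i x. int i = j \<Longrightarrow> x \<in> comp B i \<Longrightarrow> pairing \<theta> x = 0"
  shows "coef \<theta> z = 0"
proof -
  have "coef \<theta> (PA n z) = 0" for n
  proof (cases "int n = j")
    case True
    show ?thesis
      by (rule vec_eq_outerI[where t=z and f="\<lambda>z. coef \<theta> (PA n z)" and g="\<lambda>z. 0"])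
         (simp_all add: vlin_zero_fun PA_outer coef_outer \<theta>[OF True hcomp_props(1)])
  next
    case False
    then show ?thesis
      using z by (simp add: acomp_int_def vlin_zero[OF vlin_coef0])
  qed
  then have "coef \<theta> (\<Sum>n\<le>degree_bound. PA n z) = 0"
    by (simp add: vlin_sum[OF vlin_coef0])
  then show ?thesis
    by (simp add: sum_PA)
qed

text \<open>Arguments \<open>1 # y\<close> have degree zero, so their values have degree -k, where
  \<open>\<theta>\<close> vanishes.\<close>

lemma qcoef_dcomp:
  assumes d: "d \<in> dcomp k" and \<theta>: "\<And>i x. int i = - k \<Longrightarrow> x \<in> comp B i \<Longrightarrow> pairing \<theta> x = 0"
  shows "qcoef \<theta> d = 0"
proof (rule ev_eqI)
  fix y
  have "ev d (outer \<one>\<^bsub>B\<^esub> y) \<in> acomp_int (int 0 - k)"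
    using d outer_acomp[OF one_comp, of y] unfolding dcomp_def by blast
  then have "coef \<theta> (ev d (outer \<one>\<^bsub>B\<^esub> y)) = 0"
    by (rule coef_acomp_int) (use \<theta> in auto)
  then show "ev (qcoef \<theta> d) y = ev 0 y"
    by (simp add: ev_qcoef vlin_zero[OF vlin_ev_left[OF vlin_id]])
qed

text \<open>The top component is a line, so H acts on x by a character \<open>\<chi>\<close> and x
  coacts by a grouplike \<open>\<gamma>\<close>. Moving \<open>1 # h\<close> past x twists h by
  \<open>\<chi>\<close>, and moving an operator past x multiplies its argument by
  \<open>\<gamma>\<close>. Both changes are invertible.\<close>

lemma twist:
  assumes x: "x \<in> comp B N" "x \<noteq> 0" and \<theta>: "\<And>y. hcomp N y = vscale (pairing \<theta> y) x"
  shows "\<exists>r. incl_DH H B r \<otimes>\<^bsub>D\<^esub> incl_B H B x = incl_B H B x \<otimes>\<^bsub>D\<^esub> incl_DH H B u"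
proof -
  define \<chi> where "\<chi> h = pairing \<theta> (h \<rightharpoonup> x)" for h
  define \<gamma> where "\<gamma> = (\<lambda>i. pairing \<theta> (ycoact B x i))"
  have in_comp: "y = vscale (pairing \<theta> y) x" if "y \<in> comp B N" for y
  proof -
    have h: "hcomp N y = y"
      using hcomp_comp[OF that, of N] by simp
    show ?thesis
      using \<theta>[of y] unfolding h .
  qed
  have \<theta>x: "pairing \<theta> x = 1"
  proof -
    obtain i where "x i \<noteq> 0"
      using x(2) by (auto simp: fun_eq_iff)
    then show ?thesis
      using fun_cong[OF in_comp[OF x(1)], of i] unfolding vscale_apply mult_cancel_right1 by blast
  qed
  have \<chi>: "h \<rightharpoonup> x = vscale (\<chi> h) x" for h
    unfolding \<chi>_def by (rule in_comp[OF comp_act[OF x(1)]])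
  have lin_\<chi>0: "lin \<chi>"
    unfolding \<chi>_def by simp
  note lin_\<chi> = lin_comp[OF lin_\<chi>0]
  have \<chi>_mult: "\<chi> (h \<otimes>\<^bsub>H\<^esub> g) = \<chi> h * \<chi> g" for h g
  proof -
    have "(h \<otimes>\<^bsub>H\<^esub> g) \<rightharpoonup> x = h \<rightharpoonup> (g \<rightharpoonup> x)"
      by (rule act_mult)
    also have "\<dots> = h \<rightharpoonup> (vscale (\<chi> g) x)"
      by (simp only: \<chi>)
    also have "\<dots> = vscale (\<chi> g) (h \<rightharpoonup> x)"
      by (rule vlin_scale) simp
    also have "\<dots> = vscale (\<chi> g) (vscale (\<chi> h) x)"
      by (simp only: \<chi>)
    finally have "pairing \<theta> ((h \<otimes>\<^bsub>H\<^esub> g) \<rightharpoonup> x) = \<chi> g * (\<chi> h * pairing \<theta> x)"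
      by (simp only: pairing_simps)
    then show ?thesis
      by (simp only: \<chi>_def[symmetric] \<theta>x mult_1_right) (rule mult.commute)
  qed
  have \<chi>_one: "\<chi> \<one>\<^bsub>H\<^esub> = 1"
    by (simp only: \<chi>_def act_one \<theta>x)
  have coact: "ycoact B x = tens vscale \<gamma> x"
    unfolding tens_def \<gamma>_def by (rule ext, rule in_comp[OF comp_coact[OF x(1)]])
  have sw_coact: "CB x F = F \<gamma> x" if "\<And>b. lin (\<lambda>a. F a b)" "\<And>a. lin (F a)" for F :: "_ \<Rightarrow> _ \<Rightarrow> 'k"
    unfolding coact by (rule sw_tens[OF that])
  have \<gamma>_comult: "DH \<gamma> P = P \<gamma> \<gamma>" if P: "\<And>b. lin (\<lambda>a. P a b)" "\<And>a. lin (P a)" for P :: "_ \<Rightarrow> _ \<Rightarrow> 'k"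
  proof -
    have l: "vlin f \<Longrightarrow> lin (\<lambda>x. P (f x) b)" "vlin g \<Longrightarrow> lin (\<lambda>x. P a (g x))"
      for f :: "('c \<Rightarrow> 'k) \<Rightarrow> _" and g :: "('d \<Rightarrow> 'k) \<Rightarrow> _" and a b
      using lin_comp[OF P(1)] lin_comp[OF P(2)] by auto
    have "CB x (\<lambda>g y. DH g (\<lambda>g1 g2. P g1 g2 * pairing \<theta> y)) = CB x (\<lambda>g y. CB y (\<lambda>h z. P g h * pairing \<theta> z))"
      by (rule sw_coact_coassoc) (simp_all add: l P)
    then show ?thesis
      by (simp add: sw_coact l P \<theta>x)
  qed
  have \<gamma>_counit: "counit H \<gamma> = 1"
  proof -
    have *: "CB x (\<lambda>g y. counit H g * pairing \<theta> y) = counit H \<gamma> * pairing \<theta> x"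
      by (rule sw_coact) simp_all
    show ?thesis
      using sw_coact_counit[OF lin_pairing0[of \<theta>], of x] unfolding * \<theta>x by simp
  qed
  have \<gamma>_inv: "antipode H \<gamma> \<otimes>\<^bsub>H\<^esub> \<gamma> = \<one>\<^bsub>H\<^esub>"
  proof (rule vec_eqI)
    fix p
    show "pairing p (antipode H \<gamma> \<otimes>\<^bsub>H\<^esub> \<gamma>) = pairing p \<one>\<^bsub>H\<^esub>"
      using V.sw_antipode(1)[OF lin_pairing0[of p], of \<gamma>] by (simp add: \<gamma>_comult \<gamma>_counit)
  qed
  define tw :: "(('h \<Rightarrow> 'k) \<Rightarrow> 'k) \<Rightarrow> ('h \<Rightarrow> 'k) \<Rightarrow> 'h \<Rightarrow> 'k" where "tw f h = DH h (\<lambda>h1 h2. vscale (f h1) h2)" for f h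
  have vlin_tw: "vlin (tw f)" if "lin f" for f
  proof (rule vlin_pairingI)
    fix p
    have "pairing p (tw f h) = DH h (\<lambda>h1 h2. f h1 * pairing p h2)" for h
      by (simp add: tw_def)
    then show "lin (\<lambda>h. pairing p (tw f h))"
      by (simp add: that lin_comp[OF that])
  qed
  \<comment> \<open>The character composed with the antipode is its convolution inverse.\<close>
  have tw_inv: "tw \<chi> (tw (\<lambda>h. \<chi> (antipode H h)) h) = h" for h
  proof (rule vec_eqI)
    fix p
    have "pairing p (tw \<chi> (tw (\<lambda>h. \<chi> (antipode H h)) h))
      = DH h (\<lambda>h1 h'. pairing p (tw \<chi> (vscale (\<chi> (antipode H h1)) h')))"
      unfolding tw_def[of "\<lambda>h. \<chi> (antipode H h)"]
      by (rule lin_sw[where G="\<lambda>z. pairing p (tw \<chi> z)"]) (rule lin_comp[OF lin_pairing0 vlin_tw[OF lin_\<chi>0]])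
    also have "\<dots> = DH h (\<lambda>h1 h'. DH h' (\<lambda>h2 h3. \<chi> (antipode H h1 \<otimes>\<^bsub>H\<^esub> h2) * pairing p h3))"
      unfolding vlin_scale[OF vlin_tw[OF lin_\<chi>0]] \<chi>_mult by (simp add: tw_def sw_mult_right mult.assoc)
    also have "\<dots> = pairing p h"
      using V.sw_antipode_cancel(1)[of "\<lambda>a b. \<chi> a * pairing p b" h] by (simp add: lin_\<chi> lin_\<chi>0 \<chi>_one)
    finally show "pairing p (tw \<chi> (tw (\<lambda>h. \<chi> (antipode H h)) h)) = pairing p h" .
  qed
  \<comment> \<open>Undoes the shift by \<open>\<gamma>\<close> in the argument and the twist by
    \<open>\<chi>\<close> in the value.\<close>
  define r where "r = mat (\<lambda>k. tw (\<lambda>h. \<chi> (antipode H h)) (ev u (antipode H \<gamma> \<otimes>\<^bsub>H\<^esub> k)))"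
  have ev_r: "ev r k = tw (\<lambda>h. \<chi> (antipode H h)) (ev u (antipode H \<gamma> \<otimes>\<^bsub>H\<^esub> k))" for k
    unfolding r_def by (rule ev_mat) (rule vlin_comp[OF vlin_tw]; simp add: lin_\<chi>)
  have outer_tw: "outer \<one>\<^bsub>B\<^esub> h \<otimes>\<^bsub>A\<^esub> outer x \<one>\<^bsub>H\<^esub> = outer x (tw \<chi> h)" for h
  proof (rule vec_eqI)
    fix p
    show "pairing p (outer \<one>\<^bsub>B\<^esub> h \<otimes>\<^bsub>A\<^esub> outer x \<one>\<^bsub>H\<^esub>) = pairing p (outer x (tw \<chi> h))"
      by (simp add: outer_mult \<chi> tw_def vlin_scale[OF vlin_outer[OF vlin_id]]
          vlin_sw[OF vlin_outer_right[OF vlin_id]] vlin_scale[OF vlin_outer_right[OF vlin_id]])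
  qed
  have final: "incl_DH H B r \<otimes>\<^bsub>D\<^esub> incl_B H B x = incl_B H B x \<otimes>\<^bsub>D\<^esub> incl_DH H B u"
  proof (rule ev_eqI, rule vec_eqI)
    fix y p
    let ?G = "\<lambda>a b. pairing p (outer \<one>\<^bsub>B\<^esub> (ev r (a \<otimes>\<^bsub>H\<^esub> \<pi> y)) \<otimes>\<^bsub>A\<^esub> outer b \<one>\<^bsub>H\<^esub>)"
    have inner: "DB z (\<lambda>y1 y2. CB y2 (\<lambda>h y0. c * (counit B y0 * pairing p (a \<otimes>\<^bsub>A\<^esub> outer y1 h))))
      = c * pairing p (a \<otimes>\<^bsub>A\<^esub> outer z \<one>\<^bsub>H\<^esub>)" for z c a
    proof -
      have "CB y2 (\<lambda>h y0. c * (counit B y0 * pairing p (a \<otimes>\<^bsub>A\<^esub> outer y1 h)))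
        = counit B y2 * (c * pairing p (a \<otimes>\<^bsub>A\<^esub> outer y1 \<one>\<^bsub>H\<^esub>))" for y1 y2
        unfolding mult.left_commute[of c] by (rule sw_counit_coact) simp
      then show ?thesis
        by simp
    qed
    have "pairing p (ev (incl_DH H B r \<otimes>\<^bsub>D\<^esub> incl_B H B x) y)
      = DA (outer x \<one>\<^bsub>H\<^esub>) (\<lambda>w1 w'. DA w' (\<lambda>w2 w3. pairing p (outer \<one>\<^bsub>B\<^esub> (ev r (\<pi> w1 \<otimes>\<^bsub>H\<^esub> (\<pi> y \<otimes>\<^bsub>H\<^esub> antipode H (\<pi> w3)))) \<otimes>\<^bsub>A\<^esub> w2)))"
      by (subst lin_D_mult[OF lin_pairing0])
         (simp add: ev_incl_B AH.sw_comult_scale ev_incl_DH \<pi>_mult \<pi>_antipode)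
    also have "\<dots> = DB x (\<lambda>x1 x2. CB x2 (\<lambda>g x0. counit B x1 * ?G g x0))"
      by (simp add: A_comult_outer V.comult_one_sw coef_outer V.scale_mult V.mult_scale AH.scale_mult
          vlin_scale[OF V.vlin_antipode[OF vlin_id]] vlin_scale[OF vlin_ev[OF vlin_id]] vlin_scale[OF vlin_outer_right[OF vlin_id]]
          sw_mult_right mult.assoc inner)
    also have "\<dots> = ?G \<gamma> x"
      by (simp add: sw_coact sw_mult_right[symmetric])
    also have "\<dots> = pairing p (outer x (tw \<chi> (ev r (\<gamma> \<otimes>\<^bsub>H\<^esub> \<pi> y))))"
      by (simp only: outer_tw)
    also have "ev r (\<gamma> \<otimes>\<^bsub>H\<^esub> \<pi> y) = tw (\<lambda>h. \<chi> (antipode H h)) (ev u (\<pi> y))"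
      unfolding ev_r V.assoc[symmetric] \<gamma>_inv V.one_left ..
    also have "pairing p (outer x (tw \<chi> (tw (\<lambda>h. \<chi> (antipode H h)) (ev u (\<pi> y)))))
      = pairing p (ev (incl_B H B x \<otimes>\<^bsub>D\<^esub> incl_DH H B u) y)"
      unfolding tw_inv ev_incl_B_mult ev_incl_DH outer_mult_one_right V.one_left ..
    finally show "pairing p (ev (incl_DH H B r \<otimes>\<^bsub>D\<^esub> incl_B H B x) y) = pairing p (ev (incl_B H B x \<otimes>\<^bsub>D\<^esub> incl_DH H B u) y)" .
  qed
  show ?thesis
    by (rule exI[where x=r], rule final)
qed

end

section \<open>Modules over finite-dimensional algebras\<close>

text \<open>Only additivity is recorded, since some maps below go between modules over different
  rings, such as \<open>cf\<close> from a module over the double of the bosonization to one over the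
  double of H.\<close>

definition add_hom :: "('a, 'm) ring_scheme \<Rightarrow> ('b, 'n) ring_scheme \<Rightarrow> ('a \<Rightarrow> 'b) \<Rightarrow> bool" where
  "add_hom G G' h \<longleftrightarrow> abelian_group G \<and> abelian_group G' \<and> (\<forall>x\<in>carrier G. h x \<in> carrier G') \<and>
    (\<forall>x\<in>carrier G. \<forall>y\<in>carrier G. h (x \<oplus>\<^bsub>G\<^esub> y) = h x \<oplus>\<^bsub>G'\<^esub> h y)"

lemma add_hom_closed: "add_hom G G' h \<Longrightarrow> x \<in> carrier G \<Longrightarrow> h x \<in> carrier G'"
  and add_hom_add: "add_hom G G' h \<Longrightarrow> x \<in> carrier G \<Longrightarrow> y \<in> carrier G \<Longrightarrow> h (x \<oplus>\<^bsub>G\<^esub> y) = h x \<oplus>\<^bsub>G'\<^esub> h y"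
  by (auto simp: add_hom_def)

lemma add_hom_zero:
  assumes h: "add_hom G G' h"
  shows "h \<zero>\<^bsub>G\<^esub> = \<zero>\<^bsub>G'\<^esub>"
proof -
  interpret G: abelian_group G using h by (simp add: add_hom_def)
  interpret G': abelian_group G' using h by (simp add: add_hom_def)
  have c: "h \<zero>\<^bsub>G\<^esub> \<in> carrier G'"
    by (rule add_hom_closed[OF h G.zero_closed])
  have "h \<zero>\<^bsub>G\<^esub> = h \<zero>\<^bsub>G\<^esub> \<oplus>\<^bsub>G'\<^esub> h \<zero>\<^bsub>G\<^esub>"
    using add_hom_add[OF h G.zero_closed G.zero_closed] by simp
  then have "\<ominus>\<^bsub>G'\<^esub> h \<zero>\<^bsub>G\<^esub> \<oplus>\<^bsub>G'\<^esub> h \<zero>\<^bsub>G\<^esub> = \<ominus>\<^bsub>G'\<^esub> h \<zero>\<^bsub>G\<^esub> \<oplus>\<^bsub>G'\<^esub> (h \<zero>\<^bsub>G\<^esub> \<oplus>\<^bsub>G'\<^esub> h \<zero>\<^bsub>G\<^esub>)"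
    by simp
  then show ?thesis
    using c by (simp add: G'.l_neg G'.a_assoc[symmetric])
qed

lemma add_hom_minus:
  assumes h: "add_hom G G' h" and x: "x \<in> carrier G"
  shows "h (\<ominus>\<^bsub>G\<^esub> x) = \<ominus>\<^bsub>G'\<^esub> h x"
proof -
  interpret G: abelian_group G using h by (simp add: add_hom_def)
  interpret G': abelian_group G' using h by (simp add: add_hom_def)
  have "h (\<ominus>\<^bsub>G\<^esub> x) \<oplus>\<^bsub>G'\<^esub> h x = \<zero>\<^bsub>G'\<^esub>"
    using add_hom_add[OF h G.a_inv_closed[OF x] x] x add_hom_zero[OF h] by (simp add: G.l_neg)
  then show ?thesis
    using G'.minus_equality[of "h (\<ominus>\<^bsub>G\<^esub> x)" "h x"] add_hom_closed[OF h] x by simp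
qed

lemma add_hom_diff:
  assumes h: "add_hom G G' h" and x: "x \<in> carrier G" "y \<in> carrier G"
  shows "h (x \<ominus>\<^bsub>G\<^esub> y) = h x \<ominus>\<^bsub>G'\<^esub> h y"
proof -
  interpret G: abelian_group G using h by (simp add: add_hom_def)
  show ?thesis
    unfolding a_minus_def using add_hom_add[OF h x(1) G.a_inv_closed[OF x(2)]] add_hom_minus[OF h x(2)] by simp
qed

lemma add_hom_finsum:
  assumes h: "add_hom G G' h" and I: "finite I" and f: "\<And>i. i \<in> I \<Longrightarrow> f i \<in> carrier G"
  shows "h (finsum G f I) = finsum G' (\<lambda>i. h (f i)) I"
proof -
  interpret G: abelian_group G using h by (simp add: add_hom_def)
  interpret G': abelian_group G' using h by (simp add: add_hom_def)
  show ?thesis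
    using I f
  proof (induction I rule: finite_induct)
    case empty
    show ?case
      by (simp add: add_hom_zero[OF h])
  next
    case (insert i I)
    then have "f \<in> I \<rightarrow> carrier G" "f i \<in> carrier G" "(\<lambda>i. h (f i)) \<in> I \<rightarrow> carrier G'" "h (f i) \<in> carrier G'"
      using add_hom_closed[OF h] by auto
    then show ?case
      using insert by (simp add: G.finsum_insert G'.finsum_insert add_hom_add[OF h] G.finsum_closed)
  qed
qed

lemma add_hom_comp: "add_hom G G' h \<Longrightarrow> add_hom G' G'' k \<Longrightarrow> add_hom G G'' (\<lambda>x. k (h x))"
  unfolding add_hom_def by simp

lemma (in abelian_group) add_hom_finsum_fun:
  assumes I: "finite I" and G': "abelian_group G'" and h: "\<And>i. i \<in> I \<Longrightarrow> add_hom G' G (h i)"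
  shows "add_hom G' G (\<lambda>x. finsum G (\<lambda>i. h i x) I)"
  unfolding add_hom_def
proof (intro conjI ballI)
  interpret G': abelian_group G' by fact
  have c: "x \<in> carrier G' \<Longrightarrow> (\<lambda>i. h i x) \<in> I \<rightarrow> carrier G" for x
    using add_hom_closed[OF h] by auto
  show "finsum G (\<lambda>i. h i x) I \<in> carrier G" if "x \<in> carrier G'" for x
    by (rule finsum_closed[OF c[OF that]])
  show "finsum G (\<lambda>i. h i (x \<oplus>\<^bsub>G'\<^esub> y)) I = finsum G (\<lambda>i. h i x) I \<oplus> finsum G (\<lambda>i. h i y) I"
    if x: "x \<in> carrier G'" and y: "y \<in> carrier G'" for x y
  proof -
    have "finsum G (\<lambda>i. h i (x \<oplus>\<^bsub>G'\<^esub> y)) I = finsum G (\<lambda>i. h i x \<oplus> h i y) I"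
    proof (rule finsum_cong'[OF refl])
      show "(\<lambda>i. h i x \<oplus> h i y) \<in> I \<rightarrow> carrier G"
        using c[OF x] c[OF y] by auto
      show "h i (x \<oplus>\<^bsub>G'\<^esub> y) = h i x \<oplus> h i y" if "i \<in> I" for i
        by (rule add_hom_add[OF h[OF that] x y])
    qed
    also have "\<dots> = finsum G (\<lambda>i. h i x) I \<oplus> finsum G (\<lambda>i. h i y) I"
      by (rule finsum_addf[OF c[OF x] c[OF y]])
    finally show ?thesis .
  qed
qed (use G' in \<open>simp_all add: abelian_group_axioms\<close>)

lemma (in abelian_group) finsum_in:
  assumes "finite I" "\<And>i. i \<in> I \<Longrightarrow> f i \<in> P" "P \<subseteq> carrier G" "\<zero> \<in> P" "\<And>x y. x \<in> P \<Longrightarrow> y \<in> P \<Longrightarrow> x \<oplus> y \<in> P"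
  shows "finsum G f I \<in> P"
  using assms(1,2)
proof (induction I rule: finite_induct)
  case empty
  show ?case
    using assms(4) by simp
next
  case (insert i I)
  then have "f \<in> I \<rightarrow> carrier G" "f i \<in> carrier G"
    using assms(3) by auto
  then show ?case
    using insert assms(5) by (simp add: finsum_insert)
qed

lemma (in abelian_group) finsum_swap:
  assumes I: "finite I" "finite J" and g: "\<And>i j. i \<in> I \<Longrightarrow> j \<in> J \<Longrightarrow> g i j \<in> carrier G"
  shows "finsum G (\<lambda>i. finsum G (g i) J) I = finsum G (\<lambda>j. finsum G (\<lambda>i. g i j) I) J"
  using I(1) g
proof (induction I rule: finite_induct)
  case empty
  show ?case
    by (simp add: finsum_zero)
next
  case (insert i I)
  have c1: "finsum G (g i') J \<in> carrier G" if "i' \<in> insert i I" for i'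
    by (rule finsum_closed) (use insert.prems that in auto)
  have c2: "(\<lambda>j. finsum G (\<lambda>i. g i j) I) \<in> J \<rightarrow> carrier G"
    by (intro Pi_I finsum_closed) (use insert.prems in auto)
  have "finsum G (\<lambda>i. finsum G (g i) J) (insert i I) = finsum G (g i) J \<oplus> finsum G (\<lambda>i. finsum G (g i) J) I"
    by (rule finsum_insert) (use insert.hyps c1 in auto)
  also have "\<dots> = finsum G (g i) J \<oplus> finsum G (\<lambda>j. finsum G (\<lambda>i. g i j) I) J"
    using insert by simp
  also have "\<dots> = finsum G (\<lambda>j. g i j \<oplus> finsum G (\<lambda>i. g i j) I) J"
    by (rule finsum_addf[symmetric]) (use insert.prems c2 in auto)
  also have "\<dots> = finsum G (\<lambda>j. finsum G (\<lambda>i. g i j) (insert i I)) J"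
  proof (rule finsum_cong'[OF refl])
    show "(\<lambda>j. finsum G (\<lambda>i. g i j) (insert i I)) \<in> J \<rightarrow> carrier G"
      by (intro Pi_I finsum_closed) (use insert.prems in auto)
    show "g i j \<oplus> finsum G (\<lambda>i. g i j) I = finsum G (\<lambda>i. g i j) (insert i I)" if "j \<in> J" for j
      by (rule finsum_insert[symmetric]) (use insert.hyps insert.prems that in auto)
  qed
  finally show ?case .
qed

lemma (in abelian_group) subgroup_iff:
  "subgroup P (add_monoid G) \<longleftrightarrow> P \<subseteq> carrier G \<and> \<zero> \<in> P \<and> (\<forall>x\<in>P. \<forall>y\<in>P. x \<oplus> y \<in> P) \<and> (\<forall>x\<in>P. \<ominus> x \<in> P)"
  by (auto simp: subgroup_def a_inv_def)

lemma (in abelian_group) generate_subset: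
  assumes "X \<subseteq> P" "P \<subseteq> carrier G" "\<zero> \<in> P" "\<And>x y. x \<in> P \<Longrightarrow> y \<in> P \<Longrightarrow> x \<oplus> y \<in> P" "\<And>x. x \<in> P \<Longrightarrow> \<ominus> x \<in> P"
  shows "generate (add_monoid G) X \<subseteq> P"
  by (rule group.generate_subgroup_incl[OF a_group assms(1)]) (use assms in \<open>auto simp: subgroup_iff\<close>)

lemma (in abelian_group) generate_closed:
  assumes "X \<subseteq> carrier G"
  shows "generate (add_monoid G) X \<subseteq> carrier G" "\<zero> \<in> generate (add_monoid G) X"
    "\<And>x y. x \<in> generate (add_monoid G) X \<Longrightarrow> y \<in> generate (add_monoid G) X \<Longrightarrow> x \<oplus> y \<in> generate (add_monoid G) X"
    "\<And>x. x \<in> generate (add_monoid G) X \<Longrightarrow> \<ominus> x \<in> generate (add_monoid G) X"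
    "X \<subseteq> generate (add_monoid G) X"
  using group.generate_is_subgroup[OF a_group, of X] assms generate.incl[of _ X "add_monoid G"]
  by (auto simp: subgroup_iff)

locale alg_module =
  fixes A :: "('i::finite \<Rightarrow> 'k::field) ring" and M :: "('i \<Rightarrow> 'k, 'm) module" (structure)
  assumes algebra: "fd_algebra A" and left_module: "left_module A M"
begin

sublocale abelian_group M
  using left_module by (simp add: left_module_def)

lemma A_simps [simp]: "carrier A = UNIV" "a \<oplus>\<^bsub>A\<^esub> b = a + b"
  using fd_algebra.carrier_eq[OF algebra] fd_algebra.add_eq[OF algebra] by auto

lemma sm_closed [simp]: "x \<in> carrier M \<Longrightarrow> a \<odot> x \<in> carrier M"
  using left_module.smult_closed[OF left_module] by simp

lemma sm_ladd: "x \<in> carrier M \<Longrightarrow> (a + b) \<odot> x = a \<odot> x \<oplus> b \<odot> x"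
  using left_module.smult_l_distr[OF left_module, of a b x] by simp

lemma sm_radd: "x \<in> carrier M \<Longrightarrow> y \<in> carrier M \<Longrightarrow> a \<odot> (x \<oplus> y) = a \<odot> x \<oplus> a \<odot> y"
  using left_module.smult_r_distr[OF left_module, of a x y] by simp

lemma sm_mult: "x \<in> carrier M \<Longrightarrow> (a \<otimes>\<^bsub>A\<^esub> b) \<odot> x = a \<odot> (b \<odot> x)"
  using left_module.smult_assoc[OF left_module, of a b x] by simp

lemma sm_one: "x \<in> carrier M \<Longrightarrow> \<one>\<^bsub>A\<^esub> \<odot> x = x"
  by (rule left_module.smult_one[OF left_module])

lemma add_hom_sm: "add_hom M M (\<lambda>x. a \<odot> x)"
  unfolding add_hom_def by (simp add: sm_radd abelian_group_axioms)

lemma sm_rzero [simp]: "a \<odot> \<zero> = \<zero>"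
  by (rule add_hom_zero[OF add_hom_sm])

lemma sm_rminus: "x \<in> carrier M \<Longrightarrow> a \<odot> (\<ominus> x) = \<ominus> (a \<odot> x)"
  by (rule add_hom_minus[OF add_hom_sm])

lemma sm_lzero: "x \<in> carrier M \<Longrightarrow> 0 \<odot> x = \<zero>"
proof -
  assume x: "x \<in> carrier M"
  have "0 \<odot> x \<oplus> 0 \<odot> x = 0 \<odot> x"
    using sm_ladd[OF x, of 0 0] by simp
  then have "\<ominus> (0 \<odot> x) \<oplus> (0 \<odot> x \<oplus> 0 \<odot> x) = \<ominus> (0 \<odot> x) \<oplus> 0 \<odot> x"
    by simp
  then show ?thesis
    using x by (simp add: a_assoc[symmetric] l_neg)
qed

lemma sm_lminus: "x \<in> carrier M \<Longrightarrow> (- a) \<odot> x = \<ominus> (a \<odot> x)"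
  using sm_ladd[of x "- a" a] sm_lzero[of x] minus_equality[of "(- a) \<odot> x" "a \<odot> x"] by simp

lemma sm_lsum: "finite I \<Longrightarrow> x \<in> carrier M \<Longrightarrow> (\<Sum>i\<in>I. a i) \<odot> x = finsum M (\<lambda>i. a i \<odot> x) I"
proof (induction I rule: finite_induct)
  case empty
  then show ?case
    using sm_lzero[of x] by (simp add: zero_fun_def)
next
  case (insert i I)
  have "finsum M (\<lambda>i. a i \<odot> x) (insert i I) = a i \<odot> x \<oplus> finsum M (\<lambda>i. a i \<odot> x) I"
    by (rule finsum_insert) (use insert in auto)
  also have "\<dots> = a i \<odot> x \<oplus> sum a I \<odot> x"
    using insert by (simp only:)
  also have "\<dots> = (a i + sum a I) \<odot> x"
    by (rule sm_ladd[OF insert.prems, symmetric])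
  also have "a i + sum a I = sum a (insert i I)"
    by (rule sum.insert[OF insert.hyps, symmetric])
  finally show ?case ..
qed

lemma sm_rsum: "finite I \<Longrightarrow> (\<And>i. i \<in> I \<Longrightarrow> f i \<in> carrier M) \<Longrightarrow> a \<odot> finsum M f I = finsum M (\<lambda>i. a \<odot> f i) I"
  by (rule add_hom_finsum[OF add_hom_sm])

abbreviation ks :: "'k \<Rightarrow> 'm \<Rightarrow> 'm" where
  "ks \<equiv> kscale A M"

lemma ks_closed [simp]: "x \<in> carrier M \<Longrightarrow> ks c x \<in> carrier M"
  by (simp add: kscale_def)

lemma ks_sm: "x \<in> carrier M \<Longrightarrow> ks c (a \<odot> x) = vscale c a \<odot> x"
  and sm_ks: "x \<in> carrier M \<Longrightarrow> a \<odot> ks c x = vscale c a \<odot> x"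
  unfolding kscale_def
  by (simp_all add: sm_mult[symmetric] fd_algebra.scale_mult[OF algebra] fd_algebra.mult_scale[OF algebra]
      fd_algebra.one_left[OF algebra] fd_algebra.one_right[OF algebra])

lemma ks_ladd: "x \<in> carrier M \<Longrightarrow> ks (c + d) x = ks c x \<oplus> ks d x"
proof -
  assume x: "x \<in> carrier M"
  have "vscale (c + d) \<one>\<^bsub>A\<^esub> = vscale c \<one>\<^bsub>A\<^esub> + vscale d \<one>\<^bsub>A\<^esub>"
    by (auto simp: fscale_def algebra_simps)
  then show ?thesis
    by (simp only: kscale_def sm_ladd[OF x])
qed

lemma ks_radd: "x \<in> carrier M \<Longrightarrow> y \<in> carrier M \<Longrightarrow> ks c (x \<oplus> y) = ks c x \<oplus> ks c y"
  by (simp add: kscale_def sm_radd)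

lemma ks_ks: "x \<in> carrier M \<Longrightarrow> ks c (ks d x) = ks (c * d) x"
  unfolding kscale_def[of A M d] by (simp add: ks_sm) (simp add: kscale_def)

lemma ks_one: "x \<in> carrier M \<Longrightarrow> ks 1 x = x"
  by (simp add: kscale_def sm_one)

lemma ks_zero [simp]: "x \<in> carrier M \<Longrightarrow> ks 0 x = \<zero>"
  by (simp add: kscale_def sm_lzero)

text \<open>The algebra is all of its type, so closure under the action includes scalars and,
  through \<open>- \<one>\<close>, negatives; \<open>submodule_iff\<close> links it to
  \<open>submodule\<close>.\<close>

definition sub :: "'m set \<Rightarrow> bool" where
  "sub P \<longleftrightarrow> P \<subseteq> carrier M \<and> \<zero> \<in> P \<and> (\<forall>x\<in>P. \<forall>y\<in>P. x \<oplus> y \<in> P) \<and> (\<forall>a. \<forall>x\<in>P. a \<odot> x \<in> P)"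

lemma sub_minus: "sub P \<Longrightarrow> x \<in> P \<Longrightarrow> \<ominus> x \<in> P"
proof -
  assume P: "sub P" and x: "x \<in> P"
  then have c: "x \<in> carrier M"
    by (auto simp: sub_def)
  have "\<ominus> x = (- \<one>\<^bsub>A\<^esub>) \<odot> x"
    using c by (simp add: sm_lminus sm_one)
  then show ?thesis
    using P x by (simp add: sub_def)
qed

lemma submodule_iff: "submodule P A M \<longleftrightarrow> sub P"
proof
  show "sub P \<Longrightarrow> submodule P A M"
    using sub_minus[of P] unfolding submodule_def submodule_axioms_def subgroup_iff by (auto simp: sub_def)
  show "submodule P A M \<Longrightarrow> sub P"
    unfolding submodule_def submodule_axioms_def subgroup_iff by (auto simp: sub_def)
qed

lemma subD:
  assumes "sub P"
  shows "P \<subseteq> carrier M" "\<zero> \<in> P" "\<And>x y. x \<in> P \<Longrightarrow> y \<in> P \<Longrightarrow> x \<oplus> y \<in> P" "\<And>a x. x \<in> P \<Longrightarrow> a \<odot> x \<in> P"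
  using assms by (auto simp: sub_def)

lemma sub_finsum: "sub P \<Longrightarrow> finite I \<Longrightarrow> (\<And>i. i \<in> I \<Longrightarrow> f i \<in> P) \<Longrightarrow> finsum M f I \<in> P"
  by (rule finsum_in) (auto simp: sub_def)

lemma sub_generate:
  assumes X: "X \<subseteq> carrier M" and s: "\<And>a x. x \<in> X \<Longrightarrow> a \<odot> x \<in> generate (add_monoid M) X"
  shows "sub (generate (add_monoid M) X)"
proof -
  note g = generate_closed[OF X]
  have "generate (add_monoid M) X \<subseteq> {x \<in> carrier M. \<forall>a. a \<odot> x \<in> generate (add_monoid M) X}"
    by (rule generate_subset) (use X g s in \<open>auto simp: sm_radd sm_rminus\<close>)
  then show ?thesis
    using g by (auto simp: sub_def)
qed

section \<open>Quotient modules\<close>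

context
  fixes K
  assumes K: "sub K"
begin

abbreviation "Q \<equiv> quot_module M K"
abbreviation "q \<equiv> \<lambda>x. K +>\<^bsub>M\<^esub> x"

lemma subgroup_K: "subgroup K (add_monoid M)"
  using K sub_minus[OF K] by (auto simp: subgroup_iff sub_def)

lemma abelian_subgroup_K: "abelian_subgroup K M"
  by (rule abelian_subgroupI3, rule additive_subgroup.intro, rule subgroup_K, rule abelian_group_axioms)

lemma mem_q: "x \<in> carrier M \<Longrightarrow> y \<in> q x \<longleftrightarrow> y \<in> carrier M \<and> y \<ominus> x \<in> K"
proof -
  assume x: "x \<in> carrier M"
  have "y \<ominus> x \<in> K" "y \<in> carrier M" if yq: "y \<in> q x"
  proof -
    obtain h where h: "h \<in> K" "y = h \<oplus> x"
      using yq by (auto simp: a_r_coset_def')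
    then have "h \<in> carrier M"
      using K by (auto simp: sub_def)
    then show "y \<ominus> x \<in> K" "y \<in> carrier M"
      using h x by (simp_all add: a_minus_def a_assoc r_neg)
  qed
  moreover have "y \<in> q x" if "y \<in> carrier M" "y \<ominus> x \<in> K"
  proof -
    have "y = (y \<ominus> x) \<oplus> x"
      using that x by (simp add: a_minus_def a_assoc l_neg)
    then show ?thesis
      using that by (auto simp: a_r_coset_def')
  qed
  ultimately show ?thesis
    by blast
qed

lemma q_eq: "x \<in> carrier M \<Longrightarrow> y \<in> carrier M \<Longrightarrow> x \<ominus> y \<in> K \<Longrightarrow> q x = q y"
  using a_repr_independence[of x K y] subgroup_K by (simp add: mem_q)

lemma q_self: "x \<in> carrier M \<Longrightarrow> x \<in> q x"
  using K by (simp add: mem_q a_minus_def r_neg sub_def)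

lemma q_eq_iff: "x \<in> carrier M \<Longrightarrow> y \<in> carrier M \<Longrightarrow> q x = q y \<longleftrightarrow> x \<ominus> y \<in> K"
  using q_eq q_self[of x] mem_q[of y x] by auto

lemma carrier_Q: "carrier Q = q ` carrier M"
  by (auto simp: quot_module_def A_RCOSETS_def')

lemma add_Q: "x \<in> carrier M \<Longrightarrow> y \<in> carrier M \<Longrightarrow> q x \<oplus>\<^bsub>Q\<^esub> q y = q (x \<oplus> y)"
  using abelian_subgroup.a_rcos_sum[OF abelian_subgroup_K] by (simp add: quot_module_def)

lemma zero_Q: "\<zero>\<^bsub>Q\<^esub> = q \<zero>"
  using K by (simp add: quot_module_def sub_def)

lemma smult_Q: "x \<in> carrier M \<Longrightarrow> a \<odot>\<^bsub>Q\<^esub> q x = q (a \<odot> x)"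
proof -
  assume x: "x \<in> carrier M"
  have "q (a \<odot> y) = q (a \<odot> x)" if "y \<in> q x" for y
  proof (rule q_eq)
    have y: "y \<in> carrier M" "y \<ominus> x \<in> K"
      using that mem_q[OF x] by auto
    then show "a \<odot> y \<in> carrier M" "a \<odot> x \<in> carrier M"
      using x by auto
    have "a \<odot> y \<ominus> a \<odot> x = a \<odot> (y \<ominus> x)"
      by (rule add_hom_diff[OF add_hom_sm y(1) x, symmetric])
    then show "a \<odot> y \<ominus> a \<odot> x \<in> K"
      using K y(2) by (simp add: sub_def)
  qed
  then have "(\<Union>y\<in>q x. q (a \<odot> y)) = (\<Union>y\<in>q x. q (a \<odot> x))"
    by (rule SUP_cong[OF refl])
  also have "\<dots> = q (a \<odot> x)"
    using q_self[OF x] by blast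
  finally show ?thesis
    by (simp add: quot_module_def)
qed

lemma alg_module_Q: "alg_module A Q"
proof (rule alg_module.intro)
  show "fd_algebra A"
    by (rule algebra)
  have "abelian_group Q"
  proof (rule abelian_groupI)
    show "\<And>x y z. x \<in> carrier Q \<Longrightarrow> y \<in> carrier Q \<Longrightarrow> z \<in> carrier Q \<Longrightarrow> x \<oplus>\<^bsub>Q\<^esub> y \<oplus>\<^bsub>Q\<^esub> z = x \<oplus>\<^bsub>Q\<^esub> (y \<oplus>\<^bsub>Q\<^esub> z)"
      by (auto simp: carrier_Q add_Q a_assoc)
    show "\<And>x y. x \<in> carrier Q \<Longrightarrow> y \<in> carrier Q \<Longrightarrow> x \<oplus>\<^bsub>Q\<^esub> y = y \<oplus>\<^bsub>Q\<^esub> x"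
      by (auto simp: carrier_Q add_Q a_comm)
    fix x assume "x \<in> carrier Q"
    then obtain y where y: "y \<in> carrier M" "x = q y"
      by (auto simp: carrier_Q)
    then show "\<exists>y\<in>carrier Q. y \<oplus>\<^bsub>Q\<^esub> x = \<zero>\<^bsub>Q\<^esub>"
      by (intro bexI[of _ "q (\<ominus> y)"]) (auto simp: carrier_Q add_Q zero_Q l_neg)
  qed (auto simp: carrier_Q add_Q zero_Q)
  moreover have "ring A"
    using algebra by (simp add: fd_algebra_def)
  ultimately show "left_module A Q"
    unfolding left_module_def left_module_axioms_def
    by (auto simp: carrier_Q add_Q smult_Q sm_ladd sm_radd sm_mult sm_one)
qed

end

end

text \<open>The scalar multiplication enters \<open>ktensor\<close> only through \<open>kscale R N\<close>, so no module structure of \<open>N\<close> over \<open>R\<close> is assumed.\<close>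

locale ktensor_space =
  fixes D :: "('i::finite \<Rightarrow> 'k::field) ring" and R :: "('i \<Rightarrow> 'k) ring" and N :: "('i \<Rightarrow> 'k, 'm) module" (structure)
  assumes D: "fd_algebra D" and N: "abelian_group N"
    and k_closed [simp]: "x \<in> carrier N \<Longrightarrow> kscale R N c x \<in> carrier N"
    and k_ladd: "x \<in> carrier N \<Longrightarrow> kscale R N (c + d) x = kscale R N c x \<oplus> kscale R N d x"
    and k_radd: "x \<in> carrier N \<Longrightarrow> y \<in> carrier N \<Longrightarrow> kscale R N c (x \<oplus> y) = kscale R N c x \<oplus> kscale R N c y"
    and k_mult: "x \<in> carrier N \<Longrightarrow> kscale R N c (kscale R N d x) = kscale R N (c * d) x"
    and k_one: "x \<in> carrier N \<Longrightarrow> kscale R N 1 x = x"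
begin

sublocale N: abelian_group N
  by (rule N)

abbreviation "\<kappa> \<equiv> kscale R N"
abbreviation "TT \<equiv> ktensor D R N"

lemma add_hom_k: "add_hom N N (\<kappa> c)"
  unfolding add_hom_def by (simp add: k_radd N)

lemma k_lzero: "x \<in> carrier N \<Longrightarrow> \<kappa> 0 x = \<zero>"
proof -
  assume x: "x \<in> carrier N"
  have "\<kappa> 0 x \<oplus> \<kappa> 0 x = \<kappa> 0 x"
    using k_ladd[OF x, of 0 0] by simp
  then have "\<ominus> (\<kappa> 0 x) \<oplus> (\<kappa> 0 x \<oplus> \<kappa> 0 x) = \<ominus> (\<kappa> 0 x) \<oplus> \<kappa> 0 x"
    by simp
  then show ?thesis
    using x by (simp add: N.a_assoc[symmetric] N.l_neg)
qed

lemma k_sum: "finite I \<Longrightarrow> x \<in> carrier N \<Longrightarrow> \<kappa> (\<Sum>i\<in>I. c i) x = finsum N (\<lambda>i. \<kappa> (c i) x) I"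
proof (induction I rule: finite_induct)
  case empty
  then show ?case
    by (simp add: k_lzero)
next
  case (insert i I)
  have "finsum N (\<lambda>i. \<kappa> (c i) x) (insert i I) = \<kappa> (c i) x \<oplus> finsum N (\<lambda>i. \<kappa> (c i) x) I"
    by (rule N.finsum_insert) (use insert in auto)
  then show ?case
    using insert by (simp add: k_ladd)
qed

lemma TT_simps: "carrier TT = {t. \<forall>i. t i \<in> carrier N}" "\<zero>\<^bsub>TT\<^esub> = (\<lambda>i. \<zero>)" "t \<oplus>\<^bsub>TT\<^esub> u = (\<lambda>i. t i \<oplus> u i)"
  "a \<odot>\<^bsub>TT\<^esub> t = (\<lambda>j. finsum N (\<lambda>i. \<kappa> ((a \<otimes>\<^bsub>D\<^esub> bvec i) j) (t i)) UNIV)"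
  by (simp_all add: ktensor_def)

lemma abelian_group_TT: "abelian_group TT"
proof (rule abelian_groupI)
  fix t assume "t \<in> carrier TT"
  then show "\<exists>u\<in>carrier TT. u \<oplus>\<^bsub>TT\<^esub> t = \<zero>\<^bsub>TT\<^esub>"
    by (intro bexI[of _ "\<lambda>i. \<ominus> t i"]) (auto simp: TT_simps N.l_neg)
qed (auto simp: TT_simps N.a_ac)

lemma finsum_k_closed: "(\<And>i. t i \<in> carrier N) \<Longrightarrow> finsum N (\<lambda>i. \<kappa> (c i) (t i)) I \<in> carrier N"
  by (rule N.finsum_closed) auto

lemma finsum_cong_UNIV: "(\<And>i. f i = g i) \<Longrightarrow> finsum N f UNIV = finsum N g UNIV"
  by (rule arg_cong[where f="\<lambda>f. finsum N f UNIV"]) (rule ext)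

lemma finsum_delta: "(\<And>i :: 'i. t i \<in> carrier N) \<Longrightarrow> finsum N (\<lambda>i. \<kappa> (if j = i then 1 else 0) (t i)) UNIV = t j"
proof -
  assume t: "\<And>i. t i \<in> carrier N"
  have "finsum N (\<lambda>i. \<kappa> (if j = i then 1 else 0) (t i)) UNIV = finsum N (\<lambda>i. if j = i then t i else \<zero>) UNIV"
    by (rule finsum_cong_UNIV) (simp add: t k_one k_lzero)
  also have "\<dots> = t j"
    by (rule N.finsum_singleton) (use t in auto)
  finally show ?thesis .
qed

lemma alg_module_TT: "alg_module D TT"
proof (rule alg_module.intro)
  interpret D: fd_algebra D
    by (rule D)
  show "fd_algebra D"
    by (rule D)
  show "left_module D TT"
    unfolding left_module_def left_module_axioms_def
  proof (intro conjI allI impI)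
    show "ring D" "abelian_group TT"
      by (rule D.ring_axioms, rule abelian_group_TT)
    fix a b x assume x: "x \<in> carrier TT"
    have x': "x i \<in> carrier N" for i
      using x by (simp add: TT_simps)
    show "a \<odot>\<^bsub>TT\<^esub> x \<in> carrier TT"
      by (simp add: TT_simps finsum_k_closed x')
    have "finsum N (\<lambda>i. \<kappa> (((a + b) \<otimes>\<^bsub>D\<^esub> bvec i) j) (x i)) UNIV
      = finsum N (\<lambda>i. \<kappa> ((a \<otimes>\<^bsub>D\<^esub> bvec i) j) (x i)) UNIV \<oplus> finsum N (\<lambda>i. \<kappa> ((b \<otimes>\<^bsub>D\<^esub> bvec i) j) (x i)) UNIV" for j
    proof -
      have "((a + b) \<otimes>\<^bsub>D\<^esub> bvec i) j = (a \<otimes>\<^bsub>D\<^esub> bvec i) j + (b \<otimes>\<^bsub>D\<^esub> bvec i) j" for i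
        unfolding vlin_add[OF D.vlin_mult[OF vlin_id]] by simp
      then show ?thesis
        by (simp add: k_ladd x' N.finsum_addf)
    qed
    then show "(a \<oplus>\<^bsub>D\<^esub> b) \<odot>\<^bsub>TT\<^esub> x = a \<odot>\<^bsub>TT\<^esub> x \<oplus>\<^bsub>TT\<^esub> b \<odot>\<^bsub>TT\<^esub> x"
      by (simp add: D.add_eq TT_simps del: plus_fun_apply)
    show "a \<odot>\<^bsub>TT\<^esub> (x \<oplus>\<^bsub>TT\<^esub> y) = a \<odot>\<^bsub>TT\<^esub> x \<oplus>\<^bsub>TT\<^esub> a \<odot>\<^bsub>TT\<^esub> y" if y: "y \<in> carrier TT" for y
    proof -
      have y': "y i \<in> carrier N" for i
        using y by (simp add: TT_simps)
      show ?thesis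
        by (simp add: TT_simps k_radd x' y' N.finsum_addf)
    qed
    show "(a \<otimes>\<^bsub>D\<^esub> b) \<odot>\<^bsub>TT\<^esub> x = a \<odot>\<^bsub>TT\<^esub> (b \<odot>\<^bsub>TT\<^esub> x)"
    proof
      fix j
      \<comment> \<open>The matrix of left multiplication by \<open>a b\<close> is the product of
        the matrices of a and b.\<close>
      have e: "((a \<otimes>\<^bsub>D\<^esub> b) \<otimes>\<^bsub>D\<^esub> bvec i) j = (\<Sum>k\<in>UNIV. (a \<otimes>\<^bsub>D\<^esub> bvec k) j * (b \<otimes>\<^bsub>D\<^esub> bvec i) k)" for i
      proof -
        have "a \<otimes>\<^bsub>D\<^esub> (b \<otimes>\<^bsub>D\<^esub> bvec i) = (\<Sum>k\<in>UNIV. vscale ((b \<otimes>\<^bsub>D\<^esub> bvec i) k) (a \<otimes>\<^bsub>D\<^esub> bvec k))"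
          by (rule vlin_expand[OF D.vlin_mult_right[OF vlin_id]])
        then show ?thesis
          by (simp add: D.assoc sum_apply vscale_apply mult.commute)
      qed
      have "((a \<otimes>\<^bsub>D\<^esub> b) \<odot>\<^bsub>TT\<^esub> x) j
        = finsum N (\<lambda>i. finsum N (\<lambda>k. \<kappa> ((a \<otimes>\<^bsub>D\<^esub> bvec k) j) (\<kappa> ((b \<otimes>\<^bsub>D\<^esub> bvec i) k) (x i))) UNIV) UNIV"
        by (simp only: TT_simps e k_sum[OF finite_UNIV x'] k_mult[OF x'])
      also have "\<dots> = finsum N (\<lambda>k. finsum N (\<lambda>i. \<kappa> ((a \<otimes>\<^bsub>D\<^esub> bvec k) j) (\<kappa> ((b \<otimes>\<^bsub>D\<^esub> bvec i) k) (x i))) UNIV) UNIV"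
        by (rule N.finsum_swap) (simp_all add: x')
      also have "\<dots> = (a \<odot>\<^bsub>TT\<^esub> (b \<odot>\<^bsub>TT\<^esub> x)) j"
        unfolding TT_simps
        by (rule finsum_cong_UNIV, rule add_hom_finsum[OF add_hom_k, symmetric]) (simp_all add: x')
      finally show "((a \<otimes>\<^bsub>D\<^esub> b) \<odot>\<^bsub>TT\<^esub> x) j = (a \<odot>\<^bsub>TT\<^esub> (b \<odot>\<^bsub>TT\<^esub> x)) j" .
    qed
    show "\<one>\<^bsub>D\<^esub> \<odot>\<^bsub>TT\<^esub> x = x"
      by (rule ext) (simp add: TT_simps D.one_left bvec_def finsum_delta x')
  qed
qed

lemma tens_closed: "x \<in> carrier N \<Longrightarrow> tens \<kappa> d x \<in> carrier TT"
  by (simp add: TT_simps tens_def)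

lemma tens_ladd: "x \<in> carrier N \<Longrightarrow> tens \<kappa> (d + e) x = tens \<kappa> d x \<oplus>\<^bsub>TT\<^esub> tens \<kappa> e x"
  by (simp add: TT_simps tens_def k_ladd)

lemma tens_radd: "x \<in> carrier N \<Longrightarrow> y \<in> carrier N \<Longrightarrow> tens \<kappa> d (x \<oplus> y) = tens \<kappa> d x \<oplus>\<^bsub>TT\<^esub> tens \<kappa> d y"
  by (simp add: TT_simps tens_def k_radd)

lemma smult_tens: "x \<in> carrier N \<Longrightarrow> a \<odot>\<^bsub>TT\<^esub> tens \<kappa> d x = tens \<kappa> (a \<otimes>\<^bsub>D\<^esub> d) x"
proof
  fix j assume x: "x \<in> carrier N"
  have "a \<otimes>\<^bsub>D\<^esub> d = (\<Sum>k\<in>UNIV. vscale (d k) (a \<otimes>\<^bsub>D\<^esub> bvec k))"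
    by (rule vlin_expand[OF fd_algebra.vlin_mult_right[OF D vlin_id]])
  then have "(a \<otimes>\<^bsub>D\<^esub> d) j = (\<Sum>k\<in>UNIV. (a \<otimes>\<^bsub>D\<^esub> bvec k) j * d k)"
    by (simp add: sum_apply vscale_apply mult.commute)
  then show "(a \<odot>\<^bsub>TT\<^esub> tens \<kappa> d x) j = tens \<kappa> (a \<otimes>\<^bsub>D\<^esub> d) x j"
    by (simp add: TT_simps tens_def k_mult x k_sum)
qed

lemma finsum_apply: "finite I \<Longrightarrow> (\<And>i. i \<in> I \<Longrightarrow> f i \<in> carrier TT) \<Longrightarrow> finsum TT f I j = finsum N (\<lambda>i. f i j) I"
proof -
  assume I: "finite I" and f: "\<And>i. i \<in> I \<Longrightarrow> f i \<in> carrier TT"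
  have "add_hom TT N (\<lambda>t. t j)"
    unfolding add_hom_def by (simp add: abelian_group_TT N TT_simps)
  from add_hom_finsum[OF this I f] show ?thesis
    by simp
qed

lemma tens_expand: "t \<in> carrier TT \<Longrightarrow> t = finsum TT (\<lambda>i. tens \<kappa> (bvec i) (t i)) UNIV"
proof
  fix j assume t: "t \<in> carrier TT"
  then have t': "t i \<in> carrier N" for i
    by (simp add: TT_simps)
  show "t j = finsum TT (\<lambda>i. tens \<kappa> (bvec i) (t i)) UNIV j"
    by (subst finsum_apply[OF finite_UNIV tens_closed[OF t']]) (simp add: tens_def bvec_def finsum_delta t')
qed

end

section \<open>Verma modules\<close>

lemma (in abelian_group) hom_sum:
  assumes "\<And>a b. g (a + b) = g a \<oplus> g b" "\<And>a. g a \<in> carrier G" "finite I"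
  shows "g (\<Sum>i\<in>I. h i) = finsum G (\<lambda>i. g (h i)) I"
  using assms(3)
proof (induction I rule: finite_induct)
  case empty
  have "g 0 \<oplus> g 0 = g 0"
    using assms(1)[of 0 0] by simp
  then have "\<ominus> g 0 \<oplus> (g 0 \<oplus> g 0) = \<ominus> g 0 \<oplus> g 0"
    by (rule arg_cong)
  then have "g 0 = \<zero>"
    using assms(2)[of 0] by (simp add: a_assoc[symmetric] l_neg)
  then show ?case
    by (simp only: sum.empty finsum_empty)
next
  case (insert i I)
  have "finsum G (\<lambda>i. g (h i)) (insert i I) = g (h i) \<oplus> finsum G (\<lambda>i. g (h i)) I"
    by (rule finsum_insert) (use insert assms(2) in auto)
  also have "\<dots> = g (h i) \<oplus> g (sum h I)"
    using insert.IH by (simp only:)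
  also have "\<dots> = g (h i + sum h I)"
    by (rule assms(1)[symmetric])
  also have "h i + sum h I = sum h (insert i I)"
    by (rule sum.insert[OF insert.hyps, symmetric])
  finally show ?case ..
qed

lemma (in abelian_group) diff_eq_zero_iff: "x \<in> carrier G \<Longrightarrow> y \<in> carrier G \<Longrightarrow> x \<ominus> y = \<zero> \<longleftrightarrow> x = y"
proof
  assume x: "x \<in> carrier G" and y: "y \<in> carrier G"
  have e: "x = (x \<ominus> y) \<oplus> y"
    unfolding a_minus_def using x y by (simp add: a_assoc l_neg)
  show "x = y" if z: "x \<ominus> y = \<zero>"
    using e y unfolding z by simp
  show "x \<ominus> y = \<zero>" if "x = y"
    unfolding a_minus_def that using y by (rule r_neg)
qed

text \<open>\<open>lam\<close> is an arbitrary module here, and the locale is interpreted once more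
  for the module \<open>mu\<close> found inside the Verma module.\<close>

locale verma_setting =
  nichols_algebra H s act coact B \<iota> + L: alg_module "drinfeld_double H" lam
  for H :: "('h::finite, 'k::field) hopf"
    and s :: "'k \<Rightarrow> 'v::ab_group_add \<Rightarrow> 'v"
    and act coact
    and B :: "('b::finite, 'h, 'k) braided_hopf"
    and \<iota> :: "'v \<Rightarrow> 'b \<Rightarrow> 'k"
    and lam :: "('h \<times> 'h \<Rightarrow> 'k, 'l) module"
begin

abbreviation "RR \<equiv> DVH_nonneg H B"
abbreviation "NN \<equiv> inflate H B lam"
abbreviation "MM \<equiv> verma H B lam"
abbreviation "DHH \<equiv> drinfeld_double H"
abbreviation proj where "proj \<equiv> proj_DH H B"

lemma NN_simps: "carrier NN = carrier lam" "\<zero>\<^bsub>NN\<^esub> = \<zero>\<^bsub>lam\<^esub>" "x \<oplus>\<^bsub>NN\<^esub> y = x \<oplus>\<^bsub>lam\<^esub> y"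
  "r \<odot>\<^bsub>NN\<^esub> x = proj r \<odot>\<^bsub>lam\<^esub> x"
  by (simp_all add: inflate_def restrict_scalars_def)

lemma RR_carrier: "carrier RR = Rset"
  using nonneg_eq by (simp add: DVH_nonneg_def)

lemma RR_one: "\<one>\<^bsub>RR\<^esub> = \<one>\<^bsub>D\<^esub>"
  by (simp add: DVH_nonneg_def del: D_simps(4))

lemma proj_one: "proj \<one>\<^bsub>D\<^esub> = \<one>\<^bsub>DHH\<^esub>"
  using proj_incl_DH[of "\<one>\<^bsub>DHH\<^esub>"] unfolding incl_DH_one .

lemma vlin_proj: "vlin proj"
proof -
  have "proj = qcoef \<epsilon>B"
    by (rule ext, rule proj_DH_eq)
  then show ?thesis
    using vlin_qcoef0[of \<epsilon>B] by simp
qed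

lemma proj_scale_one: "proj (vscale c \<one>\<^bsub>D\<^esub>) = vscale c \<one>\<^bsub>DHH\<^esub>"
  unfolding vlin_scale[OF vlin_proj] proj_one ..

lemma scale_one_Rset: "vscale c \<one>\<^bsub>D\<^esub> \<in> Rset"
  using incl_DH_Rset[of "vscale c \<one>\<^bsub>DHH\<^esub>"] unfolding vlin_scale[OF vlin_incl_DH] incl_DH_one .

lemma kscale_NN: "kscale RR NN c x = L.ks c x"
  unfolding kscale_def NN_simps RR_one proj_scale_one ..

lemma abelian_group_NN: "abelian_group NN"
proof (rule abelian_groupI; unfold NN_simps)
  fix x assume "x \<in> carrier lam"
  then show "\<exists>y\<in>carrier lam. y \<oplus>\<^bsub>lam\<^esub> x = \<zero>\<^bsub>lam\<^esub>"
    by (intro bexI[of _ "\<ominus>\<^bsub>lam\<^esub> x"]) (simp_all add: L.l_neg)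
qed (simp_all add: L.a_ac)

sublocale KS: ktensor_space D RR NN
  by (rule ktensor_space.intro; (unfold NN_simps kscale_NN)?)
     (simp_all add: DD.fd_algebra_axioms abelian_group_NN L.ks_ladd L.ks_radd L.ks_ks L.ks_one del: L.A_simps)

abbreviation "TT \<equiv> ktensor D RR NN"

sublocale KT: alg_module D TT
  by (rule KS.alg_module_TT)

lemma abelian_lam: "abelian_group lam"
  by (rule L.abelian_group_axioms)

definition relX where "relX = {tens (kscale RR NN) (d \<otimes>\<^bsub>D\<^esub> r) x \<ominus>\<^bsub>TT\<^esub> tens (kscale RR NN) d (r \<odot>\<^bsub>NN\<^esub> x) | d r x.
        d \<in> carrier D \<and> r \<in> carrier RR \<and> x \<in> carrier NN}"

abbreviation "Trel \<equiv> induced_relations D RR NN"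

lemma Trel_eq: "Trel = generate (add_monoid TT) relX"
  unfolding induced_relations_def relX_def ..

lemma relX_I: "r \<in> Rset \<Longrightarrow> x \<in> carrier lam \<Longrightarrow>
    tens (kscale RR NN) (d \<otimes>\<^bsub>D\<^esub> r) x \<ominus>\<^bsub>TT\<^esub> tens (kscale RR NN) d (proj r \<odot>\<^bsub>lam\<^esub> x) \<in> relX"
  unfolding relX_def NN_simps RR_carrier D_simps(1) by blast

lemma relX_E:
  assumes "t \<in> relX"
  obtains d r x where "t = tens (kscale RR NN) (d \<otimes>\<^bsub>D\<^esub> r) x \<ominus>\<^bsub>TT\<^esub> tens (kscale RR NN) d (proj r \<odot>\<^bsub>lam\<^esub> x)"
    "r \<in> Rset" "x \<in> carrier lam"
  using assms unfolding relX_def NN_simps RR_carrier by blast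

lemma tens_closed: "x \<in> carrier lam \<Longrightarrow> tens (kscale RR NN) d x \<in> carrier TT"
  by (rule KS.tens_closed) (simp add: NN_simps)

lemma relX_carrier: "relX \<subseteq> carrier TT"
proof
  fix t assume "t \<in> relX"
  then show "t \<in> carrier TT"
    by (rule relX_E) (simp add: KT.minus_closed tens_closed)
qed

text \<open>Left multiplication by a carries the relation for d to the relation for
  \<open>a d\<close>.\<close>

lemma sub_Trel: "KT.sub Trel"
  unfolding Trel_eq
proof (rule KT.sub_generate[OF relX_carrier])
  fix a t assume "t \<in> relX"
  then obtain d r x where t: "t = tens (kscale RR NN) (d \<otimes>\<^bsub>D\<^esub> r) x \<ominus>\<^bsub>TT\<^esub> tens (kscale RR NN) d (proj r \<odot>\<^bsub>lam\<^esub> x)"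
    and r: "r \<in> Rset" and x: "x \<in> carrier lam"
    by (rule relX_E)
  have sm: "a \<odot>\<^bsub>TT\<^esub> tens (kscale RR NN) d x = tens (kscale RR NN) (a \<otimes>\<^bsub>D\<^esub> d) x" if "x \<in> carrier lam" for d x
    by (rule KS.smult_tens) (simp add: NN_simps that)
  have "a \<odot>\<^bsub>TT\<^esub> t = tens (kscale RR NN) ((a \<otimes>\<^bsub>D\<^esub> d) \<otimes>\<^bsub>D\<^esub> r) x \<ominus>\<^bsub>TT\<^esub> tens (kscale RR NN) (a \<otimes>\<^bsub>D\<^esub> d) (proj r \<odot>\<^bsub>lam\<^esub> x)"
    unfolding t DD.assoc
    by (subst add_hom_diff[OF KT.add_hom_sm]) (simp_all only: tens_closed x L.sm_closed sm)
  then show "a \<odot>\<^bsub>TT\<^esub> t \<in> generate (add_monoid TT) relX"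
    using generate.incl[OF relX_I[OF r x]] by simp
qed

section \<open>The Verma module and its universal property\<close>

lemma verma_eq: "MM = quot_module TT Trel"
  by (simp only: verma_def induced_module_def)

sublocale M: alg_module D MM
  unfolding verma_eq by (rule KT.alg_module_Q[OF sub_Trel])

abbreviation T where "T \<equiv> induced_tensor D RR NN"

lemma add_hom_q: "add_hom TT MM (\<lambda>t. Trel +>\<^bsub>TT\<^esub> t)"
  unfolding add_hom_def
proof (intro conjI ballI)
  show "abelian_group TT" "abelian_group MM"
    by (rule KT.abelian_group_axioms, rule M.abelian_group_axioms)
  show "Trel +>\<^bsub>TT\<^esub> x \<in> carrier MM" if "x \<in> carrier TT" for x
    unfolding verma_eq KT.carrier_Q[OF sub_Trel] using that by (rule imageI)
  show "Trel +>\<^bsub>TT\<^esub> (x \<oplus>\<^bsub>TT\<^esub> y) = (Trel +>\<^bsub>TT\<^esub> x) \<oplus>\<^bsub>MM\<^esub> (Trel +>\<^bsub>TT\<^esub> y)" if "x \<in> carrier TT" "y \<in> carrier TT" for x y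
    unfolding verma_eq by (rule KT.add_Q[OF sub_Trel that, symmetric])
qed

lemma T_closed [simp]: "x \<in> carrier lam \<Longrightarrow> T d x \<in> carrier MM"
  unfolding induced_tensor_def by (rule add_hom_closed[OF add_hom_q tens_closed])

lemma T_ladd: "x \<in> carrier lam \<Longrightarrow> T (d + e) x = T d x \<oplus>\<^bsub>MM\<^esub> T e x"
  unfolding induced_tensor_def
  by (subst KS.tens_ladd) (simp_all only: NN_simps add_hom_add[OF add_hom_q] tens_closed)

lemma add_hom_T: "add_hom lam MM (T d)"
  unfolding add_hom_def
proof (intro conjI ballI)
  show "abelian_group lam" "abelian_group MM"
    by (rule L.abelian_group_axioms, rule M.abelian_group_axioms)
  show "T d x \<in> carrier MM" if "x \<in> carrier lam" for x
    by (rule T_closed[OF that])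
  show "T d (x \<oplus>\<^bsub>lam\<^esub> y) = T d x \<oplus>\<^bsub>MM\<^esub> T d y" if x: "x \<in> carrier lam" and y: "y \<in> carrier lam" for x y
  proof -
    have "tens (kscale RR NN) d (x \<oplus>\<^bsub>lam\<^esub> y) = tens (kscale RR NN) d x \<oplus>\<^bsub>TT\<^esub> tens (kscale RR NN) d y"
      using KS.tens_radd[of x y d] x y by (simp only: NN_simps)
    then show ?thesis
      unfolding induced_tensor_def by (simp only: add_hom_add[OF add_hom_q] tens_closed x y)
  qed
qed

lemma T_smult: "x \<in> carrier lam \<Longrightarrow> a \<odot>\<^bsub>MM\<^esub> T d x = T (a \<otimes>\<^bsub>D\<^esub> d) x"
  unfolding induced_tensor_def verma_eq
  by (subst KT.smult_Q[OF sub_Trel tens_closed]) (simp_all only: KS.smult_tens NN_simps)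

lemma T_balanced: "r \<in> Rset \<Longrightarrow> x \<in> carrier lam \<Longrightarrow> T (d \<otimes>\<^bsub>D\<^esub> r) x = T d (proj r \<odot>\<^bsub>lam\<^esub> x)"
  unfolding induced_tensor_def
  by (rule KT.q_eq[OF sub_Trel]) (simp_all only: tens_closed L.sm_closed Trel_eq generate.incl[OF relX_I])

lemma T_lsum: "finite I \<Longrightarrow> x \<in> carrier lam \<Longrightarrow> T (\<Sum>i\<in>I. d i) x = finsum MM (\<lambda>i. T (d i) x) I"
  by (rule M.hom_sum[where g="\<lambda>d. T d x"]) (simp_all only: T_ladd T_closed)

lemma T_expand:
  assumes "m \<in> carrier MM"
  obtains x where "\<And>i. x i \<in> carrier lam" "m = finsum MM (\<lambda>i. T (bvec i) (x i)) UNIV"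
proof -
  obtain t where t: "t \<in> carrier TT" "m = Trel +>\<^bsub>TT\<^esub> t"
    using assms unfolding verma_eq KT.carrier_Q[OF sub_Trel] by blast
  have x: "t i \<in> carrier lam" for i
    using t(1) unfolding KS.TT_simps NN_simps by blast
  have "m = Trel +>\<^bsub>TT\<^esub> (finsum TT (\<lambda>i. tens (kscale RR NN) (bvec i) (t i)) UNIV)"
    using KS.tens_expand[OF t(1)] t(2) by (simp only:)
  also have "\<dots> = finsum MM (\<lambda>i. T (bvec i) (t i)) UNIV"
    unfolding induced_tensor_def by (rule add_hom_finsum[OF add_hom_q finite_UNIV tens_closed[OF x]])
  finally show ?thesis
    using that x by blast
qed

lemma T_zero: "T d \<zero>\<^bsub>lam\<^esub> = \<zero>\<^bsub>MM\<^esub>"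
  by (rule add_hom_zero[OF add_hom_T])

lemma T_induct:
  assumes m: "m \<in> carrier MM" and T: "\<And>d x. x \<in> carrier lam \<Longrightarrow> P (T d x)"
    and add: "\<And>m m'. m \<in> carrier MM \<Longrightarrow> m' \<in> carrier MM \<Longrightarrow> P m \<Longrightarrow> P m' \<Longrightarrow> P (m \<oplus>\<^bsub>MM\<^esub> m')"
  shows "P m"
proof -
  obtain x where x: "\<And>i. x i \<in> carrier lam" "m = finsum MM (\<lambda>i. T (bvec i) (x i)) UNIV"
    using T_expand[OF m] by blast
  have "finsum MM (\<lambda>i. T (bvec i) (x i)) UNIV \<in> {m \<in> carrier MM. P m}"
  proof (rule M.finsum_in[OF finite_UNIV])
    show "\<zero>\<^bsub>MM\<^esub> \<in> {m \<in> carrier MM. P m}"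
      using T[of "\<zero>\<^bsub>lam\<^esub>" undefined] by (simp add: T_zero)
  qed (use x(1) T add in auto)
  then show ?thesis
    using x(2) by simp
qed

lemma add_hom_eqI:
  assumes "add_hom MM G f" "add_hom MM G g" "\<And>d x. x \<in> carrier lam \<Longrightarrow> f (T d x) = g (T d x)" "m \<in> carrier MM"
  shows "f m = g m"
  by (rule T_induct[OF assms(4), where P="\<lambda>m. f m = g m"])
     (simp_all add: assms(3) add_hom_add[OF assms(1)] add_hom_add[OF assms(2)])

text \<open>A biadditive family balanced over \<open>Rset\<close> vanishes on the defining
  relations, so it factors through the quotient. Compatibility with scalars is balance at multiples
  of the unit, which lie in \<open>Rset\<close>.\<close>

lemma universal:
  assumes G: "abelian_group G" and r: "\<And>d. add_hom lam G (f d)"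
    and l: "\<And>d e x. x \<in> carrier lam \<Longrightarrow> f (d + e) x = f d x \<oplus>\<^bsub>G\<^esub> f e x"
    and bal: "\<And>d r x. r \<in> Rset \<Longrightarrow> x \<in> carrier lam \<Longrightarrow> f (d \<otimes>\<^bsub>D\<^esub> r) x = f d (proj r \<odot>\<^bsub>lam\<^esub> x)"
  shows "\<exists>F. add_hom MM G F \<and> (\<forall>d. \<forall>x\<in>carrier lam. F (T d x) = f d x)"
proof -
  interpret G: abelian_group G by fact
  define F0 where "F0 t = finsum G (\<lambda>i. f (bvec i) (t i)) UNIV" for t
  have F0: "add_hom TT G F0"
    unfolding F0_def
  proof (rule G.add_hom_finsum_fun[OF finite_UNIV KS.abelian_group_TT])
    fix i
    have "add_hom TT lam (\<lambda>t. t i)"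
      unfolding add_hom_def by (simp add: KS.abelian_group_TT KS.TT_simps NN_simps L.abelian_group_axioms del: split_paired_All)
    then show "add_hom TT G (\<lambda>t. f (bvec i) (t i))"
      by (rule add_hom_comp) (rule r)
  qed
  have F0_tens: "F0 (tens (kscale RR NN) d x) = f d x" if x: "x \<in> carrier lam" for d x
  proof -
    \<comment> \<open>The scalar \<open>d i\<close> acts on x; balance at that multiple of the unit
      moves it into the left factor.\<close>
    have 1: "f (bvec i) (tens (kscale RR NN) d x i) = f (vscale (d i) (bvec i)) x" for i
    proof -
      have "tens (kscale RR NN) d x i = proj (vscale (d i) \<one>\<^bsub>D\<^esub>) \<odot>\<^bsub>lam\<^esub> x"
        unfolding tens_def kscale_def NN_simps RR_one ..
      then have "f (bvec i) (tens (kscale RR NN) d x i) = f (bvec i \<otimes>\<^bsub>D\<^esub> vscale (d i) \<one>\<^bsub>D\<^esub>) x"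
        using bal[OF scale_one_Rset x] by (simp only:)
      then show ?thesis
        unfolding DD.mult_scale DD.one_right .
    qed
    have "F0 (tens (kscale RR NN) d x) = finsum G (\<lambda>i. f (vscale (d i) (bvec i)) x) UNIV"
      unfolding F0_def 1 ..
    also have "\<dots> = f (\<Sum>i\<in>UNIV. vscale (d i) (bvec i)) x"
      by (rule G.hom_sum[where g="\<lambda>d. f d x", symmetric]) (simp_all only: l x add_hom_closed[OF r] finite_UNIV)
    also have "(\<Sum>i\<in>UNIV. vscale (d i) (bvec i)) = d"
      by (rule vlin_expand[OF vlin_id, symmetric])
    finally show ?thesis .
  qed
  have kill: "Trel \<subseteq> {t \<in> carrier TT. F0 t = \<zero>\<^bsub>G\<^esub>}"
    unfolding Trel_eq
  proof (rule KT.generate_subset)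
    show "relX \<subseteq> {t \<in> carrier TT. F0 t = \<zero>\<^bsub>G\<^esub>}"
    proof
      fix t assume t: "t \<in> relX"
      then obtain d r x where t': "t = tens (kscale RR NN) (d \<otimes>\<^bsub>D\<^esub> r) x \<ominus>\<^bsub>TT\<^esub> tens (kscale RR NN) d (proj r \<odot>\<^bsub>lam\<^esub> x)"
        and rx: "r \<in> Rset" "x \<in> carrier lam"
        by (rule relX_E)
      have "F0 t = f (d \<otimes>\<^bsub>D\<^esub> r) x \<ominus>\<^bsub>G\<^esub> f d (proj r \<odot>\<^bsub>lam\<^esub> x)"
        unfolding t' by (subst add_hom_diff[OF F0]) (simp_all only: tens_closed rx L.sm_closed F0_tens)
      then have "F0 t = \<zero>\<^bsub>G\<^esub>"
        using add_hom_closed[OF r] rx(2) by (simp add: bal[OF rx] a_minus_def G.r_neg)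
      then show "t \<in> {t \<in> carrier TT. F0 t = \<zero>\<^bsub>G\<^esub>}"
        using relX_carrier t by blast
    qed
  qed (auto simp: add_hom_zero[OF F0] add_hom_add[OF F0] add_hom_minus[OF F0])
  \<comment> \<open>Elements of the quotient are cosets, and any representative gives the same value
    because \<open>F0\<close> kills the relations.\<close>
  define F where "F X = F0 (SOME t. t \<in> X)" for X
  have F: "F (Trel +>\<^bsub>TT\<^esub> t) = F0 t" if t: "t \<in> carrier TT" for t
  proof -
    have "t \<in> Trel +>\<^bsub>TT\<^esub> t"
      by (rule KT.q_self[OF sub_Trel t])
    then have "(SOME t'. t' \<in> Trel +>\<^bsub>TT\<^esub> t) \<in> Trel +>\<^bsub>TT\<^esub> t"
      by (rule someI[where P="\<lambda>t'. t' \<in> Trel +>\<^bsub>TT\<^esub> t"])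
    then obtain t' where t': "t' = (SOME t'. t' \<in> Trel +>\<^bsub>TT\<^esub> t)" "t' \<in> carrier TT" "t' \<ominus>\<^bsub>TT\<^esub> t \<in> Trel"
      using KT.mem_q[OF sub_Trel t] by blast
    have "F0 t' \<ominus>\<^bsub>G\<^esub> F0 t = \<zero>\<^bsub>G\<^esub>"
      using kill t'(3) add_hom_diff[OF F0 t'(2) t] by auto
    then show ?thesis
      unfolding F_def t'(1)[symmetric]
      by (rule iffD1[OF G.diff_eq_zero_iff[OF add_hom_closed[OF F0 t'(2)] add_hom_closed[OF F0 t]]])
  qed
  have "add_hom MM G F"
    unfolding add_hom_def
  proof (intro conjI ballI)
    show "abelian_group MM" "abelian_group G"
      by (rule M.abelian_group_axioms, rule G)
    fix x y assume "x \<in> carrier MM"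
    then obtain t where t: "t \<in> carrier TT" "x = Trel +>\<^bsub>TT\<^esub> t"
      unfolding verma_eq KT.carrier_Q[OF sub_Trel] by blast
    show "F x \<in> carrier G"
      unfolding t(2) F[OF t(1)] by (rule add_hom_closed[OF F0 t(1)])
    assume "y \<in> carrier MM"
    then obtain u where u: "u \<in> carrier TT" "y = Trel +>\<^bsub>TT\<^esub> u"
      unfolding verma_eq KT.carrier_Q[OF sub_Trel] by blast
    show "F (x \<oplus>\<^bsub>MM\<^esub> y) = F x \<oplus>\<^bsub>G\<^esub> F y"
      unfolding t(2) u(2) add_hom_add[OF add_hom_q t(1) u(1), symmetric]
      by (simp only: F t(1) u(1) KT.add.m_closed add_hom_add[OF F0] KT.a_closed)
  qed
  moreover have "F (T d x) = f d x" if "x \<in> carrier lam" for d x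
    unfolding induced_tensor_def F[OF tens_closed[OF that]] F0_tens[OF that] ..
  ultimately show ?thesis
    by blast
qed

text \<open>In terms of B tensor \<open>lam\<close> this is \<open>\<theta>\<close> tensor identity;
  \<open>universal\<close> and \<open>qcoef_mult\<close> provide it.\<close>

definition cf where
  "cf \<theta> = (SOME F. add_hom MM lam F \<and> (\<forall>d. \<forall>x\<in>carrier lam. F (T d x) = qcoef \<theta> d \<odot>\<^bsub>lam\<^esub> x))"

lemma cf: "add_hom MM lam (cf \<theta>)" "x \<in> carrier lam \<Longrightarrow> cf \<theta> (T d x) = qcoef \<theta> d \<odot>\<^bsub>lam\<^esub> x"
proof -
  have "\<exists>F. add_hom MM lam F \<and> (\<forall>d. \<forall>x\<in>carrier lam. F (T d x) = qcoef \<theta> d \<odot>\<^bsub>lam\<^esub> x)"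
  proof (rule universal[OF abelian_lam L.add_hom_sm])
    show "x \<in> carrier lam \<Longrightarrow> qcoef \<theta> (d + e) \<odot>\<^bsub>lam\<^esub> x = qcoef \<theta> d \<odot>\<^bsub>lam\<^esub> x \<oplus>\<^bsub>lam\<^esub> qcoef \<theta> e \<odot>\<^bsub>lam\<^esub> x" for d e x
      unfolding vlin_add[OF vlin_qcoef0] by (rule L.sm_ladd)
    show "r \<in> Rset \<Longrightarrow> x \<in> carrier lam \<Longrightarrow> qcoef \<theta> (d \<otimes>\<^bsub>D\<^esub> r) \<odot>\<^bsub>lam\<^esub> x = qcoef \<theta> d \<odot>\<^bsub>lam\<^esub> (proj r \<odot>\<^bsub>lam\<^esub> x)" for d r x
      unfolding qcoef_mult by (rule L.sm_mult)
  qed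
  then have "add_hom MM lam (cf \<theta>) \<and> (\<forall>d. \<forall>x\<in>carrier lam. cf \<theta> (T d x) = qcoef \<theta> d \<odot>\<^bsub>lam\<^esub> x)"
    unfolding cf_def by (rule someI_ex)
  then show "add_hom MM lam (cf \<theta>)" "x \<in> carrier lam \<Longrightarrow> cf \<theta> (T d x) = qcoef \<theta> d \<odot>\<^bsub>lam\<^esub> x"
    by auto
qed

lemmas cf_closed [simp] = add_hom_closed[OF cf(1)]

abbreviation \<tau> where "\<tau> b \<equiv> T (incl_B H B b)"

lemma cf_\<tau>: "x \<in> carrier lam \<Longrightarrow> cf \<theta> (\<tau> b x) = L.ks (pairing \<theta> b) x"
  by (simp only: cf(2) qcoef_incl_B kscale_def)

text \<open>The triangular decomposition writes every \<open>T d x\<close> through B and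
  \<open>Rset\<close>, and balance absorbs the latter into \<open>lam\<close>. Together with
  \<open>cf_\<tau>\<close> this identifies the Verma module with B tensor
  \<open>lam\<close>.\<close>

lemma \<tau>_expand: "m \<in> carrier MM \<Longrightarrow> m = finsum MM (\<lambda>i. \<tau> (bvec i) (cf (bvec i) m)) UNIV"
proof (rule add_hom_eqI[where f="\<lambda>m. m" and g="\<lambda>m. finsum MM (\<lambda>i. \<tau> (bvec i) (cf (bvec i) m)) UNIV" and G=MM])
  show "add_hom MM MM (\<lambda>m. m)"
    unfolding add_hom_def by (simp add: M.abelian_group_axioms)
  show "add_hom MM MM (\<lambda>m. finsum MM (\<lambda>i. \<tau> (bvec i) (cf (bvec i) m)) UNIV)"
    by (rule M.add_hom_finsum_fun[OF finite_UNIV M.abelian_group_axioms]) (rule add_hom_comp[OF cf(1) add_hom_T])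
  fix d x assume x: "x \<in> carrier lam"
  have "T d x = T (\<Sum>i\<in>UNIV. incl_B H B (bvec i) \<otimes>\<^bsub>D\<^esub> Rcoef i d) x"
    by (rule arg_cong[where f="\<lambda>d. T d x"]) (rule decompose)
  also have "\<dots> = finsum MM (\<lambda>i. T (incl_B H B (bvec i) \<otimes>\<^bsub>D\<^esub> Rcoef i d) x) UNIV"
    by (rule T_lsum[OF finite_UNIV x])
  also have "\<dots> = finsum MM (\<lambda>i. \<tau> (bvec i) (cf (bvec i) (T d x))) UNIV"
    by (simp only: T_balanced[OF Rcoef_Rset x] proj_Rcoef cf(2)[OF x])
  finally show "T d x = finsum MM (\<lambda>i. \<tau> (bvec i) (cf (bvec i) (T d x))) UNIV" .
qed

lemma cf_eqI: "m \<in> carrier MM \<Longrightarrow> m' \<in> carrier MM \<Longrightarrow> (\<And>\<theta>. cf \<theta> m = cf \<theta> m') \<Longrightarrow> m = m'"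
proof -
  assume m: "m \<in> carrier MM" and m': "m' \<in> carrier MM" and e: "\<And>\<theta>. cf \<theta> m = cf \<theta> m'"
  have "m = finsum MM (\<lambda>i. \<tau> (bvec i) (cf (bvec i) m)) UNIV"
    by (rule \<tau>_expand[OF m])
  also have "\<dots> = finsum MM (\<lambda>i. \<tau> (bvec i) (cf (bvec i) m')) UNIV"
    by (simp only: e)
  also have "\<dots> = m'"
    by (rule \<tau>_expand[OF m', symmetric])
  finally show ?thesis .
qed

lemma cf_finsum: "m \<in> carrier MM \<Longrightarrow> cf \<theta> m = finsum lam (\<lambda>i. L.ks (\<theta> i) (cf (bvec i) m)) UNIV"
proof -
  assume m: "m \<in> carrier MM"
  have "cf \<theta> m = cf \<theta> (finsum MM (\<lambda>i. \<tau> (bvec i) (cf (bvec i) m)) UNIV)"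
    by (rule arg_cong[OF \<tau>_expand[OF m]])
  also have "\<dots> = finsum lam (\<lambda>i. cf \<theta> (\<tau> (bvec i) (cf (bvec i) m))) UNIV"
    by (rule add_hom_finsum[OF cf(1) finite_UNIV]) (simp add: m)
  also have "\<dots> = finsum lam (\<lambda>i. L.ks (\<theta> i) (cf (bvec i) m)) UNIV"
    by (simp only: cf_\<tau>[OF cf_closed[OF m]] pairing_bvec_right)
  finally show ?thesis .
qed

lemma cf_add: "m \<in> carrier MM \<Longrightarrow> cf (\<theta> + \<phi>) m = cf \<theta> m \<oplus>\<^bsub>lam\<^esub> cf \<phi> m"
proof -
  assume m: "m \<in> carrier MM"
  have "cf (\<theta> + \<phi>) m = finsum lam (\<lambda>i. L.ks (\<theta> i) (cf (bvec i) m) \<oplus>\<^bsub>lam\<^esub> L.ks (\<phi> i) (cf (bvec i) m)) UNIV"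
    unfolding cf_finsum[OF m, of "\<theta> + \<phi>"] plus_fun_apply L.ks_ladd[OF cf_closed[OF m]] ..
  also have "\<dots> = cf \<theta> m \<oplus>\<^bsub>lam\<^esub> cf \<phi> m"
    unfolding cf_finsum[OF m, of \<theta>] cf_finsum[OF m, of \<phi>]
    by (rule L.finsum_addf) (simp_all add: m)
  finally show ?thesis .
qed

definition Mdeg :: "int \<Rightarrow> _ set" where
  "Mdeg z = {m \<in> carrier MM. \<forall>\<theta>. (\<forall>i x. int i = z \<longrightarrow> x \<in> comp B i \<longrightarrow> pairing \<theta> x = 0) \<longrightarrow> cf \<theta> m = \<zero>\<^bsub>lam\<^esub>}"

lemma Mdeg_carrier: "m \<in> Mdeg z \<Longrightarrow> m \<in> carrier MM"
  by (simp add: Mdeg_def)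

lemma Mdeg_zero: "\<zero>\<^bsub>MM\<^esub> \<in> Mdeg z"
  by (simp add: Mdeg_def add_hom_zero[OF cf(1)])

lemma Mdeg_add: "m \<in> Mdeg z \<Longrightarrow> m' \<in> Mdeg z \<Longrightarrow> m \<oplus>\<^bsub>MM\<^esub> m' \<in> Mdeg z"
  by (simp add: Mdeg_def add_hom_add[OF cf(1)])

lemma Mdeg_minus: "m \<in> Mdeg z \<Longrightarrow> \<ominus>\<^bsub>MM\<^esub> m \<in> Mdeg z"
  by (simp add: Mdeg_def add_hom_minus[OF cf(1)])

lemma Mdeg_finsum: "finite I \<Longrightarrow> (\<And>i. i \<in> I \<Longrightarrow> f i \<in> Mdeg z) \<Longrightarrow> finsum MM f I \<in> Mdeg z"
  by (rule M.finsum_in) (auto simp: Mdeg_zero Mdeg_add Mdeg_carrier)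

lemma Mdeg_neg: "m \<in> Mdeg z \<Longrightarrow> z < 0 \<Longrightarrow> m = \<zero>\<^bsub>MM\<^esub>"
  by (rule cf_eqI) (auto simp: Mdeg_def add_hom_zero[OF cf(1)])

lemma T_Mdeg: "d \<in> dcomp k \<Longrightarrow> x \<in> carrier lam \<Longrightarrow> T d x \<in> Mdeg (- k)"
  using qcoef_dcomp by (simp add: Mdeg_def cf(2) L.sm_lzero)

lemma cf_Mdeg_cong:
  assumes m: "m \<in> Mdeg (int j)" and e: "\<And>x. x \<in> comp B j \<Longrightarrow> pairing \<theta> x = pairing \<phi> x"
  shows "cf \<theta> m = cf \<phi> m"
proof -
  have c: "m \<in> carrier MM"
    by (rule Mdeg_carrier[OF m])
  have "pairing (\<theta> - \<phi>) x = 0" if "x \<in> comp B j" for x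
    using pairing_add_left[of "\<theta> - \<phi>" \<phi> x] e[OF that] by simp
  then have 0: "cf (\<theta> - \<phi>) m = \<zero>\<^bsub>lam\<^esub>"
    using m by (auto simp: Mdeg_def)
  have "cf \<theta> m = cf (\<theta> - \<phi> + \<phi>) m"
    by simp
  also have "\<dots> = cf (\<theta> - \<phi>) m \<oplus>\<^bsub>lam\<^esub> cf \<phi> m"
    by (rule cf_add[OF c])
  finally show ?thesis
    using c by (simp add: 0)
qed

definition pr where "pr j m = finsum MM (\<lambda>i. \<tau> (hcomp j (bvec i)) (cf (bvec i) m)) UNIV"

lemma add_hom_pr: "add_hom MM MM (pr j)"
  unfolding pr_def
  by (rule M.add_hom_finsum_fun[OF finite_UNIV M.abelian_group_axioms]) (rule add_hom_comp[OF cf(1) add_hom_T])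

lemmas pr_closed [simp] = add_hom_closed[OF add_hom_pr]

lemma pr_Mdeg: "m \<in> carrier MM \<Longrightarrow> pr j m \<in> Mdeg (int j)"
  unfolding pr_def
  by (rule Mdeg_finsum[OF finite_UNIV]) (use T_Mdeg[OF incl_B_dcomp[OF hcomp_props(1)]] in simp)

lemma cf_pr: "m \<in> carrier MM \<Longrightarrow> cf \<theta> (pr j m) = cf (dual_hcomp j \<theta>) m"
proof -
  assume m: "m \<in> carrier MM"
  have "cf \<theta> (pr j m) = finsum lam (\<lambda>i. cf \<theta> (\<tau> (hcomp j (bvec i)) (cf (bvec i) m))) UNIV"
    unfolding pr_def by (rule add_hom_finsum[OF cf(1) finite_UNIV]) (simp add: m)
  also have "\<dots> = cf (dual_hcomp j \<theta>) m"
    unfolding cf_finsum[OF m, of "dual_hcomp j \<theta>"] by (simp only: cf_\<tau>[OF cf_closed[OF m]] dual_hcomp_def)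
  finally show ?thesis .
qed

lemma pr_id: "m \<in> Mdeg (int j) \<Longrightarrow> pr j m = m"
proof (rule cf_eqI)
  assume m: "m \<in> Mdeg (int j)"
  then show c: "pr j m \<in> carrier MM" "m \<in> carrier MM"
    by (simp_all add: Mdeg_carrier)
  show "cf \<theta> (pr j m) = cf \<theta> m" for \<theta>
    unfolding cf_pr[OF c(2)] by (rule cf_Mdeg_cong[OF m]) (simp add: pairing_dual_hcomp hcomp_comp)
qed

lemma pr_other: "m \<in> Mdeg z \<Longrightarrow> z \<noteq> int j \<Longrightarrow> pr j m = \<zero>\<^bsub>MM\<^esub>"
proof (rule cf_eqI)
  assume m: "m \<in> Mdeg z" and z: "z \<noteq> int j"
  then show c: "pr j m \<in> carrier MM" "\<zero>\<^bsub>MM\<^esub> \<in> carrier MM"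
    by (simp_all add: Mdeg_carrier)
  have "pairing (dual_hcomp j \<theta>) x = 0" if "int i = z" "x \<in> comp B i" for \<theta> i x
    using that z by (auto simp: pairing_dual_hcomp hcomp_comp)
  then show "cf \<theta> (pr j m) = cf \<theta> \<zero>\<^bsub>MM\<^esub>" for \<theta>
    using m unfolding cf_pr[OF Mdeg_carrier[OF m]] by (auto simp: Mdeg_def add_hom_zero[OF cf(1)])
qed

lemma sum_pr: "m \<in> carrier MM \<Longrightarrow> m = finsum MM (\<lambda>j. pr j m) {..degree_bound}"
proof -
  assume m: "m \<in> carrier MM"
  have c: "cf (bvec i) m \<in> carrier lam" for i
    by (simp add: m)
  have v: "incl_B H B (bvec i) = (\<Sum>j\<le>degree_bound. incl_B H B (hcomp j (bvec i)))" for i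
    unfolding vlin_sum[OF vlin_incl_B, symmetric] sum_hcomp ..
  have "m = finsum MM (\<lambda>i. \<tau> (bvec i) (cf (bvec i) m)) UNIV"
    by (rule \<tau>_expand[OF m])
  also have "\<dots> = finsum MM (\<lambda>i. finsum MM (\<lambda>j. \<tau> (hcomp j (bvec i)) (cf (bvec i) m)) {..degree_bound}) UNIV"
    unfolding v T_lsum[OF finite_atMost c] ..
  also have "\<dots> = finsum MM (\<lambda>j. pr j m) {..degree_bound}"
    unfolding pr_def by (rule M.finsum_swap) (simp_all add: c)
  finally show ?thesis .
qed

text \<open>On vectors coming from B the action is multiplication in the double, where degrees add
  by \<open>dcomp_mult\<close>; degree k therefore lowers depth by k.\<close>

lemma dcomp_Mdeg: "d \<in> dcomp k \<Longrightarrow> m \<in> Mdeg z \<Longrightarrow> d \<odot>\<^bsub>MM\<^esub> m \<in> Mdeg (z - k)"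
proof (cases "z < 0")
  case True
  assume "m \<in> Mdeg z"
  then have "m = \<zero>\<^bsub>MM\<^esub>"
    using True by (rule Mdeg_neg)
  then show ?thesis
    by (simp add: Mdeg_zero)
next
  case False
  assume d: "d \<in> dcomp k" and m: "m \<in> Mdeg z"
  obtain j where j: "z = int j"
    using False by (metis nonneg_int_cases not_less)
  have c: "m \<in> carrier MM"
    by (rule Mdeg_carrier[OF m])
  have "d \<odot>\<^bsub>MM\<^esub> m = d \<odot>\<^bsub>MM\<^esub> pr j m"
    using pr_id m j by simp
  also have "\<dots> = finsum MM (\<lambda>i. d \<odot>\<^bsub>MM\<^esub> \<tau> (hcomp j (bvec i)) (cf (bvec i) m)) UNIV"
    unfolding pr_def by (rule M.sm_rsum[OF finite_UNIV]) (simp add: c)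
  also have "\<dots> \<in> Mdeg (z - k)"
  proof (rule Mdeg_finsum[OF finite_UNIV])
    fix i
    have "T (d \<otimes>\<^bsub>D\<^esub> incl_B H B (hcomp j (bvec i))) (cf (bvec i) m) \<in> Mdeg (- (k + - int j))"
      by (rule T_Mdeg[OF dcomp_mult[OF d incl_B_dcomp[OF hcomp_props(1)]]]) (simp add: c)
    then show "d \<odot>\<^bsub>MM\<^esub> \<tau> (hcomp j (bvec i)) (cf (bvec i) m) \<in> Mdeg (z - k)"
      by (simp add: T_smult c j)
  qed
  finally show ?thesis .
qed

end

section \<open>The socle\<close>

lemma (in alg_module) alg_module_sub: "sub P \<Longrightarrow> alg_module A (M\<lparr>carrier := P\<rparr>)"
proof (rule alg_module.intro)
  assume P: "sub P"
  note p = subD[OF P]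
  have c: "x \<in> P \<Longrightarrow> x \<in> carrier M" for x
    using p(1) by blast
  show "fd_algebra A"
    by (rule algebra)
  have "abelian_group (M\<lparr>carrier := P\<rparr>)"
  proof (rule abelian_groupI)
    fix x assume "x \<in> carrier (M\<lparr>carrier := P\<rparr>)"
    then have x: "x \<in> P" by simp
    then show "\<exists>y\<in>carrier (M\<lparr>carrier := P\<rparr>). y \<oplus>\<^bsub>M\<lparr>carrier := P\<rparr>\<^esub> x = \<zero>\<^bsub>M\<lparr>carrier := P\<rparr>\<^esub>"
      using sub_minus[OF P x] by (intro bexI[of _ "\<ominus> x"]) (simp_all add: l_neg c)
  qed (auto simp: p c a_ac)
  moreover have "ring A"
    using algebra by (simp add: fd_algebra_def)
  ultimately show "left_module A (M\<lparr>carrier := P\<rparr>)"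
    unfolding left_module_def left_module_axioms_def
    by (auto simp: p c sm_ladd sm_radd sm_mult sm_one)
qed

context verma_setting
begin

text \<open>Left multiplication by b multiplies operator values on the left, so on coefficients it
  is the transpose of left multiplication in B.\<close>

lemma cf_incl: "m \<in> carrier MM \<Longrightarrow> cf \<theta> (incl_B H B b \<odot>\<^bsub>MM\<^esub> m) = cf (\<lambda>i. pairing \<theta> (b \<cdot> bvec i)) m"
proof (rule add_hom_eqI[where f="\<lambda>m. cf \<theta> (incl_B H B b \<odot>\<^bsub>MM\<^esub> m)" and g="cf (\<lambda>i. pairing \<theta> (b \<cdot> bvec i))" and G=lam])
  let ?\<phi> = "\<lambda>i. pairing \<theta> (b \<cdot> bvec i)"
  show "add_hom MM lam (\<lambda>m. cf \<theta> (incl_B H B b \<odot>\<^bsub>MM\<^esub> m))"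
    by (rule add_hom_comp[OF M.add_hom_sm cf(1)])
  show "add_hom MM lam (cf ?\<phi>)"
    by (rule cf(1))
  fix d x assume x: "x \<in> carrier lam"
  have p: "pairing ?\<phi> y = pairing \<theta> (b \<cdot> y)" for y
    by (subst pairing_expand, subst lin_expand[of "\<lambda>y. pairing \<theta> (b \<cdot> y)"]) simp_all
  have c: "coef \<theta> (outer b \<one>\<^bsub>H\<^esub> \<otimes>\<^bsub>A\<^esub> z) = coef ?\<phi> z" for z
    by (rule vec_eq_outerI[where t=z and f="\<lambda>z. coef \<theta> (outer b \<one>\<^bsub>H\<^esub> \<otimes>\<^bsub>A\<^esub> z)" and g="coef ?\<phi>"])
       (simp_all add: outer_mult_one_left coef_outer p vlin_coef0)
  have "qcoef \<theta> (incl_B H B b \<otimes>\<^bsub>D\<^esub> d) = qcoef ?\<phi> d"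
    by (rule ev_eqI) (simp only: ev_qcoef ev_incl_B_mult c)
  then show "cf \<theta> (incl_B H B b \<odot>\<^bsub>MM\<^esub> T d x) = cf ?\<phi> (T d x)"
    by (simp only: T_smult[OF x] cf(2)[OF x])
qed

lemma T_scale: "x \<in> carrier lam \<Longrightarrow> T (vscale c d) x = T d (L.ks c x)"
  using T_balanced[OF scale_one_Rset, of x d c]
  by (simp only: DD.mult_scale DD.one_right proj_scale_one kscale_def)

lemma exists_pr: "m \<in> carrier MM \<Longrightarrow> m \<noteq> \<zero>\<^bsub>MM\<^esub> \<Longrightarrow> \<exists>j. pr j m \<noteq> \<zero>\<^bsub>MM\<^esub>"
proof (rule ccontr)
  assume m: "m \<in> carrier MM" "m \<noteq> \<zero>\<^bsub>MM\<^esub>" and "\<not> (\<exists>j. pr j m \<noteq> \<zero>\<^bsub>MM\<^esub>)"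
  then have "pr j m = \<zero>\<^bsub>MM\<^esub>" for j
    by blast
  then have "finsum MM (\<lambda>j. pr j m) {..degree_bound} = \<zero>\<^bsub>MM\<^esub>"
    by (simp only: M.finsum_zero)
  then show False
    using sum_pr[OF m(1)] m(2) by simp
qed

lemma exists_cf: "m \<in> carrier MM \<Longrightarrow> m \<noteq> \<zero>\<^bsub>MM\<^esub> \<Longrightarrow> \<exists>i. cf (bvec i) m \<noteq> \<zero>\<^bsub>lam\<^esub>"
proof (rule ccontr)
  assume m: "m \<in> carrier MM" "m \<noteq> \<zero>\<^bsub>MM\<^esub>" and "\<not> (\<exists>i. cf (bvec i) m \<noteq> \<zero>\<^bsub>lam\<^esub>)"
  then have "cf (bvec i) m = \<zero>\<^bsub>lam\<^esub>" for i
    by blast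
  then have "finsum MM (\<lambda>i. \<tau> (bvec i) (cf (bvec i) m)) UNIV = \<zero>\<^bsub>MM\<^esub>"
    by (simp only: T_zero M.finsum_zero)
  then show False
    using \<tau>_expand[OF m(1)] m(2) by simp
qed

lemma Mdeg_trivial: "(\<And>x. x \<in> comp B j \<Longrightarrow> x = 0) \<Longrightarrow> m \<in> Mdeg (int j) \<Longrightarrow> m = \<zero>\<^bsub>MM\<^esub>"
proof (rule cf_eqI)
  assume c: "\<And>x. x \<in> comp B j \<Longrightarrow> x = 0" and m: "m \<in> Mdeg (int j)"
  show "m \<in> carrier MM" "\<zero>\<^bsub>MM\<^esub> \<in> carrier MM"
    using m by (simp_all add: Mdeg_carrier)
  have "pairing \<theta> x = 0" if "int i = int j" "x \<in> comp B i" for \<theta> i x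
    using c[of x] that by simp
  then show "cf \<theta> m = cf \<theta> \<zero>\<^bsub>MM\<^esub>" for \<theta>
    using m by (auto simp: Mdeg_def add_hom_zero[OF cf(1)])
qed

end

locale simple_verma = verma_setting H s act coact B \<iota> lam
  for H :: "('h::finite, 'k::field) hopf"
    and s :: "'k \<Rightarrow> 'v::ab_group_add \<Rightarrow> 'v"
    and act coact
    and B :: "('b::finite, 'h, 'k) braided_hopf"
    and \<iota> :: "'v \<Rightarrow> 'b \<Rightarrow> 'k"
    and lam :: "('h \<times> 'h \<Rightarrow> 'k, 'l) module" +
  assumes nontrivial: "\<exists>l\<in>carrier lam. l \<noteq> \<zero>\<^bsub>lam\<^esub>"
    and simple: "\<And>P. L.sub P \<Longrightarrow> P \<noteq> {\<zero>\<^bsub>lam\<^esub>} \<Longrightarrow> P = carrier lam"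
begin

text \<open>By the Frobenius property some \<open>b\<close> moves the lowest nonzero component of an element to the top degree; by \<open>twist\<close> and simplicity of \<open>lam\<close> the whole top component follows.\<close>

lemma top_component:
  obtains N xt where "xt \<in> comp B N" "xt \<noteq> 0"
    "\<forall>P. M.sub P \<longrightarrow> P \<noteq> {\<zero>\<^bsub>MM\<^esub>} \<longrightarrow> (\<forall>l\<in>carrier lam. \<tau> xt l \<in> P)"
proof -
  obtain N xt \<theta>0 where xt: "xt \<in> comp B N" "xt \<noteq> 0" and above: "\<And>n y. n > N \<Longrightarrow> y \<in> comp B n \<Longrightarrow> y = 0"
    and \<theta>0: "\<theta>0 \<in> dual_comp N" "\<And>y. hcomp N y = vscale (pairing \<theta>0 y) xt"
    and frob: "\<And>q. \<exists>b. \<forall>y. pairing q y = pairing \<theta>0 (b \<cdot> y)"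
    using frobenius by metis
  have "\<tau> xt l \<in> P" if P: "M.sub P" "P \<noteq> {\<zero>\<^bsub>MM\<^esub>}" and l: "l \<in> carrier lam" for P l
  proof -
    note p = M.subD[OF P(1)]
    obtain m where m: "m \<in> P" "m \<noteq> \<zero>\<^bsub>MM\<^esub>"
      using P(2) p(2) by blast
    have mc: "m \<in> carrier MM"
      using m(1) p(1) by blast
    define j where "j = (LEAST j. pr j m \<noteq> \<zero>\<^bsub>MM\<^esub>)"
    have j: "pr j m \<noteq> \<zero>\<^bsub>MM\<^esub>"
      unfolding j_def by (rule LeastI_ex[OF exists_pr[OF mc m(2)]])
    have j_less: "k < j \<Longrightarrow> pr k m = \<zero>\<^bsub>MM\<^esub>" for k
      using not_less_Least[of k "\<lambda>j. pr j m \<noteq> \<zero>\<^bsub>MM\<^esub>"] unfolding j_def by blast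
    have jN: "j \<le> N"
    proof (rule ccontr)
      assume "\<not> j \<le> N"
      then have "x \<in> comp B j \<Longrightarrow> x = 0" for x
        using above[of j x] by simp
      then show False
        using Mdeg_trivial[OF _ pr_Mdeg[OF mc, of j]] j by blast
    qed
    obtain i where i: "cf (bvec i) (pr j m) \<noteq> \<zero>\<^bsub>lam\<^esub>"
      using exists_cf[OF pr_closed[OF mc] j] by blast
    define q where "q = dual_hcomp j (bvec i)"
    obtain b where b: "\<And>y. pairing q y = pairing \<theta>0 (b \<cdot> y)"
      using frob[of q] by blast
    \<comment> \<open>As \<open>\<theta>0\<close> has degree N and q degree j, only the part of b in
      degree N - j matters.\<close>
    define b' where "b' = hcomp (N - j) b"
    have b': "b' \<in> comp B (N - j)"
      unfolding b'_def by (rule hcomp_props(1))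
    have \<theta>0_comp: "pairing \<theta>0 y = 0" if "y \<in> comp B n" "n \<noteq> N" for n y
      using \<theta>0(1) that by (auto simp: dual_comp_def)
    have \<theta>0_b': "pairing \<theta>0 (b' \<cdot> y) = pairing q y" for y
    proof (rule lin_hcomp_eqI[where f="\<lambda>y. pairing \<theta>0 (b' \<cdot> y)" and g="pairing q"])
      fix k y assume y: "y \<in> comp B k"
      show "pairing \<theta>0 (b' \<cdot> y) = pairing q y"
      proof (cases "k = j")
        case False
        have "pairing q y = 0"
          unfolding q_def pairing_dual_hcomp using hcomp_comp[OF y, of j] False by simp
        moreover have "pairing \<theta>0 (b' \<cdot> y) = 0"
          by (rule \<theta>0_comp[OF comp_mult[OF b' y]]) (use False jN in arith)
        ultimately show ?thesis
          by simp
      next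
        case True
        have "pairing q y = pairing \<theta>0 ((\<Sum>n\<le>degree_bound. hcomp n b) \<cdot> y)"
          unfolding b sum_hcomp ..
        also have "\<dots> = (\<Sum>n\<le>degree_bound. pairing \<theta>0 (hcomp n b \<cdot> y))"
          by (rule lin_sum[where f="\<lambda>b. pairing \<theta>0 (b \<cdot> y)"]) simp
        also have "\<dots> = (\<Sum>n\<le>degree_bound. if n = N - j then pairing \<theta>0 (b' \<cdot> y) else 0)"
        proof (rule sum.cong[OF refl])
          fix n
          have "pairing \<theta>0 (hcomp n b \<cdot> y) = 0" if "n \<noteq> N - j"
            by (rule \<theta>0_comp[OF comp_mult[OF hcomp_props(1) y]]) (use that True jN in arith)
          then show "pairing \<theta>0 (hcomp n b \<cdot> y) = (if n = N - j then pairing \<theta>0 (b' \<cdot> y) else 0)"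
            by (simp add: b'_def)
        qed
        also have "\<dots> = pairing \<theta>0 (b' \<cdot> y)"
        proof (cases "N - j \<le> degree_bound")
          case True
          then show ?thesis
            by simp
        next
          case False
          then have "b' = 0"
            using comp_bound[OF _ b'] by simp
          then show ?thesis
            by (simp add: vlin_zero[OF B.vlin_mult[OF vlin_id]])
        qed
        finally show ?thesis ..
      qed
    qed (simp_all add: lin_pairing0)
    define m' where "m' = incl_B H B b' \<odot>\<^bsub>MM\<^esub> m"
    have m'P: "m' \<in> P" and m'c: "m' \<in> carrier MM"
      unfolding m'_def using p(4)[OF m(1)] mc by simp_all
    have "cf \<theta>0 m' = cf q m"
    proof -
      have "(\<lambda>i. pairing \<theta>0 (b' \<cdot> bvec i)) = q"
        by (rule ext) (simp add: \<theta>0_b')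
      then show ?thesis
        unfolding m'_def cf_incl[OF mc] by (simp only:)
    qed
    then have l0: "cf \<theta>0 m' \<noteq> \<zero>\<^bsub>lam\<^esub>"
      using i unfolding cf_pr[OF mc] q_def by simp
    have "m' = finsum MM (\<lambda>k. incl_B H B b' \<odot>\<^bsub>MM\<^esub> pr k m) {..degree_bound}"
    proof -
      have "m' = incl_B H B b' \<odot>\<^bsub>MM\<^esub> finsum MM (\<lambda>k. pr k m) {..degree_bound}"
        unfolding m'_def by (rule arg_cong[OF sum_pr[OF mc]])
      also have "\<dots> = finsum MM (\<lambda>k. incl_B H B b' \<odot>\<^bsub>MM\<^esub> pr k m) {..degree_bound}"
        by (rule M.sm_rsum) (simp_all add: mc)
      finally show ?thesis .
    qed
    \<comment> \<open>Depths below j do not occur in m, depth j is carried to N, and depths above j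
      are carried beyond N, where B is zero.\<close>
    also have "\<dots> \<in> Mdeg (int N)"
    proof (rule Mdeg_finsum)
      fix k
      have d: "incl_B H B b' \<odot>\<^bsub>MM\<^esub> pr k m \<in> Mdeg (int k - - int (N - j))"
        by (rule dcomp_Mdeg[OF incl_B_dcomp[OF b'] pr_Mdeg[OF mc]])
      consider "k < j" | "k = j" | "k > j"
        by linarith
      then show "incl_B H B b' \<odot>\<^bsub>MM\<^esub> pr k m \<in> Mdeg (int N)"
      proof cases
        case 1
        then show ?thesis
          by (simp add: j_less Mdeg_zero)
      next
        case 2
        then show ?thesis
          using d jN by (simp add: of_nat_diff)
      next
        case 3
        have "int k - - int (N - j) = int (k + (N - j))"
          by simp
        with d have d': "incl_B H B b' \<odot>\<^bsub>MM\<^esub> pr k m \<in> Mdeg (int (k + (N - j)))"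
          by (simp only:)
        have gt: "k + (N - j) > N"
          using 3 jN by arith
        have "incl_B H B b' \<odot>\<^bsub>MM\<^esub> pr k m = \<zero>\<^bsub>MM\<^esub>"
          by (rule Mdeg_trivial[OF above[OF gt] d'])
        then show ?thesis
          by (simp add: Mdeg_zero)
      qed
    qed simp
    finally have m'N: "m' \<in> Mdeg (int N)" .
    have "m' = finsum MM (\<lambda>i. \<tau> (hcomp N (bvec i)) (cf (bvec i) m')) UNIV"
      using pr_id[OF m'N] unfolding pr_def by simp
    also have "\<dots> = finsum MM (\<lambda>i. \<tau> xt (L.ks (\<theta>0 i) (cf (bvec i) m'))) UNIV"
      unfolding \<theta>0(2) vlin_scale[OF vlin_incl_B] T_scale[OF cf_closed[OF m'c]] pairing_bvec_right ..
    also have "\<dots> = \<tau> xt (finsum lam (\<lambda>i. L.ks (\<theta>0 i) (cf (bvec i) m')) UNIV)"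
      by (rule add_hom_finsum[OF add_hom_T finite_UNIV, symmetric]) (simp add: m'c)
    also have "\<dots> = \<tau> xt (cf \<theta>0 m')"
      unfolding cf_finsum[OF m'c, of \<theta>0] ..
    finally have m'_eq: "m' = \<tau> xt (cf \<theta>0 m')" .
    \<comment> \<open>The coefficients of \<open>xt\<close> that occur in P. Stability under the
      double of H is where \<open>twist\<close> enters: it turns the action on the coefficient into
      an action on the vector.\<close>
    define L' where "L' = {l \<in> carrier lam. \<tau> xt l \<in> P}"
    have "L.sub L'"
      unfolding L.sub_def
    proof (intro conjI ballI allI)
      show "L' \<subseteq> carrier lam" "\<zero>\<^bsub>lam\<^esub> \<in> L'"
        unfolding L'_def using p(2) by (auto simp: T_zero)
      show "x \<oplus>\<^bsub>lam\<^esub> y \<in> L'" if "x \<in> L'" "y \<in> L'" for x y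
        using that p(3) unfolding L'_def by (simp add: add_hom_add[OF add_hom_T])
      show "u \<odot>\<^bsub>lam\<^esub> x \<in> L'" if "x \<in> L'" for u x
      proof -
        have x: "x \<in> carrier lam" "\<tau> xt x \<in> P"
          using that by (auto simp: L'_def)
        obtain r where r: "incl_DH H B r \<otimes>\<^bsub>D\<^esub> incl_B H B xt = incl_B H B xt \<otimes>\<^bsub>D\<^esub> incl_DH H B u"
          using twist[OF xt \<theta>0(2), of u] by blast
        have "\<tau> xt (u \<odot>\<^bsub>lam\<^esub> x) = T (incl_B H B xt \<otimes>\<^bsub>D\<^esub> incl_DH H B u) x"
          unfolding T_balanced[OF incl_DH_Rset x(1)] proj_incl_DH ..
        also have "\<dots> = incl_DH H B r \<odot>\<^bsub>MM\<^esub> \<tau> xt x"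
          unfolding r[symmetric] T_smult[OF x(1)] ..
        finally have "\<tau> xt (u \<odot>\<^bsub>lam\<^esub> x) \<in> P"
          using p(4)[OF x(2)] by simp
        then show ?thesis
          using x(1) by (simp add: L'_def)
      qed
    qed
    moreover have "cf \<theta>0 m' \<in> L'"
      using m'P m'_eq m'c by (simp add: L'_def)
    then have "L' \<noteq> {\<zero>\<^bsub>lam\<^esub>}"
      using l0 by blast
    ultimately have "L' = carrier lam"
      by (rule simple)
    then show ?thesis
      using l by (auto simp: L'_def)
  qed
  then have "\<forall>P. M.sub P \<longrightarrow> P \<noteq> {\<zero>\<^bsub>MM\<^esub>} \<longrightarrow> (\<forall>l\<in>carrier lam. \<tau> xt l \<in> P)"
    by (intro allI impI ballI)
  then show thesis
    by (rule that[OF xt])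
qed

text \<open>The intersection runs over all nonzero submodules, homogeneous or not, so that leastness
  serves both categories.\<close>

definition S0 where "S0 = carrier MM \<inter> \<Inter>{P. M.sub P \<and> P \<noteq> {\<zero>\<^bsub>MM\<^esub>}}"

lemma sub_S0: "M.sub S0"
  unfolding S0_def M.sub_def by auto

lemma S0_least: "M.sub P \<Longrightarrow> P \<noteq> {\<zero>\<^bsub>MM\<^esub>} \<Longrightarrow> S0 \<subseteq> P"
  unfolding S0_def by blast

lemma S0_carrier: "m \<in> S0 \<Longrightarrow> m \<in> carrier MM"
  by (simp add: S0_def)

lemma S0_nonzero: obtains N w where "w \<in> S0" "w \<noteq> \<zero>\<^bsub>MM\<^esub>" "w \<in> Mdeg (int N)"
proof -
  obtain N xt where xt: "xt \<in> comp B N" "xt \<noteq> 0"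
    and top: "\<forall>P. M.sub P \<longrightarrow> P \<noteq> {\<zero>\<^bsub>MM\<^esub>} \<longrightarrow> (\<forall>l\<in>carrier lam. \<tau> xt l \<in> P)"
    by (rule top_component)
  obtain l where l: "l \<in> carrier lam" "l \<noteq> \<zero>\<^bsub>lam\<^esub>"
    using nontrivial by blast
  obtain i where i: "xt i \<noteq> 0"
    using xt(2) by (auto simp: fun_eq_iff)
  have 1: "\<tau> xt l \<noteq> \<zero>\<^bsub>MM\<^esub>"
  proof
    assume "\<tau> xt l = \<zero>\<^bsub>MM\<^esub>"
    then have "cf (bvec i) (\<tau> xt l) = \<zero>\<^bsub>lam\<^esub>"
      by (simp only: add_hom_zero[OF cf(1)])
    then have z: "L.ks (xt i) l = \<zero>\<^bsub>lam\<^esub>"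
      by (simp only: cf_\<tau>[OF l(1)] pairing_bvec)
    have "l = L.ks (inverse (xt i) * xt i) l"
      unfolding left_inverse[OF i] by (rule L.ks_one[OF l(1), symmetric])
    also have "\<dots> = L.ks (inverse (xt i)) \<zero>\<^bsub>lam\<^esub>"
      by (simp only: L.ks_ks[OF l(1), symmetric] z)
    also have "\<dots> = \<zero>\<^bsub>lam\<^esub>"
      unfolding kscale_def by (rule L.sm_rzero)
    finally show False
      using l(2) by simp
  qed
  have 2: "\<tau> xt l \<in> S0"
    unfolding S0_def
  proof (intro IntI InterI)
    show "\<tau> xt l \<in> carrier MM"
      by (rule T_closed[OF l(1)])
    fix P assume "P \<in> {P. M.sub P \<and> P \<noteq> {\<zero>\<^bsub>MM\<^esub>}}"
    then have P: "M.sub P" "P \<noteq> {\<zero>\<^bsub>MM\<^esub>}"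
      by simp_all
    show "\<tau> xt l \<in> P"
      by (rule bspec[OF mp[OF mp[OF spec[OF top] P(1)] P(2)] l(1)])
  qed
  have 3: "\<tau> xt l \<in> Mdeg (int N)"
    using T_Mdeg[OF incl_B_dcomp[OF xt(1)] l(1)] by simp
  show thesis
    by (rule that[OF 2 1 3])
qed

text \<open>The elements of \<open>S0\<close> whose components all lie in \<open>S0\<close> form a
  submodule, because the double is spanned by homogeneous elements. It contains a nonzero
  homogeneous vector by \<open>S0_nonzero\<close>, so leastness makes it all of
  \<open>S0\<close>.\<close>

lemma S0_pr: "m \<in> S0 \<Longrightarrow> pr j m \<in> S0"
proof -
  note p = M.subD[OF sub_S0]
  define S1 where "S1 = {m \<in> S0. \<forall>j. pr j m \<in> S0}"
  have S1c: "m \<in> S1 \<Longrightarrow> m \<in> carrier MM" for m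
    by (simp add: S1_def S0_carrier)
  have z: "\<zero>\<^bsub>MM\<^esub> \<in> S1" and a: "x \<in> S1 \<Longrightarrow> y \<in> S1 \<Longrightarrow> x \<oplus>\<^bsub>MM\<^esub> y \<in> S1" for x y
    unfolding S1_def using p(2,3) by (simp_all add: add_hom_zero[OF add_hom_pr] add_hom_add[OF add_hom_pr] S0_carrier)
  have h: "x \<in> S1" if "x \<in> S0" "x \<in> Mdeg z" for x z
  proof -
    have "pr j x \<in> S0" for j
      using pr_id[of x j] pr_other[OF that(2), of j] that p(2) by (cases "z = int j") auto
    then show ?thesis
      using that by (simp add: S1_def)
  qed
  have S1_sum: "finsum MM f I \<in> S1" if "finite I" "\<And>i. i \<in> I \<Longrightarrow> f i \<in> S1" for f and I :: "nat set"
    by (rule M.finsum_in[OF that]) (use S1c z a in auto)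
  have d: "d \<odot>\<^bsub>MM\<^esub> m \<in> S1" if "d \<in> dcomp k" "m \<in> S1" for d k m
  proof -
    have mc: "m \<in> carrier MM"
      by (rule S1c[OF that(2)])
    have "d \<odot>\<^bsub>MM\<^esub> m = d \<odot>\<^bsub>MM\<^esub> finsum MM (\<lambda>i. pr i m) {..degree_bound}"
      by (rule arg_cong[OF sum_pr[OF mc]])
    also have "\<dots> = finsum MM (\<lambda>i. d \<odot>\<^bsub>MM\<^esub> pr i m) {..degree_bound}"
      by (rule M.sm_rsum) (simp_all add: mc)
    also have "\<dots> \<in> S1"
    proof (rule S1_sum)
      fix i
      show "d \<odot>\<^bsub>MM\<^esub> pr i m \<in> S1"
      proof (rule h)
        show "d \<odot>\<^bsub>MM\<^esub> pr i m \<in> S0"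
          using that(2) p(4) by (simp add: S1_def)
        show "d \<odot>\<^bsub>MM\<^esub> pr i m \<in> Mdeg (int i - k)"
          by (rule dcomp_Mdeg[OF that(1) pr_Mdeg[OF mc]])
      qed
    qed simp
    finally show ?thesis .
  qed
  have "M.sub S1"
    unfolding M.sub_def
  proof (intro conjI ballI allI)
    show "t \<odot>\<^bsub>MM\<^esub> m \<in> S1" if m: "m \<in> S1" for t m
    proof -
      obtain f where f: "t = (\<Sum>i\<le>degree_bound. \<Sum>j\<le>degree_bound. f i j)" "\<And>i j. f i j \<in> dcomp (int j - int i)"
        using dcomp_decompose[of t] by blast
      have "t \<odot>\<^bsub>MM\<^esub> m = finsum MM (\<lambda>i. finsum MM (\<lambda>j. f i j \<odot>\<^bsub>MM\<^esub> m) {..degree_bound}) {..degree_bound}"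
        unfolding f(1) M.sm_lsum[OF finite_atMost S1c[OF m]] ..
      also have "\<dots> \<in> S1"
        by (intro S1_sum finite_atMost d[OF f(2) m])
      finally show ?thesis .
    qed
  qed (use S1c z a in auto)
  moreover obtain N w where "w \<in> S0" "w \<noteq> \<zero>\<^bsub>MM\<^esub>" "w \<in> Mdeg (int N)"
    by (rule S0_nonzero)
  then have "S1 \<noteq> {\<zero>\<^bsub>MM\<^esub>}"
    using h by blast
  ultimately have "S0 \<subseteq> S1"
    by (rule S0_least)
  then show "m \<in> S0 \<Longrightarrow> pr j m \<in> S0"
    by (auto simp: S1_def)
qed

text \<open>Least depth means highest degree; the integer n of the theorem is
  \<open>- int j0\<close>.\<close>

definition j0 where "j0 = (LEAST j. \<exists>m\<in>S0. m \<in> Mdeg (int j) \<and> m \<noteq> \<zero>\<^bsub>MM\<^esub>)"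

definition mu0 where "mu0 = S0 \<inter> Mdeg (int j0)"

lemma mu0_nonzero: "\<exists>m\<in>mu0. m \<noteq> \<zero>\<^bsub>MM\<^esub>"
proof -
  have "\<exists>j. \<exists>m\<in>S0. m \<in> Mdeg (int j) \<and> m \<noteq> \<zero>\<^bsub>MM\<^esub>"
    by (rule S0_nonzero) blast
  from LeastI_ex[OF this] show ?thesis
    unfolding j0_def[symmetric] mu0_def by blast
qed

lemma S0_below: "m \<in> S0 \<Longrightarrow> m \<in> Mdeg z \<Longrightarrow> z < int j0 \<Longrightarrow> m = \<zero>\<^bsub>MM\<^esub>"
proof (cases "z < 0")
  case False
  assume m: "m \<in> S0" "m \<in> Mdeg z" "z < int j0"
  obtain j where j: "z = int j"
    using False by (metis nonneg_int_cases not_less)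
  then show ?thesis
    using not_less_Least[of j "\<lambda>j. \<exists>m\<in>S0. m \<in> Mdeg (int j) \<and> m \<noteq> \<zero>\<^bsub>MM\<^esub>"] m unfolding j0_def[symmetric] by auto
qed (rule Mdeg_neg)

lemma Vbar_dcomp: "\<alpha> \<in> Vbar H B \<Longrightarrow> \<alpha> \<in> dcomp 1"
proof -
  assume "\<alpha> \<in> Vbar H B"
  then obtain \<phi> where \<phi>: "\<alpha> = outer \<one>\<^bsub>A\<^esub> (outer \<phi> (counit_coords H))" "\<phi> \<in> dual_comp 1"
    by (auto simp: Vbar_eq)
  show ?thesis
    unfolding dcomp_def mem_Collect_eq \<phi>(1) ev_outer
  proof (intro allI impI)
    fix i y assume y: "y \<in> acomp i"
    show "vscale (pairing (outer \<phi> (counit_coords H)) y) \<one>\<^bsub>A\<^esub> \<in> acomp_int (int i - 1)"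
    proof (cases "i = 1")
      case True
      have "outer \<one>\<^bsub>B\<^esub> \<one>\<^bsub>H\<^esub> \<in> acomp_int (int 0)"
        unfolding acomp_int_acomp by (rule outer_acomp[OF one_comp])
      then show ?thesis
        using True by (simp add: acomp_int_scale)
    next
      case False
      have "pairing (outer \<phi> (counit_coords H)) (PA i z) = 0" for z
      proof (rule lin_eq_outerI[where t=z and f="\<lambda>z. pairing (outer \<phi> (counit_coords H)) (PA i z)" and g="\<lambda>z. 0"])
        show "pairing (outer \<phi> (counit_coords H)) (PA i (outer x h)) = 0" for x h
          using pairing_dual_comp[OF \<phi>(2), of i x] False by (simp add: PA_outer pairing_outer)
      qed (simp_all add: lin_zero_fun)
      from this[of y] have "pairing (outer \<phi> (counit_coords H)) y = 0"
        using y by (simp add: acomp_def)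
      then show ?thesis
        using acomp_int_zero by simp
    qed
  qed
qed

text \<open>The dual of V lowers depth by one, and \<open>S0\<close> has no nonzero element of depth
  less than \<open>j0\<close>.\<close>

lemma mu0_Vbar: "\<alpha> \<in> Vbar H B \<Longrightarrow> x \<in> mu0 \<Longrightarrow> \<alpha> \<odot>\<^bsub>MM\<^esub> x = \<zero>\<^bsub>MM\<^esub>"
proof (rule S0_below)
  assume \<alpha>: "\<alpha> \<in> Vbar H B" and x: "x \<in> mu0"
  show "\<alpha> \<odot>\<^bsub>MM\<^esub> x \<in> S0"
    using x M.subD(4)[OF sub_S0] by (simp add: mu0_def)
  show "\<alpha> \<odot>\<^bsub>MM\<^esub> x \<in> Mdeg (int j0 - 1)"
    by (rule dcomp_Mdeg[OF Vbar_dcomp[OF \<alpha>]]) (use x in \<open>simp add: mu0_def\<close>)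
qed simp

end

section \<open>Highest weight spaces over the double of H\<close>

context verma_setting
begin

abbreviation "DM \<equiv> restrict_scalars (incl_DH H B) MM"

lemma DM_simps: "carrier DM = carrier MM" "\<zero>\<^bsub>DM\<^esub> = \<zero>\<^bsub>MM\<^esub>" "x \<oplus>\<^bsub>DM\<^esub> y = x \<oplus>\<^bsub>MM\<^esub> y"
  "r \<odot>\<^bsub>DM\<^esub> x = incl_DH H B r \<odot>\<^bsub>MM\<^esub> x"
  by (simp_all add: restrict_scalars_def)

lemma alg_module_DM: "alg_module DHH DM"
proof (rule alg_module.intro)
  show "fd_algebra DHH"
    by (rule L.algebra)
  have "abelian_group DM"
  proof (rule abelian_groupI; unfold DM_simps)
    fix x assume "x \<in> carrier MM"
    then show "\<exists>y\<in>carrier MM. y \<oplus>\<^bsub>MM\<^esub> x = \<zero>\<^bsub>MM\<^esub>"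
      by (intro bexI[of _ "\<ominus>\<^bsub>MM\<^esub> x"]) (simp_all add: M.l_neg)
  qed (simp_all add: M.a_ac)
  moreover have "ring DHH"
    using L.algebra by (simp add: fd_algebra_def)
  moreover have "\<forall>x\<in>carrier MM. incl_DH H B \<one>\<^bsub>DHH\<^esub> \<odot>\<^bsub>MM\<^esub> x = x"
    unfolding incl_DH_one using M.sm_one by blast
  ultimately show "left_module DHH DM"
    unfolding left_module_def left_module_axioms_def
    by (simp add: DM_simps vlin_add[OF vlin_incl_DH] incl_DH_mult incl_DH_one M.sm_ladd M.sm_radd M.sm_mult M.sm_one
        del: D_simps plus_fun_apply)
qed

sublocale DM: alg_module DHH DM
  by (rule alg_module_DM)

text \<open>The nonnegative part is generated by the dual of V, which kills \<open>\<nu>\<close>,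
  and the double of H, on which \<open>proj\<close> is the identity. In the product case the claim
  for r is applied to a vector already moved by r', so \<open>\<nu>\<close> has to be stable under
  the double of H.\<close>

lemma Rset_stable:
  assumes \<nu>: "DM.sub \<nu>" and kill: "\<forall>\<alpha>\<in>Vbar H B. \<forall>x\<in>\<nu>. \<alpha> \<odot>\<^bsub>MM\<^esub> x = \<zero>\<^bsub>MM\<^esub>"
    and r: "r \<in> Rset" and x: "x \<in> \<nu>"
  shows "r \<odot>\<^bsub>MM\<^esub> x = incl_DH H B (proj r) \<odot>\<^bsub>MM\<^esub> x"
proof -
  note p = DM.subD[OF \<nu>, unfolded DM_simps]
  have c: "x \<in> \<nu> \<Longrightarrow> x \<in> carrier MM" for x
    using p(1) by blast
  have "r \<in> nonneg"
    using r nonneg_eq by simp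
  then have "r \<in> Rset \<and> (\<forall>x\<in>\<nu>. r \<odot>\<^bsub>MM\<^esub> x = incl_DH H B (proj r) \<odot>\<^bsub>MM\<^esub> x)"
  proof (induction r rule: generate_ring.induct)
    case one
    show ?case
      using incl_DH_Rset[of "\<one>\<^bsub>DHH\<^esub>"] unfolding incl_DH_one proj_one by blast
  next
    case (incl r)
    then show ?case
    proof
      assume r: "r \<in> Vbar H B"
      have z: "incl_DH H B (proj r) = 0"
        unfolding proj_Vbar[OF r] by (rule vlin_zero[OF vlin_incl_DH])
      have "r \<odot>\<^bsub>MM\<^esub> x = incl_DH H B (proj r) \<odot>\<^bsub>MM\<^esub> x" if x: "x \<in> \<nu>" for x
        unfolding z bspec[OF bspec[OF kill r] x] by (rule M.sm_lzero[OF c[OF x], symmetric])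
      then show ?thesis
        using Vbar_Rset[OF r] by blast
    next
      assume "r \<in> range (incl_DH H B)"
      then show ?thesis
        by (auto simp: incl_DH_Rset proj_incl_DH)
    qed
  next
    case (a_inv r)
    then have r: "r \<in> Rset" and e: "\<And>x. x \<in> \<nu> \<Longrightarrow> r \<odot>\<^bsub>MM\<^esub> x = incl_DH H B (proj r) \<odot>\<^bsub>MM\<^esub> x"
      by blast+
    show ?case
      unfolding DD.a_inv_eq vlin_minus[OF vlin_proj] vlin_minus[OF vlin_incl_DH]
    proof (intro conjI ballI)
      show "- r \<in> Rset"
        by (rule Rset_minus[OF r])
      show "(- r) \<odot>\<^bsub>MM\<^esub> x = (- incl_DH H B (proj r)) \<odot>\<^bsub>MM\<^esub> x" if "x \<in> \<nu>" for x
        by (simp only: M.sm_lminus[OF c[OF that]] e[OF that])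
    qed
  next
    case (eng_add r r')
    then have r: "r \<in> Rset" "r' \<in> Rset"
      and e: "\<And>x. x \<in> \<nu> \<Longrightarrow> r \<odot>\<^bsub>MM\<^esub> x = incl_DH H B (proj r) \<odot>\<^bsub>MM\<^esub> x"
        "\<And>x. x \<in> \<nu> \<Longrightarrow> r' \<odot>\<^bsub>MM\<^esub> x = incl_DH H B (proj r') \<odot>\<^bsub>MM\<^esub> x"
      by blast+
    show ?case
      unfolding D_simps(3) vlin_add[OF vlin_proj] vlin_add[OF vlin_incl_DH]
    proof (intro conjI ballI)
      show "r + r' \<in> Rset"
        by (rule Rset_add[OF r])
      show "(r + r') \<odot>\<^bsub>MM\<^esub> x = (incl_DH H B (proj r) + incl_DH H B (proj r')) \<odot>\<^bsub>MM\<^esub> x" if "x \<in> \<nu>" for x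
        by (simp only: M.sm_ladd[OF c[OF that]] e[OF that])
    qed
  next
    case (eng_mult r r')
    then have rr: "r \<in> Rset" "r' \<in> Rset"
      by auto
    have e: "proj (r \<otimes>\<^bsub>D\<^esub> r') = proj r \<otimes>\<^bsub>DHH\<^esub> proj r'"
      using qcoef_mult[OF rr(2), of \<epsilon>B r] by (simp only: proj_DH_eq[symmetric])
    have "(r \<otimes>\<^bsub>D\<^esub> r') \<odot>\<^bsub>MM\<^esub> x = incl_DH H B (proj (r \<otimes>\<^bsub>D\<^esub> r')) \<odot>\<^bsub>MM\<^esub> x" if x: "x \<in> \<nu>" for x
    proof -
      have "(r \<otimes>\<^bsub>D\<^esub> r') \<odot>\<^bsub>MM\<^esub> x = r \<odot>\<^bsub>MM\<^esub> (incl_DH H B (proj r') \<odot>\<^bsub>MM\<^esub> x)"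
        using eng_mult(4) x by (simp add: M.sm_mult c)
      also have "\<dots> = incl_DH H B (proj r) \<odot>\<^bsub>MM\<^esub> (incl_DH H B (proj r') \<odot>\<^bsub>MM\<^esub> x)"
        using eng_mult(3) p(4)[OF x] by blast
      also have "\<dots> = incl_DH H B (proj (r \<otimes>\<^bsub>D\<^esub> r')) \<odot>\<^bsub>MM\<^esub> x"
        unfolding e incl_DH_mult by (rule M.sm_mult[OF c[OF x], symmetric])
      finally show ?thesis .
    qed
    then show ?case
      using Rset_mult[OF rr] by blast
  qed
  then show ?thesis
    using x by blast
qed

end

context simple_verma
begin

text \<open>The submodule generated by a highest weight space lies in the degrees from that of the space upwards.\<close>

lemma hw_generates:
  assumes \<nu>: "DM.sub \<nu>" and kill: "\<forall>\<alpha>\<in>Vbar H B. \<forall>x\<in>\<nu>. \<alpha> \<odot>\<^bsub>MM\<^esub> x = \<zero>\<^bsub>MM\<^esub>"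
    and deg: "\<nu> \<subseteq> Mdeg (int k)" and nz: "\<nu> \<noteq> {\<zero>\<^bsub>MM\<^esub>}"
  shows "k \<le> j0" "k = j0 \<Longrightarrow> mu0 \<subseteq> \<nu>"
proof -
  note p = DM.subD[OF \<nu>, unfolded DM_simps]
  have c: "x \<in> \<nu> \<Longrightarrow> x \<in> carrier MM" for x
    using p(1) by blast
  define X where "X = {incl_B H B b \<odot>\<^bsub>MM\<^esub> x | b x. x \<in> \<nu>}"
  have Xc: "X \<subseteq> carrier MM"
    using c by (auto simp: X_def)
  note g = M.generate_closed[OF Xc]
  have "M.sub (generate (add_monoid MM) X)"
  proof (rule M.sub_generate[OF Xc])
    fix a m assume "m \<in> X"
    then obtain b x where m: "m = incl_B H B b \<odot>\<^bsub>MM\<^esub> x" and x: "x \<in> \<nu>"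
      by (auto simp: X_def)
    let ?d = "a \<otimes>\<^bsub>D\<^esub> incl_B H B b"
    have "a \<odot>\<^bsub>MM\<^esub> m = ?d \<odot>\<^bsub>MM\<^esub> x"
      unfolding m by (rule M.sm_mult[OF c[OF x], symmetric])
    \<comment> \<open>By the triangular decomposition any element moves x into B times
      \<open>\<nu>\<close>, since its \<open>Rset\<close> factors preserve
      \<open>\<nu>\<close>.\<close>
    also have "\<dots> = (\<Sum>i\<in>UNIV. incl_B H B (bvec i) \<otimes>\<^bsub>D\<^esub> Rcoef i ?d) \<odot>\<^bsub>MM\<^esub> x"
      by (rule arg_cong[where f="\<lambda>d. d \<odot>\<^bsub>MM\<^esub> x"]) (rule decompose)
    also have "\<dots> = finsum MM (\<lambda>i. (incl_B H B (bvec i) \<otimes>\<^bsub>D\<^esub> Rcoef i ?d) \<odot>\<^bsub>MM\<^esub> x) UNIV"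
      by (rule M.sm_lsum[OF finite_UNIV c[OF x]])
    also have "\<dots> \<in> generate (add_monoid MM) X"
    proof (rule M.finsum_in[OF finite_UNIV _ g(1,2,3)])
      fix i
      have "Rcoef i ?d \<odot>\<^bsub>MM\<^esub> x \<in> \<nu>"
        unfolding Rset_stable[OF \<nu> kill Rcoef_Rset x] by (rule p(4)[OF x])
      then have "incl_B H B (bvec i) \<odot>\<^bsub>MM\<^esub> (Rcoef i ?d \<odot>\<^bsub>MM\<^esub> x) \<in> X"
        by (auto simp: X_def)
      then show "(incl_B H B (bvec i) \<otimes>\<^bsub>D\<^esub> Rcoef i ?d) \<odot>\<^bsub>MM\<^esub> x \<in> generate (add_monoid MM) X"
        unfolding M.sm_mult[OF c[OF x]] using g(5) by blast
    qed
    finally show "a \<odot>\<^bsub>MM\<^esub> m \<in> generate (add_monoid MM) X" .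
  qed
  moreover have "generate (add_monoid MM) X \<noteq> {\<zero>\<^bsub>MM\<^esub>}"
  proof -
    obtain x where x: "x \<in> \<nu>" "x \<noteq> \<zero>\<^bsub>MM\<^esub>"
      using nz p(2) by blast
    have "incl_B H B \<one>\<^bsub>B\<^esub> \<odot>\<^bsub>MM\<^esub> x = x"
      unfolding incl_B_one by (rule M.sm_one[OF c[OF x(1)]])
    then have "x \<in> X"
      unfolding X_def using x(1) by (intro CollectI exI[of _ "\<one>\<^bsub>B\<^esub>"] exI[of _ x]) simp
    then show ?thesis
      using g(5) x(2) by blast
  qed
  ultimately have 1: "S0 \<subseteq> generate (add_monoid MM) X"
    by (rule S0_least)
  \<comment> \<open>An additive condition met by X: no component of depth less than k, and at depth
    k only elements of \<open>\<nu>\<close>. It passes to the submodule because X generates that as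
    an additive group.\<close>
  define Y where "Y = {m \<in> carrier MM. (\<forall>j<k. pr j m = \<zero>\<^bsub>MM\<^esub>) \<and> pr k m \<in> \<nu>}"
  have XY: "X \<subseteq> Y"
  proof
    fix m assume "m \<in> X"
    then obtain b x where m: "m = incl_B H B b \<odot>\<^bsub>MM\<^esub> x" and x: "x \<in> \<nu>"
      by (auto simp: X_def)
    have xk: "x \<in> Mdeg (int k)"
      using deg x by blast
    let ?t = "\<lambda>n. incl_B H B (hcomp n b) \<odot>\<^bsub>MM\<^esub> x"
    have t: "?t n \<in> Mdeg (int (k + n))" for n
      using dcomp_Mdeg[OF incl_B_dcomp[OF hcomp_props(1)] xk, of n b] by simp
    have mt: "m = finsum MM ?t {..degree_bound}"
    proof -
      have "m = (\<Sum>n\<le>degree_bound. incl_B H B (hcomp n b)) \<odot>\<^bsub>MM\<^esub> x"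
        unfolding m vlin_sum[OF vlin_incl_B, symmetric] sum_hcomp ..
      then show ?thesis
        by (simp only: M.sm_lsum[OF finite_atMost c[OF x]])
    qed
    have pm: "pr j m = finsum MM (\<lambda>n. pr j (?t n)) {..degree_bound}" for j
      unfolding mt by (rule add_hom_finsum[OF add_hom_pr]) (simp_all add: c x)
    have "pr j m = \<zero>\<^bsub>MM\<^esub>" if "j < k" for j
    proof -
      have "pr j (?t n) = \<zero>\<^bsub>MM\<^esub>" for n
        by (rule pr_other[OF t]) (use that in simp)
      then show ?thesis
        unfolding pm by (simp only: M.finsum_zero)
    qed
    moreover have "pr k m \<in> \<nu>"
      unfolding pm
    proof (rule M.finsum_in[OF finite_atMost])
      fix n
      show "pr k (?t n) \<in> \<nu>"
      \<comment> \<open>Only the scalar part of b keeps x at depth k.\<close>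
      proof (cases "n = 0")
        case True
        have "?t 0 = vscale (counit B b) \<one>\<^bsub>D\<^esub> \<odot>\<^bsub>MM\<^esub> x"
          unfolding hcomp_0 vlin_scale[OF vlin_incl_B] incl_B_one ..
        also have "\<dots> = incl_DH H B (vscale (counit B b) \<one>\<^bsub>DHH\<^esub>) \<odot>\<^bsub>MM\<^esub> x"
          unfolding vlin_scale[OF vlin_incl_DH] incl_DH_one ..
        finally have "?t 0 \<in> \<nu>"
          using p(4)[OF x] by simp
        moreover have "pr k (?t 0) = ?t 0"
          by (rule pr_id) (use t[of 0] in simp)
        ultimately show ?thesis
          using True by simp
      next
        case False
        have "pr k (?t n) = \<zero>\<^bsub>MM\<^esub>"
          by (rule pr_other[OF t]) (use False in simp)
        then show ?thesis
          using p(2) by simp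
      qed
    qed (use p in auto)
    moreover have "m \<in> carrier MM"
      using m c[OF x] by simp
    ultimately show "m \<in> Y"
      by (simp add: Y_def)
  qed
  have "generate (add_monoid MM) X \<subseteq> Y"
  proof (rule M.generate_subset[OF XY])
    show "Y \<subseteq> carrier MM" "\<zero>\<^bsub>MM\<^esub> \<in> Y"
      using p(2) by (auto simp: Y_def add_hom_zero[OF add_hom_pr])
    show "x \<oplus>\<^bsub>MM\<^esub> y \<in> Y" if "x \<in> Y" "y \<in> Y" for x y
      using that p(3) by (simp add: Y_def add_hom_add[OF add_hom_pr])
    have "\<ominus>\<^bsub>DM\<^esub> x = \<ominus>\<^bsub>MM\<^esub> x" for x
      by (simp add: a_inv_def m_inv_def restrict_scalars_def)
    then show "\<ominus>\<^bsub>MM\<^esub> x \<in> Y" if "x \<in> Y" for x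
      using that DM.sub_minus[OF \<nu>, of "pr k x"] by (simp add: Y_def add_hom_minus[OF add_hom_pr])
  qed
  with 1 have SY: "S0 \<subseteq> Y"
    by blast
  obtain m where m: "m \<in> S0" "m \<in> Mdeg (int j0)" "m \<noteq> \<zero>\<^bsub>MM\<^esub>"
    using mu0_nonzero by (auto simp: mu0_def)
  show "k \<le> j0"
  proof (rule ccontr)
    assume "\<not> k \<le> j0"
    then have "pr j0 m = \<zero>\<^bsub>MM\<^esub>"
      using SY m(1) by (auto simp: Y_def)
    then show False
      using pr_id[OF m(2)] m(3) by simp
  qed
  show "mu0 \<subseteq> \<nu>" if "k = j0"
  proof
    fix x assume x: "x \<in> mu0"
    then have "pr k x \<in> \<nu>"
      using SY by (auto simp: Y_def mu0_def)
    then show "x \<in> \<nu>"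
      using pr_id[of x k] x that by (simp add: mu0_def)
  qed
qed

lemma sub_mu0: "DM.sub mu0"
  unfolding DM.sub_def DM_simps
proof (intro conjI ballI allI)
  note p = M.subD[OF sub_S0]
  show "mu0 \<subseteq> carrier MM" "\<zero>\<^bsub>MM\<^esub> \<in> mu0"
    using p(2) by (auto simp: mu0_def Mdeg_zero S0_carrier)
  show "x \<oplus>\<^bsub>MM\<^esub> y \<in> mu0" if "x \<in> mu0" "y \<in> mu0" for x y
    using that p(3) by (simp add: mu0_def Mdeg_add)
  show "incl_DH H B r \<odot>\<^bsub>MM\<^esub> x \<in> mu0" if "x \<in> mu0" for r x
    using that p(4) dcomp_Mdeg[OF incl_DH_dcomp, of x "int j0" r] by (simp add: mu0_def)
qed

lemma mu0_kill: "\<forall>\<alpha>\<in>Vbar H B. \<forall>x\<in>mu0. \<alpha> \<odot>\<^bsub>MM\<^esub> x = \<zero>\<^bsub>MM\<^esub>"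
  using mu0_Vbar by blast

text \<open>Submodules of \<open>mu0\<close> are again killed by the dual of V and sit at depth
  \<open>j0\<close>, so by \<open>hw_generates\<close> a nonzero one contains
  \<open>mu0\<close>.\<close>

lemma mu0_simple: "DM.sub \<nu> \<Longrightarrow> \<nu> \<subseteq> mu0 \<Longrightarrow> \<nu> \<noteq> {\<zero>\<^bsub>MM\<^esub>} \<Longrightarrow> \<nu> = mu0"
proof -
  assume \<nu>: "DM.sub \<nu>" "\<nu> \<subseteq> mu0" "\<nu> \<noteq> {\<zero>\<^bsub>MM\<^esub>}"
  have kill: "\<forall>\<alpha>\<in>Vbar H B. \<forall>x\<in>\<nu>. \<alpha> \<odot>\<^bsub>MM\<^esub> x = \<zero>\<^bsub>MM\<^esub>"
    using mu0_Vbar \<nu>(2) by blast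
  have "\<nu> \<subseteq> Mdeg (int j0)"
    using \<nu>(2) by (auto simp: mu0_def)
  from hw_generates(2)[OF \<nu>(1) kill this \<nu>(3)] show ?thesis
    using \<nu>(2) by blast
qed

end

section \<open>The cover of the socle by a Verma module\<close>

context verma_setting
begin

text \<open>A generator of degree d - m has depth m; conversely \<open>pr\<close> writes an element
  of depth j through generators with B-factor of degree j.\<close>

lemma verma_grading_eq: "verma_grading H B lam (concentrated d lam) a = Mdeg (d - a)"
proof -
  define X where "X = {T (incl_B H B b) x | b x m j. b \<in> comp B m \<and> x \<in> concentrated d lam j \<and> j - int m = a}"
  have e: "verma_grading H B lam (concentrated d lam) a = generate (add_monoid MM) X"
    unfolding verma_grading_def X_def ..
  have X: "X \<subseteq> Mdeg (d - a)"
  proof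
    fix t assume "t \<in> X"
    then obtain b x m j where t: "t = \<tau> b x" and b: "b \<in> comp B m" and x: "x \<in> concentrated d lam j" and j: "j - int m = a"
      unfolding X_def by blast
    show "t \<in> Mdeg (d - a)"
    proof (cases "j = d")
      case True
      then have "x \<in> carrier lam" "- (- int m) = d - a"
        using x j by (auto simp: concentrated_def)
      then show ?thesis
        unfolding t using T_Mdeg[OF incl_B_dcomp[OF b], of x] by simp
    next
      case False
      then have "x = \<zero>\<^bsub>lam\<^esub>"
        using x by (simp add: concentrated_def)
      then show ?thesis
        unfolding t by (simp add: T_zero Mdeg_zero)
    qed
  qed
  have Xc: "X \<subseteq> carrier MM"
    using X Mdeg_carrier by blast
  have "generate (add_monoid MM) X \<subseteq> Mdeg (d - a)"
    by (rule M.generate_subset[OF X]) (auto simp: Mdeg_carrier Mdeg_zero Mdeg_add Mdeg_minus)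
  moreover have "Mdeg (d - a) \<subseteq> generate (add_monoid MM) X"
  proof
    fix m assume m: "m \<in> Mdeg (d - a)"
    note g = M.generate_closed[OF Xc]
    show "m \<in> generate (add_monoid MM) X"
    proof (cases "d - a < 0")
      case True
      then have "m = \<zero>\<^bsub>MM\<^esub>"
        using Mdeg_neg[OF m] by simp
      then show ?thesis
        using g(2) by simp
    next
      case False
      define j where "j = nat (d - a)"
      have j: "d - a = int j"
        using False by (simp add: j_def)
      have c: "cf (bvec i) m \<in> carrier lam" for i
        using Mdeg_carrier[OF m] by simp
      have "m = finsum MM (\<lambda>i. \<tau> (hcomp j (bvec i)) (cf (bvec i) m)) UNIV"
        using pr_id[of m j] m j unfolding pr_def by simp
      also have "\<dots> \<in> generate (add_monoid MM) X"
      proof (rule M.finsum_in[OF finite_UNIV _ g(1,2,3)])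
        fix i
        have "\<tau> (hcomp j (bvec i)) (cf (bvec i) m) \<in> X"
          unfolding X_def
          by (intro CollectI exI[of _ "hcomp j (bvec i)"] exI[of _ "cf (bvec i) m"] exI[of _ j] exI[of _ d])
             (use hcomp_props(1) c j in \<open>simp add: concentrated_def\<close>)
        then show "\<tau> (hcomp j (bvec i)) (cf (bvec i) m) \<in> generate (add_monoid MM) X"
          using g(5) by blast
      qed
      finally show ?thesis .
    qed
  qed
  ultimately show ?thesis
    unfolding e by blast
qed

text \<open>An element is the sum of its components, so stability under \<open>pr\<close> gives the
  generation by homogeneous elements that the graded category asks for.\<close>

lemma subobject_verma:
  assumes P: "M.sub P" and pr: "\<And>m j. m \<in> P \<Longrightarrow> pr j m \<in> P"
  shows "subobject C D MM (verma_grading H B lam (concentrated d lam)) P"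
  unfolding subobject_def M.submodule_iff verma_grading_eq
proof (intro conjI impI P subset_antisym)
  note p = M.subD[OF P]
  have Xc: "(\<Union>a. P \<inter> Mdeg (d - a)) \<subseteq> carrier MM"
    using p(1) by blast
  note g = M.generate_closed[OF Xc]
  show "generate (add_monoid MM) (\<Union>a. P \<inter> Mdeg (d - a)) \<subseteq> P"
    by (rule M.generate_subset) (use p M.sub_minus[OF P] in auto)
  show "P \<subseteq> generate (add_monoid MM) (\<Union>a. P \<inter> Mdeg (d - a))"
  proof
    fix m assume m: "m \<in> P"
    then have mc: "m \<in> carrier MM"
      using p(1) by blast
    have "finsum MM (\<lambda>j. pr j m) {..degree_bound} \<in> generate (add_monoid MM) (\<Union>a. P \<inter> Mdeg (d - a))"
    proof (rule M.finsum_in[OF finite_atMost _ g(1,2,3)])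
      fix j
      have "pr j m \<in> Mdeg (d - (d - int j))"
        using pr_Mdeg[OF mc, of j] by simp
      then have "pr j m \<in> (\<Union>a. P \<inter> Mdeg (d - a))"
        using pr[OF m] by blast
      then show "pr j m \<in> generate (add_monoid MM) (\<Union>a. P \<inter> Mdeg (d - a))"
        using g(5) by blast
    qed
    then show "m \<in> generate (add_monoid MM) (\<Union>a. P \<inter> Mdeg (d - a))"
      using sum_pr[OF mc] by simp
  qed
qed

lemma subobject_DM:
  assumes P: "DM.sub P" and deg: "P \<subseteq> Mdeg z"
  shows "subobject C DHH DM (verma_grading H B lam (concentrated d lam)) P"
  unfolding subobject_def DM.submodule_iff verma_grading_eq
proof (intro conjI impI P subset_antisym)
  note p = DM.subD[OF P]
  have Xc: "(\<Union>a. P \<inter> Mdeg (d - a)) \<subseteq> carrier DM"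
    using p(1) by blast
  show "generate (add_monoid DM) (\<Union>a. P \<inter> Mdeg (d - a)) \<subseteq> P"
    by (rule DM.generate_subset) (use p DM.sub_minus[OF P] in auto)
  have "P \<subseteq> P \<inter> Mdeg (d - (d - z))"
    using deg by simp
  then show "P \<subseteq> generate (add_monoid DM) (\<Union>a. P \<inter> Mdeg (d - a))"
    using DM.generate_closed(5)[OF Xc] by blast
qed

end

section \<open>The map from the Verma module of \<open>mu\<close>\<close>

context simple_verma
begin

abbreviation "mu \<equiv> verma_submodule H B lam mu0"

lemma mu_eq: "mu = DM\<lparr>carrier := mu0\<rparr>"
  unfolding verma_submodule_def ..

lemma mu_simps: "carrier mu = mu0" "\<zero>\<^bsub>mu\<^esub> = \<zero>\<^bsub>MM\<^esub>" "x \<oplus>\<^bsub>mu\<^esub> y = x \<oplus>\<^bsub>MM\<^esub> y"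
  "r \<odot>\<^bsub>mu\<^esub> x = incl_DH H B r \<odot>\<^bsub>MM\<^esub> x"
  by (simp_all add: verma_submodule_def restrict_scalars_def)

lemma mu0_carrier: "x \<in> mu0 \<Longrightarrow> x \<in> carrier MM"
  by (simp add: mu0_def S0_carrier)

text \<open>All constructions are repeated with inducing module \<open>mu\<close>; names with
  \<open>W\<close> refer to its Verma module.\<close>

sublocale W: verma_setting H s act coact B \<iota> mu
proof (rule verma_setting.intro)
  show "nichols_algebra H s act coact B \<iota>"
    by (rule nichols_algebra_axioms)
  show "alg_module DHH mu"
    unfolding mu_eq by (rule DM.alg_module_sub[OF sub_mu0])
qed

definition \<Phi> where "\<Phi> = (SOME F. add_hom W.MM MM F \<and> (\<forall>d. \<forall>x\<in>carrier mu. F (W.T d x) = d \<odot>\<^bsub>MM\<^esub> x))"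

text \<open>By \<open>Rset_stable\<close> the nonnegative part acts on \<open>mu0\<close> through
  \<open>proj\<close>, which is the balance condition of the universal property.\<close>

lemma \<Phi>_props: "add_hom W.MM MM \<Phi>" "x \<in> mu0 \<Longrightarrow> \<Phi> (W.T d x) = d \<odot>\<^bsub>MM\<^esub> x"
proof -
  have "\<exists>F. add_hom W.MM MM F \<and> (\<forall>d. \<forall>x\<in>carrier mu. F (W.T d x) = d \<odot>\<^bsub>MM\<^esub> x)"
  proof (rule W.universal[OF M.abelian_group_axioms])
    show "add_hom mu MM (\<lambda>x. d \<odot>\<^bsub>MM\<^esub> x)" for d
      unfolding add_hom_def using W.L.abelian_group_axioms M.abelian_group_axioms
      by (simp add: mu_simps mu0_carrier M.sm_radd)
    show "x \<in> carrier mu \<Longrightarrow> (d + e) \<odot>\<^bsub>MM\<^esub> x = d \<odot>\<^bsub>MM\<^esub> x \<oplus>\<^bsub>MM\<^esub> e \<odot>\<^bsub>MM\<^esub> x" for d e x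
      by (rule M.sm_ladd) (simp add: mu_simps mu0_carrier)
    show "(d \<otimes>\<^bsub>D\<^esub> r) \<odot>\<^bsub>MM\<^esub> x = d \<odot>\<^bsub>MM\<^esub> (proj r \<odot>\<^bsub>mu\<^esub> x)" if r: "r \<in> Rset" and x: "x \<in> carrier mu" for d r x
    proof -
      have x': "x \<in> mu0"
        using x by (simp add: mu_simps)
      show ?thesis
        unfolding mu_simps Rset_stable[OF sub_mu0 mu0_kill r x', symmetric] by (rule M.sm_mult[OF mu0_carrier[OF x']])
    qed
  qed
  then have "add_hom W.MM MM \<Phi> \<and> (\<forall>d. \<forall>x\<in>carrier mu. \<Phi> (W.T d x) = d \<odot>\<^bsub>MM\<^esub> x)"
    unfolding \<Phi>_def by (rule someI_ex)
  then show "add_hom W.MM MM \<Phi>" "x \<in> mu0 \<Longrightarrow> \<Phi> (W.T d x) = d \<odot>\<^bsub>MM\<^esub> x"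
    by (auto simp: mu_simps)
qed

lemmas \<Phi>_closed = add_hom_closed[OF \<Phi>_props(1)]
lemmas \<Phi>_add = add_hom_add[OF \<Phi>_props(1)]
lemmas \<Phi>_zero = add_hom_zero[OF \<Phi>_props(1)]

lemma \<Phi>_smult: "m \<in> carrier W.MM \<Longrightarrow> \<Phi> (a \<odot>\<^bsub>W.MM\<^esub> m) = a \<odot>\<^bsub>MM\<^esub> \<Phi> m"
proof (rule W.add_hom_eqI[where f="\<lambda>m. \<Phi> (a \<odot>\<^bsub>W.MM\<^esub> m)" and g="\<lambda>m. a \<odot>\<^bsub>MM\<^esub> \<Phi> m" and G=MM])
  show "add_hom W.MM MM (\<lambda>m. \<Phi> (a \<odot>\<^bsub>W.MM\<^esub> m))"
    by (rule add_hom_comp[OF W.M.add_hom_sm \<Phi>_props(1)])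
  show "add_hom W.MM MM (\<lambda>m. a \<odot>\<^bsub>MM\<^esub> \<Phi> m)"
    by (rule add_hom_comp[OF \<Phi>_props(1) M.add_hom_sm])
  fix d x assume x: "x \<in> carrier mu"
  then have x': "x \<in> mu0"
    by (simp add: mu_simps)
  show "\<Phi> (a \<odot>\<^bsub>W.MM\<^esub> W.T d x) = a \<odot>\<^bsub>MM\<^esub> \<Phi> (W.T d x)"
    unfolding W.T_smult[OF x] \<Phi>_props(2)[OF x'] by (rule M.sm_mult[OF mu0_carrier[OF x']])
qed

lemma \<Phi>_S0: "m \<in> carrier W.MM \<Longrightarrow> \<Phi> m \<in> S0"
proof (rule W.T_induct[where P="\<lambda>m. \<Phi> m \<in> S0"])
  show "\<Phi> (W.T d x) \<in> S0" if "x \<in> carrier mu" for d x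
  proof -
    have x: "x \<in> mu0"
      using that by (simp only: mu_simps)
    then have "x \<in> S0"
      by (simp add: mu0_def)
    then show ?thesis
      unfolding \<Phi>_props(2)[OF x] by (rule M.subD(4)[OF sub_S0])
  qed
  show "\<Phi> (m \<oplus>\<^bsub>W.MM\<^esub> m') \<in> S0" if "m \<in> carrier W.MM" "m' \<in> carrier W.MM" "\<Phi> m \<in> S0" "\<Phi> m' \<in> S0" for m m'
    unfolding \<Phi>_add[OF that(1,2)] by (rule M.subD(3)[OF sub_S0 that(3,4)])
qed

text \<open>The image of the inducing module, \<open>mu0\<close>, sits at depth \<open>j0\<close>,
  so depths are shifted by that amount.\<close>

lemma \<Phi>_deg: "m \<in> W.Mdeg z \<Longrightarrow> \<Phi> m \<in> Mdeg (z + int j0)"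
proof (cases "z < 0")
  case True
  assume "m \<in> W.Mdeg z"
  then have "m = \<zero>\<^bsub>W.MM\<^esub>"
    using True by (rule W.Mdeg_neg)
  then show ?thesis
    by (simp add: \<Phi>_zero Mdeg_zero)
next
  case False
  assume m: "m \<in> W.Mdeg z"
  define j where "j = nat z"
  have j: "z = int j"
    using False by (simp add: j_def)
  have c: "W.cf (bvec i) m \<in> carrier mu" for i
    using W.Mdeg_carrier[OF m] by simp
  have c': "W.cf (bvec i) m \<in> mu0" for i
    using c[of i] by (simp only: mu_simps)
  have "m = finsum W.MM (\<lambda>i. W.\<tau> (hcomp j (bvec i)) (W.cf (bvec i) m)) UNIV"
    using W.pr_id[of m j] m j unfolding W.pr_def by simp
  then have "\<Phi> m = \<Phi> (finsum W.MM (\<lambda>i. W.\<tau> (hcomp j (bvec i)) (W.cf (bvec i) m)) UNIV)"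
    by (rule arg_cong)
  also have "\<dots> = finsum MM (\<lambda>i. \<Phi> (W.\<tau> (hcomp j (bvec i)) (W.cf (bvec i) m))) UNIV"
    by (rule add_hom_finsum[OF \<Phi>_props(1) finite_UNIV W.T_closed[OF c]])
  also have "\<dots> \<in> Mdeg (z + int j0)"
  proof (rule Mdeg_finsum[OF finite_UNIV])
    fix i
    have "W.cf (bvec i) m \<in> Mdeg (int j0)"
      using c'[of i] by (simp add: mu0_def)
    from dcomp_Mdeg[OF incl_B_dcomp[OF hcomp_props(1)] this, of j "bvec i"]
    show "\<Phi> (W.\<tau> (hcomp j (bvec i)) (W.cf (bvec i) m)) \<in> Mdeg (z + int j0)"
      unfolding \<Phi>_props(2)[OF c'] by (simp add: j add.commute)
  qed
  finally show ?thesis .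
qed

lemma \<Phi>_pr: "m \<in> carrier W.MM \<Longrightarrow> pr (j + j0) (\<Phi> m) = \<Phi> (W.pr j m)"
proof -
  assume m: "m \<in> carrier W.MM"
  have t: "pr (j + j0) (\<Phi> (W.pr i m)) = (if j = i then \<Phi> (W.pr i m) else \<zero>\<^bsub>MM\<^esub>)" for i
  proof (cases "j = i")
    case True
    have "pr (j + j0) (\<Phi> (W.pr i m)) = \<Phi> (W.pr i m)"
      by (rule pr_id) (use \<Phi>_deg[OF W.pr_Mdeg[OF m, of i]] True in simp)
    then show ?thesis
      using True by simp
  next
    case False
    have "pr (j + j0) (\<Phi> (W.pr i m)) = \<zero>\<^bsub>MM\<^esub>"
      by (rule pr_other[OF \<Phi>_deg[OF W.pr_Mdeg[OF m, of i]]]) (use False in simp)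
    then show ?thesis
      using False by simp
  qed
  have c: "\<Phi> (W.pr i m) \<in> carrier MM" for i
    by (rule \<Phi>_closed[OF W.pr_closed[OF m]])
  have "pr (j + j0) (\<Phi> m) = pr (j + j0) (\<Phi> (finsum W.MM (\<lambda>i. W.pr i m) {..degree_bound}))"
    by (rule arg_cong[OF W.sum_pr[OF m], where f="\<lambda>m. pr (j + j0) (\<Phi> m)"])
  also have "\<dots> = finsum MM (\<lambda>i. pr (j + j0) (\<Phi> (W.pr i m))) {..degree_bound}"
    by (rule add_hom_finsum[OF add_hom_comp[OF \<Phi>_props(1) add_hom_pr]]) (simp_all add: m)
  also have "\<dots> = finsum MM (\<lambda>i. if j = i then \<Phi> (W.pr i m) else \<zero>\<^bsub>MM\<^esub>) {..degree_bound}"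
    unfolding t ..
  also have "\<dots> = \<Phi> (W.pr j m)"
  proof (cases "j \<le> degree_bound")
    case True
    show ?thesis
      by (rule M.finsum_singleton) (use True c in auto)
  next
    case False
    have "x = 0" if "x \<in> comp B j" for x
      by (rule comp_bound[OF _ that]) (use False in simp)
    then have "W.pr j m = \<zero>\<^bsub>W.MM\<^esub>"
      by (rule W.Mdeg_trivial[OF _ W.pr_Mdeg[OF m]])
    moreover have "finsum MM (\<lambda>i. if j = i then \<Phi> (W.pr i m) else \<zero>\<^bsub>MM\<^esub>) {..degree_bound} = finsum MM (\<lambda>i. \<zero>\<^bsub>MM\<^esub>) {..degree_bound}"
      by (rule M.finsum_cong') (use False in auto)
    ultimately show ?thesis
      by (simp add: \<Phi>_zero M.finsum_zero)
  qed
  finally show ?thesis .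
qed

lemma \<Phi>_unit: "x \<in> mu0 \<Longrightarrow> \<Phi> (W.\<tau> \<one>\<^bsub>B\<^esub> x) = x"
  unfolding incl_B_one by (simp only: \<Phi>_props(2) M.sm_one mu0_carrier)

lemma image_sub: "W.M.sub P \<Longrightarrow> M.sub (\<Phi> ` P)"
proof -
  assume P: "W.M.sub P"
  note p = W.M.subD[OF P]
  have c: "m \<in> P \<Longrightarrow> m \<in> carrier W.MM" for m
    using p(1) by blast
  show ?thesis
    unfolding M.sub_def
  proof (intro conjI ballI allI)
    show "\<Phi> ` P \<subseteq> carrier MM"
      using \<Phi>_closed c by blast
    show "\<zero>\<^bsub>MM\<^esub> \<in> \<Phi> ` P"
      using p(2) \<Phi>_zero by (metis imageI)
    fix x assume "x \<in> \<Phi> ` P"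
    then obtain m where m: "m \<in> P" "x = \<Phi> m"
      by blast
    show "a \<odot>\<^bsub>MM\<^esub> x \<in> \<Phi> ` P" for a
      unfolding m(2) \<Phi>_smult[OF c[OF m(1)], symmetric] by (rule imageI[OF p(4)[OF m(1)]])
    fix y assume "y \<in> \<Phi> ` P"
    then obtain m' where m': "m' \<in> P" "y = \<Phi> m'"
      by blast
    show "x \<oplus>\<^bsub>MM\<^esub> y \<in> \<Phi> ` P"
      unfolding m(2) m'(2) \<Phi>_add[OF c[OF m(1)] c[OF m'(1)], symmetric] by (rule imageI[OF p(3)[OF m(1) m'(1)]])
  qed
qed

lemma W_carrier_sub: "W.M.sub (carrier W.MM)"
  by (simp add: W.M.sub_def)

lemma \<Phi>_image: "\<Phi> ` carrier W.MM = S0"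
proof
  show "\<Phi> ` carrier W.MM \<subseteq> S0"
    using \<Phi>_S0 by blast
  obtain x where x: "x \<in> mu0" "x \<noteq> \<zero>\<^bsub>MM\<^esub>"
    using mu0_nonzero by blast
  have "W.\<tau> \<one>\<^bsub>B\<^esub> x \<in> carrier W.MM"
    by (rule W.T_closed) (simp only: mu_simps x(1))
  then have "x \<in> \<Phi> ` carrier W.MM"
    using \<Phi>_unit[OF x(1)] by (metis imageI)
  then show "S0 \<subseteq> \<Phi> ` carrier W.MM"
    using S0_least[OF image_sub[OF W_carrier_sub]] x(2) by blast
qed

definition K where "K = {m \<in> carrier W.MM. \<Phi> m = \<zero>\<^bsub>MM\<^esub>}"

lemma sub_K: "W.M.sub K"
  unfolding W.M.sub_def K_def by (simp add: \<Phi>_zero \<Phi>_add \<Phi>_smult subset_iff)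

lemma K_pr: "m \<in> K \<Longrightarrow> W.pr j m \<in> K"
  using \<Phi>_pr[of m j] by (simp add: K_def add_hom_zero[OF add_hom_pr])

lemma K_proper: "K \<noteq> carrier W.MM"
proof
  assume "K = carrier W.MM"
  then have "\<Phi> ` carrier W.MM \<subseteq> {\<zero>\<^bsub>MM\<^esub>}"
    by (auto simp: K_def)
  then show False
    using \<Phi>_image mu0_nonzero by (auto simp: mu0_def)
qed

text \<open>A submodule P not inside K covers the socle by leastness. Depth 0 maps identically to
  \<open>mu0\<close>, so for each x in \<open>mu0\<close> some m in P has depth 0 component 1 tensor
  x. Multiplying m by b of degree z gives b tensor x up to deeper terms, which are in P by
  induction; so P is everything.\<close>

lemma proper_le_K:
  assumes P: "W.M.sub P" and ne: "P \<noteq> carrier W.MM"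
  shows "P \<subseteq> K"
proof (rule ccontr)
  note p = W.M.subD[OF P]
  have c: "m \<in> P \<Longrightarrow> m \<in> carrier W.MM" for m
    using p(1) by blast
  assume "\<not> P \<subseteq> K"
  then have "\<Phi> ` P \<noteq> {\<zero>\<^bsub>MM\<^esub>}"
    using c by (auto simp: K_def)
  then have S: "S0 \<subseteq> \<Phi> ` P"
    by (rule S0_least[OF image_sub[OF P]])
  have gen: "\<exists>m\<in>P. W.pr 0 m = W.\<tau> \<one>\<^bsub>B\<^esub> x" if x: "x \<in> mu0" for x
  proof -
    obtain m where m: "m \<in> P" "\<Phi> m = x"
      using S x by (auto simp: mu0_def)
    have cm: "W.cf (bvec i) m \<in> carrier mu" for i
      using c[OF m(1)] by simp
    \<comment> \<open>The depth 0 component of m is 1 tensor y, because \<open>hcomp 0\<close> is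
      the counit times the unit.\<close>
    define y where "y = finsum mu (\<lambda>i. W.L.ks (counit B (bvec i)) (W.cf (bvec i) m)) UNIV"
    have y: "y \<in> mu0"
    proof -
      have "y \<in> carrier mu"
        unfolding y_def by (rule W.L.finsum_closed) (use W.L.ks_closed[OF cm] in blast)
      then show ?thesis
        by (simp only: mu_simps)
    qed
    have "W.pr 0 m = finsum W.MM (\<lambda>i. W.\<tau> \<one>\<^bsub>B\<^esub> (W.L.ks (counit B (bvec i)) (W.cf (bvec i) m))) UNIV"
      unfolding W.pr_def hcomp_0 vlin_scale[OF vlin_incl_B] W.T_scale[OF cm] ..
    also have "\<dots> = W.\<tau> \<one>\<^bsub>B\<^esub> y"
      unfolding y_def by (rule add_hom_finsum[OF W.add_hom_T finite_UNIV, symmetric]) (rule W.L.ks_closed[OF cm])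
    finally have *: "W.pr 0 m = W.\<tau> \<one>\<^bsub>B\<^esub> y" .
    have "y = \<Phi> (W.pr 0 m)"
      unfolding * by (rule \<Phi>_unit[OF y, symmetric])
    also have "\<dots> = pr (0 + j0) (\<Phi> m)"
      by (rule \<Phi>_pr[OF c[OF m(1)], symmetric])
    also have "\<dots> = x"
      using pr_id[of x j0] x m(2) by (simp add: mu0_def)
    finally show ?thesis
      using * m(1) by blast
  qed
  \<comment> \<open>Induction from large depths towards 0. The offset by one makes the measure still
    drop from z = \<open>degree_bound\<close> to larger z, where the component is zero.\<close>
  have deg: "W.Mdeg (int z) \<subseteq> P" for z
  proof (induction "degree_bound + 1 - z" arbitrary: z rule: less_induct)
    case less
    show ?case
    proof (cases "z \<le> degree_bound")
      case False
      have z0: "x = 0" if "x \<in> comp B z" for x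
        by (rule comp_bound[OF _ that]) (use False in simp)
      have "w = \<zero>\<^bsub>W.MM\<^esub>" if "w \<in> W.Mdeg (int z)" for w
        by (rule W.Mdeg_trivial[OF z0 that])
      then show ?thesis
        using p(2) by blast
    next
      case True
      have IH: "W.Mdeg (int z') \<subseteq> P" if "z' > z" for z'
        by (rule less) (use that True in arith)
      have \<tau>P: "W.\<tau> b x \<in> P" if b: "b \<in> comp B z" and x: "x \<in> mu0" for b x
      proof -
        obtain m where m: "m \<in> P" "W.pr 0 m = W.\<tau> \<one>\<^bsub>B\<^esub> x"
          using gen[OF x] by blast
        have mc: "m \<in> carrier W.MM"
          by (rule c[OF m(1)])
        let ?b = "incl_B H B b"
        have tc: "?b \<odot>\<^bsub>W.MM\<^esub> W.pr j m \<in> carrier W.MM" for j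
          using mc by simp
        define r where "r = finsum W.MM (\<lambda>j. ?b \<odot>\<^bsub>W.MM\<^esub> W.pr j m) {1..degree_bound}"
        have r: "r \<in> P"
          unfolding r_def
        proof (rule W.M.sub_finsum[OF P finite_atLeastAtMost])
          fix j assume j: "j \<in> {1..degree_bound}"
          have "?b \<odot>\<^bsub>W.MM\<^esub> W.pr j m \<in> W.Mdeg (int j - - int z)"
            by (rule W.dcomp_Mdeg[OF incl_B_dcomp[OF b] W.pr_Mdeg[OF mc]])
          also have "int j - - int z = int (j + z)"
            by simp
          finally show "?b \<odot>\<^bsub>W.MM\<^esub> W.pr j m \<in> P"
            using IH[of "j + z"] j by auto
        qed
        have ins: "{..degree_bound} = insert 0 {1..degree_bound}"
          by auto
        have "?b \<odot>\<^bsub>W.MM\<^esub> m = ?b \<odot>\<^bsub>W.MM\<^esub> finsum W.MM (\<lambda>j. W.pr j m) {..degree_bound}"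
          by (rule arg_cong[OF W.sum_pr[OF mc]])
        also have "\<dots> = finsum W.MM (\<lambda>j. ?b \<odot>\<^bsub>W.MM\<^esub> W.pr j m) {..degree_bound}"
          by (rule W.M.sm_rsum) (simp_all add: mc)
        also have "\<dots> = ?b \<odot>\<^bsub>W.MM\<^esub> W.pr 0 m \<oplus>\<^bsub>W.MM\<^esub> r"
          unfolding r_def ins by (rule W.M.finsum_insert) (use tc in auto)
        finally have eq: "?b \<odot>\<^bsub>W.MM\<^esub> m = ?b \<odot>\<^bsub>W.MM\<^esub> W.pr 0 m \<oplus>\<^bsub>W.MM\<^esub> r" .
        have rc: "r \<in> carrier W.MM"
          by (rule c[OF r])
        have "?b \<odot>\<^bsub>W.MM\<^esub> W.pr 0 m = ?b \<odot>\<^bsub>W.MM\<^esub> m \<oplus>\<^bsub>W.MM\<^esub> \<ominus>\<^bsub>W.MM\<^esub> r"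
          unfolding eq using tc[of 0] rc by (simp add: W.M.a_assoc W.M.r_neg)
        then have "?b \<odot>\<^bsub>W.MM\<^esub> W.pr 0 m \<in> P"
          using p(3)[OF p(4)[OF m(1)] W.M.sub_minus[OF P r]] by simp
        moreover have "?b \<odot>\<^bsub>W.MM\<^esub> W.pr 0 m = W.\<tau> b x"
        proof -
          have x': "x \<in> carrier mu"
            using x by (simp only: mu_simps)
          show ?thesis
            unfolding m(2) W.T_smult[OF x'] incl_B_one DD.one_right ..
        qed
        ultimately show ?thesis
          by simp
      qed
      show ?thesis
      proof
        fix w assume w: "w \<in> W.Mdeg (int z)"
        have cw: "W.cf (bvec i) w \<in> mu0" for i
          using W.cf_closed[OF W.Mdeg_carrier[OF w], of "bvec i"] by (simp only: mu_simps)
        have "w = finsum W.MM (\<lambda>i. W.\<tau> (hcomp z (bvec i)) (W.cf (bvec i) w)) UNIV"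
          using W.pr_id[OF w] unfolding W.pr_def by simp
        also have "\<dots> \<in> P"
          by (rule W.M.sub_finsum[OF P finite_UNIV]) (rule \<tau>P[OF hcomp_props(1) cw])
        finally show "w \<in> P" .
      qed
    qed
  qed
  have "m \<in> P" if m: "m \<in> carrier W.MM" for m
  proof -
    have "finsum W.MM (\<lambda>j. W.pr j m) {..degree_bound} \<in> P"
      by (rule W.M.sub_finsum[OF P finite_atMost]) (use deg W.pr_Mdeg[OF m] in blast)
    then show ?thesis
      using W.sum_pr[OF m] by simp
  qed
  then show False
    using ne p(1) by blast
qed

text \<open>\<open>S0\<close> is homogeneous by \<open>S0_pr\<close> and least among all nonzero
  submodules, so it is the only simple subobject in either category.\<close>

lemma socle_eq: "verma_socle C H B lam (concentrated d lam) = S0"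
proof -
  let ?g = "verma_grading H B lam (concentrated d lam)"
  have sub: "subobject C D MM ?g S0"
    by (rule subobject_verma[OF sub_S0 S0_pr])
  have sub_of: "M.sub P" if "subobject C D MM ?g P" for P
    using that by (simp add: subobject_def M.submodule_iff)
  have nz: "S0 \<noteq> {\<zero>\<^bsub>MM\<^esub>}"
    using mu0_nonzero by (auto simp: mu0_def)
  have "simple_subobject C D MM ?g P \<longleftrightarrow> P = S0" for P
  proof
    assume P: "simple_subobject C D MM ?g P"
    then have "S0 \<subseteq> P"
      using S0_least sub_of by (auto simp: simple_subobject_def)
    then show "P = S0"
      using P sub nz by (auto simp: simple_subobject_def)
  next
    assume "P = S0"
    then show "simple_subobject C D MM ?g P"
      using sub nz S0_least sub_of unfolding simple_subobject_def by blast
  qed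
  then have "{N. simple_subobject C D MM ?g N} = {S0}"
    by blast
  then have "verma_socle C H B lam (concentrated d lam) = generate (add_monoid MM) S0"
    by (simp add: verma_socle_def socle_def)
  also have "\<dots> = S0"
  proof
    note p = M.subD[OF sub_S0]
    show "generate (add_monoid MM) S0 \<subseteq> S0"
      by (rule M.generate_subset) (use p M.sub_minus[OF sub_S0] in auto)
    show "S0 \<subseteq> generate (add_monoid MM) S0"
      by (rule M.generate_closed(5)[OF p(1)])
  qed
  finally show ?thesis .
qed

text \<open>K is homogeneous and contains every proper submodule, so it is the only maximal
  subobject in either category.\<close>

lemma radical_eq: "radical C D W.MM (verma_grading H B mu (concentrated d mu)) = K"
proof -
  let ?g = "verma_grading H B mu (concentrated d mu)"
  have sub: "subobject C D W.MM ?g K"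
    by (rule W.subobject_verma[OF sub_K K_pr])
  have sub_of: "W.M.sub P" if "subobject C D W.MM ?g P" for P
    using that by (simp add: subobject_def W.M.submodule_iff)
  have "maximal_subobject C D W.MM ?g P \<longleftrightarrow> P = K" for P
  proof
    assume P: "maximal_subobject C D W.MM ?g P"
    then have "P \<subseteq> K"
      using proper_le_K sub_of by (auto simp: maximal_subobject_def)
    then show "P = K"
      using P sub K_proper by (auto simp: maximal_subobject_def)
  next
    assume "P = K"
    then show "maximal_subobject C D W.MM ?g P"
      using sub K_proper proper_le_K sub_of unfolding maximal_subobject_def by blast
  qed
  then have "{N. maximal_subobject C D W.MM ?g N} = {K}"
    by blast
  then show ?thesis
    using W.M.subD(1)[OF sub_K] by (auto simp: radical_def)
qed

lemma \<Phi>_eq_iff: "m \<in> carrier W.MM \<Longrightarrow> m' \<in> carrier W.MM \<Longrightarrow> K +>\<^bsub>W.MM\<^esub> m = K +>\<^bsub>W.MM\<^esub> m' \<longleftrightarrow> \<Phi> m = \<Phi> m'"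
proof -
  assume m: "m \<in> carrier W.MM" "m' \<in> carrier W.MM"
  have "K +>\<^bsub>W.MM\<^esub> m = K +>\<^bsub>W.MM\<^esub> m' \<longleftrightarrow> m \<ominus>\<^bsub>W.MM\<^esub> m' \<in> K"
    by (rule W.M.q_eq_iff[OF sub_K m])
  also have "\<dots> \<longleftrightarrow> \<Phi> m \<ominus>\<^bsub>MM\<^esub> \<Phi> m' = \<zero>\<^bsub>MM\<^esub>"
    unfolding K_def mem_Collect_eq add_hom_diff[OF \<Phi>_props(1) m] using W.M.minus_closed[OF m] by blast
  also have "\<dots> \<longleftrightarrow> \<Phi> m = \<Phi> m'"
    by (rule M.diff_eq_zero_iff[OF \<Phi>_closed[OF m(1)] \<Phi>_closed[OF m(2)]])
  finally show ?thesis .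
qed

text \<open>The cover \<open>\<Phi>\<close> induces an isomorphism from the quotient by K onto the
  socle, and \<open>f\<close> is its inverse. Depth z in the cover is depth \<open>z + j0\<close> in
  the socle, which produces the shift by \<open>- int j0\<close>.\<close>

lemma iso:
  "graded_isomorphic D (MM\<lparr>carrier := S0\<rparr>) (\<lambda>a. S0 \<inter> verma_grading H B lam (concentrated d lam) a)
    (simple_L C H B mu (concentrated d mu)) (shift (simple_L_grading C H B mu (concentrated d mu)) (- int j0))"
proof -
  let ?Q = "quot_module W.MM K"
  let ?q = "\<lambda>m. K +>\<^bsub>W.MM\<^esub> m"
  define f where "f x = ?q (SOME m. m \<in> carrier W.MM \<and> \<Phi> m = x)" for x
  have L: "simple_L C H B mu (concentrated d mu) = ?Q"
    unfolding simple_L_def head_def radical_eq ..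
  have Lg: "simple_L_grading C H B mu (concentrated d mu) a = ?q ` W.Mdeg (d - a)" for a
    unfolding simple_L_grading_def head_grading_def radical_eq W.verma_grading_eq ..
  have f: "f (\<Phi> m) = ?q m" if "m \<in> carrier W.MM" for m
  proof -
    have "\<exists>m'. m' \<in> carrier W.MM \<and> \<Phi> m' = \<Phi> m"
      using that by blast
    from someI_ex[OF this] show ?thesis
      unfolding f_def using that by (simp add: \<Phi>_eq_iff)
  qed
  have S: "\<exists>m\<in>carrier W.MM. x = \<Phi> m" if "x \<in> S0" for x
    using that \<Phi>_image by blast
  have "f \<in> iso (add_monoid (MM\<lparr>carrier := S0\<rparr>)) (add_monoid ?Q)"
    unfolding iso_def hom_def
  proof (intro CollectI conjI ballI)
    show "f \<in> carrier (add_monoid (MM\<lparr>carrier := S0\<rparr>)) \<rightarrow> carrier (add_monoid ?Q)"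
    proof
      fix x assume "x \<in> carrier (add_monoid (MM\<lparr>carrier := S0\<rparr>))"
      then obtain m where "m \<in> carrier W.MM" "x = \<Phi> m"
        using S by auto
      then show "f x \<in> carrier (add_monoid ?Q)"
        by (simp add: f W.M.carrier_Q[OF sub_K])
    qed
    fix x y assume "x \<in> carrier (add_monoid (MM\<lparr>carrier := S0\<rparr>))" "y \<in> carrier (add_monoid (MM\<lparr>carrier := S0\<rparr>))"
    then have "x \<in> S0" "y \<in> S0"
      by simp_all
    then obtain m m' where m: "m \<in> carrier W.MM" "x = \<Phi> m" "m' \<in> carrier W.MM" "y = \<Phi> m'"
      using S[of x] S[of y] by blast
    have "f (x \<oplus>\<^bsub>MM\<^esub> y) = ?q (m \<oplus>\<^bsub>W.MM\<^esub> m')"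
      unfolding m(2,4) \<Phi>_add[OF m(1,3), symmetric] using m by (simp add: f)
    also have "\<dots> = f x \<oplus>\<^bsub>?Q\<^esub> f y"
      unfolding m(2,4) f[OF m(1)] f[OF m(3)] by (rule W.M.add_Q[OF sub_K m(1,3), symmetric])
    finally show "f (x \<otimes>\<^bsub>add_monoid (MM\<lparr>carrier := S0\<rparr>)\<^esub> y) = f x \<otimes>\<^bsub>add_monoid ?Q\<^esub> f y"
      by simp
  next
    have "inj_on f S0"
    proof (rule inj_onI)
      fix x y assume "x \<in> S0" "y \<in> S0" and e: "f x = f y"
      obtain m where m: "m \<in> carrier W.MM" "x = \<Phi> m"
        using S[OF \<open>x \<in> S0\<close>] by blast
      obtain m' where m': "m' \<in> carrier W.MM" "y = \<Phi> m'"
        using S[OF \<open>y \<in> S0\<close>] by blast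
      show "x = y"
        using e unfolding m(2) m'(2) f[OF m(1)] f[OF m'(1)] \<Phi>_eq_iff[OF m(1) m'(1)] .
    qed
    moreover have "f ` S0 = carrier ?Q"
      unfolding \<Phi>_image[symmetric] W.M.carrier_Q[OF sub_K] image_image by (rule image_cong) (simp_all add: f)
    ultimately show "bij_betw f (carrier (add_monoid (MM\<lparr>carrier := S0\<rparr>))) (carrier (add_monoid ?Q))"
      by (simp add: bij_betw_def)
  qed
  moreover have "f (a \<odot>\<^bsub>MM\<^esub> x) = a \<odot>\<^bsub>?Q\<^esub> f x" if x: "x \<in> S0" for a x
  proof -
    obtain m where m: "m \<in> carrier W.MM" "x = \<Phi> m"
      using S[OF x] by blast
    have "f (a \<odot>\<^bsub>MM\<^esub> x) = ?q (a \<odot>\<^bsub>W.MM\<^esub> m)"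
      unfolding m(2) \<Phi>_smult[OF m(1), symmetric] by (rule f) (simp add: m)
    then show ?thesis
      unfolding m(2) f[OF m(1)] by (simp only: W.M.smult_Q[OF sub_K m(1)])
  qed
  moreover have "f ` (S0 \<inter> Mdeg (d - a)) = ?q ` W.Mdeg (d - (a - - int j0))" for a
  proof -
    \<comment> \<open>Surjectivity in each degree: take any preimage and project it to the matching
      depth. For depths less than \<open>j0\<close> both sides are zero.\<close>
    have "S0 \<inter> Mdeg (d - a) = \<Phi> ` W.Mdeg (d - (a - - int j0))"
    proof
      show "\<Phi> ` W.Mdeg (d - (a - - int j0)) \<subseteq> S0 \<inter> Mdeg (d - a)"
        using \<Phi>_S0 W.Mdeg_carrier \<Phi>_deg[of _ "d - (a - - int j0)"] by auto
      show "S0 \<inter> Mdeg (d - a) \<subseteq> \<Phi> ` W.Mdeg (d - (a - - int j0))"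
      proof
        fix x assume x: "x \<in> S0 \<inter> Mdeg (d - a)"
        show "x \<in> \<Phi> ` W.Mdeg (d - (a - - int j0))"
        proof (cases "d - a < int j0")
          case True
          then have "x = \<Phi> \<zero>\<^bsub>W.MM\<^esub>"
            using S0_below[of x "d - a"] x by (simp add: \<Phi>_zero)
          then show ?thesis
            using W.Mdeg_zero by blast
        next
          case False
          define j where "j = nat (d - a - int j0)"
          have j: "d - a = int (j + j0)" "d - (a - - int j0) = int j"
            using False by (simp_all add: j_def)
          obtain m where m: "m \<in> carrier W.MM" "x = \<Phi> m"
            using S x by blast
          have "x = pr (j + j0) x"
            by (rule pr_id[symmetric]) (use x j in simp)
          also have "\<dots> = \<Phi> (W.pr j m)"
            unfolding m(2) by (rule \<Phi>_pr[OF m(1)])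
          finally show ?thesis
            using W.pr_Mdeg[OF m(1), of j] unfolding j(2) by blast
        qed
      qed
    qed
    then show ?thesis
      by (simp add: image_image f W.Mdeg_carrier cong: image_cong_simp)
  qed
  ultimately show ?thesis
    unfolding graded_isomorphic_def L verma_grading_eq shift_def Lg
    by (intro bexI[of _ f]) simp_all
qed

text \<open>Component k is depth -k, which is nonnegative because a highest weight is nonzero;
  \<open>hw_generates\<close> then compares it with \<open>j0\<close>. In the case of equality
  \<open>mu0\<close> is a nonzero subobject of the simple \<open>\<nu>\<close>.\<close>

lemma hw_in_component_iff:
  assumes "hw_in_component C H B lam (concentrated d lam) k \<nu>"
  shows "- int j0 \<le> k" "k = - int j0 \<Longrightarrow> \<nu> = mu0"
proof -
  let ?g = "verma_grading H B lam (concentrated d lam)"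
  have ss: "simple_subobject C DHH DM ?g \<nu>" and kill: "\<forall>\<alpha>\<in>Vbar H B. \<forall>x\<in>\<nu>. \<alpha> \<odot>\<^bsub>MM\<^esub> x = \<zero>\<^bsub>MM\<^esub>"
    and deg: "\<nu> \<subseteq> Mdeg (- k)"
    using assms by (auto simp: hw_in_component_def highest_weight_def verma_component_def verma_grading_eq)
  have \<nu>: "DM.sub \<nu>" and nz: "\<nu> \<noteq> {\<zero>\<^bsub>MM\<^esub>}"
    using ss by (auto simp: simple_subobject_def subobject_def DM.submodule_iff DM_simps)
  have "\<not> - k < 0"
  proof
    assume "- k < 0"
    then have "\<nu> \<subseteq> {\<zero>\<^bsub>MM\<^esub>}"
      using deg Mdeg_neg by blast
    then show False
      using nz DM.subD(2)[OF \<nu>] by (auto simp: DM_simps)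
  qed
  then obtain n where n: "- k = int n"
    by (metis nonneg_int_cases not_less)
  note hg = hw_generates[OF \<nu> kill deg[unfolded n] nz]
  show "- int j0 \<le> k"
    using hg(1) n by simp
  show "\<nu> = mu0" if "k = - int j0"
  proof -
    have "mu0 \<subseteq> \<nu>"
      by (rule hg(2)) (use n that in linarith)
    moreover have "subobject C DHH DM ?g mu0"
      by (rule subobject_DM[OF sub_mu0, of "int j0"]) (auto simp: mu0_def)
    moreover have "mu0 \<noteq> {\<zero>\<^bsub>MM\<^esub>}"
      using mu0_nonzero by blast
    ultimately show ?thesis
      using ss by (auto simp: simple_subobject_def DM_simps)
  qed
qed

lemma hw_mu0: "hw_in_component C H B lam (concentrated d lam) (- int j0) mu0"
proof -
  have "mu0 \<noteq> {\<zero>\<^bsub>DM\<^esub>}"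
    using mu0_nonzero by (auto simp: DM_simps)
  moreover have "P = {\<zero>\<^bsub>DM\<^esub>} \<or> P = mu0"
    if "subobject C DHH DM (verma_grading H B lam (concentrated d lam)) P" "P \<subseteq> mu0" for P
    using mu0_simple[of P] that by (auto simp: subobject_def DM.submodule_iff DM_simps)
  moreover have "subobject C DHH DM (verma_grading H B lam (concentrated d lam)) mu0"
    by (rule subobject_DM[OF sub_mu0, of "int j0"]) (auto simp: mu0_def)
  ultimately show ?thesis
    unfolding hw_in_component_def highest_weight_def simple_subobject_def verma_component_def verma_grading_eq
    using mu0_Vbar by (auto simp: mu0_def)
qed

end

lemma ex1_eq: "\<exists>!x. P x \<Longrightarrow> P a \<Longrightarrow> P b \<Longrightarrow> a = b"
  by blast

text \<open>A homogeneous component of a graded simple module is itself a graded submodule, hence everything.\<close>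

lemma weight_concentrated:
  fixes H :: "('h::finite, 'k::field) hopf"
  assumes H: "hopf_algebra H" and w: "weight C H lam gr"
  obtains d where "gr = concentrated d lam" "weight_degree lam gr = d" "alg_module (drinfeld_double H) lam"
    "\<exists>l\<in>carrier lam. l \<noteq> \<zero>\<^bsub>lam\<^esub>"
    "\<forall>P. alg_module.sub lam P \<longrightarrow> P \<noteq> {\<zero>\<^bsub>lam\<^esub>} \<longrightarrow> P = carrier lam"
proof -
  let ?R = "drinfeld_double H"
  have am: "alg_module ?R lam"
    using w hopf_algebra.fd_algebra_double[OF H] by (simp add: weight_def alg_module_def)
  interpret L: alg_module ?R lam
    by (rule am)
  have mg: "module_grading ?R lam gr" and ss: "simple_subobject C ?R lam gr (carrier lam)"
    using w by (auto simp: weight_def)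
  have ne: "carrier lam \<noteq> {\<zero>\<^bsub>lam\<^esub>}"
    using ss by (simp add: simple_subobject_def)
  then have nt: "\<exists>l\<in>carrier lam. l \<noteq> \<zero>\<^bsub>lam\<^esub>"
    using L.zero_closed by blast
  have gs: "L.sub (gr j)" for j
    using mg by (simp add: module_grading_def L.submodule_iff)
  have dec: "\<exists>!c. (\<forall>j. c j \<in> gr j) \<and> finite {j. c j \<noteq> \<zero>\<^bsub>lam\<^esub>} \<and> x = finsum lam c {j. c j \<noteq> \<zero>\<^bsub>lam\<^esub>}" if "x \<in> carrier lam" for x
    using mg that by (simp add: module_grading_def)
  \<comment> \<open>The family supported at a is a decomposition of x. Uniqueness of decompositions
    then separates distinct components in \<open>disj\<close>.\<close>
  have single: "(\<forall>j. (if j = a then x else \<zero>\<^bsub>lam\<^esub>) \<in> gr j) \<and> finite {j. (if j = a then x else \<zero>\<^bsub>lam\<^esub>) \<noteq> \<zero>\<^bsub>lam\<^esub>} \<and>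
      x = finsum lam (\<lambda>j. if j = a then x else \<zero>\<^bsub>lam\<^esub>) {j. (if j = a then x else \<zero>\<^bsub>lam\<^esub>) \<noteq> \<zero>\<^bsub>lam\<^esub>}"
    if x: "x \<in> gr a" for x and a :: int
  proof -
    have xc: "x \<in> carrier lam"
      using x L.subD(1)[OF gs] by blast
    show ?thesis
    proof (cases "x = \<zero>\<^bsub>lam\<^esub>")
      case True
      then show ?thesis
        using L.subD(2)[OF gs] by simp
    next
      case False
      then have "{j. (if j = a then x else \<zero>\<^bsub>lam\<^esub>) \<noteq> \<zero>\<^bsub>lam\<^esub>} = {a}"
        by auto
      moreover have "finsum lam (\<lambda>j. if j = a then x else \<zero>\<^bsub>lam\<^esub>) {a} = x"
        using xc L.finsum_insert[of "{}" a "\<lambda>j. if j = a then x else \<zero>\<^bsub>lam\<^esub>"] by simp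
      ultimately show ?thesis
        using x L.subD(2)[OF gs] by simp
    qed
  qed
  have disj: "x = \<zero>\<^bsub>lam\<^esub>" if x: "x \<in> gr a" "x \<in> gr b" and ab: "a \<noteq> b" for x a b
  proof -
    have xc: "x \<in> carrier lam"
      using x(1) L.subD(1)[OF gs] by blast
    have e: "(\<lambda>j. if j = a then x else \<zero>\<^bsub>lam\<^esub>) = (\<lambda>j. if j = b then x else \<zero>\<^bsub>lam\<^esub>)"
      by (rule ex1_eq[OF dec[OF xc]], rule single[OF x(1)], rule single[OF x(2)])
    from fun_cong[OF e, of a] show ?thesis
      using ab by simp
  qed
  have grsub: "subobject C ?R lam gr (gr a)" for a
    unfolding subobject_def L.submodule_iff
  proof (intro conjI impI gs subset_antisym)
    note p = L.subD[OF gs[of a]]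
    have Xc: "(\<Union>b. gr a \<inter> gr b) \<subseteq> carrier lam"
      using p(1) by blast
    show "generate (add_monoid lam) (\<Union>b. gr a \<inter> gr b) \<subseteq> gr a"
      by (rule L.generate_subset) (use p L.sub_minus[OF gs[of a]] in auto)
    show "gr a \<subseteq> generate (add_monoid lam) (\<Union>b. gr a \<inter> gr b)"
      using L.generate_closed(5)[OF Xc] by blast
  qed
  have "\<exists>d. gr d \<noteq> {\<zero>\<^bsub>lam\<^esub>}"
  proof (rule ccontr)
    assume "\<not> (\<exists>d. gr d \<noteq> {\<zero>\<^bsub>lam\<^esub>})"
    then have z: "gr d = {\<zero>\<^bsub>lam\<^esub>}" for d
      by blast
    obtain l where l: "l \<in> carrier lam" "l \<noteq> \<zero>\<^bsub>lam\<^esub>"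
      using nt by blast
    obtain c where c0: "(\<forall>j. c j \<in> gr j) \<and> finite {j. c j \<noteq> \<zero>\<^bsub>lam\<^esub>} \<and> l = finsum lam c {j. c j \<noteq> \<zero>\<^bsub>lam\<^esub>}"
      using ex1_implies_ex[OF dec[OF l(1)]] by (rule exE)
    have c: "\<forall>j. c j \<in> gr j" "l = finsum lam c {j. c j \<noteq> \<zero>\<^bsub>lam\<^esub>}"
      by (rule conjunct1[OF c0], rule conjunct2[OF conjunct2[OF c0]])
    have "c j = \<zero>\<^bsub>lam\<^esub>" for j
      using spec[OF c(1), of j] unfolding z by simp
    then have e: "{j. c j \<noteq> \<zero>\<^bsub>lam\<^esub>} = {}"
      by blast
    have "l = \<zero>\<^bsub>lam\<^esub>"
      using c(2) unfolding e by simp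
    then show False
      using l(2) by simp
  qed
  then obtain d where d: "gr d \<noteq> {\<zero>\<^bsub>lam\<^esub>}"
    by blast
  have gd: "gr d = carrier lam"
  proof -
    have "\<forall>P. subobject C ?R lam gr P \<and> P \<subseteq> carrier lam \<longrightarrow> P = {\<zero>\<^bsub>lam\<^esub>} \<or> P = carrier lam"
      using ss unfolding simple_subobject_def by (rule conjunct2[OF conjunct2])
    then show ?thesis
      using grsub[of d] d L.subD(1)[OF gs[of d]] by blast
  qed
  have conc: "gr = concentrated d lam"
  proof
    fix a
    show "gr a = concentrated d lam a"
    proof (cases "a = d")
      case False
      have "x = \<zero>\<^bsub>lam\<^esub>" if "x \<in> gr a" for x
      proof (rule disj[OF that _ False])
        show "x \<in> gr d"
          unfolding gd using that L.subD(1)[OF gs[of a]] by blast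
      qed
      then show ?thesis
      proof -
        have "gr a = {\<zero>\<^bsub>lam\<^esub>}"
          using \<open>\<And>x. x \<in> gr a \<Longrightarrow> x = \<zero>\<^bsub>lam\<^esub>\<close> L.subD(2)[OF gs[of a]] by blast
        then show ?thesis
          using False by (simp add: concentrated_def)
      qed
    qed (simp add: concentrated_def gd)
  qed
  have wd: "weight_degree lam gr = d"
    unfolding weight_degree_def
  proof (rule the_equality[where a=d])
    show "gr d = carrier lam"
      by (rule gd)
    fix e assume e: "gr e = carrier lam"
    show "e = d"
    proof (rule ccontr)
      assume "e \<noteq> d"
      then have "gr e = {\<zero>\<^bsub>lam\<^esub>}"
        unfolding fun_cong[OF conc, of e] by (simp add: concentrated_def)
      then show False
        using e ne by simp
    qed
  qed
  \<comment> \<open>As \<open>lam\<close> is a single component, every submodule is homogeneous, so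
    simplicity in the category is simplicity among all submodules.\<close>
  have simp: "P = carrier lam" if P: "L.sub P" "P \<noteq> {\<zero>\<^bsub>lam\<^esub>}" for P
  proof -
    note p = L.subD[OF P(1)]
    have Xc: "(\<Union>a. P \<inter> gr a) \<subseteq> carrier lam"
      using p(1) by blast
    have "P \<subseteq> P \<inter> gr d"
      using p(1) gd by blast
    then have "P \<subseteq> generate (add_monoid lam) (\<Union>a. P \<inter> gr a)"
      using L.generate_closed(5)[OF Xc] by blast
    moreover have "generate (add_monoid lam) (\<Union>a. P \<inter> gr a) \<subseteq> P"
      by (rule L.generate_subset) (use p L.sub_minus[OF P(1)] in auto)
    ultimately have "subobject C ?R lam gr P"
      using P(1) by (auto simp: subobject_def L.submodule_iff)
    then show ?thesis
      using ss P(2) p(1) by (auto simp: simple_subobject_def)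
  qed
  show thesis
    by (rule that[OF conc wd am nt], intro allI impI, rule simp)
qed

theorem corollary3p6:
  fixes H :: "('h::finite, 'k::{alg_closed_field, field_char_0}) hopf"
    and s :: "'k \<Rightarrow> 'v::ab_group_add \<Rightarrow> 'v"
    and act :: "('h \<Rightarrow> 'k) \<Rightarrow> 'v \<Rightarrow> 'v"
    and coact :: "'v \<Rightarrow> 'h \<Rightarrow> 'v"
    and B :: "('b::finite, 'h, 'k) braided_hopf"
    and \<iota> :: "'v \<Rightarrow> 'b \<Rightarrow> 'k"
    and C :: mod_category
    and lam :: "('h \<times> 'h \<Rightarrow> 'k, 'l) module"
    and gr :: "int \<Rightarrow> 'l set"
  assumes "hopf_algebra H"
    and "yd_module H s act coact"
    and "\<exists>F. finite F \<and> module.span s F = UNIV"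
    and "nichols_algebra H s act coact B \<iota>"
    and "weight C H lam gr"
  shows "\<exists>n \<mu>.
      hw_in_component C H B lam gr n \<mu> \<and>
      (\<forall>k \<nu>. hw_in_component C H B lam gr k \<nu> \<longrightarrow> n \<le> k) \<and>
      (\<forall>\<nu>. hw_in_component C H B lam gr n \<nu> \<longrightarrow> \<nu> = \<mu>) \<and>
      (let M = verma H B lam; grM = verma_grading H B lam gr; S = verma_socle C H B lam gr;
           mu = verma_submodule H B lam \<mu>;
           gr_mu = concentrated (weight_degree lam gr) mu
       in graded_isomorphic (DVH H B)
            (M\<lparr>carrier := S\<rparr>) (\<lambda>a. S \<inter> grM a)
            (simple_L C H B mu gr_mu) (shift (simple_L_grading C H B mu gr_mu) n))"
proof -
  obtain d where gr: "gr = concentrated d lam" and wd: "weight_degree lam gr = d"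
    and am: "alg_module (drinfeld_double H) lam" and nt: "\<exists>l\<in>carrier lam. l \<noteq> \<zero>\<^bsub>lam\<^esub>"
    and simp: "\<forall>P. alg_module.sub lam P \<longrightarrow> P \<noteq> {\<zero>\<^bsub>lam\<^esub>} \<longrightarrow> P = carrier lam"
    by (rule weight_concentrated[OF assms(1,5)])
  interpret simple_verma H s act coact B \<iota> lam
    by (intro simple_verma.intro verma_setting.intro simple_verma_axioms.intro assms(4) am nt) (use simp in blast)
  \<comment> \<open>The witnesses: n is minus the least depth in the socle, and \<open>\<mu>\<close>
    is the part of the socle at that depth.\<close>
  have "hw_in_component C H B lam gr (- int j0) mu0"
    unfolding gr by (rule hw_mu0)
  moreover have "\<forall>k \<nu>. hw_in_component C H B lam gr k \<nu> \<longrightarrow> - int j0 \<le> k"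
    unfolding gr using hw_in_component_iff(1) by blast
  moreover have "\<forall>\<nu>. hw_in_component C H B lam gr (- int j0) \<nu> \<longrightarrow> \<nu> = mu0"
    unfolding gr using hw_in_component_iff(2) by blast
  \<comment> \<open>\<open>weight_degree\<close> places \<open>mu\<close> in the degree d of
    \<open>lam\<close>, which matches the convention for the shift.\<close>
  moreover have "graded_isomorphic D (MM\<lparr>carrier := verma_socle C H B lam gr\<rparr>)
      (\<lambda>a. verma_socle C H B lam gr \<inter> verma_grading H B lam gr a)
      (simple_L C H B mu (concentrated (weight_degree lam gr) mu))
      (shift (simple_L_grading C H B mu (concentrated (weight_degree lam gr) mu)) (- int j0))"
    unfolding wd unfolding gr socle_eq by (rule iso)
  ultimately show ?thesis
    unfolding Let_def by blast
qed

end
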